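(* Let $\boldsymbol{\sigma}$ be an eventually recognizable primitive directive sequence. Then the following statements hold: (i) if $\boldsymbol{\sigma}$ is recognizable, then it is saturating; (ii) if $\boldsymbol{\sigma}$ is pure, then $\boldsymbol{\sigma}$ is recognizable; (iii) if $\boldsymbol{\sigma}$ is saturating and encoding, then $\boldsymbol{\sigma}$ is recognizable; (iv) if $\boldsymbol{\sigma}$ is recurrent, bounded, and encoding, then $\boldsymbol{\sigma}$ is recognizable.
   Context: For a finite alphabet $A$, $A^+$ is the free semigroup on $A$ (nonempty words), $|w|$ is the length of $w$, and $\mathrm{fac}(w)$ is the set of nonempty factors of $w$. A directive sequence is a sequence $\boldsymbol{\sigma}=(\sigma_n)_{n\in\mathbb N}$ of semigroup homomorphisms $\sigma_n\colon A_{n+1}^+\to A_n^+$, each $A_n$ a finite nonempty alphabet. Put $\sigma_{n,m}=\sigma_n\circ\cdots\circ\sigma_{m-1}$ for $n\le m$ (the identity of $A_n^+$ if $n=m$) and $\boldsymbol{\sigma}^{(k)}=(\sigma_{n+k})_{n\in\mathbb N}$. Put $L(\boldsymbol{\sigma})=\bigcup_{n\ge 0}\bigcup_{a\in A_n}\mathrm{fac}(\sigma_{0,n}(a))$, and let $X(\boldsymbol{\sigma})$ be the set of $x\in A_0^{\mathbb Z}$ all of whose nonempty finite factors lie in $L(\boldsymbol{\sigma})$. A homomorphism $\varphi\colon A^+\to B^+$ is positive if for every $a\in A$ one has $|\varphi(a)|\ge 2$ and every letter of $B$ occurs in $\varphi(a)$. The sequence $\boldsymbol{\sigma}$ is primitive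 if for every $n$ there is $m>n$ with $\sigma_{n,m}$ positive; then $X(\boldsymbol{\sigma})$ is a minimal shift space with language $L(\boldsymbol{\sigma})$. Recognizability: let $T$ be the shift map, $T(x)[i]=x[i+1]$. A homomorphism $\sigma\colon A^+\to B^+$ acts on $A^{\mathbb Z}$ by concatenation, $\sigma(x)=\cdots\sigma(x[-1])\cdot\sigma(x[0])\sigma(x[1])\cdots$. It is recognizable in $X\subseteq A^{\mathbb Z}$ if every $y\in B^{\mathbb Z}$ has at most one pair $(k,x)$ with $x\in X$, $0\le k<|\sigma(x[0])|$ and $T^k\sigma(x)=y$. The sequence $\boldsymbol{\sigma}$ is recognizable if $\sigma_n$ is recognizable in $X(\boldsymbol{\sigma}^{(n+1)})$ for every $n\in\mathbb N$, and eventually recognizable if this holds for all but finitely many $n$. Other properties of $\boldsymbol{\sigma}$: it is encoding if every $\sigma_n$ is injective; it is pure if it is encoding and each $C=\sigma_n(A_{n+1})$ is a pure code, meaning that $u^k\in C^+$ implies $u\in C^+$ for all $u\in A_n^+$, $k\ge 1$ ($C^+$ being the subsemigroup generated by $C$); it is recurrent if for every $n\in\mathbb N$ there is $m>0$ with $(\sigma_0,\dots,\sigma_n)=(\sigma_m,\dots,\sigma_{m+n})$; it is bounded if the sequence of cardinalities of the $A_n$ is bounded. Saturation: let $\overline{\Omega}_A\mathsf S$ be the free profinite semigroup on the finite alphabet $A$, which contains $A^+$ as a dense subsemigroup; each homomorphism $\varphi\colon A^+\to B^+$ has a unique continuous homomorphic extension $\varphi^{\mathsf S}\colon\overline{\Omega}_A\mathsf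 S\to\overline{\Omega}_B\mathsf S$. For $\boldsymbol{\sigma}$ primitive, the set $\overline{L(\boldsymbol{\sigma})}\setminus L(\boldsymbol{\sigma})$ (closure in $\overline{\Omega}_{A_0}\mathsf S$) is contained in a single regular $\mathcal J$-class of $\overline{\Omega}_{A_0}\mathsf S$, denoted $J_{\mathsf S}(\boldsymbol{\sigma})$. The profinite image is $\mathrm{Im}_{\mathsf S}(\boldsymbol{\sigma})=\bigcap_{n\in\mathbb N}\mathrm{Im}(\sigma_{0,n}^{\mathsf S})$. The sequence $\boldsymbol{\sigma}$ is saturating if $\mathrm{Im}_{\mathsf S}(\boldsymbol{\sigma})$ contains a maximal subgroup of $\overline{\Omega}_{A_0}\mathsf S$ that is contained in $J_{\mathsf S}(\boldsymbol{\sigma})$. *)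

theory Defs
  imports
    "HOL-Analysis.Analysis"
    "HOL-Algebra.Group"
    "HOL-Library.Sublist"
begin

section \<open>Words and homomorphisms of free semigroups\<close>

text \<open>The free semigroup \<open>A\<^sup>+\<close>, whose operation is \<open>@\<close>.\<close>

definition words :: "'a set \<Rightarrow> 'a list set" where
  "words A = {w. w \<noteq> [] \<and> set w \<subseteq> A}"

definition factors :: "'a list \<Rightarrow> 'a list set" where
  "factors w = {u. u \<noteq> [] \<and> sublist u w}"

text \<open>A homomorphism \<open>A\<^sup>+ \<rightarrow> B\<^sup>+\<close> is a function on all lists of which only the values on
  \<^term>\<open>words A\<close> matter.\<close>

definition word_hom :: "'a set \<Rightarrow> 'b set \<Rightarrow> ('a list \<Rightarrow> 'b list) \<Rightarrow> bool" where
  "word_hom A B \<phi> \<longleftrightarrow> \<phi> \<in> words A \<rightarrow> words B \<and>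
     (\<forall>u\<in>words A. \<forall>v\<in>words A. \<phi> (u @ v) = \<phi> u @ \<phi> v)"

definition positive_hom :: "'a set \<Rightarrow> 'b set \<Rightarrow> ('a list \<Rightarrow> 'b list) \<Rightarrow> bool" where
  "positive_hom A B \<phi> \<longleftrightarrow> (\<forall>a\<in>A. length (\<phi> [a]) \<ge> 2 \<and> (\<forall>b\<in>B. b \<in> set (\<phi> [a])))"

inductive_set generated_subsemigroup :: "'a list set \<Rightarrow> 'a list set" for C where
  incl: "c \<in> C \<Longrightarrow> c \<in> generated_subsemigroup C"
| app: "u \<in> generated_subsemigroup C \<Longrightarrow> v \<in> generated_subsemigroup C \<Longrightarrow>
    u @ v \<in> generated_subsemigroup C"

definition pure_in :: "'a set \<Rightarrow> 'a list set \<Rightarrow> bool" where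
  "pure_in A C \<longleftrightarrow> (\<forall>u\<in>words A. \<forall>k\<ge>1.
     concat (replicate k u) \<in> generated_subsemigroup C \<longrightarrow> u \<in> generated_subsemigroup C)"


section \<open>Bi-infinite words\<close>

definition shift_map :: "(int \<Rightarrow> 'a) \<Rightarrow> int \<Rightarrow> 'a" where
  "shift_map x = (\<lambda>i. x (i + 1))"

text \<open>The bi-infinite word \<open>\<cdots>\<phi>(x[-1])\<cdot>\<phi>(x[0])\<phi>(x[1])\<cdots>\<close>.  When \<open>\<phi>\<close> maps letters to nonempty
  words, the first \<open>i + 1\<close> blocks on either side of the origin cover at least \<open>i + 1\<close> positions.\<close>

definition biinf_image :: "('a list \<Rightarrow> 'b list) \<Rightarrow> (int \<Rightarrow> 'a) \<Rightarrow> int \<Rightarrow> 'b" where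
  "biinf_image \<phi> x = (\<lambda>i. if i \<ge> 0
     then concat (map (\<lambda>j. \<phi> [x j]) [0..i]) ! nat i
     else rev (concat (map (\<lambda>j. \<phi> [x j]) [i..-1])) ! nat (- i - 1))"

definition recognizable_in ::
    "'b set \<Rightarrow> ('a list \<Rightarrow> 'b list) \<Rightarrow> (int \<Rightarrow> 'a) set \<Rightarrow> bool" where
  "recognizable_in B \<phi> X \<longleftrightarrow> (\<forall>y. range y \<subseteq> B \<longrightarrow>
     (\<exists>\<^sub>\<le>\<^sub>1(k, x). x \<in> X \<and> k < length (\<phi> [x 0]) \<and> (shift_map ^^ k) (biinf_image \<phi> x) = y))"


section \<open>Directive sequences\<close>

text \<open>All alphabets are taken inside one type of letters; the alphabets themselves may vary
  arbitrarily.\<close>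

definition directive_sequence :: "(nat \<Rightarrow> 'a set) \<Rightarrow> (nat \<Rightarrow> 'a list \<Rightarrow> 'a list) \<Rightarrow> bool" where
  "directive_sequence A \<sigma> \<longleftrightarrow>
     (\<forall>n. finite (A n) \<and> A n \<noteq> {} \<and> word_hom (A (Suc n)) (A n) (\<sigma> n))"

definition comp_hom :: "(nat \<Rightarrow> 'a list \<Rightarrow> 'a list) \<Rightarrow> nat \<Rightarrow> nat \<Rightarrow> 'a list \<Rightarrow> 'a list" where
  "comp_hom \<sigma> n m = foldr (\<circ>) (map \<sigma> [n..<m]) id"

definition seq_language ::
    "(nat \<Rightarrow> 'a set) \<Rightarrow> (nat \<Rightarrow> 'a list \<Rightarrow> 'a list) \<Rightarrow> 'a list set" where
  "seq_language A \<sigma> = (\<Union>n. \<Union>a\<in>A n. factors (comp_hom \<sigma> 0 n [a]))"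

definition seq_shift ::
    "(nat \<Rightarrow> 'a set) \<Rightarrow> (nat \<Rightarrow> 'a list \<Rightarrow> 'a list) \<Rightarrow> (int \<Rightarrow> 'a) set" where
  "seq_shift A \<sigma> = {x. range x \<subseteq> A 0 \<and> (\<forall>i j. i \<le> j \<longrightarrow> map x [i..j] \<in> seq_language A \<sigma>)}"

definition primitive_seq :: "(nat \<Rightarrow> 'a set) \<Rightarrow> (nat \<Rightarrow> 'a list \<Rightarrow> 'a list) \<Rightarrow> bool" where
  "primitive_seq A \<sigma> \<longleftrightarrow> (\<forall>n. \<exists>m>n. positive_hom (A m) (A n) (comp_hom \<sigma> n m))"

definition recognizable_at ::
    "(nat \<Rightarrow> 'a set) \<Rightarrow> (nat \<Rightarrow> 'a list \<Rightarrow> 'a list) \<Rightarrow> nat \<Rightarrow> bool" where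
  "recognizable_at A \<sigma> n \<longleftrightarrow> recognizable_in (A n) (\<sigma> n)
     (seq_shift (\<lambda>i. A (i + (n + 1))) (\<lambda>i. \<sigma> (i + (n + 1))))"

definition recognizable_seq :: "(nat \<Rightarrow> 'a set) \<Rightarrow> (nat \<Rightarrow> 'a list \<Rightarrow> 'a list) \<Rightarrow> bool" where
  "recognizable_seq A \<sigma> \<longleftrightarrow> (\<forall>n. recognizable_at A \<sigma> n)"

definition eventually_recognizable_seq ::
    "(nat \<Rightarrow> 'a set) \<Rightarrow> (nat \<Rightarrow> 'a list \<Rightarrow> 'a list) \<Rightarrow> bool" where
  "eventually_recognizable_seq A \<sigma> \<longleftrightarrow> finite {n. \<not> recognizable_at A \<sigma> n}"

definition encoding_seq :: "(nat \<Rightarrow> 'a set) \<Rightarrow> (nat \<Rightarrow> 'a list \<Rightarrow> 'a list) \<Rightarrow> bool" where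
  "encoding_seq A \<sigma> \<longleftrightarrow> (\<forall>n. inj_on (\<sigma> n) (words (A (Suc n))))"

text \<open>That \<open>\<sigma>\<^sub>n(A\<^sub>n\<^sub>+\<^sub>1)\<close> is a code is part of being encoding.\<close>

definition pure_seq :: "(nat \<Rightarrow> 'a set) \<Rightarrow> (nat \<Rightarrow> 'a list \<Rightarrow> 'a list) \<Rightarrow> bool" where
  "pure_seq A \<sigma> \<longleftrightarrow> encoding_seq A \<sigma> \<and> (\<forall>n. pure_in (A n) ((\<lambda>a. \<sigma> n [a]) ` A (Suc n)))"

text \<open>Homomorphisms are equal when domain, codomain and values on the domain agree.\<close>

definition recurrent_seq :: "(nat \<Rightarrow> 'a set) \<Rightarrow> (nat \<Rightarrow> 'a list \<Rightarrow> 'a list) \<Rightarrow> bool" where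
  "recurrent_seq A \<sigma> \<longleftrightarrow> (\<forall>n. \<exists>m>0. \<forall>i\<le>n.
     A i = A (m + i) \<and> A (Suc i) = A (Suc (m + i)) \<and>
     (\<forall>w\<in>words (A (Suc i)). \<sigma> i w = \<sigma> (m + i) w))"

definition bounded_seq :: "(nat \<Rightarrow> 'a set) \<Rightarrow> bool" where
  "bounded_seq A \<longleftrightarrow> (\<exists>N. \<forall>n. card (A n) \<le> N)"


section \<open>Semigroups\<close>

text \<open>A semigroup is given by its carrier \<open>S\<close> and its operation \<open>f\<close>.\<close>

definition principal_ideal :: "'s set \<Rightarrow> ('s \<Rightarrow> 's \<Rightarrow> 's) \<Rightarrow> 's \<Rightarrow> 's set" where
  "principal_ideal S f x =
     {x} \<union> {f s x | s. s \<in> S} \<union> {f x t | t. t \<in> S} \<union> {f (f s x) t | s t. s \<in> S \<and> t \<in> S}"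

definition J_classes :: "'s set \<Rightarrow> ('s \<Rightarrow> 's \<Rightarrow> 's) \<Rightarrow> 's set set" where
  "J_classes S f = S // {(x, y) \<in> S \<times> S. principal_ideal S f x = principal_ideal S f y}"

definition regular_elements :: "'s set \<Rightarrow> ('s \<Rightarrow> 's \<Rightarrow> 's) \<Rightarrow> 's set" where
  "regular_elements S f = {x \<in> S. \<exists>s\<in>S. f (f x s) x = x}"

definition subgroups :: "'s set \<Rightarrow> ('s \<Rightarrow> 's \<Rightarrow> 's) \<Rightarrow> 's set set" where
  "subgroups S f = {H. H \<subseteq> S \<and> (\<exists>e. group \<lparr>carrier = H, monoid.mult = f, one = e\<rparr>)}"

definition maximal_subgroups :: "'s set \<Rightarrow> ('s \<Rightarrow> 's \<Rightarrow> 's) \<Rightarrow> 's set set" where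
  "maximal_subgroups S f = {H \<in> subgroups S f. \<forall>K\<in>subgroups S f. H \<subseteq> K \<longrightarrow> H = K}"


section \<open>The free profinite semigroup\<close>

text \<open>The free profinite semigroup on \<open>A\<close> is the projective limit of the finite quotients of
  \<open>A\<^sup>+\<close>: an element assigns to every congruence of finite index one of its classes, compatibly
  with inclusion of congruences.\<close>

definition finite_congruences :: "'a set \<Rightarrow> ('a list \<times> 'a list) set set" where
  "finite_congruences A = {r. equiv (words A) r \<and> finite (words A // r) \<and>
     (\<forall>u v w. (u, v) \<in> r \<longrightarrow> w \<in> words A \<longrightarrow> (u @ w, v @ w) \<in> r \<and> (w @ u, w @ v) \<in> r)}"

type_synonym 'a pseudoword = "('a list \<times> 'a list) set \<Rightarrow> 'a list set"

definition free_profinite :: "'a set \<Rightarrow> 'a pseudoword set" where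
  "free_profinite A = {x \<in> (\<Pi>\<^sub>E r\<in>finite_congruences A. words A // r).
     \<forall>r\<in>finite_congruences A. \<forall>s\<in>finite_congruences A. r \<subseteq> s \<longrightarrow> x r \<subseteq> x s}"

definition profinite_mult :: "'a set \<Rightarrow> 'a pseudoword \<Rightarrow> 'a pseudoword \<Rightarrow> 'a pseudoword" where
  "profinite_mult A x y =
     (\<lambda>r\<in>finite_congruences A. r `` {u @ v | u v. u \<in> x r \<and> v \<in> y r})"

definition profinite_topology :: "'a set \<Rightarrow> 'a pseudoword topology" where
  "profinite_topology A = subtopology
     (product_topology (\<lambda>r. discrete_topology (words A // r)) (finite_congruences A))
     (free_profinite A)"

text \<open>The inclusion of \<open>A\<^sup>+\<close>.\<close>

definition pseudoword_of :: "'a set \<Rightarrow> 'a list \<Rightarrow> 'a pseudoword" where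
  "pseudoword_of A w = (\<lambda>r\<in>finite_congruences A. r `` {w})"

definition is_profinite_extension ::
    "'a set \<Rightarrow> 'b set \<Rightarrow> ('a list \<Rightarrow> 'b list) \<Rightarrow> ('a pseudoword \<Rightarrow> 'b pseudoword) \<Rightarrow> bool" where
  "is_profinite_extension A B \<phi> f \<longleftrightarrow>
     f \<in> extensional (free_profinite A) \<and>
     continuous_map (profinite_topology A) (profinite_topology B) f \<and>
     (\<forall>x\<in>free_profinite A. \<forall>y\<in>free_profinite A.
        f (profinite_mult A x y) = profinite_mult B (f x) (f y)) \<and>
     (\<forall>w\<in>words A. f (pseudoword_of A w) = pseudoword_of B (\<phi> w))"

text \<open>Existence and uniqueness are shown in \<open>ex1_profinite_extension\<close> below.\<close>

definition profinite_extension ::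
    "'a set \<Rightarrow> 'b set \<Rightarrow> ('a list \<Rightarrow> 'b list) \<Rightarrow> 'a pseudoword \<Rightarrow> 'b pseudoword" where
  "profinite_extension A B \<phi> = (THE f. is_profinite_extension A B \<phi> f)"


section \<open>Saturating directive sequences\<close>

text \<open>The \<open>\<J>\<close>-class \<open>J\<^sub>S(\<sigma>)\<close>; meaningful for primitive sequences.\<close>

definition seq_J_class ::
    "(nat \<Rightarrow> 'a set) \<Rightarrow> (nat \<Rightarrow> 'a list \<Rightarrow> 'a list) \<Rightarrow> 'a pseudoword set" where
  "seq_J_class A \<sigma> = (THE J.
     J \<in> J_classes (free_profinite (A 0)) (profinite_mult (A 0)) \<and>
     J \<subseteq> regular_elements (free_profinite (A 0)) (profinite_mult (A 0)) \<and>
     (Abstract_Topology.closure_of (profinite_topology (A 0)) (pseudoword_of (A 0) ` seq_language A \<sigma>))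
       - pseudoword_of (A 0) ` seq_language A \<sigma> \<subseteq> J)"

definition profinite_image ::
    "(nat \<Rightarrow> 'a set) \<Rightarrow> (nat \<Rightarrow> 'a list \<Rightarrow> 'a list) \<Rightarrow> 'a pseudoword set" where
  "profinite_image A \<sigma> =
     (\<Inter>n. profinite_extension (A n) (A 0) (comp_hom \<sigma> 0 n) ` free_profinite (A n))"

definition saturating_seq :: "(nat \<Rightarrow> 'a set) \<Rightarrow> (nat \<Rightarrow> 'a list \<Rightarrow> 'a list) \<Rightarrow> bool" where
  "saturating_seq A \<sigma> \<longleftrightarrow>
     (\<exists>H \<in> maximal_subgroups (free_profinite (A 0)) (profinite_mult (A 0)).
        H \<subseteq> seq_J_class A \<sigma> \<and> H \<subseteq> profinite_image A \<sigma>)"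


section \<open>Basic properties of the constructions\<close>

lemma words_append: "u \<in> words A \<Longrightarrow> v \<in> words A \<Longrightarrow> u @ v \<in> words A"
  by (auto simp: words_def)

lemma word_homD:
  assumes "word_hom A B \<phi>"
  shows "u \<in> words A \<Longrightarrow> \<phi> u \<in> words B"
    and "u \<in> words A \<Longrightarrow> v \<in> words A \<Longrightarrow> \<phi> (u @ v) = \<phi> u @ \<phi> v"
  using assms by (auto simp: word_hom_def)

lemma length_concat_ge:
  "(\<And>j. f j \<noteq> []) \<Longrightarrow> length (concat (map f xs)) \<ge> length xs"
proof (induction xs)
  case (Cons a xs)
  then show ?case using length_greater_0_conv[of "f a"] by (simp del: length_greater_0_conv)
qed simp

text \<open>The word read from the origin to the right, respectively to the left, in
  \<^term>\<open>biinf_image \<phi> x\<close>.\<close>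

lemma biinf_image_right:
  assumes ne: "\<And>j. \<phi> [x j] \<noteq> []" and p: "p < length (concat (map (\<lambda>j. \<phi> [x j]) [0..n]))"
  shows "biinf_image \<phi> x (int p) = concat (map (\<lambda>j. \<phi> [x j]) [0..n]) ! p"
proof -
  let ?W = "\<lambda>n. concat (map (\<lambda>j. \<phi> [x j]) [0..n])"
  have p': "p < length (?W (int p))"
    using length_concat_ge[of "\<lambda>j. \<phi> [x j]" "[0..int p]"] ne by simp
  have "?W a ! p = ?W b ! p" if "a \<le> b" "p < length (?W a)" for a b
  proof -
    have "a \<ge> 0" using that(2) by (cases "a \<ge> 0") simp_all
    then have "[0..b] = [0..a] @ [a+1..b]"
      using that(1) upto_split2 by blast
    then show ?thesis using that(2) by (simp only: map_append concat_append nth_append if_True)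
  qed
  then have "?W (int p) ! p = ?W n ! p"
    using p p' by (metis linear)
  then show ?thesis by (simp add: biinf_image_def)
qed

lemma biinf_image_left:
  assumes ne: "\<And>j. \<phi> [x j] \<noteq> []" and p: "p < length (concat (map (\<lambda>j. \<phi> [x j]) [n..-1]))"
  shows "biinf_image \<phi> x (- int p - 1) = rev (concat (map (\<lambda>j. \<phi> [x j]) [n..-1])) ! p"
proof -
  let ?W = "\<lambda>n. concat (map (\<lambda>j. \<phi> [x j]) [n..-1])"
  have p': "p < length (?W (- int p - 1))"
    using length_concat_ge[of "\<lambda>j. \<phi> [x j]" "[- int p - 1..-1]"] ne by simp
  have "rev (?W a) ! p = rev (?W b) ! p" if "b \<le> a" "p < length (?W a)" for a b
  proof -
    have "a \<le> -1" using that(2) by (cases "a \<le> -1") simp_all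
    then have "[b..-1] = [b..a-1] @ [a..-1]"
      using that(1) upto_split1 by blast
    then have "rev (?W b) = rev (?W a) @ rev (concat (map (\<lambda>j. \<phi> [x j]) [b..a-1]))"
      by (simp only: map_append concat_append rev_append)
    then show ?thesis using that(2) by (simp only: nth_append length_rev if_True)
  qed
  then have "rev (?W (- int p - 1)) ! p = rev (?W n) ! p"
    using p p' by (metis linear)
  then show ?thesis by (simp add: biinf_image_def)
qed

lemma finite_congruencesD:
  assumes "r \<in> finite_congruences A"
  shows "equiv (words A) r" "finite (words A // r)"
    "(u, v) \<in> r \<Longrightarrow> w \<in> words A \<Longrightarrow> (u @ w, v @ w) \<in> r"
    "(u, v) \<in> r \<Longrightarrow> w \<in> words A \<Longrightarrow> (w @ u, w @ v) \<in> r"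
  using assms by (auto simp: finite_congruences_def)

lemma finite_congruences_append:
  assumes r: "r \<in> finite_congruences A" and "(u, u') \<in> r" "(v, v') \<in> r"
  shows "(u @ v, u' @ v') \<in> r"
proof -
  have eq: "equiv (words A) r" by (rule finite_congruencesD(1)[OF r])
  have "v \<in> words A" "u' \<in> words A"
    using assms(2,3) eq by (meson equiv_class_eq_iff)+
  then have "(u @ v, u' @ v) \<in> r" "(u' @ v, u' @ v') \<in> r"
    using finite_congruencesD(3,4)[OF r] assms(2,3) by blast+
  then show ?thesis using eq by (meson equivE transE)
qed

lemma free_profinite_class:
  assumes "x \<in> free_profinite A" "r \<in> finite_congruences A"
  shows "x r \<in> words A // r"
  using assms by (auto simp: free_profinite_def PiE_def)

lemma free_profinite_mono:
  assumes "x \<in> free_profinite A" "r \<in> finite_congruences A" "s \<in> finite_congruences A" "r \<subseteq> s"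
  shows "x r \<subseteq> x s"
  using assms by (auto simp: free_profinite_def)

lemma free_profinite_rep:
  assumes x: "x \<in> free_profinite A" and r: "r \<in> finite_congruences A" and w: "w \<in> x r"
  shows "w \<in> words A" "x r = r `` {w}"
proof -
  have eq: "equiv (words A) r" by (rule finite_congruencesD(1)[OF r])
  from free_profinite_class[OF x r] obtain v where v: "v \<in> words A" "x r = r `` {v}"
    by (auto elim: quotientE)
  with w have "(v, w) \<in> r" by auto
  with eq v show "w \<in> words A" "x r = r `` {w}"
    by (auto dest: equiv_class_eq simp: equiv_class_eq_iff)
qed

lemma free_profinite_ex_rep:
  assumes x: "x \<in> free_profinite A" and r: "r \<in> finite_congruences A"
  obtains w where "w \<in> words A" "w \<in> x r" "x r = r `` {w}"
proof -
  have "x r \<noteq> {}"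
    using in_quotient_imp_non_empty[OF finite_congruencesD(1)[OF r] free_profinite_class[OF x r]] .
  then show ?thesis using free_profinite_rep[OF x r] that by blast
qed

lemma profinite_mult_eq:
  assumes r: "r \<in> finite_congruences A"
    and x: "x \<in> free_profinite A" and y: "y \<in> free_profinite A"
    and u: "u \<in> x r" and v: "v \<in> y r"
  shows "profinite_mult A x y r = r `` {u @ v}"
proof -
  have eq: "equiv (words A) r" by (rule finite_congruencesD(1)[OF r])
  have "(u @ v, u' @ v') \<in> r" if "u' \<in> x r" "v' \<in> y r" for u' v'
  proof (rule finite_congruences_append[OF r])
    show "(u, u') \<in> r" using free_profinite_rep(2)[OF x r u] that(1) by auto
    show "(v, v') \<in> r" using free_profinite_rep(2)[OF y r v] that(2) by auto
  qed
  then have "r `` {u' @ v'} = r `` {u @ v}" if "u' \<in> x r" "v' \<in> y r" for u' v'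
    using that equiv_class_eq[OF eq] by metis
  then have "r `` {u @ v | u v. u \<in> x r \<and> v \<in> y r} = r `` {u @ v}"
    using u v by blast
  then show ?thesis using r by (simp add: profinite_mult_def)
qed

lemma profinite_mult_closed:
  assumes x: "x \<in> free_profinite A" and y: "y \<in> free_profinite A"
  shows "profinite_mult A x y \<in> free_profinite A"
  unfolding free_profinite_def
proof (intro CollectI conjI ballI impI PiE_I)
  fix r assume r: "r \<in> finite_congruences A"
  obtain u v where uv: "u \<in> words A" "u \<in> x r" "v \<in> words A" "v \<in> y r"
    using free_profinite_ex_rep[OF x r] free_profinite_ex_rep[OF y r] by metis
  show "profinite_mult A x y r \<in> words A // r"
    unfolding profinite_mult_eq[OF r x y uv(2,4)] using uv by (simp add: quotientI words_append)
next
  fix r s assume r: "r \<in> finite_congruences A" and s: "s \<in> finite_congruences A" and "r \<subseteq> s"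
  then have "x r \<subseteq> x s" "y r \<subseteq> y s" using free_profinite_mono x y by blast+
  then show "profinite_mult A x y r \<subseteq> profinite_mult A x y s"
    using r s \<open>r \<subseteq> s\<close> unfolding profinite_mult_def by fastforce
qed (simp add: profinite_mult_def)

lemma profinite_mult_rep:
  assumes r: "r \<in> finite_congruences A"
    and x: "x \<in> free_profinite A" and y: "y \<in> free_profinite A"
    and u: "u \<in> x r" and v: "v \<in> y r"
  shows "u @ v \<in> profinite_mult A x y r"
  unfolding profinite_mult_eq[OF assms]
  using equiv_class_self[OF finite_congruencesD(1)[OF r]]
    words_append[OF free_profinite_rep(1)[OF x r u] free_profinite_rep(1)[OF y r v]] .

lemma free_profinite_eqI:
  assumes "x \<in> free_profinite A" "y \<in> free_profinite A"
    and "\<And>r. r \<in> finite_congruences A \<Longrightarrow> x r = y r"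
  shows "x = y"
  using assms by (auto simp: free_profinite_def intro: PiE_ext)

lemma profinite_mult_assoc:
  assumes x: "x \<in> free_profinite A" and y: "y \<in> free_profinite A" and z: "z \<in> free_profinite A"
  shows "profinite_mult A (profinite_mult A x y) z = profinite_mult A x (profinite_mult A y z)"
proof (rule free_profinite_eqI)
  fix r assume r: "r \<in> finite_congruences A"
  obtain u v w where uvw: "u \<in> x r" "v \<in> y r" "w \<in> z r"
    using free_profinite_ex_rep[OF x r] free_profinite_ex_rep[OF y r]
      free_profinite_ex_rep[OF z r] by metis
  show "profinite_mult A (profinite_mult A x y) z r = profinite_mult A x (profinite_mult A y z) r"
    using profinite_mult_eq[OF r profinite_mult_closed[OF x y] z
        profinite_mult_rep[OF r x y uvw(1,2)] uvw(3)]
      profinite_mult_eq[OF r x profinite_mult_closed[OF y z] uvw(1)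
        profinite_mult_rep[OF r y z uvw(2,3)]] by simp
qed (use assms profinite_mult_closed in blast)+

lemma pseudoword_of_self:
  "r \<in> finite_congruences A \<Longrightarrow> w \<in> words A \<Longrightarrow> w \<in> pseudoword_of A w r"
  by (auto simp: pseudoword_of_def dest: finite_congruencesD(1) equiv_class_self)

lemma pseudoword_of_closed: "w \<in> words A \<Longrightarrow> pseudoword_of A w \<in> free_profinite A"
  by (auto simp: free_profinite_def pseudoword_of_def quotientI)

lemma pseudoword_of_append:
  assumes "u \<in> words A" "v \<in> words A"
  shows "pseudoword_of A (u @ v) = profinite_mult A (pseudoword_of A u) (pseudoword_of A v)"
proof (rule free_profinite_eqI)
  fix r assume r: "r \<in> finite_congruences A"
  have "profinite_mult A (pseudoword_of A u) (pseudoword_of A v) r = r `` {u @ v}"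
    by (rule profinite_mult_eq[OF r pseudoword_of_closed[OF assms(1)] pseudoword_of_closed[OF assms(2)]
        pseudoword_of_self[OF r assms(1)] pseudoword_of_self[OF r assms(2)]])
  then show "pseudoword_of A (u @ v) r
    = profinite_mult A (pseudoword_of A u) (pseudoword_of A v) r"
    using r by (simp add: pseudoword_of_def[of A "u @ v"])
qed (use assms in \<open>simp_all add: pseudoword_of_closed profinite_mult_closed words_append\<close>)

lemma inj_on_pseudoword_of:
  assumes "finite A"
  shows "inj_on (pseudoword_of A) (words A)"
proof (rule inj_onI)
  fix u v assume u: "u \<in> words A" and v: "v \<in> words A" and eq: "pseudoword_of A u = pseudoword_of A v"
  define N where "N = length u"
  define r where "r = {(p, q). p \<in> words A \<and> q \<in> words A \<and>
    (p = q \<or> length p > N \<and> length q > N)}"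
  have equiv: "equiv (words A) r"
    by (rule equivI) (auto simp: r_def refl_on_def sym_def trans_def)
  have cls: "r `` {w} = (if length w > N then {p \<in> words A. length p > N} else {w})"
    if "w \<in> words A" for w
    using that by (auto simp: r_def)
  have "words A // r \<subseteq>
    insert {p \<in> words A. length p > N} ((\<lambda>w. {w}) ` {w. set w \<subseteq> A \<and> length w \<le> N})"
  proof
    fix c assume "c \<in> words A // r"
    then obtain w where "w \<in> words A" "c = r `` {w}" by (auto elim: quotientE)
    then show "c \<in> insert {p \<in> words A. length p > N} ((\<lambda>w. {w}) ` {w. set w \<subseteq> A \<and> length w \<le> N})"
      using cls[of w] by (cases "length w > N") (auto simp: words_def)
  qed
  then have "finite (words A // r)"
    by (rule finite_subset) (simp add: finite_lists_length_le[OF assms])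
  with equiv have r: "r \<in> finite_congruences A"
    by (auto simp: finite_congruences_def r_def words_def)
  have "u \<in> pseudoword_of A v r"
    using pseudoword_of_self[OF r u] eq by simp
  then have "(v, u) \<in> r" using r by (simp add: pseudoword_of_def)
  then show "u = v" by (auto simp: r_def N_def)
qed

lemma topspace_profinite_topology [simp]: "topspace (profinite_topology A) = free_profinite A"
  by (auto simp: profinite_topology_def free_profinite_def)

lemma Hausdorff_profinite_topology: "Hausdorff_space (profinite_topology A)"
  unfolding profinite_topology_def
  by (simp add: Hausdorff_space_subtopology Hausdorff_space_product_topology)

lemma finite_congruences_Int:
  assumes r: "r \<in> finite_congruences A" and s: "s \<in> finite_congruences A"
  shows "r \<inter> s \<in> finite_congruences A"
proof -
  note er = finite_congruencesD(1)[OF r] and es = finite_congruencesD(1)[OF s]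
  have "equiv (words A) (r \<inter> s)"
  proof (rule equivI)
    show "r \<inter> s \<subseteq> words A \<times> words A" using equiv_type[OF er] by blast
    show "refl_on (words A) (r \<inter> s)"
      using er es by (simp add: equiv_def refl_on_def)
    show "sym (r \<inter> s)" "trans (r \<inter> s)"
      using er es by (simp_all add: equiv_def sym_Int trans_Int)
  qed
  moreover have "words A // (r \<inter> s) \<subseteq> (\<lambda>(c, d). c \<inter> d) ` ((words A // r) \<times> (words A // s))"
  proof
    fix c assume "c \<in> words A // (r \<inter> s)"
    then obtain w where "w \<in> words A" "c = r `` {w} \<inter> s `` {w}" by (auto elim!: quotientE)
    then show "c \<in> (\<lambda>(c, d). c \<inter> d) ` ((words A // r) \<times> (words A // s))"
      by (intro image_eqI[of _ _ "(r `` {w}, s `` {w})"]) (simp_all add: quotientI)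
  qed
  then have "finite (words A // (r \<inter> s))"
    by (rule finite_subset) (simp add: finite_congruencesD(2)[OF r] finite_congruencesD(2)[OF s])
  ultimately show ?thesis
    unfolding finite_congruences_def
    by (simp add: finite_congruencesD(3,4)[OF r] finite_congruencesD(3,4)[OF s])
qed

lemma finite_congruences_top: "words A \<times> words A \<in> finite_congruences A"
proof -
  have "words A // (words A \<times> words A) \<subseteq> {words A}" by (auto elim!: quotientE)
  then have "finite (words A // (words A \<times> words A))" by (rule finite_subset) simp
  then show ?thesis
    by (auto simp: finite_congruences_def equiv_def refl_on_def sym_def trans_def words_append)
qed

lemma finite_congruences_Inter:
  assumes "finite F" "F \<subseteq> finite_congruences A"
  shows "\<exists>t\<in>finite_congruences A. \<forall>r\<in>F. t \<subseteq> r"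
  using assms
proof (induction F)
  case empty
  then show ?case using finite_congruences_top by blast
next
  case (insert r F)
  then obtain t where t: "t \<in> finite_congruences A" "\<forall>r\<in>F. t \<subseteq> r" by blast
  have "r \<inter> t \<in> finite_congruences A"
    using insert.prems t(1) by (intro finite_congruences_Int) blast+
  moreover have "\<forall>s\<in>insert r F. r \<inter> t \<subseteq> s"
    using t(2) by blast
  ultimately show ?case by (rule bexI[rotated])
qed

lemma dense_pseudoword_of:
  "Abstract_Topology.closure_of (profinite_topology A) (pseudoword_of A ` words A) = free_profinite A"
proof
  show "Abstract_Topology.closure_of (profinite_topology A) (pseudoword_of A ` words A) \<subseteq> free_profinite A"
    using closure_of_subset_topspace[of "profinite_topology A"] by simp
  show "free_profinite A \<subseteq> Abstract_Topology.closure_of (profinite_topology A) (pseudoword_of A ` words A)"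
  proof
    fix x assume x: "x \<in> free_profinite A"
    have "\<exists>y. y \<in> pseudoword_of A ` words A \<and> y \<in> T"
      if "x \<in> T" "openin (profinite_topology A) T" for T
    proof -
      let ?I = "finite_congruences A"
      let ?X = "\<lambda>r. discrete_topology (words A // r)"
      from that(2) obtain T' where T': "openin (product_topology ?X ?I) T'"
        "T = T' \<inter> free_profinite A"
        unfolding profinite_topology_def openin_subtopology by (elim exE conjE)
      have "x \<in> T'" using that(1) T'(2) by blast
      from openin_product_topology_alt[THEN iffD1, rule_format, OF T'(1) this]
      obtain U where U: "finite {i \<in> ?I. U i \<noteq> topspace (?X i)}" "x \<in> Pi\<^sub>E ?I U"
        "Pi\<^sub>E ?I U \<subseteq> T'"
        by (elim exE conjE)
      obtain t where t: "t \<in> ?I" "\<forall>r\<in>{i \<in> ?I. U i \<noteq> topspace (?X i)}. t \<subseteq> r"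
        using finite_congruences_Inter[OF U(1)] by (metis (no_types, lifting) mem_Collect_eq subsetI)
      obtain w where w: "w \<in> words A" "w \<in> x t" by (rule free_profinite_ex_rep[OF x t(1)])
      have "pseudoword_of A w \<in> Pi\<^sub>E ?I U"
      proof (rule PiE_I)
        fix r assume r: "r \<in> ?I"
        show "pseudoword_of A w r \<in> U r"
        proof (cases "U r = topspace (?X r)")
          case True
          then show ?thesis using r w by (simp add: pseudoword_of_def quotientI)
        next
          case False
          then have "t \<subseteq> r" using t(2) r by blast
          then have "w \<in> x r" using free_profinite_mono[OF x t(1) r] w by auto
          then have "x r = r `` {w}" by (rule free_profinite_rep(2)[OF x r])
          then show ?thesis using PiE_mem[OF U(2) r] r by (simp add: pseudoword_of_def)
        qed
      qed (simp add: pseudoword_of_def)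
      then show ?thesis using U(3) T'(2) pseudoword_of_closed[OF w(1)] w(1) by blast
    qed
    with x show "x \<in> Abstract_Topology.closure_of (profinite_topology A) (pseudoword_of A ` words A)"
      unfolding in_closure_of by simp
  qed
qed

lemma ex1_profinite_extension:
  assumes \<phi>: "word_hom A B \<phi>"
  shows "\<exists>!f. is_profinite_extension A B \<phi> f"
proof (rule ex_ex1I)
  define pull where "pull r = {(u, v). u \<in> words A \<and> v \<in> words A \<and> (\<phi> u, \<phi> v) \<in> r}" for r
  have pull: "pull r \<in> finite_congruences A" if r: "r \<in> finite_congruences B" for r
  proof -
    note er = finite_congruencesD(1)[OF r]
    have "equiv (words A) (pull r)"
    proof (rule equivI)
      show "pull r \<subseteq> words A \<times> words A" by (auto simp: pull_def)
      show "refl_on (words A) (pull r)"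
        using er word_homD(1)[OF \<phi>] by (simp add: pull_def equiv_def refl_on_def)
      show "sym (pull r)"
        using er by (simp add: pull_def equiv_def sym_def)
      show "trans (pull r)"
        using er unfolding pull_def equiv_def trans_def by blast
    qed
    moreover have "words A // pull r \<subseteq> (\<lambda>c. words A \<inter> \<phi> -` c) ` (words B // r)"
    proof
      fix c assume "c \<in> words A // pull r"
      then obtain w where "w \<in> words A" "c = words A \<inter> \<phi> -` (r `` {\<phi> w})"
        by (auto simp: pull_def elim!: quotientE)
      then show "c \<in> (\<lambda>c. words A \<inter> \<phi> -` c) ` (words B // r)"
        using word_homD(1)[OF \<phi>] by (blast intro: quotientI)
    qed
    then have "finite (words A // pull r)"
      by (rule finite_subset) (simp add: finite_congruencesD(2)[OF r])
    moreover have "(u @ w, v @ w) \<in> pull r" "(w @ u, w @ v) \<in> pull r"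
      if "(u, v) \<in> pull r" "w \<in> words A" for u v w
      using that finite_congruencesD(3,4)[OF r] word_homD[OF \<phi>]
      by (simp_all add: pull_def words_append)
    ultimately show ?thesis
      unfolding finite_congruences_def by blast
  qed
  define g where "g x = (\<lambda>r\<in>finite_congruences B. r `` (\<phi> ` x (pull r)))" for x
  have g_eq: "g x r = r `` {\<phi> w}"
    if x: "x \<in> free_profinite A" and r: "r \<in> finite_congruences B" and w: "w \<in> x (pull r)"
    for x r w
  proof -
    have "(\<phi> w, \<phi> u) \<in> r" if "u \<in> x (pull r)" for u
      using free_profinite_rep(2)[OF x pull[OF r] w] that by (auto simp: pull_def)
    then have "r `` {\<phi> u} = r `` {\<phi> w}" if "u \<in> x (pull r)" for u
      using that equiv_class_eq[OF finite_congruencesD(1)[OF r]] by metis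
    then have "r `` (\<phi> ` x (pull r)) = r `` {\<phi> w}" using w by blast
    then show ?thesis using r by (simp add: g_def)
  qed
  have g_closed: "g x \<in> free_profinite B" if x: "x \<in> free_profinite A" for x
    unfolding free_profinite_def
  proof (intro CollectI conjI ballI impI PiE_I)
    fix r assume r: "r \<in> finite_congruences B"
    obtain w where "w \<in> words A" "w \<in> x (pull r)" by (rule free_profinite_ex_rep[OF x pull[OF r]])
    then show "g x r \<in> words B // r"
      using g_eq[OF x r] word_homD(1)[OF \<phi>] by (simp add: quotientI)
  next
    fix r s assume r: "r \<in> finite_congruences B" and s: "s \<in> finite_congruences B" and "r \<subseteq> s"
    have "pull r \<subseteq> pull s" using \<open>r \<subseteq> s\<close> by (auto simp: pull_def)
    then have "x (pull r) \<subseteq> x (pull s)" using free_profinite_mono x pull r s by blast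
    then show "g x r \<subseteq> g x s" using r s \<open>r \<subseteq> s\<close> unfolding g_def by auto
  qed (simp add: g_def)
  have g_rep: "\<phi> w \<in> g x r"
    if x: "x \<in> free_profinite A" and r: "r \<in> finite_congruences B" and w: "w \<in> x (pull r)"
    for x r w
    using g_eq[OF that] equiv_class_self[OF finite_congruencesD(1)[OF r]]
      word_homD(1)[OF \<phi> free_profinite_rep(1)[OF x pull[OF r] w]] by simp
  have cont: "continuous_map (profinite_topology A) (profinite_topology B) g"
  proof -
    have "continuous_map (profinite_topology A) (discrete_topology (words B // r)) (\<lambda>x. g x r)"
      if r: "r \<in> finite_congruences B" for r
    proof -
      have 1: "continuous_map (profinite_topology A) (discrete_topology (words A // pull r))
        (\<lambda>x. x (pull r))"
        unfolding profinite_topology_def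
        by (rule continuous_map_from_subtopology, rule continuous_map_product_projection)
          (rule pull[OF r])
      have "r `` (\<phi> ` c) \<in> words B // r" if c: "c \<in> words A // pull r" for c
      proof -
        obtain w where w: "w \<in> words A" "c = pull r `` {w}" using c by (auto elim: quotientE)
        have "r `` {\<phi> u} = r `` {\<phi> w}" if "u \<in> c" for u
          using that w equiv_class_eq[OF finite_congruencesD(1)[OF r]] by (auto simp: pull_def)
        moreover have "w \<in> c" using w equiv_class_self[OF finite_congruencesD(1)[OF pull[OF r]]] by simp
        ultimately have "r `` (\<phi> ` c) = r `` {\<phi> w}" by blast
        then show ?thesis using word_homD(1)[OF \<phi> w(1)] by (simp add: quotientI)
      qed
      then have 2: "continuous_map (discrete_topology (words A // pull r))
        (discrete_topology (words B // r)) (\<lambda>c. r `` (\<phi> ` c))"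
        by auto
      show ?thesis
        using continuous_map_compose[OF 1 2] r by (simp add: o_def g_def)
    qed
    then have "continuous_map (profinite_topology A)
      (product_topology (\<lambda>r. discrete_topology (words B // r)) (finite_congruences B)) g"
      by (auto simp: continuous_map_componentwise g_def)
    then show ?thesis
      using g_closed by (subst (2) profinite_topology_def)
        (auto simp: continuous_map_in_subtopology)
  qed
  define f where "f = restrict g (free_profinite A)"
  have "is_profinite_extension A B \<phi> f"
    unfolding is_profinite_extension_def
  proof (intro conjI ballI)
    show "f \<in> extensional (free_profinite A)" by (simp add: f_def)
    show "continuous_map (profinite_topology A) (profinite_topology B) f"
      using cont by (rule continuous_map_eq) (simp add: f_def)
  next
    fix x y assume x: "x \<in> free_profinite A" and y: "y \<in> free_profinite A"
    have "g (profinite_mult A x y) = profinite_mult B (g x) (g y)"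
    proof (rule free_profinite_eqI)
      fix r assume r: "r \<in> finite_congruences B"
      obtain u v where u: "u \<in> words A" "u \<in> x (pull r)" and v: "v \<in> words A" "v \<in> y (pull r)"
        using free_profinite_ex_rep[OF x pull[OF r]] free_profinite_ex_rep[OF y pull[OF r]] by metis
      have "g (profinite_mult A x y) r = r `` {\<phi> (u @ v)}"
        by (rule g_eq[OF profinite_mult_closed[OF x y] r
              profinite_mult_rep[OF pull[OF r] x y u(2) v(2)]])
      also have "\<dots> = profinite_mult B (g x) (g y) r"
        using profinite_mult_eq[OF r g_closed[OF x] g_closed[OF y] g_rep[OF x r u(2)]
            g_rep[OF y r v(2)]] word_homD(2)[OF \<phi> u(1) v(1)] by simp
      finally show "g (profinite_mult A x y) r = profinite_mult B (g x) (g y) r" .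
    qed (use x y g_closed profinite_mult_closed in blast)+
    then show "f (profinite_mult A x y) = profinite_mult B (f x) (f y)"
      using x y by (simp add: f_def profinite_mult_closed)
  next
    fix w assume w: "w \<in> words A"
    have "g (pseudoword_of A w) = pseudoword_of B (\<phi> w)"
    proof (rule free_profinite_eqI)
      fix r assume r: "r \<in> finite_congruences B"
      show "g (pseudoword_of A w) r = pseudoword_of B (\<phi> w) r"
        using g_eq[OF pseudoword_of_closed[OF w] r pseudoword_of_self[OF pull[OF r] w]] r
        by (simp add: pseudoword_of_def[of B])
    qed (use w g_closed pseudoword_of_closed word_homD(1)[OF \<phi>] in blast)+
    then show "f (pseudoword_of A w) = pseudoword_of B (\<phi> w)"
      using w by (simp add: f_def pseudoword_of_closed)
  qed
  then show "\<exists>f. is_profinite_extension A B \<phi> f" by blast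
next
  fix f g assume f: "is_profinite_extension A B \<phi> f" and g: "is_profinite_extension A B \<phi> g"
  have "f x = g x" if "x \<in> free_profinite A" for x
  proof (rule forall_in_closure_of_eq[of x "profinite_topology A" "pseudoword_of A ` words A"
        "profinite_topology B" f g])
    show "x \<in> Abstract_Topology.closure_of (profinite_topology A) (pseudoword_of A ` words A)"
      using that by (simp add: dense_pseudoword_of)
  qed (use f g in \<open>auto simp: is_profinite_extension_def Hausdorff_profinite_topology\<close>)
  moreover have "f \<in> extensional (free_profinite A)" "g \<in> extensional (free_profinite A)"
    using f g by (simp_all add: is_profinite_extension_def)
  ultimately show "f = g" by (metis extensionalityI)
qed

end

theory Submission
  imports Defs
begin

text \<open>All parts turn on one notion: \<open>\<sigma>\<^sub>0\<^sub>,\<^sub>n\<close> is desynchronized if arbitrarily long words of the language have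
  two parsings into blocks, such that a cutting point of the first is strictly inside a block of the
  second. By compactness, recognizability excludes desynchronization. If there is none, an
  approximation of a unit \<open>h = ehe\<close> of a maximal subgroup is delimited in both directions by long
  approximations of \<open>e\<close>, hence by cutting points, so that \<open>h\<close> lies in the image of every \<open>\<sigma>\<^sub>0\<^sub>,\<^sub>n\<close>. Conversely, a
  failure of recognizability of an injective \<open>\<sigma>\<^sub>n\<close> desynchronizes it, and if the maximal subgroup
  lies in the profinite image, then the two parsings of an approximation of \<open>e\<close> can be
  interchanged, which contradicts injectivity.

  This reduces the statements on pure and recurrent sequences to saturation. Modulo any finite
  congruence a unit has a power equal to \<open>e\<close>, which is in the image of every \<open>\<sigma>\<^sub>0\<^sub>,\<^sub>n\<close>: purity extracts the root, while
  recurrence yields a retraction onto the profinite image, and the maximal subgroups of a free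
  profinite semigroup are torsion-free.\<close>


section \<open>Ultrafilters\<close>

text \<open>Recognizability concerns single bi-infinite words, saturation concerns limits visible
  only through finite quotients. Desynchronization lies between them because it speaks of finite
  words of unbounded length: limits taken letter by letter lead to bi-infinite words, limits taken
  congruence by congruence lead to pseudowords. The second passage can be reversed because every
  finite congruence can be refined so that a factorization of a class is realized by its words
  (multiplication is open), and so that a class meeting the image of a homomorphism is contained in
  it (images are clopen). Limits of the common factors of two parsings lie in the regular J-class of
  \<open>e\<close>, where stability allows factors to be cancelled and recombined. For recurrent
  sequences the obstacle is that a unit at level 0 is not known to have a preimage at a level from
  which on the sequence is recognizable; only some power of it visibly has one. Comparing the unit
  with its retract turns the defect into an element of finite order. Torsion-freeness itself comes
  from counting edges in a finite Cayley graph.\<close>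

definition ultra :: "'i filter \<Rightarrow> bool" where
  "ultra U \<longleftrightarrow> U \<noteq> bot \<and> (\<forall>P. eventually P U \<or> eventually (\<lambda>i. \<not> P i) U)"

text \<open>Zorn's lemma for proper filters ordered by refinement: a minimal proper filter below
  \<open>F\<close> decides every predicate, since refining it by an undecided one would leave it
  proper.\<close>

lemma ultra_exists:
  fixes F :: "'i filter"
  assumes "F \<noteq> bot"
  shows "\<exists>U\<le>F. ultra U"
proof -
  let ?S = "{G. G \<noteq> bot \<and> G \<le> F}"
  let ?P = "\<lambda>G H :: 'i filter. H \<le> G"
  have "\<exists>m\<in>?S. \<forall>a\<in>?S. ?P m a \<longrightarrow> a = m"
  proof (rule predicate_Zorn)
    show "partial_order_on ?S (relation_of ?P ?S)"
      by (rule partial_order_on_relation_ofI) auto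
  next
    fix C assume C: "C \<in> Chains (relation_of ?P ?S)"
    have sub: "C \<subseteq> ?S" and tot: "\<And>G H. G \<in> C \<Longrightarrow> H \<in> C \<Longrightarrow> G \<le> H \<or> H \<le> G"
      using C by (auto simp: Chains_def relation_of_def)
    show "\<exists>u\<in>?S. \<forall>a\<in>C. ?P a u"
    proof (cases "C = {}")
      case True
      then show ?thesis using assms by blast
    next
      case False
      have "\<exists>x\<in>C. x \<le> inf G H" if "G \<in> C" "H \<in> C" for G H
        using tot[OF that] that by (auto simp: inf_absorb1 inf_absorb2)
      then have "eventually (\<lambda>_. False) (Inf C) \<longleftrightarrow> (\<exists>b\<in>C. eventually (\<lambda>_. False) b)"
        by (rule eventually_Inf_base[OF False])
      then have "Inf C \<noteq> bot"
        using sub by (auto simp: trivial_limit_def)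
      moreover have "Inf C \<le> F"
        using False sub by (auto intro: Inf_lower2)
      ultimately show ?thesis by (intro bexI[of _ "Inf C"]) (auto intro: Inf_lower)
    qed
  qed
  then obtain U where U: "U \<noteq> bot" "U \<le> F" "\<And>a. a \<noteq> bot \<Longrightarrow> a \<le> F \<Longrightarrow> a \<le> U \<Longrightarrow> a = U"
    by blast
  have "eventually P U \<or> eventually (\<lambda>i. \<not> P i) U" for P
  proof (rule disjCI)
    assume "\<not> eventually (\<lambda>i. \<not> P i) U"
    then have "inf U (principal {i. P i}) \<noteq> bot"
      by (simp add: trivial_limit_def eventually_inf_principal)
    then have "inf U (principal {i. P i}) = U"
      using U(2,3) by (meson inf_le1 order_trans)
    moreover have "eventually P (inf U (principal {i. P i}))"
      by (simp add: eventually_inf_principal)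
    ultimately show "eventually P U" by simp
  qed
  then show ?thesis using U by (auto simp: ultra_def)
qed

lemma ultra_nonbot: "ultra U \<Longrightarrow> U \<noteq> bot"
  by (simp add: ultra_def)

text \<open>All limits below, of pseudowords as well as of bi-infinite words, are taken by this
  principle, which avoids passing to subsequences.\<close>

lemma ultra_finite_image:
  assumes "ultra U" "finite C" "eventually (\<lambda>i. f i \<in> C) U"
  shows "\<exists>c\<in>C. eventually (\<lambda>i. f i = c) U"
proof (rule ccontr)
  assume "\<not> ?thesis"
  then have "\<forall>c\<in>C. eventually (\<lambda>i. f i \<noteq> c) U"
    using assms(1) by (auto simp: ultra_def)
  then have "eventually (\<lambda>i. \<forall>c\<in>C. f i \<noteq> c) U"
    using assms(2) by (simp add: eventually_ball_finite)
  with assms(3) have "eventually (\<lambda>i. False) U"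
    by eventually_elim blast
  then show False using assms(1) by (simp add: ultra_def trivial_limit_def)
qed

section \<open>Finite congruences\<close>

abbreviation profinite_mult_infix ::
    "'a pseudoword \<Rightarrow> 'a set \<Rightarrow> 'a pseudoword \<Rightarrow> 'a pseudoword" ("(_ \<odot>\<^bsub>_\<^esub>/ _)" [71, 0, 70] 70)
  where "x \<odot>\<^bsub>A\<^esub> y \<equiv> profinite_mult A x y"

text \<open>New congruences are built below as kernels of finite-valued invariants of words, so that
  only compatibility of the invariant with concatenation has to be checked.\<close>

lemma finite_congruence_kernel:
  assumes fin: "finite (F ` words A)"
    and R: "\<And>u v w. u \<in> words A \<Longrightarrow> v \<in> words A \<Longrightarrow> w \<in> words A \<Longrightarrow> F u = F v \<Longrightarrow> F (u @ w) = F (v @ w)"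
    and L: "\<And>u v w. u \<in> words A \<Longrightarrow> v \<in> words A \<Longrightarrow> w \<in> words A \<Longrightarrow> F u = F v \<Longrightarrow> F (w @ u) = F (w @ v)"
  shows "{(u, v). u \<in> words A \<and> v \<in> words A \<and> F u = F v} \<in> finite_congruences A" (is "?r \<in> _")
proof -
  have "equiv (words A) ?r"
    by (rule equivI) (auto simp: refl_on_def sym_def trans_def)
  moreover have "words A // ?r \<subseteq> (\<lambda>c. {w \<in> words A. c = F w}) ` (F ` words A)"
    by (auto elim!: quotientE)
  then have "finite (words A // ?r)"
    by (rule finite_subset) (simp add: fin)
  moreover have "(u @ w, v @ w) \<in> ?r \<and> (w @ u, w @ v) \<in> ?r" if "(u, v) \<in> ?r" "w \<in> words A" for u v w
    using that R[of u v w] L[of u v w] by (simp add: words_append)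
  ultimately show ?thesis
    unfolding finite_congruences_def by blast
qed

text \<open>Finite congruences are directed downwards by intersection, so their down-sets generate a
  proper filter. The second coordinate lets lengths or levels tend to infinity along the same
  ultrafilter.\<close>

lemma ultra_congruences:
  "\<exists>U :: (('a list \<times> 'a list) set \<times> nat) filter. ultra U \<and>
    (\<forall>r\<in>finite_congruences A. eventually (\<lambda>i. fst i \<in> finite_congruences A \<and> fst i \<subseteq> r) U) \<and>
    (\<forall>n. eventually (\<lambda>i. n \<le> snd i) U)"
proof -
  let ?I = "finite_congruences A"
  let ?b = "\<lambda>r. principal {s \<in> ?I. s \<subseteq> r}"
  define F where "F = Inf (?b ` ?I)"
  have ev: "eventually P F \<longleftrightarrow> (\<exists>r\<in>?I. eventually P (?b r))" for P
  proof -
    have "eventually P F \<longleftrightarrow> (\<exists>b\<in>?b ` ?I. eventually P b)"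
      unfolding F_def
    proof (rule eventually_Inf_base)
      show "?b ` ?I \<noteq> {}" using finite_congruences_top by blast
      fix G H assume "G \<in> ?b ` ?I" "H \<in> ?b ` ?I"
      then obtain r s where rs: "r \<in> ?I" "s \<in> ?I" "G = ?b r" "H = ?b s" by blast
      have "?b (r \<inter> s) \<le> inf G H" using rs by auto
      then show "\<exists>x\<in>?b ` ?I. x \<le> inf G H"
        using finite_congruences_Int[OF rs(1,2)] by blast
    qed
    then show ?thesis by simp
  qed
  have "F \<noteq> bot"
    by (auto simp: trivial_limit_def ev eventually_principal)
  then have "F \<times>\<^sub>F sequentially \<noteq> bot"
    by (simp add: prod_filter_eq_bot)
  then obtain U where U: "U \<le> F \<times>\<^sub>F sequentially" "ultra U"
    using ultra_exists by blast
  show ?thesis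
  proof (intro exI[of _ U] conjI ballI allI)
    show "ultra U" by fact
  next
    fix r assume "r \<in> ?I"
    then have "eventually (\<lambda>s. s \<in> ?I \<and> s \<subseteq> r) F"
      by (auto simp: ev eventually_principal)
    then have "eventually (\<lambda>x. fst x \<in> ?I \<and> fst x \<subseteq> r) (F \<times>\<^sub>F sequentially)"
      by (rule eventually_compose_filterlim[OF _ filterlim_fst])
    then show "eventually (\<lambda>i. fst i \<in> ?I \<and> fst i \<subseteq> r) U"
      using filter_leD[OF U(1)] by blast
  next
    fix n :: nat
    have "eventually (\<lambda>x. n \<le> snd x) (F \<times>\<^sub>F sequentially)"
      by (rule eventually_compose_filterlim[OF eventually_ge_at_top filterlim_snd])
    then show "eventually (\<lambda>i. n \<le> snd i) U"
      using filter_leD[OF U(1)] by (simp add: case_prod_beta)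
  qed
qed

text \<open>Agrees with a homomorphism \<phi> on nonempty words over its alphabet, but is also
  multiplicative at the empty word, where \<open>word_hom\<close> says nothing about \<phi>.\<close>

definition letterwise :: "('a list \<Rightarrow> 'b list) \<Rightarrow> 'a list \<Rightarrow> 'b list" where
  "letterwise \<phi> u = concat (map (\<lambda>a. \<phi> [a]) u)"

lemma letterwise_simps [simp]:
  "letterwise \<phi> [] = []" "letterwise \<phi> (a # u) = \<phi> [a] @ letterwise \<phi> u"
  "letterwise \<phi> (u @ v) = letterwise \<phi> u @ letterwise \<phi> v"
  by (simp_all add: letterwise_def)

lemma word_hom_letterwise:
  assumes "word_hom A B \<phi>" "u \<in> words A"
  shows "\<phi> u = letterwise \<phi> u"
  using assms(2)
proof (induction u)
  case (Cons a u)
  show ?case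
  proof (cases "u = []")
    case False
    then have "[a] \<in> words A" "u \<in> words A" using Cons.prems by (auto simp: words_def)
    then show ?thesis using word_homD(2)[OF assms(1), of "[a]" u] Cons.IH by simp
  qed simp
qed (simp add: words_def)

lemma word_hom_letter:
  assumes "word_hom A B \<phi>" "a \<in> A"
  shows "\<phi> [a] \<noteq> []" "set (\<phi> [a]) \<subseteq> B"
  using word_homD(1)[OF assms(1), of "[a]"] assms(2) by (auto simp: words_def)

lemma letterwise_set:
  assumes "word_hom A B \<phi>" "set u \<subseteq> A"
  shows "set (letterwise \<phi> u) \<subseteq> B"
  using assms(2) word_hom_letter(2)[OF assms(1)] by (induction u) auto

text \<open>Images of recognizable languages under homomorphisms are recognizable: the transition relation
  of a word \<open>w\<close> records how \<open>x @ w\<close> can be read as an image followed by an incomplete block.\<close>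

lemma image_split:
  assumes P: "P = insert [] {x. \<exists>a\<in>A. \<exists>y. y \<noteq> [] \<and> \<phi> [a] = x @ y}"
    and "set u \<subseteq> A" "x'' \<in> P" "W1 @ W2 = letterwise \<phi> u @ x''"
  shows "\<exists>u1 u2 x'. u = u1 @ u2 \<and> W1 = letterwise \<phi> u1 @ x' \<and> x' \<in> P \<and> x' @ W2 = letterwise \<phi> u2 @ x''"
  using assms(2,4)
proof (induction u arbitrary: W1)
  case Nil
  have "W1 \<in> P"
    using assms(3) Nil unfolding P by (auto simp: append_eq_append_conv2)
      (metis append_is_Nil_conv append_assoc)
  then show ?case using Nil by (intro exI[of _ "[]"] exI[of _ W1]) auto
next
  case (Cons a u)
  show ?case
  proof (cases "length W1 < length (\<phi> [a])")
    case True
    from Cons.prems(2) have "take (length W1) (W1 @ W2) = take (length W1) (\<phi> [a] @ letterwise \<phi> u @ x'')"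
      by simp
    then have "W1 = take (length W1) (\<phi> [a])" using True by simp
    then have "\<phi> [a] = W1 @ drop (length W1) (\<phi> [a])" by (metis append_take_drop_id)
    moreover have "drop (length W1) (\<phi> [a]) \<noteq> []" using True by simp
    ultimately obtain y where "\<phi> [a] = W1 @ y" "y \<noteq> []" by blast
    then have "W1 \<in> P" using Cons.prems(1) unfolding P by auto
    then show ?thesis using Cons.prems by (intro exI[of _ "[]"] exI[of _ "a # u"] exI[of _ W1]) auto
  next
    case False
    from Cons.prems(2) have "take (length (\<phi> [a])) (W1 @ W2) = \<phi> [a]" by simp
    then have "W1 = \<phi> [a] @ drop (length (\<phi> [a])) W1"
      using False by (metis append_take_drop_id leI take_append diff_is_0_eq take0 append_Nil2)
    then obtain W where W: "W1 = \<phi> [a] @ W" by blast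
    then have "W @ W2 = letterwise \<phi> u @ x''" using Cons.prems(2) by simp
    moreover have "set u \<subseteq> A" using Cons.prems(1) by simp
    ultimately obtain u1 u2 x' where "u = u1 @ u2" "W = letterwise \<phi> u1 @ x'" "x' \<in> P"
      "x' @ W2 = letterwise \<phi> u2 @ x''"
      using Cons.IH[of W] by blast
    then show ?thesis using W by (intro exI[of _ "a # u1"] exI[of _ u2] exI[of _ x']) auto
  qed
qed

lemma recognizable_image:
  assumes hom: "word_hom A B \<phi>" and finA: "finite A" and r: "r \<in> finite_congruences A"
  shows "\<exists>s\<in>finite_congruences B. \<forall>u\<in>words A. \<forall>w. (\<phi> u, w) \<in> s \<longrightarrow> (\<exists>v. (u, v) \<in> r \<and> w = \<phi> v)"
proof -
  \<comment> \<open>The incomplete blocks: proper prefixes of images of letters.\<close>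
  define P where "P = insert [] {x. \<exists>a\<in>A. \<exists>y. y \<noteq> [] \<and> \<phi> [a] = x @ y}"
  have finP: "finite P"
  proof -
    have "P \<subseteq> insert [] (\<Union>a\<in>A. set (prefixes (\<phi> [a])))"
      by (auto simp: P_def in_set_prefixes)
    then show ?thesis by (rule finite_subset) (use finA in auto)
  qed
  \<comment> \<open>The empty word becomes a class of its own, because a word lying inside a single
    block completes no letter.\<close>
  define rr where "rr = insert ([], []) r"
  have equiv: "equiv (words A) r" by (rule finite_congruencesD(1)[OF r])
  have rr_sub: "u \<in> lists A \<and> v \<in> lists A" if "(u, v) \<in> rr" for u v
    using that equiv_type[OF equiv] by (auto simp: rr_def words_def)
  have Nil_r: "([], u) \<notin> r" "(u, []) \<notin> r" for u
    using equiv_type[OF equiv] by (auto simp: words_def)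
  have lists: "lists A = insert [] (words A)" by (auto simp: words_def)
  have rr_refl: "(u, u) \<in> rr" if "set u \<subseteq> A" for u
    using that equiv by (cases "u = []") (auto simp: rr_def words_def equiv_def refl_on_def)
  have rr_cls: "rr `` {u} = rr `` {v} \<longleftrightarrow> (u, v) \<in> rr" if "set u \<subseteq> A" "set v \<subseteq> A" for u v
  proof
    assume "(u, v) \<in> rr"
    then show "rr `` {u} = rr `` {v}"
      using Nil_r equiv_class_eq[OF equiv, of u v] by (auto simp: rr_def)
  next
    assume "rr `` {u} = rr `` {v}"
    then show "(u, v) \<in> rr" using rr_refl[OF that(2)] by auto
  qed
  have rr_app: "(u @ v, u' @ v') \<in> rr" if "(u, u') \<in> rr" "(v, v') \<in> rr" for u u' v v'
    using that finite_congruences_append[OF r, of u u' v v'] by (auto simp: rr_def)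
  define T where "T w = {(x, rr `` {u}, x') | x u x'. x \<in> P \<and> x' \<in> P \<and> set u \<subseteq> A \<and> x @ w = letterwise \<phi> u @ x'}" for w
  define C where "C X Y = {(x, rr `` {u @ v}, x'') | x u x' v x''. (x, rr `` {u}, x') \<in> X \<and> (x', rr `` {v}, x'') \<in> Y
     \<and> set u \<subseteq> A \<and> set v \<subseteq> A}" for X Y :: "('b list \<times> 'a list set \<times> 'b list) set"
  \<comment> \<open>Transition relations compose: a parsing of \<open>w @ w'\<close> is cut at the
    incomplete block where \<open>w\<close> ends, and two parsings meeting in the same incomplete
    block are concatenated.\<close>
  have T_app: "T (w @ w') = C (T w) (T w')" for w w'
  proof (intro equalityI subsetI)
    fix t assume "t \<in> T (w @ w')"
    then obtain x u x'' where t: "t = (x, rr `` {u}, x'')" "x \<in> P" "x'' \<in> P" "set u \<subseteq> A"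
      "(x @ w) @ w' = letterwise \<phi> u @ x''" by (auto simp: T_def)
    obtain u1 u2 x' where s: "u = u1 @ u2" "x @ w = letterwise \<phi> u1 @ x'" "x' \<in> P" "x' @ w' = letterwise \<phi> u2 @ x''"
      using image_split[OF P_def t(4,3,5)] by blast
    have "(x, rr `` {u1}, x') \<in> T w" "(x', rr `` {u2}, x'') \<in> T w'"
      using s t by (auto simp: T_def)
    then show "t \<in> C (T w) (T w')" using s(1) t(1,4) unfolding C_def by auto
  next
    fix t assume "t \<in> C (T w) (T w')"
    then obtain x u x' v x'' where t: "t = (x, rr `` {u @ v}, x'')" "(x, rr `` {u}, x') \<in> T w"
      "(x', rr `` {v}, x'') \<in> T w'" "set u \<subseteq> A" "set v \<subseteq> A" by (auto simp: C_def)
    obtain u0 where u0: "rr `` {u} = rr `` {u0}" "set u0 \<subseteq> A" "x @ w = letterwise \<phi> u0 @ x'" "x \<in> P"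
      using t(2) by (auto simp: T_def)
    obtain v0 where v0: "rr `` {v} = rr `` {v0}" "set v0 \<subseteq> A" "x' @ w' = letterwise \<phi> v0 @ x''" "x'' \<in> P"
      using t(3) by (auto simp: T_def)
    have "(u @ v, u0 @ v0) \<in> rr"
      using u0 v0 t(4,5) rr_cls by (intro rr_app) auto
    then have "rr `` {u @ v} = rr `` {u0 @ v0}"
      using rr_cls[of "u @ v" "u0 @ v0"] u0 v0 t by auto
    moreover have "x @ w @ w' = letterwise \<phi> (u0 @ v0) @ x''"
      using u0(3) v0(3) by simp (metis append_assoc)
    ultimately show "t \<in> T (w @ w')"
      using t(1) u0 v0 unfolding T_def by (intro CollectI) (metis le_sup_iff set_append)
  qed
  define s where "s = {(u, v). u \<in> words B \<and> v \<in> words B \<and> T u = T v}"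
  have "s \<in> finite_congruences B"
    unfolding s_def
  proof (rule finite_congruence_kernel)
    have "T w \<in> Pow (P \<times> insert {[]} (words A // r) \<times> P)" for w
    proof -
      have "rr `` {u} \<in> insert {[]} (words A // r)" if "set u \<subseteq> A" for u
      proof (cases "u = []")
        case True
        then have "rr `` {u} = {[]}" using Nil_r by (auto simp: rr_def)
        then show ?thesis by simp
      next
        case False
        then have "rr `` {u} = r `` {u}" by (auto simp: rr_def)
        then show ?thesis using False that by (auto simp: words_def intro!: quotientI)
      qed
      then show ?thesis by (auto simp: T_def)
    qed
    then have "T ` words B \<subseteq> Pow (P \<times> insert {[]} (words A // r) \<times> P)" by blast
    then show "finite (T ` words B)"
      by (rule finite_subset) (use finP finite_congruencesD(2)[OF r] in auto)
  qed (simp_all add: T_app)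
  moreover have "\<exists>v. (u, v) \<in> r \<and> w = \<phi> v" if u: "u \<in> words A" and uw: "(\<phi> u, w) \<in> s" for u w
  proof -
    have "set u \<subseteq> A" "u \<noteq> []" using u by (auto simp: words_def)
    moreover have "[] \<in> P" by (simp add: P_def)
    \<comment> \<open>The word \<phi> u leads from the empty remainder to the empty remainder
      through the class of \<open>u\<close>. A word with the same transitions can be read in the
      same way, hence is the image of a word congruent to \<open>u\<close>.\<close>
    ultimately have "([], rr `` {u}, []) \<in> T (\<phi> u)"
      using word_hom_letterwise[OF hom u] unfolding T_def by fastforce
    then have "([], rr `` {u}, []) \<in> T w" using uw by (simp add: s_def)
    then obtain v where v: "rr `` {u} = rr `` {v}" "set v \<subseteq> A" "w = letterwise \<phi> v"
      by (auto simp: T_def)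
    then have "(u, v) \<in> rr" using rr_cls \<open>set u \<subseteq> A\<close> by blast
    then have "(u, v) \<in> r" using \<open>u \<noteq> []\<close> by (auto simp: rr_def)
    then have "v \<in> words A" using equiv_type[OF equiv] by auto
    then show ?thesis using v \<open>(u, v) \<in> r\<close> word_hom_letterwise[OF hom] by auto
  qed
  ultimately show ?thesis by blast
qed

text \<open>The refined invariant remembers, besides the class of a word, the pairs of classes of
  all its factorizations in two. In a product \<open>x @ y\<close> the cut falls inside
  \<open>x\<close>, between the factors, or inside \<open>y\<close>, and in each case the pair is
  determined by the invariants of \<open>x\<close> and \<open>y\<close>.\<close>

lemma split_congruence:
  assumes r: "r \<in> finite_congruences A"
  shows "\<exists>s\<in>finite_congruences A. s \<subseteq> r \<and>
    (\<forall>w u v. u \<in> words A \<longrightarrow> v \<in> words A \<longrightarrow> (u @ v, w) \<in> s \<longrightarrow> (\<exists>u' v'. w = u' @ v' \<and> (u, u') \<in> r \<and> (v, v') \<in> r))"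
proof -
  have equiv: "equiv (words A) r" by (rule finite_congruencesD(1)[OF r])
  define T where "T w = {(r `` {u}, r `` {v}) | u v. u \<in> words A \<and> v \<in> words A \<and> w = u @ v}" for w
  define F where "F w = (r `` {w}, T w)" for w
  have cls: "r `` {u @ w} = r `` {v @ w'}" if "r `` {u} = r `` {v}" "r `` {w} = r `` {w'}"
    "u \<in> words A" "v \<in> words A" "w \<in> words A" "w' \<in> words A" for u v w w'
    using that finite_congruences_append[OF r, of u v w w'] equiv
    by (metis eq_equiv_class_iff equiv_class_eq)
  have T_app: "T (x @ y) = {(a, r `` {v @ y}) | a v. v \<in> words A \<and> (a, r `` {v}) \<in> T x} \<union> {(r `` {x}, r `` {y})}
      \<union> {(r `` {x @ u}, b) | u b. u \<in> words A \<and> (r `` {u}, b) \<in> T y}"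
    if x: "x \<in> words A" and y: "y \<in> words A" for x y
  proof (intro equalityI subsetI)
    fix t assume "t \<in> T (x @ y)"
    then obtain u v where t: "t = (r `` {u}, r `` {v})" "u \<in> words A" "v \<in> words A" "x @ y = u @ v"
      by (auto simp: T_def)
    from t(4) consider z where "x = u @ z" "v = z @ y" "z \<noteq> []" | "x = u" "y = v"
      | z where "u = x @ z" "y = z @ v" "z \<noteq> []"
      by (auto simp: append_eq_append_conv2)
    then show "t \<in> {(a, r `` {v @ y}) | a v. v \<in> words A \<and> (a, r `` {v}) \<in> T x} \<union> {(r `` {x}, r `` {y})}
      \<union> {(r `` {x @ u}, b) | u b. u \<in> words A \<and> (r `` {u}, b) \<in> T y}"
    proof cases
      case 1
      then have "z \<in> words A" using x by (auto simp: words_def)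
      then have "(r `` {u}, r `` {z}) \<in> T x" using 1 t by (auto simp: T_def)
      then show ?thesis using t 1 \<open>z \<in> words A\<close> by blast
    next
      case 2
      then show ?thesis using t by simp
    next
      case 3
      then have "z \<in> words A" using y by (auto simp: words_def)
      then have "(r `` {z}, r `` {v}) \<in> T y" using 3 t by (auto simp: T_def)
      then show ?thesis using t 3 \<open>z \<in> words A\<close> by blast
    qed
  next
    fix t assume "t \<in> {(a, r `` {v @ y}) | a v. v \<in> words A \<and> (a, r `` {v}) \<in> T x} \<union> {(r `` {x}, r `` {y})}
      \<union> {(r `` {x @ u}, b) | u b. u \<in> words A \<and> (r `` {u}, b) \<in> T y}"
    then consider a v where "t = (a, r `` {v @ y})" "v \<in> words A" "(a, r `` {v}) \<in> T x"
      | "t = (r `` {x}, r `` {y})"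
      | u b where "t = (r `` {x @ u}, b)" "u \<in> words A" "(r `` {u}, b) \<in> T y" by blast
    then show "t \<in> T (x @ y)"
    proof cases
      case 1
      then obtain u' v' where uv: "a = r `` {u'}" "r `` {v} = r `` {v'}" "u' \<in> words A" "v' \<in> words A" "x = u' @ v'"
        by (auto simp: T_def)
      then have "t = (r `` {u'}, r `` {v' @ y})" using 1 cls[OF uv(2), of y y] y by simp
      then show ?thesis unfolding T_def using uv y
        by (intro CollectI exI[of _ u'] exI[of _ "v' @ y"]) (simp add: words_append)
    next
      case 2
      then show ?thesis using x y by (auto simp: T_def)
    next
      case 3
      then obtain u' v' where uv: "r `` {u} = r `` {u'}" "b = r `` {v'}" "u' \<in> words A" "v' \<in> words A" "y = u' @ v'"
        by (auto simp: T_def)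
      then have "t = (r `` {x @ u'}, r `` {v'})" using 3 cls[of x x u u'] x by simp
      then show ?thesis unfolding T_def using uv x
        by (intro CollectI exI[of _ "x @ u'"] exI[of _ v']) (simp add: words_append)
    qed
  qed
  define s where "s = {(u, v). u \<in> words A \<and> v \<in> words A \<and> F u = F v}"
  have "s \<in> finite_congruences A"
    unfolding s_def
  proof (rule finite_congruence_kernel)
    have "F ` words A \<subseteq> (words A // r) \<times> Pow ((words A // r) \<times> (words A // r))"
      by (auto simp: F_def T_def quotientI)
    then show "finite (F ` words A)"
      by (rule finite_subset) (use finite_congruencesD(2)[OF r] in auto)
  next
    fix u v w assume *: "u \<in> words A" "v \<in> words A" "w \<in> words A" "F u = F v"
    then have e: "r `` {u} = r `` {v}" "T u = T v" by (simp_all add: F_def)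
    have c: "r `` {u @ x} = r `` {v @ x}" "r `` {x @ u} = r `` {x @ v}" if "x \<in> words A" for x
      using cls[OF e(1) refl *(1,2) that that] cls[OF refl e(1) that that *(1,2)] .
    have "{(r `` {u @ x}, b) | x b. x \<in> words A \<and> (r `` {x}, b) \<in> T w}
      = {(r `` {v @ x}, b) | x b. x \<in> words A \<and> (r `` {x}, b) \<in> T w}"
      by (intro Collect_cong) (metis c(1))
    then show "F (u @ w) = F (v @ w)"
      unfolding F_def T_app[OF *(1,3)] T_app[OF *(2,3)] e by (simp only: c(1)[OF *(3)])
    have "{(a, r `` {x @ u}) | a x. x \<in> words A \<and> (a, r `` {x}) \<in> T w}
      = {(a, r `` {x @ v}) | a x. x \<in> words A \<and> (a, r `` {x}) \<in> T w}"
      by (intro Collect_cong) (metis c(2))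
    then show "F (w @ u) = F (w @ v)"
      unfolding F_def T_app[OF *(3,1)] T_app[OF *(3,2)] e by (simp only: c(2)[OF *(3)])
  qed
  moreover have "s \<subseteq> r"
    using eq_equiv_class_iff[OF equiv] by (auto simp: s_def F_def)
  moreover have "\<exists>u' v'. w = u' @ v' \<and> (u, u') \<in> r \<and> (v, v') \<in> r"
    if "u \<in> words A" "v \<in> words A" "(u @ v, w) \<in> s" for u v w
  proof -
    have "(r `` {u}, r `` {v}) \<in> T (u @ v)" using that by (auto simp: T_def)
    then have "(r `` {u}, r `` {v}) \<in> T w" using that by (auto simp: s_def F_def)
    then show ?thesis using that eq_equiv_class_iff[OF equiv] unfolding T_def by blast
  qed
  ultimately show ?thesis by blast
qed

lemma prefix_suffix_congruence:
  assumes "finite A"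
  shows "{(u, v). u \<in> words A \<and> v \<in> words A \<and> (take M u, take M (rev u)) = (take M v, take M (rev v))}
    \<in> finite_congruences A"
proof (rule finite_congruence_kernel)
  have "(\<lambda>u. (take M u, take M (rev u))) ` words A \<subseteq>
      {w. set w \<subseteq> A \<and> length w \<le> M} \<times> {w. set w \<subseteq> A \<and> length w \<le> M}"
    by (auto simp: words_def) (metis in_set_takeD set_rev subsetD)+
  then show "finite ((\<lambda>u. (take M u, take M (rev u))) ` words A)"
    by (rule finite_subset) (simp add: finite_lists_length_le assms)
next
  have *: "take M (u @ w) = take M (v @ w)" "take M (w @ u) = take M (w @ v)"
    if "take M u = take M v" for u v w :: "'a list"
  proof -
    have "take M (u @ w) = take M (take M u @ w)" for u by (simp add: min_def)
    with that show "take M (u @ w) = take M (v @ w)" by metis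
    have "take M (w @ u) = take M (w @ take M u)" for u by (simp add: min_def)
    with that show "take M (w @ u) = take M (w @ v)" by metis
  qed
  show "(take M (u @ w), take M (rev (u @ w))) = (take M (v @ w), take M (rev (v @ w)))"
    if "(take M u, take M (rev u)) = (take M v, take M (rev v))" for u v w :: "'a list"
    using that *(1)[of u v w] *(2)[of "rev u" "rev v" "rev w"] by (simp del: take_append)
  show "(take M (w @ u), take M (rev (w @ u))) = (take M (w @ v), take M (rev (w @ v)))"
    if "(take M u, take M (rev u)) = (take M v, take M (rev v))" for u v w :: "'a list"
    using that *(2)[of u v w] *(1)[of "rev u" "rev v" "rev w"] by (simp del: take_append)
qed


section \<open>Limits in free profinite semigroups\<close>

lemma free_profinite_rep_iff:
  assumes x: "x \<in> free_profinite A" and r: "r \<in> finite_congruences A" and u: "u \<in> x r"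
  shows "v \<in> x r \<longleftrightarrow> (u, v) \<in> r"
  using free_profinite_rep(2)[OF x r u] by auto

lemma pseudoword_of_eq_iff:
  assumes x: "x \<in> free_profinite A" and r: "r \<in> finite_congruences A" and w: "w \<in> words A"
  shows "pseudoword_of A w r = x r \<longleftrightarrow> w \<in> x r"
  using pseudoword_of_self[OF r w] free_profinite_rep(2)[OF x r] r
  by (auto simp: pseudoword_of_def)

lemma free_profinite_eq_at:
  assumes "x \<in> free_profinite A" "y \<in> free_profinite A" "r \<in> finite_congruences A"
    and "u \<in> x r" "u \<in> y r"
  shows "x r = y r"
  using assms free_profinite_rep(2) by metis

lemma free_profinite_eq_mono:
  assumes x: "x \<in> free_profinite A" and y: "y \<in> free_profinite A"
    and r: "r \<in> finite_congruences A" and s: "s \<in> finite_congruences A" and "s \<subseteq> r" "x s = y s"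
  shows "x r = y r"
proof -
  obtain w where "w \<in> x s" using free_profinite_ex_rep[OF x s] by blast
  then show ?thesis
    using free_profinite_mono[OF x s r] free_profinite_mono[OF y s r] assms(5,6)
      free_profinite_eq_at[OF x y r, of w] by blast
qed

text \<open>Convergence along \<open>U\<close> in the product of the discrete quotients, stated
  coordinatewise so that the topology is needed only to relate the result to the given
  definitions.\<close>

definition plim :: "'i filter \<Rightarrow> 'a set \<Rightarrow> ('i \<Rightarrow> 'a pseudoword) \<Rightarrow> 'a pseudoword \<Rightarrow> bool" where
  "plim U A f l \<longleftrightarrow> l \<in> free_profinite A \<and> (\<forall>r\<in>finite_congruences A. eventually (\<lambda>i. f i r = l r) U)"

lemma plim_closed: "plim U A f l \<Longrightarrow> l \<in> free_profinite A"
  by (simp add: plim_def)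

text \<open>Compactness: every coordinate takes finitely many values and is therefore eventually
  constant, and the inclusions between coordinates hold eventually, hence for the constants.\<close>

lemma plim_exists:
  assumes U: "ultra U" and f: "eventually (\<lambda>i. f i \<in> free_profinite A) U"
  shows "\<exists>l. plim U A f l"
proof -
  let ?I = "finite_congruences A"
  have "\<exists>c. eventually (\<lambda>i. f i r = c) U" if r: "r \<in> ?I" for r
  proof -
    have "eventually (\<lambda>i. f i r \<in> words A // r) U"
      using f by eventually_elim (rule free_profinite_class[OF _ r])
    then show ?thesis
      using ultra_finite_image[OF U finite_congruencesD(2)[OF r], of "\<lambda>i. f i r"] by blast
  qed
  then obtain c where c: "\<And>r. r \<in> ?I \<Longrightarrow> eventually (\<lambda>i. f i r = c r) U" by metis
  have "restrict c ?I \<in> free_profinite A"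
    unfolding free_profinite_def
  proof (intro CollectI conjI ballI impI PiE_I)
    fix r assume r: "r \<in> ?I"
    have "eventually (\<lambda>i. c r \<in> words A // r) U"
      using f c[OF r] by eventually_elim (metis free_profinite_class[OF _ r])
    then show "restrict c ?I r \<in> words A // r"
      using r ultra_nonbot[OF U] by (auto dest: eventually_happens')
  next
    fix r s assume r: "r \<in> ?I" and s: "s \<in> ?I" and "r \<subseteq> s"
    have "eventually (\<lambda>i. c r \<subseteq> c s) U"
      using f c[OF r] c[OF s] by eventually_elim (metis free_profinite_mono[OF _ r s \<open>r \<subseteq> s\<close>])
    then show "restrict c ?I r \<subseteq> restrict c ?I s"
      using r s ultra_nonbot[OF U] by (auto dest: eventually_happens')
  qed simp
  then show ?thesis using c by (intro exI[of _ "restrict c ?I"]) (simp add: plim_def)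
qed

lemma plim_unique:
  assumes "U \<noteq> bot" and x: "plim U A f x" and y: "plim U A f y"
  shows "x = y"
proof (rule free_profinite_eqI[of _ A])
  fix r assume "r \<in> finite_congruences A"
  then have "eventually (\<lambda>i. f i r = x r) U" "eventually (\<lambda>i. f i r = y r) U"
    using x y by (simp_all add: plim_def)
  then have "eventually (\<lambda>i. x r = y r) U" by eventually_elim simp
  then show "x r = y r" using assms(1) by (auto dest: eventually_happens')
qed (use x y in \<open>simp_all add: plim_def\<close>)

lemma plim_cong:
  assumes "eventually (\<lambda>i. f i = g i) U" "plim U A f x"
  shows "plim U A g x"
  unfolding plim_def
proof (intro conjI ballI)
  fix r assume "r \<in> finite_congruences A"
  then have "eventually (\<lambda>i. f i r = x r) U" using assms(2) by (simp add: plim_def)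
  with assms(1) show "eventually (\<lambda>i. g i r = x r) U" by eventually_elim simp
qed (use assms(2) in \<open>simp add: plim_def\<close>)

lemma plim_mult:
  assumes x: "plim U A f x" and y: "plim U A g y"
  shows "plim U A (\<lambda>i. f i \<odot>\<^bsub>A\<^esub> g i) (x \<odot>\<^bsub>A\<^esub> y)"
  unfolding plim_def
proof (intro conjI ballI)
  fix r assume r: "r \<in> finite_congruences A"
  then have "eventually (\<lambda>i. f i r = x r) U" "eventually (\<lambda>i. g i r = y r) U"
    using x y by (simp_all add: plim_def)
  then show "eventually (\<lambda>i. (f i \<odot>\<^bsub>A\<^esub> g i) r = (x \<odot>\<^bsub>A\<^esub> y) r) U"
    by eventually_elim (simp add: profinite_mult_def)
qed (use x y in \<open>simp add: plim_def profinite_mult_closed\<close>)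

lemma plim_words_iff:
  assumes "x \<in> free_profinite A" "eventually (\<lambda>i. w i \<in> words A) U"
  shows "plim U A (\<lambda>i. pseudoword_of A (w i)) x \<longleftrightarrow>
    (\<forall>r\<in>finite_congruences A. eventually (\<lambda>i. w i \<in> x r) U)"
proof -
  have "eventually (\<lambda>i. pseudoword_of A (w i) r = x r) U \<longleftrightarrow> eventually (\<lambda>i. w i \<in> x r) U"
    if "r \<in> finite_congruences A" for r
    by (rule eventually_cong[OF assms(2)]) (rule pseudoword_of_eq_iff[OF assms(1) that])
  then show ?thesis using assms(1) by (simp add: plim_def)
qed

lemma plim_wordsD:
  assumes "plim U A (\<lambda>i. pseudoword_of A (w i)) x" "r \<in> finite_congruences A"
    "eventually (\<lambda>i. w i \<in> words A) U"
  shows "eventually (\<lambda>i. w i \<in> x r) U"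
  using plim_words_iff[OF plim_closed[OF assms(1)] assms(3)] assms(1,2) by blast

text \<open>A basic open set of the product restricts finitely many coordinates; these congruences
  have a common refinement, whose class decides them all.\<close>

lemma openin_profinite_basis:
  assumes "openin (profinite_topology A) T" "x \<in> T"
  shows "\<exists>t\<in>finite_congruences A. \<forall>y\<in>free_profinite A. y t = x t \<longrightarrow> y \<in> T"
proof -
  let ?I = "finite_congruences A"
  let ?X = "\<lambda>r. discrete_topology (words A // r)"
  from assms(1) obtain T' where T': "openin (product_topology ?X ?I) T'" "T = T' \<inter> free_profinite A"
    unfolding profinite_topology_def openin_subtopology by (elim exE conjE)
  have x: "x \<in> T'" "x \<in> free_profinite A" using assms(2) T'(2) by blast+
  from openin_product_topology_alt[THEN iffD1, rule_format, OF T'(1) x(1)]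
  obtain U where U: "finite {i \<in> ?I. U i \<noteq> topspace (?X i)}" "x \<in> Pi\<^sub>E ?I U" "Pi\<^sub>E ?I U \<subseteq> T'"
    by (elim exE conjE)
  obtain t where t: "t \<in> ?I" "\<forall>r\<in>{i \<in> ?I. U i \<noteq> topspace (?X i)}. t \<subseteq> r"
    using finite_congruences_Inter[OF U(1)] by (metis (no_types, lifting) mem_Collect_eq subsetI)
  have "y \<in> T" if y: "y \<in> free_profinite A" "y t = x t" for y
  proof -
    have "y \<in> Pi\<^sub>E ?I U"
    proof (rule PiE_I)
      fix r assume r: "r \<in> ?I"
      show "y r \<in> U r"
      proof (cases "U r = topspace (?X r)")
        case True
        then show ?thesis using free_profinite_class[OF y(1) r] by simp
      next
        case False
        then have "y r = x r" using free_profinite_eq_mono[OF y(1) x(2) r t(1)] t(2) r y(2) by blast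
        then show ?thesis using PiE_mem[OF U(2) r] by simp
      qed
    qed (use y in \<open>auto simp: free_profinite_def PiE_def extensional_def\<close>)
    then show ?thesis using U(3) T'(2) y(1) by blast
  qed
  then show ?thesis using t(1) by blast
qed

lemma continuous_map_class:
  assumes "r \<in> finite_congruences A"
  shows "continuous_map (profinite_topology A) (discrete_topology (words A // r)) (\<lambda>x. x r)"
  unfolding profinite_topology_def
  by (rule continuous_map_from_subtopology, rule continuous_map_product_projection) (rule assms)

lemma openin_class:
  assumes "r \<in> finite_congruences A" "c \<in> words A // r"
  shows "openin (profinite_topology A) {x \<in> free_profinite A. x r = c}"
  using openin_continuous_map_preimage[OF continuous_map_class[OF assms(1)], of "{c}"] assms(2)
  by simp

text \<open>The closure in the profinite topology, written in coordinates; see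
  \<open>closure_of_words\<close>.\<close>

definition clo :: "'a set \<Rightarrow> 'a list set \<Rightarrow> 'a pseudoword set" where
  "clo A L = {x \<in> free_profinite A. \<forall>r\<in>finite_congruences A. \<exists>w\<in>L. w \<in> x r}"

lemma closure_of_words:
  assumes L: "L \<subseteq> words A"
  shows "Abstract_Topology.closure_of (profinite_topology A) (pseudoword_of A ` L) = clo A L"
proof (intro equalityI subsetI)
  fix x assume x: "x \<in> Abstract_Topology.closure_of (profinite_topology A) (pseudoword_of A ` L)"
  then have fp: "x \<in> free_profinite A" by (auto simp: in_closure_of)
  have "\<exists>w\<in>L. w \<in> x r" if r: "r \<in> finite_congruences A" for r
  proof -
    have "x \<in> {y \<in> free_profinite A. y r = x r}" using fp by simp
    moreover have "\<forall>T. x \<in> T \<and> openin (profinite_topology A) T \<longrightarrow> (\<exists>y. y \<in> pseudoword_of A ` L \<and> y \<in> T)"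
      using x unfolding in_closure_of by (rule conjunct2)
    ultimately obtain y where "y \<in> pseudoword_of A ` L" "y \<in> {y \<in> free_profinite A. y r = x r}"
      using openin_class[OF r free_profinite_class[OF fp r]] by meson
    then show ?thesis using pseudoword_of_eq_iff[OF fp r] L by blast
  qed
  then show "x \<in> clo A L" using fp by (simp add: clo_def)
next
  fix x assume x: "x \<in> clo A L"
  then have fp: "x \<in> free_profinite A" by (simp add: clo_def)
  have "\<exists>y. y \<in> pseudoword_of A ` L \<and> y \<in> T" if T: "x \<in> T \<and> openin (profinite_topology A) T" for T
  proof -
    obtain t where t: "t \<in> finite_congruences A" "\<forall>y\<in>free_profinite A. y t = x t \<longrightarrow> y \<in> T"
      using openin_profinite_basis T by blast
    obtain w where w: "w \<in> L" "w \<in> x t" using x t(1) by (auto simp: clo_def)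
    then have "pseudoword_of A w \<in> T"
      using t L pseudoword_of_eq_iff[OF fp t(1)] pseudoword_of_closed[of w A] by blast
    then show ?thesis using w by blast
  qed
  then show "x \<in> Abstract_Topology.closure_of (profinite_topology A) (pseudoword_of A ` L)"
    using fp by (simp add: in_closure_of)
qed

lemma clo_closed: "x \<in> clo A L \<Longrightarrow> x \<in> free_profinite A"
  by (simp add: clo_def)

lemma cloD:
  assumes "x \<in> clo A L" "r \<in> finite_congruences A"
  obtains w where "w \<in> L" "w \<in> x r"
  using assms by (auto simp: clo_def)

lemma clo_mono: "L \<subseteq> L' \<Longrightarrow> clo A L \<subseteq> clo A L'"
  by (fastforce simp: clo_def)

lemma clo_plim:
  assumes "U \<noteq> bot" and f: "eventually (\<lambda>i. f i \<in> clo A L) U" and x: "plim U A f x"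
  shows "x \<in> clo A L"
proof -
  have "\<exists>w\<in>L. w \<in> x r" if r: "r \<in> finite_congruences A" for r
  proof -
    have "eventually (\<lambda>i. f i r = x r) U" using x r by (simp add: plim_def)
    with f have "eventually (\<lambda>i. \<exists>w\<in>L. w \<in> x r) U"
      by eventually_elim (use r in \<open>force simp: clo_def\<close>)
    then show ?thesis using assms(1) by (auto dest: eventually_happens')
  qed
  then show ?thesis using x by (simp add: clo_def plim_def)
qed

lemma pseudoword_of_clo: "L \<subseteq> words A \<Longrightarrow> w \<in> L \<Longrightarrow> pseudoword_of A w \<in> clo A L"
  using pseudoword_of_closed pseudoword_of_self by (fastforce simp: clo_def)

lemma clo_mult:
  assumes "x \<in> clo A L" "y \<in> clo A L'" "\<And>u v. u \<in> L \<Longrightarrow> v \<in> L' \<Longrightarrow> u @ v \<in> M"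
  shows "x \<odot>\<^bsub>A\<^esub> y \<in> clo A M"
proof -
  have "\<exists>w\<in>M. w \<in> (x \<odot>\<^bsub>A\<^esub> y) r" if r: "r \<in> finite_congruences A" for r
    using assms cloD[OF assms(1) r] cloD[OF assms(2) r]
      profinite_mult_rep[OF r clo_closed[OF assms(1)] clo_closed[OF assms(2)]] by metis
  then show ?thesis
    using assms(1,2) by (simp add: clo_def profinite_mult_closed)
qed

text \<open>Multiplication in a free profinite semigroup is an open map.\<close>

lemma clo_split:
  assumes L: "x \<odot>\<^bsub>A\<^esub> y \<in> clo A L" and x: "x \<in> free_profinite A" and y: "y \<in> free_profinite A"
    and r: "r \<in> finite_congruences A"
  shows "\<exists>u v. u \<in> x r \<and> v \<in> y r \<and> u @ v \<in> L"
proof -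
  obtain s where s: "s \<in> finite_congruences A" "s \<subseteq> r"
    "\<And>w u v. u \<in> words A \<Longrightarrow> v \<in> words A \<Longrightarrow> (u @ v, w) \<in> s \<Longrightarrow> \<exists>u' v'. w = u' @ v' \<and> (u, u') \<in> r \<and> (v, v') \<in> r"
    using split_congruence[OF r] by blast
  obtain u where u: "u \<in> words A" "u \<in> x s" by (rule free_profinite_ex_rep[OF x s(1)])
  obtain v where v: "v \<in> words A" "v \<in> y s" by (rule free_profinite_ex_rep[OF y s(1)])
  obtain w where w: "w \<in> L" "w \<in> (x \<odot>\<^bsub>A\<^esub> y) s" by (rule cloD[OF L s(1)])
  have "(u @ v, w) \<in> s"
    using w(2) unfolding profinite_mult_eq[OF s(1) x y u(2) v(2)] by simp
  then obtain u' v' where "w = u' @ v'" "(u, u') \<in> r" "(v, v') \<in> r" using s(3) u v by blast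
  moreover have "u \<in> x r" "v \<in> y r"
    using u v free_profinite_mono[OF x s(1) r s(2)] free_profinite_mono[OF y s(1) r s(2)] by blast+
  ultimately show ?thesis
    using w(1) free_profinite_rep_iff[OF x r] free_profinite_rep_iff[OF y r] by blast
qed

text \<open>Only finitely many words of \<open>L\<close> are shorter than \<open>M\<close>. Each is
  separated from \<open>x\<close> by some finite congruence, and a common refinement with
  \<open>r\<close> separates all of them at once.\<close>

lemma clo_not_word:
  assumes x: "x \<in> clo A L" "x \<notin> pseudoword_of A ` L" and L: "L \<subseteq> words A" and A: "finite A"
    and r: "r \<in> finite_congruences A"
  shows "\<exists>w\<in>L. w \<in> x r \<and> M \<le> length w"
proof -
  have fp: "x \<in> free_profinite A" using x(1) by (rule clo_closed)
  let ?W = "{w \<in> L. length w < M}"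
  have "?W \<subseteq> {w. set w \<subseteq> A \<and> length w \<le> M}" using L by (auto simp: words_def)
  then have finW: "finite ?W" by (rule finite_subset) (simp add: finite_lists_length_le A)
  have "\<exists>s\<in>finite_congruences A. w \<notin> x s" if w: "w \<in> ?W" for w
  proof (rule ccontr)
    assume "\<not> ?thesis"
    then have "pseudoword_of A w s = x s" if "s \<in> finite_congruences A" for s
      using that w L pseudoword_of_eq_iff[OF fp that, of w] by blast
    then have "pseudoword_of A w = x"
      using w L by (intro free_profinite_eqI[OF pseudoword_of_closed fp]) blast+
    then show False using x(2) w by blast
  qed
  then obtain s where s: "\<And>w. w \<in> ?W \<Longrightarrow> s w \<in> finite_congruences A \<and> w \<notin> x (s w)" by metis
  obtain t where t: "t \<in> finite_congruences A" "\<forall>q\<in>insert r (s ` ?W). t \<subseteq> q"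
    using finite_congruences_Inter[of "insert r (s ` ?W)" A] finW r s by blast
  obtain w where w: "w \<in> L" "w \<in> x t" by (rule cloD[OF x(1) t(1)])
  have "w \<notin> ?W"
  proof
    assume "w \<in> ?W"
    then have "t \<subseteq> s w" "s w \<in> finite_congruences A" "w \<notin> x (s w)" using t(2) s by blast+
    then show False using free_profinite_mono[OF fp t(1)] w(2) by blast
  qed
  moreover have "w \<in> x r" using free_profinite_mono[OF fp t(1) r] t(2) w(2) by blast
  ultimately show ?thesis using w(1) by auto
qed


section \<open>Continuous extensions of homomorphisms\<close>

lemma profinite_extension:
  assumes "word_hom A B \<phi>"
  shows "is_profinite_extension A B \<phi> (profinite_extension A B \<phi>)"
  unfolding profinite_extension_def by (rule theI'[OF ex1_profinite_extension[OF assms]])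

lemma profinite_extension_closed:
  assumes "word_hom A B \<phi>" "x \<in> free_profinite A"
  shows "profinite_extension A B \<phi> x \<in> free_profinite B"
  using profinite_extension[OF assms(1)] assms(2) unfolding is_profinite_extension_def
  by (metis continuous_map_image_subset_topspace image_subset_iff topspace_profinite_topology)

lemma profinite_extension_mult:
  assumes "word_hom A B \<phi>" "x \<in> free_profinite A" "y \<in> free_profinite A"
  shows "profinite_extension A B \<phi> (x \<odot>\<^bsub>A\<^esub> y) = profinite_extension A B \<phi> x \<odot>\<^bsub>B\<^esub> profinite_extension A B \<phi> y"
  using profinite_extension[OF assms(1)] assms(2,3) unfolding is_profinite_extension_def by blast

lemma profinite_extension_word:
  assumes "word_hom A B \<phi>" "w \<in> words A"
  shows "profinite_extension A B \<phi> (pseudoword_of A w) = pseudoword_of B (\<phi> w)"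
  using profinite_extension[OF assms(1)] assms(2) unfolding is_profinite_extension_def by blast

lemma profinite_extension_cong:
  assumes "\<And>w. w \<in> words A \<Longrightarrow> \<phi> w = \<psi> w"
  shows "profinite_extension A B \<phi> = profinite_extension A B \<psi>"
  using assms by (simp add: profinite_extension_def is_profinite_extension_def)

definition pullback :: "'a set \<Rightarrow> ('a list \<Rightarrow> 'b list) \<Rightarrow> ('b list \<times> 'b list) set \<Rightarrow> ('a list \<times> 'a list) set" where
  "pullback A \<phi> r = {(u, v). u \<in> words A \<and> v \<in> words A \<and> (\<phi> u, \<phi> v) \<in> r}"

lemma pullback_congruence:
  assumes \<phi>: "word_hom A B \<phi>" and r: "r \<in> finite_congruences B"
  shows "pullback A \<phi> r \<in> finite_congruences A"
proof -
  note er = finite_congruencesD(1)[OF r]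
  have iff: "r `` {\<phi> u} = r `` {\<phi> v} \<longleftrightarrow> (\<phi> u, \<phi> v) \<in> r" if "u \<in> words A" "v \<in> words A" for u v
    using eq_equiv_class_iff[OF er] word_homD(1)[OF \<phi>] that by blast
  have "{(u, v). u \<in> words A \<and> v \<in> words A \<and> r `` {\<phi> u} = r `` {\<phi> v}} \<in> finite_congruences A"
  proof (rule finite_congruence_kernel)
    have "(\<lambda>u. r `` {\<phi> u}) ` words A \<subseteq> words B // r"
      using word_homD(1)[OF \<phi>] by (auto intro: quotientI)
    then show "finite ((\<lambda>u. r `` {\<phi> u}) ` words A)"
      by (rule finite_subset) (rule finite_congruencesD(2)[OF r])
  next
    fix u v w assume *: "u \<in> words A" "v \<in> words A" "w \<in> words A" "r `` {\<phi> u} = r `` {\<phi> v}"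
    then have "(\<phi> u, \<phi> v) \<in> r" using iff by blast
    then have "(\<phi> u @ \<phi> w, \<phi> v @ \<phi> w) \<in> r" "(\<phi> w @ \<phi> u, \<phi> w @ \<phi> v) \<in> r"
      using finite_congruencesD(3,4)[OF r] word_homD(1)[OF \<phi>] * by blast+
    then show "r `` {\<phi> (u @ w)} = r `` {\<phi> (v @ w)}" "r `` {\<phi> (w @ u)} = r `` {\<phi> (w @ v)}"
      using * word_homD(2)[OF \<phi>] equiv_class_eq[OF er] by metis+
  qed
  moreover have "{(u, v). u \<in> words A \<and> v \<in> words A \<and> r `` {\<phi> u} = r `` {\<phi> v}} = pullback A \<phi> r"
    using iff by (auto simp: pullback_def)
  ultimately show ?thesis by simp
qed

text \<open>Replaces the abstract characterization of the extension by a computation with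
  representatives. By continuity the class of the value is constant near \<open>x\<close>, and close
  to \<open>x\<close> there are words, where the value is known.\<close>

lemma profinite_extension_rep:
  assumes \<phi>: "word_hom A B \<phi>" and x: "x \<in> free_profinite A" and r: "r \<in> finite_congruences B"
    and w: "w \<in> x (pullback A \<phi> r)"
  shows "\<phi> w \<in> profinite_extension A B \<phi> x r"
proof -
  let ?f = "profinite_extension A B \<phi>"
  note fx = profinite_extension_closed[OF \<phi> x]
  have "continuous_map (profinite_topology A) (discrete_topology (words B // r)) ((\<lambda>y. y r) \<circ> ?f)"
    using profinite_extension[OF \<phi>] continuous_map_class[OF r]
    unfolding is_profinite_extension_def by (blast intro: continuous_map_compose)
  then have op: "openin (profinite_topology A) {y \<in> free_profinite A. ?f y r = ?f x r}"
    using openin_continuous_map_preimage[of "profinite_topology A" "discrete_topology (words B // r)"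
        "(\<lambda>y. y r) \<circ> ?f" "{?f x r}"] free_profinite_class[OF fx r] by simp
  have "\<exists>s\<in>finite_congruences A. \<forall>y\<in>free_profinite A. y s = x s \<longrightarrow>
      y \<in> {y \<in> free_profinite A. ?f y r = ?f x r}"
    by (rule openin_profinite_basis[OF op]) (simp add: x)
  then obtain s where s: "s \<in> finite_congruences A" "\<forall>y\<in>free_profinite A. y s = x s \<longrightarrow> ?f y r = ?f x r"
    by auto
  \<comment> \<open>A single word \<open>v\<close> has to be close to \<open>x\<close> both for the
    continuity argument and for the pullback congruence.\<close>
  let ?t = "s \<inter> pullback A \<phi> r"
  note p = pullback_congruence[OF \<phi> r]
  have t: "?t \<in> finite_congruences A" by (rule finite_congruences_Int[OF s(1) p])
  obtain v where v: "v \<in> words A" "v \<in> x ?t" by (rule free_profinite_ex_rep[OF x t])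
  then have "v \<in> x s" "v \<in> x (pullback A \<phi> r)"
    using free_profinite_mono[OF x t s(1)] free_profinite_mono[OF x t p] by blast+
  then have "pseudoword_of B (\<phi> v) r = ?f x r"
    using s v pseudoword_of_eq_iff[OF x s(1)] pseudoword_of_closed[OF v(1)] profinite_extension_word[OF \<phi> v(1)]
    by metis
  then have "\<phi> v \<in> ?f x r"
    using pseudoword_of_eq_iff[OF fx r] word_homD(1)[OF \<phi> v(1)] by blast
  moreover have "(\<phi> v, \<phi> w) \<in> r"
    using free_profinite_rep_iff[OF x p \<open>v \<in> x (pullback A \<phi> r)\<close>] w by (simp add: pullback_def)
  ultimately show ?thesis using free_profinite_rep_iff[OF fx r] by blast
qed

lemma profinite_extension_class:
  assumes \<phi>: "word_hom A B \<phi>" and x: "x \<in> free_profinite A" and y: "y \<in> free_profinite A"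
    and r: "r \<in> finite_congruences B" and eq: "x (pullback A \<phi> r) = y (pullback A \<phi> r)"
  shows "profinite_extension A B \<phi> x r = profinite_extension A B \<phi> y r"
proof -
  obtain w where "w \<in> x (pullback A \<phi> r)"
    by (rule free_profinite_ex_rep[OF x pullback_congruence[OF \<phi> r]])
  then show ?thesis
    using profinite_extension_rep[OF \<phi> x r] profinite_extension_rep[OF \<phi> y r] eq
      free_profinite_eq_at[OF profinite_extension_closed[OF \<phi> x] profinite_extension_closed[OF \<phi> y] r]
    by metis
qed

lemma plim_extension:
  assumes \<phi>: "word_hom A B \<phi>" and f: "eventually (\<lambda>i. f i \<in> free_profinite A) U" and x: "plim U A f x"
  shows "plim U B (\<lambda>i. profinite_extension A B \<phi> (f i)) (profinite_extension A B \<phi> x)"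
  unfolding plim_def
proof (intro conjI ballI)
  note x' = plim_closed[OF x]
  show "profinite_extension A B \<phi> x \<in> free_profinite B" by (rule profinite_extension_closed[OF \<phi> x'])
  fix r assume r: "r \<in> finite_congruences B"
  have "eventually (\<lambda>i. f i (pullback A \<phi> r) = x (pullback A \<phi> r)) U"
    using x pullback_congruence[OF \<phi> r] by (simp add: plim_def)
  with f show "eventually (\<lambda>i. profinite_extension A B \<phi> (f i) r = profinite_extension A B \<phi> x r) U"
    by eventually_elim (rule profinite_extension_class[OF \<phi> _ x' r])
qed

lemma word_hom_comp:
  assumes "word_hom A B \<phi>" "word_hom B C \<psi>"
  shows "word_hom A C (\<psi> \<circ> \<phi>)"
  using assms by (auto simp: word_hom_def Pi_def)

lemma profinite_extension_comp:
  assumes \<phi>: "word_hom A B \<phi>" and \<psi>: "word_hom B C \<psi>" and x: "x \<in> free_profinite A"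
  shows "profinite_extension A C (\<psi> \<circ> \<phi>) x = profinite_extension B C \<psi> (profinite_extension A B \<phi> x)"
proof (rule free_profinite_eqI)
  note c = word_hom_comp[OF \<phi> \<psi>]
  note y = profinite_extension_closed[OF \<phi> x]
  show "profinite_extension A C (\<psi> \<circ> \<phi>) x \<in> free_profinite C" by (rule profinite_extension_closed[OF c x])
  show "profinite_extension B C \<psi> (profinite_extension A B \<phi> x) \<in> free_profinite C"
    by (rule profinite_extension_closed[OF \<psi> y])
  fix r assume r: "r \<in> finite_congruences C"
  let ?p = "pullback A (\<psi> \<circ> \<phi>) r" and ?q = "pullback A \<phi> (pullback B \<psi> r)"
  have "?p = ?q" using word_homD(1)[OF \<phi>] by (auto simp: pullback_def)
  obtain w where w: "w \<in> x ?p" by (rule free_profinite_ex_rep[OF x pullback_congruence[OF c r]])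
  have "\<psi> (\<phi> w) \<in> profinite_extension A C (\<psi> \<circ> \<phi>) x r"
    using profinite_extension_rep[OF c x r w] by (metis comp_apply)
  moreover have "\<psi> (\<phi> w) \<in> profinite_extension B C \<psi> (profinite_extension A B \<phi> x) r"
    using profinite_extension_rep[OF \<psi> y r profinite_extension_rep[OF \<phi> x pullback_congruence[OF \<psi> r]]]
      w \<open>?p = ?q\<close> by metis
  ultimately show "profinite_extension A C (\<psi> \<circ> \<phi>) x r = profinite_extension B C \<psi> (profinite_extension A B \<phi> x) r"
    by (rule free_profinite_eq_at[OF profinite_extension_closed[OF c x] profinite_extension_closed[OF \<psi> y] r])
qed

lemma profinite_extension_clo:
  assumes \<phi>: "word_hom A B \<phi>" and x: "x \<in> clo A L"
  shows "profinite_extension A B \<phi> x \<in> clo B (\<phi> ` L)"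
  unfolding clo_def
proof (intro CollectI conjI ballI)
  note x' = clo_closed[OF x]
  show "profinite_extension A B \<phi> x \<in> free_profinite B" by (rule profinite_extension_closed[OF \<phi> x'])
  fix r assume r: "r \<in> finite_congruences B"
  obtain w where "w \<in> L" "w \<in> x (pullback A \<phi> r)" by (rule cloD[OF x pullback_congruence[OF \<phi> r]])
  then show "\<exists>w\<in>\<phi> ` L. w \<in> profinite_extension A B \<phi> x r"
    using profinite_extension_rep[OF \<phi> x' r] by blast
qed

text \<open>Words in the classes of \<open>x\<close> have preimages in \<open>L\<close>; these
  converge along an ultrafilter by compactness, and continuity identifies the image of their limit
  with \<open>x\<close>.\<close>

lemma clo_image_lift:
  assumes \<phi>: "word_hom A B \<phi>" and L: "L \<subseteq> words A" and x: "x \<in> clo B (\<phi> ` L)"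
  shows "\<exists>y\<in>clo A L. profinite_extension A B \<phi> y = x"
proof -
  obtain U :: "(('b list \<times> 'b list) set \<times> nat) filter" where U: "ultra U"
    "\<And>r. r \<in> finite_congruences B \<Longrightarrow> eventually (\<lambda>i. fst i \<in> finite_congruences B \<and> fst i \<subseteq> r) U"
    using ultra_congruences[of B] by blast
  note x' = clo_closed[OF x]
  have "\<forall>r\<in>finite_congruences B. \<exists>u. u \<in> L \<and> \<phi> u \<in> x r" using x by (auto simp: clo_def)
  then obtain u where u: "\<And>r. r \<in> finite_congruences B \<Longrightarrow> u r \<in> L \<and> \<phi> (u r) \<in> x r" by metis
  have ev: "eventually (\<lambda>i. fst i \<in> finite_congruences B) U"
    using U(2)[OF finite_congruences_top] by eventually_elim blast
  have evL: "eventually (\<lambda>i. u (fst i) \<in> L) U" using ev by eventually_elim (simp add: u)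
  have evw: "eventually (\<lambda>i. u (fst i) \<in> words A) U" using evL by eventually_elim (use L in blast)
  have evp: "eventually (\<lambda>i. pseudoword_of A (u (fst i)) \<in> free_profinite A) U"
    using evw by eventually_elim (rule pseudoword_of_closed)
  obtain y where y: "plim U A (\<lambda>i. pseudoword_of A (u (fst i))) y"
    using plim_exists[OF U(1) evp] by blast
  have "y \<in> clo A L"
    by (rule clo_plim[OF ultra_nonbot[OF U(1)] _ y])
      (use evL in \<open>eventually_elim, use L pseudoword_of_clo in blast\<close>)
  moreover have "plim U B (\<lambda>i. profinite_extension A B \<phi> (pseudoword_of A (u (fst i)))) (profinite_extension A B \<phi> y)"
    by (rule plim_extension[OF \<phi> evp y])
  then have 1: "plim U B (\<lambda>i. pseudoword_of B (\<phi> (u (fst i)))) (profinite_extension A B \<phi> y)"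
    by (rule plim_cong[rotated]) (use evw in \<open>eventually_elim, simp add: profinite_extension_word[OF \<phi>]\<close>)
  have evw': "eventually (\<lambda>i. \<phi> (u (fst i)) \<in> words B) U"
    using evw by eventually_elim (rule word_homD(1)[OF \<phi>])
  have 2: "plim U B (\<lambda>i. pseudoword_of B (\<phi> (u (fst i)))) x"
    unfolding plim_words_iff[OF x' evw']
  proof
    fix r assume r: "r \<in> finite_congruences B"
    show "eventually (\<lambda>i. \<phi> (u (fst i)) \<in> x r) U"
      using U(2)[OF r] by eventually_elim (use u free_profinite_mono[OF x' _ r] in blast)
  qed
  have "profinite_extension A B \<phi> y = x" by (rule plim_unique[OF ultra_nonbot[OF U(1)] 1 2])
  ultimately show ?thesis by blast
qed

lemma free_profinite_clo: "free_profinite A = clo A (words A)"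
proof (intro equalityI subsetI)
  fix x assume x: "x \<in> free_profinite A"
  have "\<exists>w\<in>words A. w \<in> x r" if "r \<in> finite_congruences A" for r
    by (rule free_profinite_ex_rep[OF x that]) blast
  then show "x \<in> clo A (words A)" using x by (simp add: clo_def)
qed (rule clo_closed)

lemma profinite_extension_image:
  assumes \<phi>: "word_hom A B \<phi>"
  shows "profinite_extension A B \<phi> ` free_profinite A = clo B (\<phi> ` words A)"
proof (intro equalityI subsetI)
  fix x assume "x \<in> clo B (\<phi> ` words A)"
  then obtain y where "y \<in> clo A (words A)" "profinite_extension A B \<phi> y = x"
    using clo_image_lift[OF \<phi> order_refl] by blast
  then show "x \<in> profinite_extension A B \<phi> ` free_profinite A"
    using clo_closed by blast
qed (use profinite_extension_clo[OF \<phi>] in \<open>auto simp: free_profinite_clo\<close>)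

text \<open>The closure of the image is clopen because the image is a recognizable language: one
  congruence decides membership for words and for pseudowords simultaneously. This is how statements
  about limits are brought back to words.\<close>

lemma clo_image_saturated:
  assumes \<phi>: "word_hom A B \<phi>" and A: "finite A"
  shows "\<exists>s\<in>finite_congruences B. \<forall>x\<in>free_profinite B.
    (\<exists>w\<in>\<phi> ` words A. w \<in> x s) \<longrightarrow> x \<in> clo B (\<phi> ` words A) \<and> x s \<subseteq> \<phi> ` words A"
proof -
  \<comment> \<open>With the full relation upstairs, only the property of being an image is
    remembered.\<close>
  obtain s where s: "s \<in> finite_congruences B"
    "\<And>u w. u \<in> words A \<Longrightarrow> (\<phi> u, w) \<in> s \<Longrightarrow> \<exists>v. (u, v) \<in> words A \<times> words A \<and> w = \<phi> v"
    using recognizable_image[OF \<phi> A finite_congruences_top] by blast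
  have "x \<in> clo B (\<phi> ` words A) \<and> x s \<subseteq> \<phi> ` words A"
    if x: "x \<in> free_profinite B" and w: "w \<in> \<phi> ` words A" "w \<in> x s" for x w
  proof -
    have sub: "x s \<subseteq> \<phi> ` words A"
      using s(2) w free_profinite_rep_iff[OF x s(1) w(2)] by blast
    have "\<exists>v\<in>\<phi> ` words A. v \<in> x r" if r: "r \<in> finite_congruences B" for r
    proof -
      note t = finite_congruences_Int[OF r s(1)]
      obtain v where "v \<in> x (r \<inter> s)" by (rule free_profinite_ex_rep[OF x t])
      then have "v \<in> x r" "v \<in> x s"
        using free_profinite_mono[OF x t r] free_profinite_mono[OF x t s(1)] by blast+
      then show ?thesis using sub by blast
    qed
    then show ?thesis using sub x by (simp add: clo_def)
  qed
  then show ?thesis using s(1) by blast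
qed

text \<open>The class of a word modulo \<open>r\<close> can be read off from its image modulo a
  suitable \<open>s\<close>: an image congruent to \<phi> u has a preimage congruent to
  \<open>u\<close>, and injectivity on words leaves no other preimage.\<close>

lemma profinite_extension_inj:
  assumes \<phi>: "word_hom A B \<phi>" and A: "finite A" and inj: "inj_on \<phi> (words A)"
  shows "inj_on (profinite_extension A B \<phi>) (free_profinite A)"
proof (rule inj_onI, rule free_profinite_eqI)
  fix x y r assume x: "x \<in> free_profinite A" and y: "y \<in> free_profinite A"
    and eq: "profinite_extension A B \<phi> x = profinite_extension A B \<phi> y" and r: "r \<in> finite_congruences A"
  obtain s where s: "s \<in> finite_congruences B"
    "\<And>u w. u \<in> words A \<Longrightarrow> (\<phi> u, w) \<in> s \<Longrightarrow> \<exists>v. (u, v) \<in> r \<and> w = \<phi> v"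
    using recognizable_image[OF \<phi> A r] by blast
  note p = pullback_congruence[OF \<phi> s(1)]
  note t = finite_congruences_Int[OF r p]
  obtain u where u: "u \<in> words A" "u \<in> x (r \<inter> pullback A \<phi> s)" by (rule free_profinite_ex_rep[OF x t])
  obtain v where v: "v \<in> words A" "v \<in> y (r \<inter> pullback A \<phi> s)" by (rule free_profinite_ex_rep[OF y t])
  have uv: "u \<in> x r" "v \<in> y r" "u \<in> x (pullback A \<phi> s)" "v \<in> y (pullback A \<phi> s)"
    using u v free_profinite_mono[OF x t] free_profinite_mono[OF y t] r p by blast+
  have "(\<phi> u, \<phi> v) \<in> s"
    using profinite_extension_rep[OF \<phi> x s(1) uv(3)] profinite_extension_rep[OF \<phi> y s(1) uv(4)] eq
      free_profinite_rep_iff[OF profinite_extension_closed[OF \<phi> y] s(1)] by metis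
  then obtain v' where v': "(u, v') \<in> r" "\<phi> v = \<phi> v'" using s(2) u(1) by blast
  have "v' \<in> words A" using v'(1) equiv_type[OF finite_congruencesD(1)[OF r]] by blast
  then have "v' = v" using inj v'(2) v(1) by (auto dest: inj_onD)
  then have "v \<in> x r" using v'(1) free_profinite_rep_iff[OF x r uv(1)] by blast
  then show "x r = y r" using uv(2) by (rule free_profinite_eq_at[OF x y r])
qed


section \<open>Stability\<close>

abbreviation word_power :: "'a list \<Rightarrow> nat \<Rightarrow> 'a list" where
  "word_power u k \<equiv> concat (replicate k u)"

lemma word_power_words: "u \<in> words A \<Longrightarrow> k \<noteq> 0 \<Longrightarrow> word_power u k \<in> words A"
  by (auto simp: words_def)

lemma word_power_commute: "word_power u k @ u = u @ word_power u k"
  by (induction k) auto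

lemma word_power_add: "word_power u (j + k) = word_power u j @ word_power u k"
  by (simp add: replicate_add)

lemma word_power_periodic:
  assumes r: "r \<in> finite_congruences A" and u: "u \<in> words A"
  shows "\<exists>i m. 0 < i \<and> 2 \<le> m \<and> (word_power u i, word_power u (i + m)) \<in> r"
proof -
  \<comment> \<open>Even exponents ensure a period of at least 2, so that \<open>m - 1\<close> is
    still a positive exponent.\<close>
  let ?f = "\<lambda>k. r `` {word_power u (2 * k + 2)}"
  have w: "word_power u (2 * k + 2) \<in> words A" for k using word_power_words[OF u, of "2 * k + 2"] by simp
  then have "range ?f \<subseteq> words A // r" by (auto intro: quotientI)
  then have "finite (range ?f)" using finite_congruencesD(2)[OF r] by (rule finite_subset)
  then have "\<not> inj ?f" using finite_imageD by fastforce
  then obtain j' k' where "j' \<noteq> k'" "?f j' = ?f k'" unfolding inj_def by blast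
  moreover define j k where "j = min j' k'" and "k = max j' k'"
  ultimately have jk: "j < k" "?f j = ?f k" by (auto simp: min_def max_def)
  then have "(word_power u (2 * j + 2), word_power u (2 * k + 2)) \<in> r"
    using eq_equiv_class_iff[OF finite_congruencesD(1)[OF r] w w] by blast
  moreover have "2 * k + 2 = (2 * j + 2) + 2 * (k - j)" using jk(1) by simp
  ultimately have "(word_power u (2 * j + 2), word_power u ((2 * j + 2) + 2 * (k - j))) \<in> r"
    by (simp only:)
  moreover have "0 < 2 * j + 2" "2 \<le> 2 * (k - j)" using jk(1) by simp_all
  ultimately show ?thesis by blast
qed

text \<open>Words chosen for each congruence separately, without any compatibility, have a cluster
  point.\<close>

lemma stable_limit:
  assumes \<delta>: "\<And>s. s \<in> finite_congruences A \<Longrightarrow> \<delta> s \<in> words A"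
  obtains d where "d \<in> free_profinite A"
    "\<And>r. r \<in> finite_congruences A \<Longrightarrow> \<exists>s\<in>finite_congruences A. s \<subseteq> r \<and> \<delta> s \<in> d r"
proof -
  obtain U :: "(('a list \<times> 'a list) set \<times> nat) filter" where U: "ultra U"
    "\<And>r. r \<in> finite_congruences A \<Longrightarrow> eventually (\<lambda>i. fst i \<in> finite_congruences A \<and> fst i \<subseteq> r) U"
    using ultra_congruences[of A] by blast
  have evw: "eventually (\<lambda>i. \<delta> (fst i) \<in> words A) U"
    using U(2)[OF finite_congruences_top] by eventually_elim (simp add: \<delta>)
  have evp: "eventually (\<lambda>i. pseudoword_of A (\<delta> (fst i)) \<in> free_profinite A) U"
    using evw by eventually_elim (rule pseudoword_of_closed)
  obtain d where d: "plim U A (\<lambda>i. pseudoword_of A (\<delta> (fst i))) d"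
    using plim_exists[OF U(1) evp] by blast
  show ?thesis
  proof
    show "d \<in> free_profinite A" by (rule plim_closed[OF d])
    fix r assume r: "r \<in> finite_congruences A"
    have "eventually (\<lambda>i. fst i \<in> finite_congruences A \<and> fst i \<subseteq> r \<and> \<delta> (fst i) \<in> d r) U"
      using U(2)[OF r] plim_wordsD[OF d r evw] by eventually_elim simp
    then show "\<exists>s\<in>finite_congruences A. s \<subseteq> r \<and> \<delta> s \<in> d r"
      using eventually_happens'[OF ultra_nonbot[OF U(1)]] by blast
  qed
qed

lemma stable_power_iterate:
  assumes a: "a \<in> free_profinite A" and x: "x \<in> free_profinite A" and b: "b \<in> free_profinite A"
    and eq: "x = (a \<odot>\<^bsub>A\<^esub> x) \<odot>\<^bsub>A\<^esub> b"
    and r: "r \<in> finite_congruences A" and "\<alpha> \<in> a r" "\<xi> \<in> x r" "\<beta> \<in> b r"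
  shows "word_power \<alpha> k @ \<xi> @ word_power \<beta> k \<in> x r"
proof (induction k)
  case (Suc k)
  have "(\<alpha> @ (word_power \<alpha> k @ \<xi> @ word_power \<beta> k)) @ \<beta> \<in> x r"
    by (subst eq) (intro profinite_mult_rep[OF r] profinite_mult_closed Suc assms)
  then show ?case using word_power_commute[of k \<beta>] by simp
qed (use assms in simp)

text \<open>Modulo a finite congruence, a^i = a^(i+m) for some i and m. Iterating the equation gives
  x = a^(i+m) x b^(i+m) = a^i x b^(i+m) = x b^m, so b^(m-1) serves as \<open>d\<close>; it commutes
  with b, which gives both equations. A cluster point over all congruences works globally.\<close>

lemma stable_right:
  assumes a: "a \<in> free_profinite A" and x: "x \<in> free_profinite A" and b: "b \<in> free_profinite A"
    and eq: "x = (a \<odot>\<^bsub>A\<^esub> x) \<odot>\<^bsub>A\<^esub> b"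
  shows "\<exists>d\<in>free_profinite A. x = (x \<odot>\<^bsub>A\<^esub> b) \<odot>\<^bsub>A\<^esub> d \<and> x = (x \<odot>\<^bsub>A\<^esub> d) \<odot>\<^bsub>A\<^esub> b"
proof -
  have "\<exists>\<delta>\<in>words A. \<exists>\<xi>\<in>x s. \<exists>\<beta>\<in>b s. (\<xi> @ \<beta>) @ \<delta> \<in> x s \<and> (\<xi> @ \<delta>) @ \<beta> \<in> x s" if s: "s \<in> finite_congruences A" for s
  proof -
    obtain \<alpha> where \<alpha>: "\<alpha> \<in> words A" "\<alpha> \<in> a s" by (rule free_profinite_ex_rep[OF a s])
    obtain \<beta> where \<beta>: "\<beta> \<in> words A" "\<beta> \<in> b s" by (rule free_profinite_ex_rep[OF b s])
    obtain \<xi> where \<xi>: "\<xi> \<in> words A" "\<xi> \<in> x s" by (rule free_profinite_ex_rep[OF x s])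
    note it = stable_power_iterate[OF a x b eq s \<alpha>(2) \<xi>(2) \<beta>(2)]
    obtain i m where im: "0 < i" "2 \<le> m" "(word_power \<alpha> i, word_power \<alpha> (i + m)) \<in> s"
      using word_power_periodic[OF s \<alpha>(1)] by blast
    have w: "word_power \<beta> i \<in> words A" "word_power \<beta> m \<in> words A" "word_power \<beta> (m - 1) \<in> words A"
      using im \<beta>(1) word_power_words by (metis Suc_1 Suc_le_eq diff_is_0_eq not_le not_less_eq_eq less_irrefl less_nat_zero_code)+
    have "(word_power \<alpha> i @ \<xi> @ word_power \<beta> (i + m), word_power \<alpha> (i + m) @ \<xi> @ word_power \<beta> (i + m)) \<in> s"
      using im(3) finite_congruencesD(3)[OF s] \<xi>(1) w word_power_add[of i m \<beta>] words_append by metis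
    then have "word_power \<alpha> i @ \<xi> @ word_power \<beta> (i + m) \<in> x s"
      using free_profinite_rep_iff[OF x s it[of "i + m"]] finite_congruencesD(1)[OF s]
      by (meson equivE symE)
    moreover have "(\<xi> @ word_power \<beta> m, word_power \<alpha> i @ \<xi> @ word_power \<beta> (i + m)) \<in> s"
    proof -
      have "(\<xi>, word_power \<alpha> i @ \<xi> @ word_power \<beta> i) \<in> s"
        using free_profinite_rep_iff[OF x s \<xi>(2)] it by blast
      then have "(\<xi> @ word_power \<beta> m, (word_power \<alpha> i @ \<xi> @ word_power \<beta> i) @ word_power \<beta> m) \<in> s"
        using finite_congruencesD(3)[OF s] w by blast
      then show ?thesis by (simp only: word_power_add append_assoc)
    qed
    ultimately have mem: "\<xi> @ word_power \<beta> m \<in> x s"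
      using free_profinite_rep_iff[OF x s] finite_congruencesD(1)[OF s] by (meson equivE symE)
    have "Suc (m - 1) = m" using im(2) by simp
    then have "word_power \<beta> m = \<beta> @ word_power \<beta> (m - 1)" by (metis concat.simps(2) replicate_Suc)
    then have "(\<xi> @ \<beta>) @ word_power \<beta> (m - 1) \<in> x s" "(\<xi> @ word_power \<beta> (m - 1)) @ \<beta> \<in> x s"
      using mem word_power_commute[of "m - 1" \<beta>] by simp_all
    then show ?thesis using w(3) \<xi>(2) \<beta>(2) by blast
  qed
  then obtain \<delta> where \<delta>: "\<And>s. s \<in> finite_congruences A \<Longrightarrow> \<delta> s \<in> words A \<and>
    (\<exists>\<xi>\<in>x s. \<exists>\<beta>\<in>b s. (\<xi> @ \<beta>) @ \<delta> s \<in> x s \<and> (\<xi> @ \<delta> s) @ \<beta> \<in> x s)" by metis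
  obtain d where d: "d \<in> free_profinite A"
    "\<And>r. r \<in> finite_congruences A \<Longrightarrow> \<exists>s\<in>finite_congruences A. s \<subseteq> r \<and> \<delta> s \<in> d r"
    using stable_limit[of A \<delta>] \<delta> by blast
  have *: "x r = ((x \<odot>\<^bsub>A\<^esub> b) \<odot>\<^bsub>A\<^esub> d) r \<and> x r = ((x \<odot>\<^bsub>A\<^esub> d) \<odot>\<^bsub>A\<^esub> b) r" if r: "r \<in> finite_congruences A" for r
  proof -
    obtain s where s: "s \<in> finite_congruences A" "s \<subseteq> r" "\<delta> s \<in> d r" using d(2)[OF r] by blast
    obtain \<xi> \<beta> where "\<xi> \<in> x s" "\<beta> \<in> b s" and m: "(\<xi> @ \<beta>) @ \<delta> s \<in> x s" "(\<xi> @ \<delta> s) @ \<beta> \<in> x s" using \<delta>[OF s(1)] by blast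
    then have mem: "\<xi> \<in> x r" "\<beta> \<in> b r" "(\<xi> @ \<beta>) @ \<delta> s \<in> x r" "(\<xi> @ \<delta> s) @ \<beta> \<in> x r"
      using free_profinite_mono[OF x s(1) r s(2)] free_profinite_mono[OF b s(1) r s(2)] by blast+
    have "(\<xi> @ \<beta>) @ \<delta> s \<in> ((x \<odot>\<^bsub>A\<^esub> b) \<odot>\<^bsub>A\<^esub> d) r" "(\<xi> @ \<delta> s) @ \<beta> \<in> ((x \<odot>\<^bsub>A\<^esub> d) \<odot>\<^bsub>A\<^esub> b) r"
      by (intro profinite_mult_rep[OF r] profinite_mult_closed x b d(1) mem s(3))+
    then show ?thesis
      using mem(3,4) free_profinite_eq_at[OF x _ r] profinite_mult_closed x b d(1) by metis
  qed
  have "x = (x \<odot>\<^bsub>A\<^esub> b) \<odot>\<^bsub>A\<^esub> d" "x = (x \<odot>\<^bsub>A\<^esub> d) \<odot>\<^bsub>A\<^esub> b"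
    by (intro free_profinite_eqI[of _ A] profinite_mult_closed x b d(1); use * in blast)+
  then show ?thesis using d(1) by blast
qed

text \<open>The same argument on the other side: a repetition among the powers of b gives x = a^m x
  modulo each finite congruence, and the words a^(m-1) have a cluster point.\<close>

lemma stable_left:
  assumes a: "a \<in> free_profinite A" and x: "x \<in> free_profinite A" and b: "b \<in> free_profinite A"
    and eq: "x = (a \<odot>\<^bsub>A\<^esub> x) \<odot>\<^bsub>A\<^esub> b"
  shows "\<exists>d\<in>free_profinite A. x = d \<odot>\<^bsub>A\<^esub> (a \<odot>\<^bsub>A\<^esub> x)"
proof -
  have "\<exists>\<delta>\<in>words A. \<exists>\<xi>\<in>x s. \<exists>\<alpha>\<in>a s. \<delta> @ (\<alpha> @ \<xi>) \<in> x s" if s: "s \<in> finite_congruences A" for s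
  proof -
    obtain \<alpha> where \<alpha>: "\<alpha> \<in> words A" "\<alpha> \<in> a s" by (rule free_profinite_ex_rep[OF a s])
    obtain \<beta> where \<beta>: "\<beta> \<in> words A" "\<beta> \<in> b s" by (rule free_profinite_ex_rep[OF b s])
    obtain \<xi> where \<xi>: "\<xi> \<in> words A" "\<xi> \<in> x s" by (rule free_profinite_ex_rep[OF x s])
    note it = stable_power_iterate[OF a x b eq s \<alpha>(2) \<xi>(2) \<beta>(2)]
    obtain i m where im: "0 < i" "2 \<le> m" "(word_power \<beta> i, word_power \<beta> (i + m)) \<in> s"
      using word_power_periodic[OF s \<beta>(1)] by blast
    have w: "word_power \<alpha> (m + i) \<in> words A" "word_power \<alpha> m \<in> words A" "word_power \<alpha> (m - 1) \<in> words A"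
      using im \<alpha>(1) word_power_words by (metis Suc_1 Suc_le_eq diff_is_0_eq not_le not_less_eq_eq less_irrefl less_nat_zero_code add_is_0)+
    have "((word_power \<alpha> (m + i) @ \<xi>) @ word_power \<beta> i, (word_power \<alpha> (m + i) @ \<xi>) @ word_power \<beta> (i + m)) \<in> s"
      by (rule finite_congruencesD(4)[OF s im(3) words_append[OF w(1) \<xi>(1)]])
    moreover have "(word_power \<alpha> (m + i) @ \<xi>) @ word_power \<beta> (i + m) \<in> x s"
      using it[of "m + i"] by (simp only: append_assoc add.commute)
    ultimately have "(word_power \<alpha> (m + i) @ \<xi>) @ word_power \<beta> i \<in> x s"
      using free_profinite_rep_iff[OF x s] finite_congruencesD(1)[OF s] by (meson equivE symE)
    moreover have "(word_power \<alpha> m @ \<xi>, (word_power \<alpha> (m + i) @ \<xi>) @ word_power \<beta> i) \<in> s"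
    proof -
      have "(\<xi>, word_power \<alpha> i @ \<xi> @ word_power \<beta> i) \<in> s"
        using free_profinite_rep_iff[OF x s \<xi>(2)] it by blast
      then have "(word_power \<alpha> m @ \<xi>, word_power \<alpha> m @ (word_power \<alpha> i @ \<xi> @ word_power \<beta> i)) \<in> s"
        using finite_congruencesD(4)[OF s] w by blast
      then show ?thesis by (simp only: word_power_add append_assoc)
    qed
    ultimately have mem: "word_power \<alpha> m @ \<xi> \<in> x s"
      using free_profinite_rep_iff[OF x s] finite_congruencesD(1)[OF s] by (meson equivE symE)
    have "Suc (m - 1) = m" using im(2) by simp
    then have "word_power \<alpha> m = \<alpha> @ word_power \<alpha> (m - 1)" by (metis concat.simps(2) replicate_Suc)
    then have "word_power \<alpha> (m - 1) @ (\<alpha> @ \<xi>) \<in> x s"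
      using mem word_power_commute[of "m - 1" \<alpha>] by (metis append_assoc)
    then show ?thesis using w(3) \<xi>(2) \<alpha>(2) by blast
  qed
  then obtain \<delta> where \<delta>: "\<And>s. s \<in> finite_congruences A \<Longrightarrow> \<delta> s \<in> words A \<and>
    (\<exists>\<xi>\<in>x s. \<exists>\<alpha>\<in>a s. \<delta> s @ (\<alpha> @ \<xi>) \<in> x s)" by metis
  obtain d where d: "d \<in> free_profinite A"
    "\<And>r. r \<in> finite_congruences A \<Longrightarrow> \<exists>s\<in>finite_congruences A. s \<subseteq> r \<and> \<delta> s \<in> d r"
    using stable_limit[of A \<delta>] \<delta> by blast
  have "x = d \<odot>\<^bsub>A\<^esub> (a \<odot>\<^bsub>A\<^esub> x)"
  proof (intro free_profinite_eqI[of _ A] profinite_mult_closed x a d(1))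
    fix r assume r: "r \<in> finite_congruences A"
    obtain s where s: "s \<in> finite_congruences A" "s \<subseteq> r" "\<delta> s \<in> d r" using d(2)[OF r] by blast
    obtain \<xi> \<alpha> where "\<xi> \<in> x s" "\<alpha> \<in> a s" "\<delta> s @ (\<alpha> @ \<xi>) \<in> x s" using \<delta>[OF s(1)] by blast
    then have mem: "\<xi> \<in> x r" "\<alpha> \<in> a r" "\<delta> s @ (\<alpha> @ \<xi>) \<in> x r"
      using free_profinite_mono[OF x s(1) r s(2)] free_profinite_mono[OF a s(1) r s(2)] by blast+
    have "\<delta> s @ (\<alpha> @ \<xi>) \<in> (d \<odot>\<^bsub>A\<^esub> (a \<odot>\<^bsub>A\<^esub> x)) r"
      by (intro profinite_mult_rep[OF r] profinite_mult_closed x a d(1) mem s(3))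
    then show "x r = (d \<odot>\<^bsub>A\<^esub> (a \<odot>\<^bsub>A\<^esub> x)) r"
      using mem(3) by (intro free_profinite_eq_at[OF x _ r] profinite_mult_closed x a d(1))
  qed
  then show ?thesis using d(1) by blast
qed


section \<open>Stable semigroups\<close>

text \<open>Separates the algebra from the topology: the two stability laws are all that is used
  about compactness in handling Green's relations.\<close>

locale stable_semigroup =
  fixes S :: "'s set" and f :: "'s \<Rightarrow> 's \<Rightarrow> 's" (infixl "\<cdot>" 70)
  assumes closed [simp]: "x \<in> S \<Longrightarrow> y \<in> S \<Longrightarrow> x \<cdot> y \<in> S"
    and assoc: "x \<in> S \<Longrightarrow> y \<in> S \<Longrightarrow> z \<in> S \<Longrightarrow> (x \<cdot> y) \<cdot> z = x \<cdot> (y \<cdot> z)"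
    and stable_right: "a \<in> S \<Longrightarrow> x \<in> S \<Longrightarrow> b \<in> S \<Longrightarrow> x = (a \<cdot> x) \<cdot> b \<Longrightarrow>
      \<exists>d\<in>S. x = (x \<cdot> b) \<cdot> d \<and> x = (x \<cdot> d) \<cdot> b"
    and stable_left: "a \<in> S \<Longrightarrow> x \<in> S \<Longrightarrow> b \<in> S \<Longrightarrow> x = (a \<cdot> x) \<cdot> b \<Longrightarrow> \<exists>d\<in>S. x = d \<cdot> (a \<cdot> x)"
begin

text \<open>Stability is applied three times: it removes the factor on the left, then the one on the
  right, and finally moves the multiplier obtained on the left to the middle, where it yields x = x
  d'' z x.\<close>

lemma regular_if_recurrent:
  assumes S: "x \<in> S" "a \<in> S" "z \<in> S" "b \<in> S" and eq: "x = (a \<cdot> (x \<cdot> (z \<cdot> x))) \<cdot> b"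
  shows "\<exists>s\<in>S. x = (x \<cdot> s) \<cdot> x"
proof -
  have "x = (a \<cdot> x) \<cdot> (z \<cdot> (x \<cdot> b))"
    by (rule trans[OF eq]) (use S in \<open>simp add: assoc\<close>)
  then obtain d where d: "d \<in> S" "x = (x \<cdot> (z \<cdot> (x \<cdot> b))) \<cdot> d"
    using stable_right[of a x "z \<cdot> (x \<cdot> b)"] S closed by blast
  have "x = ((x \<cdot> z) \<cdot> x) \<cdot> (b \<cdot> d)"
    by (rule trans[OF d(2)]) (use S d(1) in \<open>simp add: assoc\<close>)
  then obtain d' where d': "d' \<in> S" "x = d' \<cdot> ((x \<cdot> z) \<cdot> x)" 
    using stable_left[of "x \<cdot> z" x "b \<cdot> d"] S closed d(1) by blast
  have "x = (d' \<cdot> x) \<cdot> (z \<cdot> x)"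
    by (rule trans[OF d'(2)]) (use S d'(1) in \<open>simp add: assoc\<close>)
  then obtain d'' where d'': "d'' \<in> S" "x = (x \<cdot> d'') \<cdot> (z \<cdot> x)" 
    using stable_right[of d' x "z \<cdot> x"] S closed d'(1) by blast
  have "x = (x \<cdot> (d'' \<cdot> z)) \<cdot> x"
    by (rule trans[OF d''(2)]) (use S d''(1) in \<open>simp add: assoc\<close>)
  then show ?thesis using d''(1) S(3) closed by blast
qed

section \<open>Principal ideals and J-equivalence\<close>

lemma principal_ideal_mono:
  assumes "k \<in> S" "x \<in> principal_ideal S f k"
  shows "principal_ideal S f x \<subseteq> principal_ideal S f k"
proof
  fix y assume y: "y \<in> principal_ideal S f x"
  have k: "k \<in> principal_ideal S f k" by (simp add: principal_ideal_def)
  have l: "s \<cdot> z \<in> principal_ideal S f k" if z: "z \<in> principal_ideal S f k" "s \<in> S" for s z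
  proof -
    consider "z = k" | s' where "s' \<in> S" "z = s' \<cdot> k" | t where "t \<in> S" "z = k \<cdot> t"
      | s' t where "s' \<in> S" "t \<in> S" "z = (s' \<cdot> k) \<cdot> t"
      using z(1) by (auto simp: principal_ideal_def)
    then show ?thesis
    proof cases
      case 2
      then have "s \<cdot> z = (s \<cdot> s') \<cdot> k" using z(2) assms(1) by (simp add: assoc)
      then show ?thesis using 2 z(2) closed unfolding principal_ideal_def by blast
    next
      case 3
      then have "s \<cdot> z = (s \<cdot> k) \<cdot> t" using z(2) assms(1) by (simp add: assoc)
      then show ?thesis using 3 z(2) unfolding principal_ideal_def by blast
    next
      case 4
      then have "s \<cdot> z = ((s \<cdot> s') \<cdot> k) \<cdot> t" using z(2) assms(1) by (simp add: assoc)
      then show ?thesis using 4 z(2) closed unfolding principal_ideal_def by blast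
    qed (use z(2) in \<open>auto simp: principal_ideal_def\<close>)
  qed
  have r: "z \<cdot> t \<in> principal_ideal S f k" if z: "z \<in> principal_ideal S f k" "t \<in> S" for t z
  proof -
    consider "z = k" | s' where "s' \<in> S" "z = s' \<cdot> k" | t' where "t' \<in> S" "z = k \<cdot> t'"
      | s' t' where "s' \<in> S" "t' \<in> S" "z = (s' \<cdot> k) \<cdot> t'"
      using z(1) by (auto simp: principal_ideal_def)
    then show ?thesis
    proof cases
      case 2
      then show ?thesis using z(2) unfolding principal_ideal_def by blast
    next
      case 3
      then have "z \<cdot> t = k \<cdot> (t' \<cdot> t)" using z(2) assms(1) by (simp add: assoc)
      then show ?thesis using 3 z(2) closed unfolding principal_ideal_def by blast
    next
      case 4
      then have "z \<cdot> t = (s' \<cdot> k) \<cdot> (t' \<cdot> t)" using z(2) assms(1) by (simp add: assoc)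
      then show ?thesis using 4 z(2) closed unfolding principal_ideal_def by blast
    qed (use z(2) in \<open>auto simp: principal_ideal_def\<close>)
  qed
  from y consider "y = x" | s where "s \<in> S" "y = s \<cdot> x" | t where "t \<in> S" "y = x \<cdot> t"
      | s t where "s \<in> S" "t \<in> S" "y = (s \<cdot> x) \<cdot> t"
    by (auto simp: principal_ideal_def)
  then show "y \<in> principal_ideal S f k"
    by cases (use l r assms(2) in auto)
qed

text \<open>The semigroup has no identity, so the principal ideal contains one-sided and trivial
  products. Regularity of \<open>k\<close> supplies the missing factors \<open>k \<cdot> t\<close>
  and \<open>t \<cdot> k\<close>, and every case becomes two-sided.\<close>

lemma J_equiv_regular_iff:
  assumes k: "k \<in> S" "t \<in> S" "k = (k \<cdot> t) \<cdot> k" and x: "x \<in> S"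
  shows "principal_ideal S f x = principal_ideal S f k \<longleftrightarrow>
    (\<exists>a\<in>S. \<exists>b\<in>S. \<exists>c\<in>S. \<exists>d\<in>S. x = (a \<cdot> k) \<cdot> b \<and> k = (c \<cdot> x) \<cdot> d)"
proof
  assume eq: "principal_ideal S f x = principal_ideal S f k"
  have kk: "k = ((k \<cdot> t) \<cdot> k) \<cdot> (t \<cdot> k)" using k by (metis assoc closed)
  have "x \<in> principal_ideal S f k" using eq by (auto simp: principal_ideal_def)
  then consider "x = k" | s where "s \<in> S" "x = s \<cdot> k" | u where "u \<in> S" "x = k \<cdot> u"
      | s u where "s \<in> S" "u \<in> S" "x = (s \<cdot> k) \<cdot> u"
    by (auto simp: principal_ideal_def)
  then have 1: "\<exists>a\<in>S. \<exists>b\<in>S. x = (a \<cdot> k) \<cdot> b"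
  proof cases
    case 1
    then show ?thesis using kk k by (intro bexI[of _ "k \<cdot> t"] bexI[of _ "t \<cdot> k"]) auto
  next
    case 2
    then have "x = (s \<cdot> k) \<cdot> (t \<cdot> k)" using k by (metis assoc closed)
    then show ?thesis using 2 k closed by blast
  next
    case 3
    then have "x = ((k \<cdot> t) \<cdot> k) \<cdot> u" using k by metis
    then show ?thesis using 3 k closed by blast
  next
    case 4
    then show ?thesis by blast
  qed
  have "k \<in> principal_ideal S f x" using eq by (auto simp: principal_ideal_def)
  then consider "k = x" | s where "s \<in> S" "k = s \<cdot> x" | u where "u \<in> S" "k = x \<cdot> u"
      | s u where "s \<in> S" "u \<in> S" "k = (s \<cdot> x) \<cdot> u"
    by (auto simp: principal_ideal_def)
  then have 2: "\<exists>c\<in>S. \<exists>d\<in>S. k = (c \<cdot> x) \<cdot> d"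
  proof cases
    case 1
    then show ?thesis using kk k by (intro bexI[of _ "k \<cdot> t"] bexI[of _ "t \<cdot> k"]) auto
  next
    case 2
    then have "k = (s \<cdot> x) \<cdot> (t \<cdot> k)" using k by (metis assoc closed)
    then show ?thesis using 2 k closed by blast
  next
    case 3
    then have "k = ((k \<cdot> t) \<cdot> x) \<cdot> u" using k x by (metis assoc closed)
    then show ?thesis using 3 k closed by blast
  next
    case 4
    then show ?thesis by blast
  qed
  show "\<exists>a\<in>S. \<exists>b\<in>S. \<exists>c\<in>S. \<exists>d\<in>S. x = (a \<cdot> k) \<cdot> b \<and> k = (c \<cdot> x) \<cdot> d" using 1 2 by blast
next
  assume "\<exists>a\<in>S. \<exists>b\<in>S. \<exists>c\<in>S. \<exists>d\<in>S. x = (a \<cdot> k) \<cdot> b \<and> k = (c \<cdot> x) \<cdot> d"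
  then have "x \<in> principal_ideal S f k" "k \<in> principal_ideal S f x"
    unfolding principal_ideal_def by blast+
  then show "principal_ideal S f x = principal_ideal S f k"
    using principal_ideal_mono[OF k(1)] principal_ideal_mono[OF x] by blast
qed

text \<open>Regularity spreads over a D-class: by stability the element m = x d is L-equivalent to
  the regular element \<open>k\<close> and R-equivalent to \<open>x\<close>, so it passes regularity
  from the one to the other.\<close>

lemma regular_J_equiv:
  assumes S: "x \<in> S" "k \<in> S" "t \<in> S" "a \<in> S" "b \<in> S" "c \<in> S" "d \<in> S"
    and k: "k = (k \<cdot> t) \<cdot> k" and x: "x = (a \<cdot> k) \<cdot> b" "k = (c \<cdot> x) \<cdot> d"
  shows "\<exists>s\<in>S. x = (x \<cdot> s) \<cdot> x"
proof -
  have "x = ((a \<cdot> c) \<cdot> x) \<cdot> (d \<cdot> b)"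
  proof -
    have "x = (a \<cdot> ((c \<cdot> x) \<cdot> d)) \<cdot> b" using x by metis
    then show ?thesis by (rule trans) (use S in \<open>simp add: assoc\<close>)
  qed
  moreover have "a \<cdot> c \<in> S" "d \<cdot> b \<in> S" using S by auto
  ultimately obtain y w where y: "y \<in> S" "x = (x \<cdot> (d \<cdot> b)) \<cdot> y" and w: "w \<in> S" "x = w \<cdot> ((a \<cdot> c) \<cdot> x)"
    using stable_right[of "a \<cdot> c" x "d \<cdot> b"] stable_left[of "a \<cdot> c" x "d \<cdot> b"] S by blast
  define m where "m = x \<cdot> d"
  have mS: "m \<in> S" using S by (simp add: m_def)
  have m1: "m = (w \<cdot> a) \<cdot> k"
  proof -
    have "m = (w \<cdot> ((a \<cdot> c) \<cdot> x)) \<cdot> d" unfolding m_def by (rule arg_cong[OF w(2)])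
    also have "\<dots> = (w \<cdot> a) \<cdot> ((c \<cdot> x) \<cdot> d)" using S w(1) by (simp add: assoc)
    also have "\<dots> = (w \<cdot> a) \<cdot> k" by (simp only: x(2)[symmetric])
    finally show ?thesis .
  qed
  have m2: "k = c \<cdot> m"
    by (rule trans[OF x(2)]) (use S in \<open>simp add: m_def assoc\<close>)
  have m3: "m = (m \<cdot> t) \<cdot> (c \<cdot> m)"
  proof -
    have "m = (w \<cdot> a) \<cdot> ((k \<cdot> t) \<cdot> k)" using m1 k by metis
    also have "\<dots> = (((w \<cdot> a) \<cdot> k) \<cdot> t) \<cdot> k" using S w(1) by (simp add: assoc)
    also have "\<dots> = (m \<cdot> t) \<cdot> (c \<cdot> m)" by (simp only: m1[symmetric] m2[symmetric])
    finally show ?thesis .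
  qed
  have x2: "x = m \<cdot> (b \<cdot> y)"
    by (rule trans[OF y(2)]) (use S y(1) in \<open>simp add: m_def assoc\<close>)
  have "x = ((m \<cdot> t) \<cdot> (c \<cdot> m)) \<cdot> (b \<cdot> y)" 
    by (rule trans[OF x2 arg_cong[OF m3, of "\<lambda>v. v \<cdot> (b \<cdot> y)"]])
  also have "\<dots> = (m \<cdot> (t \<cdot> c)) \<cdot> (m \<cdot> (b \<cdot> y))" using S y(1) mS by (simp add: assoc)
  also have "\<dots> = (m \<cdot> (t \<cdot> c)) \<cdot> x" by (simp only: x2[symmetric])
  also have "\<dots> = (x \<cdot> (d \<cdot> (t \<cdot> c))) \<cdot> x" using S by (simp add: m_def assoc)
  finally show ?thesis using S closed by blast
qed

text \<open>For idempotent \<open>e\<close> this is the group of units of the local monoid eSe, that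
  is, the H-class of \<open>e\<close>.\<close>

definition unit_group :: "'s \<Rightarrow> 's set" where
  "unit_group e = {h \<in> S. e \<cdot> h = h \<and> h \<cdot> e = h \<and>
     (\<exists>h'\<in>S. e \<cdot> h' = h' \<and> h' \<cdot> e = h' \<and> h \<cdot> h' = e \<and> h' \<cdot> h = e)}"

section \<open>Groups of units as maximal subgroups\<close>

lemma unit_groupI:
  assumes "h \<in> S" "e \<cdot> h = h" "h \<cdot> e = h" "h' \<in> S" "e \<cdot> h' = h'" "h' \<cdot> e = h'" "h \<cdot> h' = e" "h' \<cdot> h = e"
  shows "h \<in> unit_group e" "h' \<in> unit_group e"
  using assms unfolding unit_group_def by blast+

lemma unit_groupE:
  assumes "h \<in> unit_group e"
  obtains h' where "h \<in> S" "e \<cdot> h = h" "h \<cdot> e = h" "h' \<in> unit_group e" "h' \<in> S" "e \<cdot> h' = h'" "h' \<cdot> e = h'"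
    "h \<cdot> h' = e" "h' \<cdot> h = e"
  using assms unfolding unit_group_def by blast

lemma unit_group_unit: "e \<in> S \<Longrightarrow> e \<cdot> e = e \<Longrightarrow> e \<in> unit_group e"
  unfolding unit_group_def by blast

lemma unit_group_mult:
  assumes "g \<in> unit_group e" "h \<in> unit_group e" "e \<in> S"
  shows "g \<cdot> h \<in> unit_group e"
proof -
  obtain g' where g: "g \<in> S" "e \<cdot> g = g" "g \<cdot> e = g" "g' \<in> S" "e \<cdot> g' = g'" "g' \<cdot> e = g'" "g \<cdot> g' = e" "g' \<cdot> g = e"
    using unit_groupE[OF assms(1)] .
  obtain h' where h: "h \<in> S" "e \<cdot> h = h" "h \<cdot> e = h" "h' \<in> S" "e \<cdot> h' = h'" "h' \<cdot> e = h'" "h \<cdot> h' = e" "h' \<cdot> h = e"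
    using unit_groupE[OF assms(2)] .
  have "(g \<cdot> h) \<cdot> (h' \<cdot> g') = e" "(h' \<cdot> g') \<cdot> (g \<cdot> h) = e"
  proof -
    have "(g \<cdot> h) \<cdot> (h' \<cdot> g') = g \<cdot> ((h \<cdot> h') \<cdot> g')" using g(1,4) h(1,4) by (simp add: assoc)
    then show "(g \<cdot> h) \<cdot> (h' \<cdot> g') = e" by (simp add: g h)
    have "(h' \<cdot> g') \<cdot> (g \<cdot> h) = h' \<cdot> ((g' \<cdot> g) \<cdot> h)" using g(1,4) h(1,4) by (simp add: assoc)
    then show "(h' \<cdot> g') \<cdot> (g \<cdot> h) = e" by (simp add: g h)
  qed
  moreover have "e \<cdot> (g \<cdot> h) = g \<cdot> h" "e \<cdot> (h' \<cdot> g') = h' \<cdot> g'"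
    using assoc[of e g h] assoc[of e h' g'] assms(3) g h by simp_all
  moreover have "(g \<cdot> h) \<cdot> e = g \<cdot> h" "(h' \<cdot> g') \<cdot> e = h' \<cdot> g'"
    using assoc[of g h e] assoc[of h' g' e] assms(3) g h by simp_all
  ultimately show ?thesis
    using g(1,4) h(1,4) by (intro unit_groupI(1)[of "g \<cdot> h" e "h' \<cdot> g'"]) auto
qed

lemma unit_group_group:
  assumes "e \<in> S" "e \<cdot> e = e"
  shows "group \<lparr>carrier = unit_group e, monoid.mult = f, one = e\<rparr>"
proof (rule groupI)
  fix x assume "x \<in> carrier \<lparr>carrier = unit_group e, monoid.mult = f, one = e\<rparr>"
  then show "\<exists>y\<in>carrier \<lparr>carrier = unit_group e, monoid.mult = f, one = e\<rparr>.
      y \<otimes>\<^bsub>\<lparr>carrier = unit_group e, monoid.mult = f, one = e\<rparr>\<^esub> x = \<one>\<^bsub>\<lparr>carrier = unit_group e, monoid.mult = f, one = e\<rparr>\<^esub>"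
    by (auto elim: unit_groupE)
qed (use assms unit_group_mult unit_group_unit in \<open>auto simp: unit_group_def assoc\<close>)

lemma subgroup_in_unit_group:
  assumes "K \<subseteq> S" "group \<lparr>carrier = K, monoid.mult = f, one = e\<rparr>"
  shows "e \<in> K" "e \<cdot> e = e" "K \<subseteq> unit_group e"
proof -
  interpret K: group "\<lparr>carrier = K, monoid.mult = f, one = e\<rparr>" by fact
  show e: "e \<in> K" "e \<cdot> e = e" using K.one_closed K.l_one[OF K.one_closed] by simp_all
  show "K \<subseteq> unit_group e"
  proof
    fix h assume h: "h \<in> K"
    then obtain h' where "h' \<in> K" "h' \<cdot> h = e" "h \<cdot> h' = e"
      using K.l_inv_ex[of h] K.r_inv_ex K.inv_closed K.l_inv K.r_inv by (metis monoid.simps(1,2) partial_object.select_convs(1))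
    then show "h \<in> unit_group e"
      using h K.l_one K.r_one assms(1) by (intro unit_groupI(1)[of h e h']) auto
  qed
qed

text \<open>A larger group contains the idempotent \<open>e\<close>; cancelling there shows that
  \<open>e\<close> is its identity, so its elements are units of \<open>e\<close>.\<close>

lemma unit_group_maximal:
  assumes "e \<in> S" "e \<cdot> e = e"
  shows "unit_group e \<in> maximal_subgroups S f"
proof -
  have "unit_group e = K" if K: "K \<in> subgroups S f" "unit_group e \<subseteq> K" for K
  proof -
    obtain e' where e': "K \<subseteq> S" "group \<lparr>carrier = K, monoid.mult = f, one = e'\<rparr>"
      using K(1) by (auto simp: subgroups_def)
    have "e \<in> unit_group e'" using unit_group_unit[OF assms] K(2) subgroup_in_unit_group(3)[OF e'] by blast
    then obtain h' where h': "e \<cdot> e' = e" "e \<cdot> h' = e'" "h' \<in> S" by (auto elim: unit_groupE)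
    have "e \<cdot> e' = e'" using assoc[OF assms(1,1) h'(3)] unfolding assms(2) h'(2) by (rule sym)
    then have "e = e'" using h'(1) by simp
    then show ?thesis using subgroup_in_unit_group(3)[OF e'] K(2) by blast
  qed
  moreover have "unit_group e \<in> subgroups S f"
    using unit_group_group[OF assms] by (auto simp: subgroups_def unit_group_def)
  ultimately show ?thesis unfolding maximal_subgroups_def by blast
qed

lemma maximal_subgroup_unit_group:
  assumes "H \<in> maximal_subgroups S f"
  shows "\<exists>e\<in>S. e \<cdot> e = e \<and> H = unit_group e"
proof -
  have "H \<in> subgroups S f" using assms by (simp add: maximal_subgroups_def)
  then obtain e where e: "H \<subseteq> S" "group \<lparr>carrier = H, monoid.mult = f, one = e\<rparr>" by (auto simp: subgroups_def)
  note * = subgroup_in_unit_group[OF e]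
  have "unit_group e \<in> maximal_subgroups S f" using *(1,2) e(1) by (intro unit_group_maximal) auto
  then have "H = unit_group e" using assms *(3) unfolding maximal_subgroups_def by blast
  then show ?thesis using *(1,2) e(1) by blast
qed

text \<open>Two factorizations of an idempotent whose left factors share a suffix and whose right factors
  share a prefix, both from below the idempotent, may be recombined inside the group of units.\<close>

lemma exchange_factorizations:
  assumes S: "e \<in> S" "u \<in> S" "u' \<in> S" "s \<in> S" "r \<in> S" "w \<in> S" "w' \<in> S" "c \<in> S" "d \<in> S" "c' \<in> S" "d' \<in> S"
    and ee: "e \<cdot> e = e"
    and p: "p = u \<cdot> s" and p': "p' = u' \<cdot> s" and q: "q = r \<cdot> w" and q': "q' = r \<cdot> w'"
    and e1: "p \<cdot> q = e" and e2: "p' \<cdot> q' = e"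
    and s: "s = (c \<cdot> e) \<cdot> d" and r: "r = (c' \<cdot> e) \<cdot> d'"
  shows "p \<cdot> q' \<in> unit_group e" "p' \<cdot> q \<in> unit_group e" "q' = q \<cdot> (p \<cdot> q')" "p' = (p' \<cdot> q) \<cdot> p"
proof -
  have pS: "p \<in> S" "p' \<in> S" "q \<in> S" "q' \<in> S" using S p p' q q' by auto
  \<comment> \<open>Since \<open>s\<close> lies below \<open>e\<close> and \<open>e\<close> lies
    below \<open>v \<cdot> s\<close> in the J-order, stability makes \<open>s\<close> and
    \<open>v \<cdot> s\<close> L-equivalent; \<open>rP\<close> is dual.\<close>
  have sP: "\<exists>\<alpha>\<in>S. s = \<alpha> \<cdot> (v \<cdot> s)" if v: "v \<in> S" "x \<in> S" "(v \<cdot> s) \<cdot> x = e" for v x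
  proof -
    have "s = ((c \<cdot> v) \<cdot> s) \<cdot> (x \<cdot> d)"
    proof -
      have "s = (c \<cdot> ((v \<cdot> s) \<cdot> x)) \<cdot> d" using s v(3) by metis
      then show ?thesis by (rule trans) (use S v(1,2) in \<open>simp add: assoc\<close>)
    qed
    then obtain y where y: "y \<in> S" "s = y \<cdot> ((c \<cdot> v) \<cdot> s)"
      using stable_left[of "c \<cdot> v" s "x \<cdot> d"] S v(1,2) closed by blast
    have "s = (y \<cdot> c) \<cdot> (v \<cdot> s)"
      by (rule trans[OF y(2)]) (use S v(1,2) y(1) in \<open>simp add: assoc\<close>)
    then show ?thesis using S y(1) closed by blast
  qed
  have rP: "\<exists>\<beta>\<in>S. r = (r \<cdot> v) \<cdot> \<beta>" if v: "v \<in> S" "x \<in> S" "x \<cdot> (r \<cdot> v) = e" for v x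
  proof -
    have "r = ((c' \<cdot> x) \<cdot> r) \<cdot> (v \<cdot> d')"
    proof -
      have "r = (c' \<cdot> (x \<cdot> (r \<cdot> v))) \<cdot> d'" using r v(3) by metis
      then show ?thesis by (rule trans) (use S v(1,2) in \<open>simp add: assoc\<close>)
    qed
    then obtain y where y: "y \<in> S" "r = (r \<cdot> (v \<cdot> d')) \<cdot> y"
      using stable_right[of "c' \<cdot> x" r "v \<cdot> d'"] S v(1,2) closed by blast
    have "r = (r \<cdot> v) \<cdot> (d' \<cdot> y)"
      by (rule trans[OF y(2)]) (use S v(1,2) y(1) in \<open>simp add: assoc\<close>)
    then show ?thesis using S y(1) closed by blast
  qed
  \<comment> \<open>By the same relations \<open>v \<cdot> s\<close> is R-equivalent to
    \<open>e\<close>, which therefore acts on it as a left identity; \<open>eQ\<close> is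
    dual.\<close>
  have eP: "e \<cdot> (v \<cdot> s) = v \<cdot> s" if v: "v \<in> S" "x \<in> S" "(v \<cdot> s) \<cdot> x = e" for v x
  proof -
    have "v \<cdot> s = ((v \<cdot> c) \<cdot> (v \<cdot> s)) \<cdot> (x \<cdot> d)"
    proof -
      have "v \<cdot> s = v \<cdot> ((c \<cdot> ((v \<cdot> s) \<cdot> x)) \<cdot> d)" using s v(3) by metis
      then show ?thesis by (rule trans) (use S v(1,2) in \<open>simp add: assoc\<close>)
    qed
    then obtain y where y: "y \<in> S" "v \<cdot> s = ((v \<cdot> s) \<cdot> (x \<cdot> d)) \<cdot> y"
      using stable_right[of "v \<cdot> c" "v \<cdot> s" "x \<cdot> d"] S v(1,2) closed by blast
    have "v \<cdot> s = ((v \<cdot> s) \<cdot> x) \<cdot> (d \<cdot> y)"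
      by (rule trans[OF y(2)]) (use S v(1,2) y(1) in \<open>simp add: assoc\<close>)
    then have vs: "v \<cdot> s = e \<cdot> (d \<cdot> y)" unfolding v(3) .
    have "e \<cdot> (e \<cdot> (d \<cdot> y)) = e \<cdot> (d \<cdot> y)" using S(1,9) y(1) ee assoc[of e e "d \<cdot> y"] by simp
    then show ?thesis unfolding vs .
  qed
  have eQ: "(r \<cdot> v) \<cdot> e = r \<cdot> v" if v: "v \<in> S" "x \<in> S" "x \<cdot> (r \<cdot> v) = e" for v x
  proof -
    have "r \<cdot> v = ((c' \<cdot> x) \<cdot> (r \<cdot> v)) \<cdot> (d' \<cdot> v)"
    proof -
      have "r \<cdot> v = ((c' \<cdot> (x \<cdot> (r \<cdot> v))) \<cdot> d') \<cdot> v" using r v(3) by metis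
      then show ?thesis by (rule trans) (use S v(1,2) in \<open>simp add: assoc\<close>)
    qed
    then obtain y where y: "y \<in> S" "r \<cdot> v = y \<cdot> ((c' \<cdot> x) \<cdot> (r \<cdot> v))"
      using stable_left[of "c' \<cdot> x" "r \<cdot> v" "d' \<cdot> v"] S v(1,2) closed by blast
    have "r \<cdot> v = (y \<cdot> c') \<cdot> (x \<cdot> (r \<cdot> v))"
      by (rule trans[OF y(2)]) (use S v(1,2) y(1) in \<open>simp add: assoc\<close>)
    then have rv: "r \<cdot> v = (y \<cdot> c') \<cdot> e" unfolding v(3) .
    have "((y \<cdot> c') \<cdot> e) \<cdot> e = (y \<cdot> c') \<cdot> e" using S(1,10) y(1) ee assoc[of "y \<cdot> c'" e e] by simp
    then show ?thesis unfolding rv .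
  qed
  have ep: "e \<cdot> p = p" "e \<cdot> p' = p'" "q \<cdot> e = q" "q' \<cdot> e = q'"
    using eP[OF S(2) pS(3)] eP[OF S(3) pS(4)] eQ[OF S(6) pS(1)] eQ[OF S(7) pS(2)] e1 e2
    unfolding p[symmetric] p'[symmetric] q[symmetric] q'[symmetric] by blast+
  obtain \<alpha> \<beta> \<beta>' where \<alpha>: "\<alpha> \<in> S" "s = \<alpha> \<cdot> p" and \<beta>: "\<beta> \<in> S" "r = q \<cdot> \<beta>" and \<beta>': "\<beta>' \<in> S" "r = q' \<cdot> \<beta>'"
    using sP[OF S(2) pS(3)] rP[OF S(6) pS(1)] rP[OF S(7) pS(2)] e1 e2
    unfolding p[symmetric] p'[symmetric] q[symmetric] q'[symmetric] by blast
  \<comment> \<open>These multipliers exhibit \<open>p'\<close> as a left multiple of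
    \<open>p\<close>, and \<open>q\<close> and \<open>q'\<close> as right multiples of each
    other.\<close>
  define a b b' where "a = u' \<cdot> \<alpha>" and "b = \<beta> \<cdot> w'" and "b' = \<beta>' \<cdot> w"
  have abS: "a \<in> S" "b \<in> S" "b' \<in> S" using \<alpha>(1) \<beta>(1) \<beta>'(1) S(3,6,7) by (auto simp: a_def b_def b'_def)
  have a: "p' = a \<cdot> p"
    unfolding p' a_def assoc[OF S(3) \<alpha>(1) pS(1)] by (rule arg_cong[OF \<alpha>(2)])
  have b: "q' = q \<cdot> b"
    unfolding q' b_def assoc[OF pS(3) \<beta>(1) S(7), symmetric] by (rule arg_cong[OF \<beta>(2)])
  have b': "q = q' \<cdot> b'"
    unfolding q b'_def assoc[OF pS(4) \<beta>'(1) S(6), symmetric] by (rule arg_cong[OF \<beta>'(2)])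
  have k1: "q' \<cdot> (p' \<cdot> q) = q"
  proof -
    have "q' \<cdot> (p' \<cdot> q) = q' \<cdot> (p' \<cdot> (q' \<cdot> b'))" using b' by metis
    also have "\<dots> = (q' \<cdot> (p' \<cdot> q')) \<cdot> b'" using pS abS by (simp add: assoc)
    also have "\<dots> = q" using e2 ep b' by metis
    finally show ?thesis .
  qed
  have k2: "q \<cdot> (p \<cdot> q') = q'"
  proof -
    have "q \<cdot> (p \<cdot> q') = q \<cdot> (p \<cdot> (q \<cdot> b))" using b by metis
    also have "\<dots> = (q \<cdot> (p \<cdot> q)) \<cdot> b" using pS abS by (simp add: assoc)
    also have "\<dots> = q'" using e1 ep b by metis
    finally show ?thesis .
  qed
  show "q' = q \<cdot> (p \<cdot> q')" by (rule k2[symmetric])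
  show "p' = (p' \<cdot> q) \<cdot> p"
  proof -
    have "((a \<cdot> p) \<cdot> q) \<cdot> p = a \<cdot> ((p \<cdot> q) \<cdot> p)" using pS abS by (simp add: assoc)
    also have "\<dots> = a \<cdot> p" by (simp only: e1 ep)
    finally show ?thesis unfolding a[symmetric] by (rule sym)
  qed
  \<comment> \<open>The two mixed products are inverse to each other, which is why both lie in the
    group of units.\<close>
  have g: "(p \<cdot> q') \<cdot> (p' \<cdot> q) = e" "(p' \<cdot> q) \<cdot> (p \<cdot> q') = e"
    using assoc[OF pS(1,4) closed[OF pS(2,3)]] assoc[OF pS(2,3) closed[OF pS(1,4)]]
    unfolding k1 k2 e1 e2 by blast+
  have "e \<cdot> (p \<cdot> q') = p \<cdot> q'" "e \<cdot> (p' \<cdot> q) = p' \<cdot> q"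
    using assoc[of e p q'] assoc[of e p' q] pS S ep by simp_all
  moreover have "(p \<cdot> q') \<cdot> e = p \<cdot> q'" "(p' \<cdot> q) \<cdot> e = p' \<cdot> q"
    using assoc[of p q' e] assoc[of p' q e] pS S ep by simp_all
  ultimately show "p \<cdot> q' \<in> unit_group e" "p' \<cdot> q \<in> unit_group e"
    using unit_groupI[of "p \<cdot> q'" e "p' \<cdot> q"] g pS by auto
qed

end


section \<open>Torsion-freeness\<close>

text \<open>On a fibre of \<open>K\<close> the summand is constant modulo \<open>c\<close>, so a
  fibre contributes its size times that constant.\<close>

lemma card_fibres_dvd_sum:
  fixes D :: "'i \<Rightarrow> int" and K :: "'i \<Rightarrow> 'k"
  assumes "finite S" and D: "\<And>x y. x \<in> S \<Longrightarrow> y \<in> S \<Longrightarrow> K x = K y \<Longrightarrow> c dvd D x - D y"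
    and card: "\<And>y. y \<in> S \<Longrightarrow> c dvd int (card {x \<in> S. K x = K y})"
  shows "c dvd (\<Sum>x\<in>S. D x)"
proof -
  have "(\<Sum>x\<in>S. D x) = (\<Sum>k\<in>K ` S. \<Sum>x\<in>{x \<in> S. K x = k}. D x)"
    by (rule sum.image_gen[OF assms(1)])
  moreover have "c dvd (\<Sum>x\<in>{x \<in> S. K x = k}. D x)" if k: "k \<in> K ` S" for k
  proof -
    obtain y where y: "y \<in> S" "k = K y" using k by blast
    have "(\<Sum>x\<in>{x \<in> S. K x = k}. D x) = (\<Sum>x\<in>{x \<in> S. K x = k}. D x - D y) + int (card {x \<in> S. K x = k}) * D y"
      by (simp add: sum_subtractf)
    moreover have "c dvd (\<Sum>x\<in>{x \<in> S. K x = k}. D x - D y)"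
      by (rule dvd_sum) (use D y in auto)
    ultimately show ?thesis using card[OF y(1)] y(2) by (simp add: dvd_add)
  qed
  ultimately show ?thesis by (simp add: dvd_sum)
qed

text \<open>Read \<open>\<nu>\<close> from the state \<open>\<eta>\<close> in the Cayley graph modulo \<open>r\<close>.  Left multiplication by \<open>\<nu>\<close> is a free
  action of the cyclic group of order \<open>c\<close> on the visited states, so there is an equivariant labelling \<open>T\<close>
  of these states by residues modulo \<open>c\<close>.  The increments of \<open>T\<close> along the path depend only on the orbit of
  the edge; each orbit is visited a multiple of \<open>c\<close> times, but the total increment is \<open>1\<close>.\<close>

lemma no_cyclic_count:
  fixes c :: nat
  assumes r: "r \<in> finite_congruences A" and \<eta>: "\<eta> \<in> words A" and \<nu>: "\<nu> \<in> words A" and c: "c \<ge> 2"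
    and \<eta>\<eta>: "(\<eta> @ \<eta>, \<eta>) \<in> r" and \<eta>\<nu>: "(\<eta> @ \<nu>, \<nu>) \<in> r" and \<nu>\<eta>: "(\<nu> @ \<eta>, \<nu>) \<in> r"
    and pc: "(word_power \<nu> c, \<eta>) \<in> r"
    and free: "\<And>i. 0 < i \<Longrightarrow> i < c \<Longrightarrow> (word_power \<nu> i, \<eta>) \<notin> r"
    and count: "\<And>z a. z \<in> words A \<Longrightarrow> a \<in> A \<Longrightarrow> c dvd (\<Sum>i<c. card {k. k < length \<nu> \<and>
      (\<eta> @ word_power \<nu> i @ take k \<nu>, z) \<in> r \<and> \<nu> ! k = a})"
  shows False
proof -
  note eq = finite_congruencesD(1)[OF r]
  have trans: "(u, w) \<in> r" if "(u, v) \<in> r" "(v, w) \<in> r" for u v w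
    using eq that by (meson equivE transE)
  have sym: "(v, u) \<in> r" if "(u, v) \<in> r" for u v
    using eq that by (meson equivE symE)
  have refl: "(u, u) \<in> r" if "u \<in> words A" for u
    using eq that by (simp add: equiv_def refl_on_def)
  have appR: "(u @ t, v @ t) \<in> r" if "(u, v) \<in> r" "set t \<subseteq> A" for u v t
    using that finite_congruencesD(3)[OF r, of u v t] by (cases "t = []") (auto simp: words_def)
  have appL: "(t @ u, t @ v) \<in> r" if "(u, v) \<in> r" "set t \<subseteq> A" for u v t
    using that finite_congruencesD(4)[OF r, of u v t] by (cases "t = []") (auto simp: words_def)
  let ?P = "word_power \<nu>"
  have setP: "set (?P i) \<subseteq> A" for i using \<nu> by (auto simp: words_def)
  have set\<nu>: "set \<nu> \<subseteq> A" "set \<eta> \<subseteq> A" "\<nu> \<noteq> []" "\<eta> \<noteq> []" using \<nu> \<eta> by (auto simp: words_def)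
  have take_A: "set (take k \<nu>) \<subseteq> A" "set (drop k \<nu>) \<subseteq> A" for k
    using set\<nu>(1) set_take_subset[of k \<nu>] set_drop_subset[of k \<nu>] by blast+
  define l where "l = length \<nu>"
  \<comment> \<open>The state reached from \<eta> after k letters of \<nu>. As
    \<open>word_power \<nu> c\<close> is congruent to \<eta>, left multiplication by it fixes all
    these states (\<open>pcy\<close>), so the cyclic group of order c acts.\<close>
  define y where "y k = \<eta> @ take k \<nu>" for k
  have yw: "y k \<in> words A" for k using set\<nu> take_A by (auto simp: y_def words_def)
  have pcy: "(?P c @ y k, y k) \<in> r" for k
  proof -
    have "(?P c @ \<eta>, \<eta>) \<in> r" using trans[OF appR[OF pc set\<nu>(2)] \<eta>\<eta>] .
    from appR[OF this take_A(1)[of k]] show ?thesis by (simp add: y_def)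
  qed
  have pcy': "(?P (c * i) @ y k, y k) \<in> r" for i k
  proof (induction i)
    case 0
    then show ?case using refl[OF yw] by simp
  next
    case (Suc i)
    have "?P (c * Suc i) @ y k = ?P c @ (?P (c * i) @ y k)"
      by (simp only: word_power_add mult_Suc_right append_assoc)
    then show ?case using trans[OF appL[OF Suc setP] pcy] by simp
  qed
  have P\<eta>: "(?P m @ \<eta>, ?P m) \<in> r" if "0 < m" for m
  proof -
    from that obtain j where "m = Suc j" by (cases m) auto
    then have "?P m = ?P j @ \<nu>" using word_power_commute[of j \<nu>] by simp
    then show ?thesis using appL[OF \<nu>\<eta> setP[of j]] by simp
  qed
  have free1: "c dvd i" if i: "(?P i @ y k, y k) \<in> r" and k: "k \<le> l" for i k
  proof -
    define m where "m = i mod c"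
    have mc: "m < c" using c by (simp add: m_def)
    have "i = m + c * (i div c)" by (simp add: m_def)
    then have "?P i @ y k = ?P m @ (?P (c * (i div c)) @ y k)" by (metis append_assoc word_power_add)
    then have "(?P m @ y k, y k) \<in> r" using trans[OF sym[OF appL[OF pcy' setP]]] i by metis
    \<comment> \<open>Reading the rest of \<nu> and c - 1 further copies of it leads from
      \<open>y k\<close> back to the class of \<eta>. A power that fixes \<open>y k\<close>
      therefore fixes \<eta>, where freeness is given.\<close>
    moreover define t where "t = drop k \<nu> @ ?P (c - 1)"
    moreover have "set t \<subseteq> A" using take_A setP unfolding t_def by simp
    ultimately have "((?P m @ y k) @ t, y k @ t) \<in> r" by (intro appR)
    moreover have yt: "y k @ t = \<eta> @ ?P c"
    proof -
      have "Suc (c - 1) = c" using c by simp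
      then have "?P c = \<nu> @ ?P (c - 1)" by (metis concat.simps(2) replicate_Suc)
      then show ?thesis by (simp add: y_def t_def)
    qed
    moreover have \<eta>P: "(\<eta> @ ?P c, \<eta>) \<in> r" using trans[OF appL[OF pc set\<nu>(2)] \<eta>\<eta>] .
    ultimately have "(?P m @ \<eta> @ ?P c, \<eta>) \<in> r" using trans by (metis append_assoc)
    then have "(?P m @ \<eta>, \<eta>) \<in> r" using trans[OF sym[OF appL[OF \<eta>P setP]]] by blast
    then have "m = 0" using free[of m] P\<eta>[of m] mc trans sym by blast
    then show ?thesis by (auto simp: m_def)
  qed
  have free2: "int c dvd int i - int j" if ij: "(?P i @ y k, ?P j @ y k) \<in> r" and k: "k \<le> l" for i j k
  proof -
    \<comment> \<open>The power with exponent (c - 1) j acts as the inverse of the power with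
      exponent j.\<close>
    have cj: "c * j = (c - 1) * j + j" using c by (metis add.commute add_mult_distrib mult_1 ordered_cancel_comm_monoid_diff_class.add_diff_inverse add_leD2 le_add1 numeral_2_eq_2 plus_1_eq_Suc order_trans)
    have "(?P ((c - 1) * j) @ ?P i @ y k, ?P ((c - 1) * j) @ ?P j @ y k) \<in> r" by (rule appL[OF ij setP])
    moreover have "?P ((c - 1) * j) @ ?P j @ y k = ?P (c * j) @ y k" by (simp only: cj word_power_add append_assoc)
    moreover have "?P ((c - 1) * j) @ ?P i @ y k = ?P ((c - 1) * j + i) @ y k" by (simp only: word_power_add append_assoc)
    ultimately have "(?P ((c - 1) * j + i) @ y k, y k) \<in> r" using trans pcy' by metis
    then have "c dvd (c - 1) * j + i" using free1 k by blast
    then have "int c dvd int ((c - 1) * j + i)" by presburger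
    moreover have "int ((c - 1) * j + i) = int c * int j + (int i - int j)"
      using cj by (simp add: algebra_simps) (metis of_nat_add of_nat_mult)
    then have "int i - int j = int ((c - 1) * j + i) - int c * int j" by simp
    ultimately show ?thesis by (metis dvd_diff dvd_triv_left)
  qed
  \<comment> \<open>Two positions are related when their states lie in the same orbit.\<close>
  define R where "R k j \<longleftrightarrow> (\<exists>i. (?P i @ y k, y j) \<in> r)" for k j
  have R_refl: "R k k" for k unfolding R_def using refl[OF yw] by (intro exI[of _ 0]) simp
  have R_sym: "R j k" if "R k j" for j k
  proof -
    from that obtain i where i: "(?P i @ y k, y j) \<in> r" by (auto simp: R_def)
    have ci: "c * i = (c - 1) * i + i" using c by (metis add.commute add_mult_distrib mult_1 ordered_cancel_comm_monoid_diff_class.add_diff_inverse add_leD2 le_add1 numeral_2_eq_2 plus_1_eq_Suc order_trans)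
    have "(?P ((c - 1) * i) @ ?P i @ y k, ?P ((c - 1) * i) @ y j) \<in> r" by (rule appL[OF i setP])
    moreover have "?P ((c - 1) * i) @ ?P i @ y k = ?P (c * i) @ y k" by (simp only: ci word_power_add append_assoc)
    ultimately have "(?P ((c - 1) * i) @ y j, y k) \<in> r" using trans sym pcy' by metis
    then show ?thesis by (auto simp: R_def)
  qed
  have R_trans: "R k m" if "R k j" "R j m" for j k m
  proof -
    from that obtain i i' where i: "(?P i @ y k, y j) \<in> r" "(?P i' @ y j, y m) \<in> r" by (auto simp: R_def)
    have "(?P (i' + i) @ y k, y m) \<in> r"
      using trans[OF appL[OF i(1) setP] i(2)] by (simp only: word_power_add append_assoc)
    then show ?thesis by (auto simp: R_def)
  qed
  \<comment> \<open>The earliest position whose state lies in the orbit serves as base point of the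
    orbit.\<close>
  define m where "m k = Min {j. j \<le> l \<and> R k j}" for k
  have m: "m k \<le> l" "R k (m k)" if "k \<le> l" for k
  proof -
    have "m k \<in> {j. j \<le> l \<and> R k j}"
      unfolding m_def by (rule Min_in) (use that R_refl in auto)
    then show "m k \<le> l" "R k (m k)" by auto
  qed
  have m_cong: "m k = m j" if "R k j" for j k
  proof -
    have "{i. i \<le> l \<and> R k i} = {i. i \<le> l \<and> R j i}" using that R_sym R_trans by blast
    then show ?thesis by (simp add: m_def)
  qed
  \<comment> \<open>The label of a state is an exponent that carries the base point to it; by
    freeness it is well defined modulo c, and \<open>T_shift\<close> is its equivariance.\<close>
  define T where "T k = (SOME i. (?P i @ y (m k), y k) \<in> r)" for k
  have T: "(?P (T k) @ y (m k), y k) \<in> r" if "k \<le> l" for k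
    unfolding T_def by (rule someI_ex) (use R_sym[OF m(2)[OF that]] in \<open>simp add: R_def\<close>)
  have T_shift: "int c dvd int (T j) - int (T k) - int i" if "(?P i @ y k, y j) \<in> r" "k \<le> l" "j \<le> l" for i j k
  proof -
    have mjk: "m j = m k" using m_cong that(1) by (metis R_def)
    have "(?P i @ ?P (T k) @ y (m k), ?P i @ y k) \<in> r" by (rule appL[OF T[OF that(2)] setP])
    then have "(?P (i + T k) @ y (m k), y j) \<in> r" using trans[OF _ that(1)] by (simp only: word_power_add append_assoc)
    then have "(?P (T j) @ y (m k), ?P (i + T k) @ y (m k)) \<in> r"
      using T[OF that(3)] mjk trans sym by metis
    then have "int c dvd int (T j) - int (i + T k)" using free2 m(1)[OF that(2)] by blast
    then show ?thesis by (simp add: algebra_simps)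
  qed
  have yS: "y (Suc k) = y k @ [\<nu> ! k]" if "k < l" for k
    using that by (simp add: y_def l_def take_Suc_conv_app_nth)
  define D where "D k = int (T (Suc k)) - int (T k)" for k
  \<comment> \<open>The orbit of the k-th edge of the path: the orbit of its source together with
    its letter.\<close>
  define K where "K k = ({j. j \<le> l \<and> R k j}, \<nu> ! k)" for k
  have K_iff: "K k = K j \<longleftrightarrow> R k j \<and> \<nu> ! k = \<nu> ! j" if "k \<le> l" "j \<le> l" for j k
    using that R_refl R_sym R_trans unfolding K_def by blast
  have "int c dvd (\<Sum>k<l. D k)"
  proof (rule card_fibres_dvd_sum[where K = K])
    fix j k assume jk: "j \<in> {..<l}" "k \<in> {..<l}" "K j = K k"
    then obtain i where i: "(?P i @ y j, y k) \<in> r" "\<nu> ! j = \<nu> ! k" using K_iff[of j k] by (auto simp: R_def)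
    have "(?P i @ y (Suc j), y (Suc k)) \<in> r"
      using appR[OF i(1), of "[\<nu> ! k]"] jk(1,2) yS i(2) set\<nu>(1) by (simp add: l_def subset_eq)
    then have "int c dvd int (T (Suc k)) - int (T (Suc j)) - int i"
      by (rule T_shift) (use jk in auto)
    moreover have "int c dvd int (T k) - int (T j) - int i"
      by (rule T_shift[OF i(1)]) (use jk in auto)
    ultimately have "int c dvd (int (T k) - int (T j) - int i) - (int (T (Suc k)) - int (T (Suc j)) - int i)"
      by (rule dvd_diff[rotated])
    then show "int c dvd D j - D k" by (simp add: D_def algebra_simps)
  next
    fix j assume "j \<in> {..<l}"
    then have j: "j < l" by simp
    let ?C = "\<lambda>i. {k. k < l \<and> (\<eta> @ ?P i @ take k \<nu>, y j) \<in> r \<and> \<nu> ! k = \<nu> ! j}"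
    have \<eta>P: "(\<eta> @ ?P i @ take k \<nu>, ?P i @ y k) \<in> r" for i k
    proof -
      have "(\<eta> @ ?P i, ?P i @ \<eta>) \<in> r"
      proof (cases i)
        case (Suc i')
        then have "?P i = \<nu> @ ?P i'" by simp
        then have "(\<eta> @ ?P i, ?P i) \<in> r" using appR[OF \<eta>\<nu> setP[of i']] by simp
        then show ?thesis using trans[OF _ sym[OF P\<eta>[of i]]] Suc by blast
      qed (use refl[OF \<eta>] in simp)
      from appR[OF this take_A(1)[of k]] show ?thesis by (simp add: y_def)
    qed
    have C_iff: "k \<in> ?C i \<longleftrightarrow> k < l \<and> (?P i @ y k, y j) \<in> r \<and> \<nu> ! k = \<nu> ! j" for i k
      using trans[OF sym[OF \<eta>P[of i k]], of "y j"] trans[OF \<eta>P[of i k], of "y j"] by blast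
    \<comment> \<open>Exactly one power below c translates a given edge of the orbit onto the edge
      leaving \<open>y j\<close>, so the visits to the orbit add up to the sum that occurs in
      \<open>count\<close>.\<close>
    have "{k \<in> {..<l}. K k = K j} = (\<Union>i<c. ?C i)"
    proof (intro equalityI subsetI)
      fix k assume "k \<in> {k \<in> {..<l}. K k = K j}"
      then obtain i where k: "k < l" "(?P i @ y k, y j) \<in> r" "\<nu> ! k = \<nu> ! j"
        using K_iff[of k j] j by (auto simp: R_def)
      have "i = i mod c + c * (i div c)" by simp
      then have "?P i @ y k = ?P (i mod c) @ (?P (c * (i div c)) @ y k)" by (metis append_assoc word_power_add)
      then have "(?P (i mod c) @ y k, y j) \<in> r" using trans[OF sym[OF appL[OF pcy' setP]]] k(2) by metis
      then have "k \<in> ?C (i mod c)" using C_iff k by blast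
      moreover have "i mod c < c" using c by simp
      ultimately show "k \<in> (\<Union>i<c. ?C i)" by blast
    next
      fix k assume "k \<in> (\<Union>i<c. ?C i)"
      then obtain i where "k \<in> ?C i" by blast
      then show "k \<in> {k \<in> {..<l}. K k = K j}"
        using C_iff[of k i] K_iff[of k j] j by (auto simp: R_def)
    qed
    moreover have "card (\<Union>i<c. ?C i) = (\<Sum>i<c. card (?C i))"
    proof (rule card_UN_disjoint)
      show "\<forall>i\<in>{..<c}. \<forall>i'\<in>{..<c}. i \<noteq> i' \<longrightarrow> ?C i \<inter> ?C i' = {}"
      proof (intro ballI impI)
        fix i i' assume ii: "i \<in> {..<c}" "i' \<in> {..<c}" "i \<noteq> i'"
        show "?C i \<inter> ?C i' = {}"
        proof (rule ccontr)
          assume "?C i \<inter> ?C i' \<noteq> {}"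
          then obtain k where "k \<in> ?C i" "k \<in> ?C i'" by blast
          then have "(?P i @ y k, ?P i' @ y k) \<in> r" "k \<le> l"
            using C_iff trans[OF _ sym] by (blast, simp)
          then have "int c dvd int i - int i'" by (rule free2)
          then show False using ii zdvd_imp_le[of "int c" "\<bar>int i - int i'\<bar>"] by auto
        qed
      qed
    qed auto
    moreover have "c dvd (\<Sum>i<c. card (?C i))"
      using count[OF yw[of j], of "\<nu> ! j"] j set\<nu>(1) by (simp add: l_def subset_eq)
    ultimately have "c dvd card {k \<in> {..<l}. K k = K j}" by (simp only:)
    then show "int c dvd int (card {k \<in> {..<l}. K k = K j})" by (simp only: of_nat_dvd_iff)
  qed simp
  moreover have "(\<Sum>k<l. D k) = int (T l) - int (T 0)"
    unfolding D_def by (rule sum_lessThan_telescope)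
  \<comment> \<open>Reading \<nu> from \<eta> ends in the translate of the initial state by the
    first power of \<nu>.\<close>
  moreover have "int c dvd int (T l) - int (T 0) - int 1"
  proof (rule T_shift)
    have "(\<nu> @ \<eta>, \<eta> @ \<nu>) \<in> r" using \<nu>\<eta> \<eta>\<nu> trans sym by blast
    then show "(?P 1 @ y 0, y l) \<in> r" by (simp add: y_def l_def)
  qed auto
  ultimately have "int c dvd (int (T l) - int (T 0)) - (int (T l) - int (T 0) - int 1)"
    by (metis dvd_diff)
  then show False using c by simp
qed


text \<open>In the right Cayley graph of the quotient by \<open>r\<close>, the number of times the
  path with label \<open>w\<close> starting at \<open>x\<close> traverses the edge that leaves
  \<open>z\<close> with letter \<open>a\<close>.\<close>

definition edge_count :: "('a list \<times> 'a list) set \<Rightarrow> 'a list \<Rightarrow> 'a list \<Rightarrow> 'a \<Rightarrow> 'a list \<Rightarrow> nat" where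
  "edge_count r x z a w = card {k. k < length w \<and> (x @ take k w, z) \<in> r \<and> w ! k = a}"

lemma edge_count_append:
  "edge_count r x z a (u @ w) = edge_count r x z a u + edge_count r (x @ u) z a w"
proof -
  let ?Q = "\<lambda>k. (x @ take k (u @ w), z) \<in> r \<and> (u @ w) ! k = a"
  have "{k. k < length (u @ w) \<and> ?Q k} =
      {k. k < length u \<and> ?Q k} \<union> (\<lambda>k. length u + k) ` {k. k < length w \<and> ?Q (length u + k)}"
  proof (intro equalityI subsetI)
    fix k assume k: "k \<in> {k. k < length (u @ w) \<and> ?Q k}"
    show "k \<in> {k. k < length u \<and> ?Q k} \<union> (\<lambda>k. length u + k) ` {k. k < length w \<and> ?Q (length u + k)}"
    proof (cases "k < length u")
      case False
      then have "k = length u + (k - length u)" by simp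
      moreover have "k - length u \<in> {k. k < length w \<and> ?Q (length u + k)}" using k False by (auto simp: nth_append)
      ultimately show ?thesis by blast
    qed (use k in auto)
  qed auto
  moreover have "card (\<dots>) = card {k. k < length u \<and> ?Q k} + card ((\<lambda>k. length u + k) ` {k. k < length w \<and> ?Q (length u + k)})"
    by (rule card_Un_disjoint) auto
  moreover have "card ((\<lambda>k. length u + k) ` {k. k < length w \<and> ?Q (length u + k)}) = card {k. k < length w \<and> ?Q (length u + k)}"
    by (rule card_image) simp
  moreover have "{k. k < length u \<and> ?Q k} = {k. k < length u \<and> (x @ take k u, z) \<in> r \<and> u ! k = a}"
    by (auto simp: nth_append)
  moreover have "{k. k < length w \<and> ?Q (length u + k)} = {k. k < length w \<and> ((x @ u) @ take k w, z) \<in> r \<and> w ! k = a}"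
    by auto
  ultimately show ?thesis by (simp only: edge_count_def)
qed

lemma edge_count_cong:
  assumes r: "r \<in> finite_congruences A" and x: "(x, x') \<in> r" and z: "(z, z') \<in> r" and w: "set w \<subseteq> A"
  shows "edge_count r x z a w = edge_count r x' z' a w"
proof -
  note eq = finite_congruencesD(1)[OF r]
  have "(x @ take k w, z) \<in> r \<longleftrightarrow> (x' @ take k w, z') \<in> r" for k
  proof -
    have "(x @ take k w, x' @ take k w) \<in> r"
    proof (cases "take k w = []")
      case True
      then show ?thesis using x by (metis append_Nil2)
    next
      case False
      then have "take k w \<in> words A" using w set_take_subset[of k w] by (auto simp: words_def)
      then show ?thesis using finite_congruencesD(3)[OF r x] by blast
    qed
    then show ?thesis using z eq by (meson equivE symE transE)
  qed
  then show ?thesis by (simp add: edge_count_def)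
qed

text \<open>Counts add up along a product, with the second path starting where the first one ends,
  and they depend only on the classes of \<open>x\<close> and \<open>z\<close>. Recording all of
  them modulo \<open>c\<close> is thus a finite-valued invariant.\<close>

lemma edge_count_congruence:
  assumes r: "r \<in> finite_congruences A" and A: "finite A" and c: "(c::nat) > 0"
  shows "\<exists>s\<in>finite_congruences A. s \<subseteq> r \<and> (\<forall>u v x z a. (u, v) \<in> s \<longrightarrow> x \<in> words A \<longrightarrow> z \<in> words A \<longrightarrow> a \<in> A \<longrightarrow>
    edge_count r x z a u mod c = edge_count r x z a v mod c)"
proof -
  note eq = finite_congruencesD(1)[OF r]
  define G where "G w = {(r `` {x}, r `` {z}, a, edge_count r x z a w mod c) | x z a. x \<in> words A \<and> z \<in> words A \<and> a \<in> A}" for w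
  define F where "F w = (r `` {w}, G w)" for w
  have GD: "edge_count r x z a u mod c = edge_count r x z a v mod c"
    if "G u = G v" "x \<in> words A" "z \<in> words A" "a \<in> A" "v \<in> words A" for u v x z a
  proof -
    have "(r `` {x}, r `` {z}, a, edge_count r x z a u mod c) \<in> G v"
      using that unfolding that(1)[symmetric] G_def by blast
    then obtain x' z' where *: "r `` {x} = r `` {x'}" "r `` {z} = r `` {z'}" "x' \<in> words A" "z' \<in> words A"
      "edge_count r x z a u mod c = edge_count r x' z' a v mod c" unfolding G_def by blast
    then have "(x', x) \<in> r" "(z', z) \<in> r" using eq_equiv_class_iff[OF eq] that(2,3) by metis+
    then show ?thesis using *(5) edge_count_cong[OF r] that(5) by (metis mem_Collect_eq words_def)
  qed
  have GI: "G u = G v" if "\<And>x z a. x \<in> words A \<Longrightarrow> z \<in> words A \<Longrightarrow> a \<in> A \<Longrightarrow>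
      edge_count r x z a u mod c = edge_count r x z a v mod c" for u v
    unfolding G_def by (intro Collect_cong) (metis that)
  define s where "s = {(u, v). u \<in> words A \<and> v \<in> words A \<and> F u = F v}"
  have "s \<in> finite_congruences A"
    unfolding s_def
  proof (rule finite_congruence_kernel)
    have "F ` words A \<subseteq> (words A // r) \<times> Pow ((words A // r) \<times> (words A // r) \<times> A \<times> {..<c})"
      using c by (auto simp: F_def G_def quotientI)
    then show "finite (F ` words A)"
      by (rule finite_subset) (use finite_congruencesD(2)[OF r] A in auto)
  next
    fix u v w assume *: "u \<in> words A" "v \<in> words A" "w \<in> words A" "F u = F v"
    then have Gu: "G u = G v" and uv: "(u, v) \<in> r" using eq_equiv_class_iff[OF eq] by (auto simp: F_def)
    have wA: "set w \<subseteq> A" using *(3) by (simp add: words_def)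
    have "G (u @ w) = G (v @ w)"
    proof (rule GI)
      fix x z a assume xz: "x \<in> words A" "z \<in> words A" "a \<in> A"
      have "(z, z) \<in> r" using xz(2) eq by (simp add: equiv_def refl_on_def)
      then have "edge_count r (x @ u) z a w = edge_count r (x @ v) z a w"
        using edge_count_cong[OF r finite_congruencesD(4)[OF r uv xz(1)] _ wA] by blast
      moreover have "edge_count r x z a u mod c = edge_count r x z a v mod c" by (rule GD[OF Gu xz *(2)])
      ultimately show "edge_count r x z a (u @ w) mod c = edge_count r x z a (v @ w) mod c"
        unfolding edge_count_append by (metis mod_add_left_eq)
    qed
    moreover have "r `` {u @ w} = r `` {v @ w}"
      using finite_congruencesD(3)[OF r uv *(3)] by (rule equiv_class_eq[OF eq])
    ultimately show "F (u @ w) = F (v @ w)" by (simp add: F_def)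
    have "G (w @ u) = G (w @ v)"
    proof (rule GI)
      fix x z a assume xz: "x \<in> words A" "z \<in> words A" "a \<in> A"
      have "edge_count r (x @ w) z a u mod c = edge_count r (x @ w) z a v mod c"
        by (rule GD[OF Gu words_append[OF xz(1) *(3)] xz(2,3) *(2)])
      then show "edge_count r x z a (w @ u) mod c = edge_count r x z a (w @ v) mod c"
        unfolding edge_count_append by (metis mod_add_right_eq)
    qed
    moreover have "r `` {w @ u} = r `` {w @ v}"
      using finite_congruencesD(4)[OF r uv *(3)] by (rule equiv_class_eq[OF eq])
    ultimately show "F (w @ u) = F (w @ v)" by (simp add: F_def)
  qed
  moreover have "s \<subseteq> r" using eq_equiv_class_iff[OF eq] by (auto simp: s_def F_def)
  moreover have "edge_count r x z a u mod c = edge_count r x z a v mod c"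
    if "(u, v) \<in> s" "x \<in> words A" "z \<in> words A" "a \<in> A" for u v x z a
    using that GD[of u v x z a] by (auto simp: s_def F_def)
  ultimately show ?thesis by blast
qed

text \<open>The index is shifted: \<open>profinite_power A v n\<close> is \<open>v\<^sup>n\<^sup>+\<^sup>1\<close>.\<close>

primrec profinite_power :: "'a set \<Rightarrow> 'a pseudoword \<Rightarrow> nat \<Rightarrow> 'a pseudoword" where
  "profinite_power A v 0 = v"
| "profinite_power A v (Suc n) = profinite_power A v n \<odot>\<^bsub>A\<^esub> v"

lemma profinite_power_closed: "v \<in> free_profinite A \<Longrightarrow> profinite_power A v n \<in> free_profinite A"
  by (induction n) (simp_all add: profinite_mult_closed)

lemma profinite_power_rep:
  assumes r: "r \<in> finite_congruences A" and v: "v \<in> free_profinite A" and "\<nu> \<in> v r"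
  shows "word_power \<nu> (Suc n) \<in> profinite_power A v n r"
proof (induction n)
  case (Suc n)
  have "word_power \<nu> (Suc (Suc n)) = word_power \<nu> (Suc n) @ \<nu>"
    using word_power_commute[of "Suc n" \<nu>] by simp
  then show ?case
    using profinite_mult_rep[OF r profinite_power_closed[OF v] v Suc assms(3)] by (simp only: profinite_power.simps)
qed (use assms in simp)

text \<open>If v had order c > 1, some congruence would keep the order, and a refinement of it would
  also see all edge counts modulo c. Since e = e e these counts vanish for e, hence for v^c = e,
  which \<open>no_cyclic_count\<close> forbids.\<close>

theorem free_profinite_torsion_free:
  assumes A: "finite A" and e: "e \<in> free_profinite A" and v: "v \<in> free_profinite A"
    and ee: "e \<odot>\<^bsub>A\<^esub> e = e" and ev: "e \<odot>\<^bsub>A\<^esub> v = v" and ve: "v \<odot>\<^bsub>A\<^esub> e = v"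
    and pow: "profinite_power A v n = e"
  shows "v = e"
proof (rule ccontr)
  assume "v \<noteq> e"
  define m where "m = (LEAST n. profinite_power A v n = e)"
  have m: "profinite_power A v m = e" unfolding m_def using pow by (rule LeastI)
  have least: "profinite_power A v i \<noteq> e" if "i < m" for i
    using not_less_Least that unfolding m_def by blast
  have "m \<noteq> 0" using m \<open>v \<noteq> e\<close> by (cases m) auto
  \<comment> \<open>With the shifted index of \<open>profinite_power\<close>, the order of
    \<open>v\<close> is \<open>Suc m\<close>.\<close>
  define c where "c = Suc m"
  have c: "c \<ge> 2" using \<open>m \<noteq> 0\<close> by (simp add: c_def)
  have "\<exists>r\<in>finite_congruences A. profinite_power A v i r \<noteq> e r" if "i < m" for i
    using least[OF that] free_profinite_eqI[OF profinite_power_closed[OF v] e] by blast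
  then obtain q where q: "\<And>i. i < m \<Longrightarrow> q i \<in> finite_congruences A \<and> profinite_power A v i (q i) \<noteq> e (q i)"
    by metis
  \<comment> \<open>Fine enough to separate all smaller powers of \<open>v\<close> from
    \<open>e\<close>, so that the order does not drop modulo \<open>r\<close>.\<close>
  obtain r where r: "r \<in> finite_congruences A" "\<forall>s\<in>q ` {..<m}. r \<subseteq> s"
    using finite_congruences_Inter[of "q ` {..<m}" A] q by auto
  obtain s where s: "s \<in> finite_congruences A" "s \<subseteq> r"
    "\<And>u v x z a. (u, v) \<in> s \<Longrightarrow> x \<in> words A \<Longrightarrow> z \<in> words A \<Longrightarrow> a \<in> A \<Longrightarrow>
      edge_count r x z a u mod c = edge_count r x z a v mod c"
    using edge_count_congruence[OF r(1) A, of c] c by fastforce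
  obtain \<eta> where \<eta>: "\<eta> \<in> words A" "\<eta> \<in> e s" by (rule free_profinite_ex_rep[OF e s(1)])
  obtain \<nu> where \<nu>: "\<nu> \<in> words A" "\<nu> \<in> v s" by (rule free_profinite_ex_rep[OF v s(1)])
  have \<eta>r: "\<eta> \<in> e r" and \<nu>r: "\<nu> \<in> v r"
    using \<eta> \<nu> free_profinite_mono[OF e s(1) r(1) s(2)] free_profinite_mono[OF v s(1) r(1) s(2)] by blast+
  have pc: "(word_power \<nu> c, \<eta>) \<in> s"
    using profinite_power_rep[OF s(1) v \<nu>(2), of m] free_profinite_rep_iff[OF e s(1)] \<eta>(2)
    unfolding m c_def by blast
  have \<eta>\<eta>: "(\<eta> @ \<eta>, \<eta>) \<in> s"
    using profinite_mult_rep[OF s(1) e e \<eta>(2) \<eta>(2)] free_profinite_rep_iff[OF e s(1)] \<eta>(2) unfolding ee by blast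
  show False
  proof (rule no_cyclic_count[OF r(1) \<eta>(1) \<nu>(1) c])
    show "(\<eta> @ \<eta>, \<eta>) \<in> r" "(word_power \<nu> c, \<eta>) \<in> r" using \<eta>\<eta> pc s(2) by blast+
    show "(\<eta> @ \<nu>, \<nu>) \<in> r"
      using profinite_mult_rep[OF r(1) e v \<eta>r \<nu>r] free_profinite_rep_iff[OF v r(1)] \<nu>r unfolding ev by blast
    show "(\<nu> @ \<eta>, \<nu>) \<in> r"
      using profinite_mult_rep[OF r(1) v e \<nu>r \<eta>r] free_profinite_rep_iff[OF v r(1)] \<nu>r unfolding ve by blast
  next
    fix i assume i: "0 < i" "i < c"
    then obtain j where j: "i = Suc j" "j < m" by (cases i) (auto simp: c_def)
    show "(word_power \<nu> i, \<eta>) \<notin> r"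
    proof
      assume *: "(word_power \<nu> i, \<eta>) \<in> r"
      have mem: "word_power \<nu> i \<in> profinite_power A v j r"
        using profinite_power_rep[OF r(1) v \<nu>r, of j] unfolding j(1) .
      note pj = profinite_power_closed[OF v, of j]
      have "\<eta> \<in> profinite_power A v j r" using free_profinite_rep_iff[OF pj r(1) mem] * by (rule iffD2)
      then have "profinite_power A v j r = e r" using \<eta>r by (rule free_profinite_eq_at[OF pj e r(1)])
      moreover have "r \<subseteq> q j" using r(2) j(2) by blast
      ultimately have "profinite_power A v j (q j) = e (q j)"
        using free_profinite_eq_mono[OF pj e conjunct1[OF q[OF j(2)]] r(1)] by blast
      then show False using conjunct2[OF q[OF j(2)]] by contradiction
    qed
  next
    fix z a assume za: "z \<in> words A" "a \<in> A"
    let ?E = "\<lambda>x w. edge_count r x z a w"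
    have sum: "?E \<eta> (word_power \<nu> k) = (\<Sum>i<k. ?E (\<eta> @ word_power \<nu> i) \<nu>)" for k
    proof (induction k)
      case (Suc k)
      have "word_power \<nu> (Suc k) = word_power \<nu> k @ \<nu>" using word_power_commute[of k \<nu>] by simp
      then show ?case using Suc by (simp add: edge_count_append del: replicate_Suc)
    qed (simp add: edge_count_def)
    have "(z, z) \<in> r" using za(1) finite_congruencesD(1)[OF r(1)] by (simp add: equiv_def refl_on_def)
    moreover have "(\<eta> @ \<eta>, \<eta>) \<in> r" using \<eta>\<eta> s(2) by blast
    ultimately have "?E (\<eta> @ \<eta>) \<eta> = ?E \<eta> \<eta>"
      using edge_count_cong[OF r(1)] \<eta>(1) by (auto simp: words_def)
    \<comment> \<open>Started at the idempotent class of \<eta>, the second copy of \<eta> traverses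
      the same edges as the first, so its counts double. They are also unchanged modulo c, hence
      vanish.\<close>
    then have "?E \<eta> (\<eta> @ \<eta>) = ?E \<eta> \<eta> + ?E \<eta> \<eta>" by (simp add: edge_count_append)
    then have "(?E \<eta> \<eta> + ?E \<eta> \<eta>) mod c = ?E \<eta> \<eta> mod c" using s(3)[OF \<eta>\<eta> \<eta>(1) za] by simp
    then have "c dvd ?E \<eta> \<eta>" by (metis add_diff_cancel_left' mod_eq_dvd_iff_nat le_add1)
    then have "c dvd ?E \<eta> (word_power \<nu> c)" using s(3)[OF pc \<eta>(1) za] by (simp add: dvd_eq_mod_eq_0)
    then show "c dvd (\<Sum>i<c. card {k. k < length \<nu> \<and> (\<eta> @ word_power \<nu> i @ take k \<nu>, z) \<in> r \<and> \<nu> ! k = a})"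
      unfolding sum by (simp add: edge_count_def)
  qed
qed


section \<open>Infinite pseudowords\<close>

lemma stable_semigroup_free_profinite: "stable_semigroup (free_profinite A) (profinite_mult A)"
  by unfold_locales (fact profinite_mult_closed profinite_mult_assoc stable_right stable_left)+

interpretation fp: stable_semigroup "free_profinite A" "profinite_mult A" for A :: "'a set"
  by (rule stable_semigroup_free_profinite)

text \<open>Its classes fix the first and the last \<open>M\<close> letters. It serves to recognize
  infinite pseudowords and to compare the ends of approximations.\<close>

definition ps_congruence :: "'a set \<Rightarrow> nat \<Rightarrow> ('a list \<times> 'a list) set" where
  "ps_congruence A M = {(u, v). u \<in> words A \<and> v \<in> words A \<and> (take M u, take M (rev u)) = (take M v, take M (rev v))}"

lemma ps_congruence: "finite A \<Longrightarrow> ps_congruence A M \<in> finite_congruences A"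
  unfolding ps_congruence_def by (rule prefix_suffix_congruence)

text \<open>Testing only the congruences that see lengths means that a single long representative
  for each \<open>M\<close> is enough (\<open>infinite_pwI\<close>).\<close>

definition infinite_pw :: "'a set \<Rightarrow> 'a pseudoword \<Rightarrow> bool" where
  "infinite_pw A x \<longleftrightarrow> (\<forall>M. \<forall>w\<in>x (ps_congruence A M). M \<le> length w)"

lemma ps_congruence_length:
  assumes "(u, v) \<in> ps_congruence A M" "M \<le> length u"
  shows "M \<le> length v"
proof -
  have "take M u = take M v" using assms(1) by (simp add: ps_congruence_def)
  then have "min (length u) M = min (length v) M" using length_take by metis
  then show ?thesis using assms(2) by simp
qed

lemma infinite_pwI:
  assumes A: "finite A" and x: "x \<in> free_profinite A" and "\<And>M. \<exists>w\<in>x (ps_congruence A M). M \<le> length w"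
  shows "infinite_pw A x"
  unfolding infinite_pw_def
  using assms(3) free_profinite_rep_iff[OF x ps_congruence[OF A]] ps_congruence_length by blast

text \<open>Turns the set difference in the definition of the J-class into a property that is
  preserved by multiplication.\<close>

lemma clo_infinite_iff:
  assumes A: "finite A" and L: "L \<subseteq> words A" and x: "x \<in> clo A L"
  shows "x \<notin> pseudoword_of A ` L \<longleftrightarrow> infinite_pw A x"
proof
  assume "x \<notin> pseudoword_of A ` L"
  then have "\<exists>w\<in>x (ps_congruence A M). M \<le> length w" for M
    using clo_not_word[OF x _ L A ps_congruence[OF A]] by blast
  then show "infinite_pw A x" by (rule infinite_pwI[OF A clo_closed[OF x]])
next
  assume inf: "infinite_pw A x"
  show "x \<notin> pseudoword_of A ` L"
  proof
    assume "x \<in> pseudoword_of A ` L"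
    then obtain w where w: "w \<in> L" "x = pseudoword_of A w" by blast
    then have "w \<in> x (ps_congruence A (Suc (length w)))"
      using pseudoword_of_self[OF ps_congruence[OF A]] L by blast
    then show False using inf unfolding infinite_pw_def by fastforce
  qed
qed

lemma infinite_pw_mult:
  assumes A: "finite A" and x: "x \<in> free_profinite A" and y: "y \<in> free_profinite A" and "infinite_pw A x"
  shows "infinite_pw A (x \<odot>\<^bsub>A\<^esub> y)"
proof (rule infinite_pwI[OF A profinite_mult_closed[OF x y]])
  fix M
  note p = ps_congruence[OF A, of M]
  obtain u where u: "u \<in> x (ps_congruence A M)" by (rule free_profinite_ex_rep[OF x p])
  obtain v where v: "v \<in> y (ps_congruence A M)" by (rule free_profinite_ex_rep[OF y p])
  have "M \<le> length (u @ v)" using u assms(4) by (fastforce simp: infinite_pw_def)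
  then show "\<exists>w\<in>(x \<odot>\<^bsub>A\<^esub> y) (ps_congruence A M). M \<le> length w"
    using profinite_mult_rep[OF p x y u v] by blast
qed

text \<open>An idempotent equals all its powers, and a power of a representative can be made
  arbitrarily long.\<close>

lemma idempotent_infinite_pw:
  assumes A: "finite A" and e: "e \<in> free_profinite A" and ee: "e \<odot>\<^bsub>A\<^esub> e = e"
  shows "infinite_pw A e"
proof (rule infinite_pwI[OF A e])
  fix M
  note p = ps_congruence[OF A, of M]
  obtain u where u: "u \<in> words A" "u \<in> e (ps_congruence A M)" by (rule free_profinite_ex_rep[OF e p])
  have "profinite_power A e M = e" by (induction M) (simp_all add: ee)
  then have mem: "word_power u (Suc M) \<in> e (ps_congruence A M)"
    using profinite_power_rep[OF p e u(2), of M] by simp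
  have "M \<le> length (word_power u (Suc M))"
  proof -
    have "length (word_power u k) = k * length u" for k by (induction k) auto
    moreover have "length u \<ge> 1" using u(1) by (cases u) (auto simp: words_def)
    ultimately show ?thesis by (metis Suc_leD le_trans mult_le_mono2 mult.right_neutral order_refl lessI less_imp_le)
  qed
  then show "\<exists>w\<in>e (ps_congruence A M). M \<le> length w" using mem by blast
qed


section \<open>Limits along fine congruences\<close>

text \<open>Along such a filter, words chosen in the classes \<open>x (fst i)\<close> converge to
  \<open>x\<close> (\<open>wlim_of_reps\<close>), while \<open>snd i\<close> is free to control
  lengths or levels.\<close>

definition fine_filter :: "'a set \<Rightarrow> (('a list \<times> 'a list) set \<times> nat) filter \<Rightarrow> bool" where
  "fine_filter A U \<longleftrightarrow> ultra U \<and>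
    (\<forall>r\<in>finite_congruences A. eventually (\<lambda>i. fst i \<in> finite_congruences A \<and> fst i \<subseteq> r) U) \<and>
    (\<forall>n. eventually (\<lambda>i. n \<le> snd i) U)"

lemma fine_filter_exists: "\<exists>U. fine_filter A U"
  unfolding fine_filter_def by (rule ultra_congruences)

lemma fine_filterD:
  assumes "fine_filter A U"
  shows "ultra U" "U \<noteq> bot" "r \<in> finite_congruences A \<Longrightarrow> eventually (\<lambda>i. fst i \<in> finite_congruences A \<and> fst i \<subseteq> r) U"
    "eventually (\<lambda>i. fst i \<in> finite_congruences A) U" "eventually (\<lambda>i. n \<le> snd i) U"
proof -
  show 1: "eventually (\<lambda>i. fst i \<in> finite_congruences A \<and> fst i \<subseteq> r) U" if "r \<in> finite_congruences A" for r
    using assms that by (simp add: fine_filter_def)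
  show "eventually (\<lambda>i. fst i \<in> finite_congruences A) U"
    using 1[OF finite_congruences_top] by eventually_elim simp
qed (use assms in \<open>auto simp: fine_filter_def dest: ultra_nonbot\<close>)

abbreviation wlim :: "'i filter \<Rightarrow> 'a set \<Rightarrow> ('i \<Rightarrow> 'a list) \<Rightarrow> 'a pseudoword \<Rightarrow> bool" where
  "wlim U A w x \<equiv> plim U A (\<lambda>i. pseudoword_of A (w i)) x"

lemma wlim_exists:
  assumes "ultra U" "eventually (\<lambda>i. w i \<in> words A) U"
  shows "\<exists>x. wlim U A w x"
proof (rule plim_exists[OF assms(1)])
  show "eventually (\<lambda>i. pseudoword_of A (w i) \<in> free_profinite A) U"
    using assms(2) by eventually_elim (rule pseudoword_of_closed)
qed

lemma wlim_of_reps: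
  assumes U: "fine_filter A U" and x: "x \<in> free_profinite A"
    and w: "eventually (\<lambda>i. w i \<in> x (fst i)) U"
  shows "wlim U A w x"
proof -
  have "eventually (\<lambda>i. w i \<in> words A) U"
    using w fine_filterD(4)[OF U] by eventually_elim (use free_profinite_rep(1)[OF x] in blast)
  moreover have "eventually (\<lambda>i. w i \<in> x r) U" if r: "r \<in> finite_congruences A" for r
    using w fine_filterD(3)[OF U r] by eventually_elim (use free_profinite_mono[OF x _ r] in blast)
  ultimately show ?thesis by (simp add: plim_words_iff[OF x])
qed

lemma wlim_append:
  assumes U: "U \<noteq> bot" and "wlim U A u x" "wlim U A v y" "wlim U A w z"
    and "eventually (\<lambda>i. u i \<in> words A) U" "eventually (\<lambda>i. v i \<in> words A) U"
    and "eventually (\<lambda>i. w i = u i @ v i) U"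
  shows "z = x \<odot>\<^bsub>A\<^esub> y"
proof (rule plim_unique[OF U assms(4)])
  have "eventually (\<lambda>i. pseudoword_of A (u i) \<odot>\<^bsub>A\<^esub> pseudoword_of A (v i) = pseudoword_of A (w i)) U"
    using assms(5-7) by eventually_elim (simp add: pseudoword_of_append)
  then show "wlim U A w (x \<odot>\<^bsub>A\<^esub> y)"
    using plim_mult[OF assms(2,3)] by (rule plim_cong)
qed

lemma wlim_clo:
  assumes U: "U \<noteq> bot" and "wlim U A w x" and "eventually (\<lambda>i. w i \<in> L) U" "L \<subseteq> words A"
  shows "x \<in> clo A L"
proof (rule clo_plim[OF U _ assms(2)])
  show "eventually (\<lambda>i. pseudoword_of A (w i) \<in> clo A L) U"
    using assms(3) by eventually_elim (rule pseudoword_of_clo[OF assms(4)])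
qed


section \<open>Languages of primitive directive sequences\<close>

lemma ultra_nat_exists: "\<exists>U :: nat filter. ultra U \<and> (\<forall>n. eventually (\<lambda>i. n \<le> i) U)"
proof -
  obtain U :: "nat filter" where "U \<le> sequentially" "ultra U"
    using ultra_exists[OF sequentially_bot] by blast
  then show ?thesis by (meson eventually_ge_at_top filter_leD)
qed

lemma comp_hom_same [simp]: "comp_hom \<sigma> n n = id"
  by (simp add: comp_hom_def)

lemma foldr_comp_append: "foldr (\<circ>) (xs @ ys) id = foldr (\<circ>) xs id \<circ> foldr (\<circ>) ys id"
  by (induction xs) (auto simp: o_assoc)

lemma comp_hom_split:
  assumes "n \<le> m" "m \<le> k"
  shows "comp_hom \<sigma> n k = comp_hom \<sigma> n m \<circ> comp_hom \<sigma> m k"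
proof -
  have "[n..<k] = [n..<m] @ [m..<k]" using assms by (metis le_add_diff_inverse upt_add_eq_append)
  then show ?thesis by (simp only: comp_hom_def map_append foldr_comp_append)
qed

lemma comp_hom_step [simp]: "comp_hom \<sigma> n (Suc n) = \<sigma> n"
  by (simp add: comp_hom_def)

lemma comp_hom_shift: "comp_hom (\<lambda>i. \<sigma> (i + d)) n m = comp_hom \<sigma> (n + d) (m + d)"
proof -
  have "map (\<lambda>i. \<sigma> (i + d)) [n..<m] = map \<sigma> [n + d..<m + d]"
    by (rule nth_equalityI) (auto simp: add_ac)
  then show ?thesis by (simp only: comp_hom_def)
qed

text \<open>The language of the sequence shifted by \<open>n\<close>, expressed with the levels of
  the original sequence so that words of different levels can be compared without
  reindexing.\<close>

definition level_language :: "(nat \<Rightarrow> 'a set) \<Rightarrow> (nat \<Rightarrow> 'a list \<Rightarrow> 'a list) \<Rightarrow> nat \<Rightarrow> 'a list set" where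
  "level_language A \<sigma> n = {w. \<exists>m\<ge>n. \<exists>a\<in>A m. w \<in> factors (comp_hom \<sigma> n m [a])}"

lemma seq_language_shift: "seq_language (\<lambda>i. A (i + n)) (\<lambda>i. \<sigma> (i + n)) = level_language A \<sigma> n"
proof (intro equalityI subsetI)
  fix w assume "w \<in> seq_language (\<lambda>i. A (i + n)) (\<lambda>i. \<sigma> (i + n))"
  then obtain m a where "a \<in> A (m + n)" "w \<in> factors (comp_hom \<sigma> n (m + n) [a])"
    by (auto simp: seq_language_def comp_hom_shift)
  then show "w \<in> level_language A \<sigma> n" unfolding level_language_def by (blast intro: le_add2)
next
  fix w assume "w \<in> level_language A \<sigma> n"
  then obtain m a where m: "n \<le> m" "a \<in> A m" "w \<in> factors (comp_hom \<sigma> n m [a])"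
    by (auto simp: level_language_def)
  then obtain d where "m = d + n" by (metis le_add_diff_inverse2)
  then show "w \<in> seq_language (\<lambda>i. A (i + n)) (\<lambda>i. \<sigma> (i + n))"
    using m by (auto simp: seq_language_def comp_hom_shift)
qed

text \<open>At most \<open>M\<close> letters at the left end of \<open>w\<close> belong to a block
  that begins before it; at least \<open>M\<close> letters then remain, enough for the next
  block.\<close>

lemma block_in_factor:
  assumes "x @ w @ y = letterwise \<phi> v" and "\<And>b. b \<in> set v \<Longrightarrow> length (\<phi> [b]) \<le> M"
    and "2 * M \<le> length w" "0 < M"
  shows "\<exists>b\<in>set v. \<exists>s t. w = s @ \<phi> [b] @ t"
  using assms(1,2)
proof (induction v arbitrary: x)
  case Nil
  then show ?case using assms(3,4) by auto
next
  case (Cons b v)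
  show ?case
  proof (cases "length (\<phi> [b]) \<le> length x")
    case True
    then obtain x0 where "x = \<phi> [b] @ x0"
      using Cons.prems(1) by (metis append_eq_append_conv_if append_take_drop_id letterwise_simps(2))
    then have "x0 @ w @ y = letterwise \<phi> v" using Cons.prems(1) by simp
    then show ?thesis using Cons.IH[of x0] Cons.prems(2) by auto
  next
    case False
    then have "x = take (length x) (\<phi> [b])"
      using Cons.prems(1) by (metis append_eq_append_conv_if letterwise_simps(2) nat_le_linear)
    then obtain z where z: "\<phi> [b] = x @ z" by (metis append_take_drop_id)
    then have wy: "w @ y = z @ letterwise \<phi> v" using Cons.prems(1) by simp
    have zM: "length z \<le> M" using z Cons.prems(2)[of b] by simp
    then have "w = z @ drop (length z) w"
      using wy assms(3) by (metis append_eq_append_conv_if append_take_drop_id le_trans mult_2 le_add1)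
    then obtain w' where w': "w = z @ w'" by blast
    then have w'y: "w' @ y = letterwise \<phi> v" using wy by simp
    have "M \<le> length w'" using w' zM assms(3) by simp
    then obtain b' v' where v: "v = b' # v'" using w'y assms(4) by (cases v) auto
    then have "length (\<phi> [b']) \<le> length w'" using Cons.prems(2)[of b'] \<open>M \<le> length w'\<close> by simp
    then have "w' = \<phi> [b'] @ drop (length (\<phi> [b'])) w'"
      using w'y v by (metis append_eq_append_conv_if append_take_drop_id letterwise_simps(2))
    then show ?thesis using v w' by (metis list.set_intros)
  qed
qed

lemma letterwise_split_letter:
  assumes "b \<in> set v"
  obtains s t where "letterwise \<phi> v = letterwise \<phi> s @ \<phi> [b] @ letterwise \<phi> t" "v = s @ b # t"
  using assms by (auto simp: in_set_conv_decomp)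

locale primitive_directive =
  fixes A :: "nat \<Rightarrow> 'a set" and \<sigma> :: "nat \<Rightarrow> 'a list \<Rightarrow> 'a list"
  assumes directive: "directive_sequence A \<sigma>" and primitive: "primitive_seq A \<sigma>"
begin

abbreviation "L \<equiv> level_language A \<sigma>"
abbreviation "\<Sigma> \<equiv> comp_hom \<sigma>"
abbreviation "E n m \<equiv> profinite_extension (A m) (A n) (comp_hom \<sigma> n m)"

lemma finite_alphabet: "finite (A n)" and alphabet_nonempty: "A n \<noteq> {}"
  and step_hom: "word_hom (A (Suc n)) (A n) (\<sigma> n)"
  using directive by (auto simp: directive_sequence_def)

lemma comp_hom_hom: "n \<le> m \<Longrightarrow> word_hom (A m) (A n) (\<Sigma> n m)"
proof (induction m rule: dec_induct)
  case base
  then show ?case by (auto simp: word_hom_def)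
next
  case (step m)
  have "\<Sigma> n (Suc m) = \<Sigma> n m \<circ> \<sigma> m" using comp_hom_split[of n m "Suc m" \<sigma>] step by simp
  show ?case unfolding \<open>\<Sigma> n (Suc m) = \<Sigma> n m \<circ> \<sigma> m\<close> by (rule word_hom_comp[OF step_hom step.IH])
qed

lemma comp_hom_letterwise:
  assumes "n \<le> m" "w \<in> words (A m)"
  shows "\<Sigma> n m w = letterwise (\<Sigma> n m) w"
  using word_hom_letterwise[OF comp_hom_hom[OF assms(1)] assms(2)] .

lemma comp_hom_word: "n \<le> m \<Longrightarrow> w \<in> words (A m) \<Longrightarrow> \<Sigma> n m w \<in> words (A n)"
  by (rule word_homD(1)[OF comp_hom_hom])

lemma letter_word: "a \<in> A m \<Longrightarrow> [a] \<in> words (A m)"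
  by (simp add: words_def)

lemma comp_hom_letter_split:
  assumes "n \<le> m" "m \<le> k" "a \<in> A k"
  shows "\<Sigma> n k [a] = letterwise (\<Sigma> n m) (\<Sigma> m k [a])" "\<Sigma> m k [a] \<in> words (A m)"
proof -
  show w: "\<Sigma> m k [a] \<in> words (A m)" by (rule comp_hom_word[OF assms(2) letter_word[OF assms(3)]])
  show "\<Sigma> n k [a] = letterwise (\<Sigma> n m) (\<Sigma> m k [a])"
    using comp_hom_letterwise[OF assms(1) w] comp_hom_split[OF assms(1,2), of \<sigma>] by simp
qed

lemma L_words: "L n \<subseteq> words (A n)"
proof
  fix w assume "w \<in> L n"
  then obtain m a where "n \<le> m" "a \<in> A m" "w \<noteq> []" "sublist w (\<Sigma> n m [a])"
    by (auto simp: level_language_def factors_def)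
  then show "w \<in> words (A n)"
    using comp_hom_word[OF _ letter_word, of n m a] set_mono_sublist unfolding words_def by blast
qed

lemma L_I: "n \<le> m \<Longrightarrow> a \<in> A m \<Longrightarrow> \<Sigma> n m [a] = x @ u @ y \<Longrightarrow> u \<noteq> [] \<Longrightarrow> u \<in> L n"
  by (auto simp: level_language_def factors_def sublist_def)

lemma L_E:
  assumes "u \<in> L n"
  obtains m a x y where "n \<le> m" "a \<in> A m" "\<Sigma> n m [a] = x @ u @ y" "u \<noteq> []"
  using assms by (auto simp: level_language_def factors_def sublist_def)

lemma L_factor:
  assumes "x @ u @ y \<in> L n" "u \<noteq> []"
  shows "u \<in> L n"
proof -
  obtain m a x' y' where "n \<le> m" "a \<in> A m" "\<Sigma> n m [a] = x' @ (x @ u @ y) @ y'" using L_E[OF assms(1)] by metis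
  then show ?thesis using L_I[of n m a "x' @ x" u "y @ y'"] assms(2) by simp
qed

text \<open>Primitivity provides a single positive composition; it stays positive at all later
  levels, because the image of a letter at the positive level is nonempty.\<close>

lemma positive_from:
  "\<exists>m>n. \<forall>k\<ge>m. \<forall>a\<in>A k. \<forall>b\<in>A n. b \<in> set (\<Sigma> n k [a])"
proof -
  obtain m where m: "n < m" "positive_hom (A m) (A n) (\<Sigma> n m)"
    using primitive by (auto simp: primitive_seq_def)
  have "b \<in> set (\<Sigma> n k [a])" if k: "m \<le> k" "a \<in> A k" "b \<in> A n" for k a b
  proof -
    note s = comp_hom_letter_split[OF less_imp_le[OF m(1)] k(1,2)]
    obtain c where c: "c \<in> set (\<Sigma> m k [a])" "c \<in> A m" using s(2) by (cases "\<Sigma> m k [a]") (auto simp: words_def)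
    obtain x y where "letterwise (\<Sigma> n m) (\<Sigma> m k [a]) = letterwise (\<Sigma> n m) x @ \<Sigma> n m [c] @ letterwise (\<Sigma> n m) y"
      by (rule letterwise_split_letter[OF c(1)])
    then show ?thesis using s(1) m(2) c(2) k(3) by (auto simp: positive_hom_def)
  qed
  then show ?thesis using m(1) by blast
qed

lemma length_letterwise_ge:
  assumes "\<And>b. b \<in> set v \<Longrightarrow> c \<le> length (\<phi> [b])"
  shows "c * length v \<le> length (letterwise \<phi> v)"
  using assms
proof (induction v)
  case (Cons b v)
  have "c \<le> length (\<phi> [b])" "c * length v \<le> length (letterwise \<phi> v)"
    using Cons.prems Cons.IH by auto
  then show ?case by simp
qed simp

text \<open>Positivity demands images of length at least 2, so each positive composition at least
  doubles the lengths.\<close>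

lemma growth: "\<exists>m\<ge>n. \<forall>k\<ge>m. \<forall>a\<in>A k. M \<le> length (\<Sigma> n k [a])"
proof (induction M arbitrary: n)
  case (Suc M)
  obtain m where m: "n < m" "positive_hom (A m) (A n) (\<Sigma> n m)"
    using primitive by (auto simp: primitive_seq_def)
  obtain m' where m': "m \<le> m'" "\<And>k a. m' \<le> k \<Longrightarrow> a \<in> A k \<Longrightarrow> M \<le> length (\<Sigma> m k [a])" using Suc by blast
  have "Suc M \<le> length (\<Sigma> n k [a])" if k: "m' \<le> k" "a \<in> A k" for k a
  proof -
    have mk: "m \<le> k" using m' k by simp
    note s = comp_hom_letter_split[OF less_imp_le[OF m(1)] mk k(2)]
    have "2 * length (\<Sigma> m k [a]) \<le> length (\<Sigma> n k [a])"
      unfolding s(1) by (rule length_letterwise_ge) (use m(2) s(2) in \<open>auto simp: positive_hom_def words_def\<close>)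
    moreover have "1 \<le> length (\<Sigma> m k [a])" using s(2) by (cases "\<Sigma> m k [a]") (auto simp: words_def)
    ultimately show ?thesis using m'(2)[OF k] by linarith
  qed
  then show ?case using m m' by (meson less_imp_le order_trans)
qed auto

text \<open>The word occurs in the image of some letter \<open>b\<close>, and by positivity
  \<open>b\<close> occurs in the image of every letter of a late level.\<close>

lemma occurs_eventually:
  assumes "u \<in> L n"
  shows "\<exists>m\<ge>n. \<forall>k\<ge>m. \<forall>a\<in>A k. \<exists>x y. \<Sigma> n k [a] = x @ u @ y"
proof -
  obtain j b x y where j: "n \<le> j" "b \<in> A j" "\<Sigma> n j [b] = x @ u @ y" by (rule L_E[OF assms])
  obtain m where m: "j < m" "\<And>k a. m \<le> k \<Longrightarrow> a \<in> A k \<Longrightarrow> b \<in> set (\<Sigma> j k [a])"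
    using positive_from[of j] j(2) by blast
  have "\<exists>x y. \<Sigma> n k [a] = x @ u @ y" if k: "m \<le> k" "a \<in> A k" for k a
  proof -
    have jk: "j \<le> k" using m(1) k(1) by simp
    obtain s t where "letterwise (\<Sigma> n j) (\<Sigma> j k [a]) = letterwise (\<Sigma> n j) s @ \<Sigma> n j [b] @ letterwise (\<Sigma> n j) t"
      by (rule letterwise_split_letter[OF m(2)[OF k]])
    then have "\<Sigma> n k [a] = (letterwise (\<Sigma> n j) s @ x) @ u @ (y @ letterwise (\<Sigma> n j) t)"
      using comp_hom_letter_split(1)[OF j(1) jk k(2)] j(3) by simp
    then show ?thesis by blast
  qed
  then show ?thesis using m(1) j(1) by (meson less_imp_le order_trans)
qed

text \<open>At a suitable level \<open>m\<close> every block contains \<open>u\<close>, and a word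
  at least twice as long as the longest block contains a whole block.\<close>

lemma uniformly_recurrent:
  assumes "u \<in> L n"
  shows "\<exists>R. \<forall>w\<in>L n. R \<le> length w \<longrightarrow> (\<exists>x y. w = x @ u @ y)"
proof -
  obtain m where m: "n \<le> m" "\<And>k a. m \<le> k \<Longrightarrow> a \<in> A k \<Longrightarrow> \<exists>x y. \<Sigma> n k [a] = x @ u @ y"
    using occurs_eventually[OF assms] by blast
  \<comment> \<open>The successor makes the bound positive, as \<open>block_in_factor\<close>
    requires.\<close>
  define M where "M = Suc (Max ((\<lambda>b. length (\<Sigma> n m [b])) ` A m))"
  have M: "length (\<Sigma> n m [b]) \<le> M" if "b \<in> A m" for b
    unfolding M_def by (rule le_SucI, rule Max_ge) (use that finite_alphabet in auto)
  have "\<exists>x y. w = x @ u @ y" if w: "w \<in> L n" "2 * M \<le> length w" for w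
  proof -
    obtain k where k: "\<And>k' a. k \<le> k' \<Longrightarrow> a \<in> A k' \<Longrightarrow> \<exists>x y. \<Sigma> n k' [a] = x @ w @ y"
      using occurs_eventually[OF w(1)] by blast
    define k' where "k' = max k m"
    obtain a where a: "a \<in> A k'" using alphabet_nonempty by blast
    obtain x y where xy: "\<Sigma> n k' [a] = x @ w @ y" using k[of k' a] a by (auto simp: k'_def)
    note s = comp_hom_letter_split[of n m k' a, OF m(1) _ a]
    have mk': "m \<le> k'" by (simp add: k'_def)
    have "\<exists>b\<in>set (\<Sigma> m k' [a]). \<exists>s t. w = s @ \<Sigma> n m [b] @ t"
    proof (rule block_in_factor)
      show "x @ w @ y = letterwise (\<Sigma> n m) (\<Sigma> m k' [a])" using xy s(1)[OF mk'] by simp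
      show "length (\<Sigma> n m [b]) \<le> M" if "b \<in> set (\<Sigma> m k' [a])" for b
        using M s(2)[OF mk'] that by (auto simp: words_def)
    qed (use w(2) in \<open>auto simp: M_def\<close>)
    then obtain b s' t' where b: "b \<in> A m" "w = s' @ \<Sigma> n m [b] @ t'"
      using s(2)[OF mk'] by (auto simp: words_def)
    obtain x' y' where "\<Sigma> n m [b] = x' @ u @ y'" using m(2)[OF order_refl b(1)] by blast
    then have "w = (s' @ x') @ u @ (y' @ t')" using b(2) by simp
    then show ?thesis by blast
  qed
  then show ?thesis by blast
qed

lemma recurrent:
  assumes "w \<in> L n"
  shows "\<exists>z\<in>words (A n). w @ z @ w \<in> L n"
proof -
  have wne: "w \<noteq> []" using assms L_words by (auto simp: words_def)
  obtain m where m: "n \<le> m" "\<And>k a. m \<le> k \<Longrightarrow> a \<in> A k \<Longrightarrow> \<exists>x y. \<Sigma> n k [a] = x @ w @ y"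
    using occurs_eventually[OF assms] by blast
  \<comment> \<open>Of three consecutive blocks, the outer two contain \<open>w\<close>, and the
    middle one makes the word between the two occurrences nonempty.\<close>
  obtain k where k: "m \<le> k" "\<And>a. a \<in> A k \<Longrightarrow> 3 \<le> length (\<Sigma> m k [a])" using growth[of m 3] by blast
  obtain a where a: "a \<in> A k" using alphabet_nonempty by blast
  note s = comp_hom_letter_split[OF m(1) k(1) a]
  obtain b1 b2 b3 v where b: "\<Sigma> m k [a] = b1 # b2 # b3 # v"
    using k(2)[OF a] by (metis (no_types, lifting) Suc_le_length_iff numeral_3_eq_3)
  have bA: "b1 \<in> A m" "b2 \<in> A m" "b3 \<in> A m" using s(2) b by (auto simp: words_def)
  obtain x1 y1 where 1: "\<Sigma> n m [b1] = x1 @ w @ y1" using m(2)[OF order_refl bA(1)] by blast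
  obtain x3 y3 where 3: "\<Sigma> n m [b3] = x3 @ w @ y3" using m(2)[OF order_refl bA(3)] by blast
  define z where "z = y1 @ \<Sigma> n m [b2] @ x3"
  have "\<Sigma> n k [a] = x1 @ (w @ z @ w) @ (y3 @ letterwise (\<Sigma> n m) v)"
    using s(1) b 1 3 by (simp add: z_def)
  then have "w @ z @ w \<in> L n" using L_I[of n k a] m(1) k(1) a wne by (metis append_is_Nil_conv order_trans)
  moreover have "z \<noteq> []" using comp_hom_word[OF m(1) letter_word[OF bA(2)]] by (auto simp: z_def words_def)
  moreover have "set z \<subseteq> A n" using \<open>w @ z @ w \<in> L n\<close> L_words by (fastforce simp: words_def)
  ultimately show ?thesis by (auto simp: words_def)
qed

lemma L_image:
  assumes "n \<le> m" "w \<in> L m"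
  shows "\<Sigma> n m w \<in> L n"
proof -
  obtain k a x y where k: "m \<le> k" "a \<in> A k" "\<Sigma> m k [a] = x @ w @ y" "w \<noteq> []" by (rule L_E[OF assms(2)])
  have w: "w \<in> words (A m)" using assms(2) L_words by blast
  have "\<Sigma> n k [a] = letterwise (\<Sigma> n m) x @ \<Sigma> n m w @ letterwise (\<Sigma> n m) y"
    using comp_hom_letter_split(1)[OF assms(1) k(1,2)] k(3) comp_hom_letterwise[OF assms(1) w] by simp
  moreover have "\<Sigma> n m w \<noteq> []" using comp_hom_word[OF assms(1) w] by (simp add: words_def)
  ultimately show ?thesis using L_I[of n k a] assms(1) k(1,2) by (meson order_trans)
qed

lemma L_long: "\<exists>w\<in>L n. M \<le> length w"
proof -
  obtain m where m: "n \<le> m" "\<And>a. a \<in> A m \<Longrightarrow> Suc M \<le> length (\<Sigma> n m [a])" using growth[of n "Suc M"] by blast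
  obtain a where a: "a \<in> A m" using alphabet_nonempty by blast
  have "\<Sigma> n m [a] \<in> L n" using L_I[OF m(1) a, of "[]" "\<Sigma> n m [a]" "[]"] m(2)[OF a] by (cases "\<Sigma> n m [a]") auto
  then show ?thesis using Suc_leD[OF m(2)[OF a]] by blast
qed

lemma L_in_image:
  assumes "n \<le> m" "w \<in> L n"
  shows "\<exists>v\<in>L m. \<exists>x y. \<Sigma> n m v = x @ w @ y"
proof -
  obtain k where k: "\<And>k' a. k \<le> k' \<Longrightarrow> a \<in> A k' \<Longrightarrow> \<exists>x y. \<Sigma> n k' [a] = x @ w @ y"
    using occurs_eventually[OF assms(2)] by blast
  define k' where "k' = max k m"
  obtain a where a: "a \<in> A k'" using alphabet_nonempty by blast
  have mk': "m \<le> k'" by (simp add: k'_def)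
  have "\<Sigma> m k' [a] \<in> L m"
    using L_I[OF mk' a, of "[]" "\<Sigma> m k' [a]" "[]"] comp_hom_letter_split(2)[OF assms(1) mk' a] by (auto simp: words_def)
  moreover have "\<exists>x y. \<Sigma> n m (\<Sigma> m k' [a]) = x @ w @ y"
    using k[of k' a] a comp_hom_split[OF assms(1) mk', of \<sigma>] by (simp add: k'_def)
  ultimately show ?thesis by blast
qed


section \<open>The regular class of a primitive directive sequence\<close>

text \<open>For \<open>n = 0\<close> this is the set that determines the J-class of the
  sequence.\<close>

definition K :: "nat \<Rightarrow> 'a pseudoword set" where
  "K n = {x \<in> clo (A n) (L n). infinite_pw (A n) x}"

lemma K_closed: "x \<in> K n \<Longrightarrow> x \<in> free_profinite (A n)"
  using clo_closed by (auto simp: K_def)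

lemma K_eq: "K n = clo (A n) (L n) - pseudoword_of (A n) ` L n"
  using clo_infinite_iff[OF finite_alphabet L_words] unfolding K_def by blast

lemma K_long_word:
  assumes "x \<in> K n" "r \<in> finite_congruences (A n)"
  shows "\<exists>w\<in>L n. w \<in> x r \<and> M \<le> length w"
  using clo_not_word[OF _ _ L_words finite_alphabet assms(2)] assms(1) unfolding K_eq by blast

lemma L_inner:
  assumes "v \<in> L n"
  shows "\<exists>\<alpha>\<in>words (A n). \<exists>\<beta>\<in>words (A n). \<alpha> @ v @ \<beta> \<in> L n"
proof -
  obtain z where z: "z \<in> words (A n)" "v @ z @ v \<in> L n" using recurrent[OF assms] by blast
  obtain z' where z': "z' \<in> words (A n)" "(v @ z @ v) @ z' @ (v @ z @ v) \<in> L n" using recurrent[OF z(2)] by blast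
  have v: "v \<in> words (A n)" using assms L_words by blast
  have "(v @ z) @ v @ (z' @ v @ z @ v) \<in> L n" using z' by simp
  then show ?thesis using v z(1) z'(1) words_append by blast
qed

text \<open>A long approximation of \<open>x\<close> in the language contains, by uniform
  recurrence, any given approximation of \<open>y\<close>; the words to its left and right converge
  to the multipliers. \<open>L_inner\<close> keeps these words nonempty, as the semigroup has no
  identity.\<close>

lemma K_J_below:
  assumes x: "x \<in> K n" and y: "y \<in> K n"
  shows "\<exists>a\<in>free_profinite (A n). \<exists>b\<in>free_profinite (A n). x = (a \<odot>\<^bsub>A n\<^esub> y) \<odot>\<^bsub>A n\<^esub> b"
proof -
  obtain U where U: "fine_filter (A n) U" using fine_filter_exists by blast
  have "\<exists>\<alpha>\<in>words (A n). \<exists>v\<in>words (A n). \<exists>\<beta>\<in>words (A n). v \<in> y s \<and> (\<alpha> @ v) @ \<beta> \<in> x s" if s: "s \<in> finite_congruences (A n)" for s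
  proof -
    obtain v where v: "v \<in> L n" "v \<in> y s" using K_long_word[OF y s] by blast
    obtain \<alpha> \<beta> where ab: "\<alpha> \<in> words (A n)" "\<beta> \<in> words (A n)" "\<alpha> @ v @ \<beta> \<in> L n" using L_inner[OF v(1)] by blast
    obtain R where R: "\<And>w. w \<in> L n \<Longrightarrow> R \<le> length w \<Longrightarrow> \<exists>p q. w = p @ (\<alpha> @ v @ \<beta>) @ q"
      using uniformly_recurrent[OF ab(3)] by blast
    obtain w where w: "w \<in> L n" "w \<in> x s" "R \<le> length w" using K_long_word[OF x s] by blast
    then obtain p q where pq: "w = p @ (\<alpha> @ v @ \<beta>) @ q" using R by blast
    have "w \<in> words (A n)" "v \<in> words (A n)" using w(1) v(1) L_words[of n] by blast+
    then have "p @ \<alpha> \<in> words (A n)" "\<beta> @ q \<in> words (A n)" "v \<in> words (A n)"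
      using pq ab(1,2) by (auto simp: words_def)
    moreover have "((p @ \<alpha>) @ v) @ (\<beta> @ q) \<in> x s" using pq w(2) by simp
    ultimately show ?thesis using v(2) by blast
  qed
  then obtain \<alpha> v \<beta> where *: "\<And>s. s \<in> finite_congruences (A n) \<Longrightarrow> \<alpha> s \<in> words (A n) \<and> v s \<in> words (A n) \<and> \<beta> s \<in> words (A n)
      \<and> v s \<in> y s \<and> (\<alpha> s @ v s) @ \<beta> s \<in> x s" by metis
  have ev: "eventually (\<lambda>i. \<alpha> (fst i) \<in> words (A n) \<and> v (fst i) \<in> words (A n) \<and> \<beta> (fst i) \<in> words (A n)
      \<and> v (fst i) \<in> y (fst i) \<and> (\<alpha> (fst i) @ v (fst i)) @ \<beta> (fst i) \<in> x (fst i)) U"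
    using fine_filterD(4)[OF U] by eventually_elim (rule *)
  have ev\<alpha>: "eventually (\<lambda>i. \<alpha> (fst i) \<in> words (A n)) U" and ev\<beta>: "eventually (\<lambda>i. \<beta> (fst i) \<in> words (A n)) U"
    and evv: "eventually (\<lambda>i. v (fst i) \<in> words (A n)) U"
    and evav: "eventually (\<lambda>i. \<alpha> (fst i) @ v (fst i) \<in> words (A n)) U"
    using ev by (eventually_elim, simp add: words_append)+
  obtain a where a: "wlim U (A n) (\<lambda>i. \<alpha> (fst i)) a" using wlim_exists[OF fine_filterD(1)[OF U] ev\<alpha>] by blast
  obtain b where b: "wlim U (A n) (\<lambda>i. \<beta> (fst i)) b" using wlim_exists[OF fine_filterD(1)[OF U] ev\<beta>] by blast
  obtain c where c: "wlim U (A n) (\<lambda>i. \<alpha> (fst i) @ v (fst i)) c"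
    using wlim_exists[OF fine_filterD(1)[OF U] evav] by blast
  have vy: "wlim U (A n) (\<lambda>i. v (fst i)) y"
    by (rule wlim_of_reps[OF U K_closed[OF y]]) (use ev in eventually_elim, simp)
  have wx: "wlim U (A n) (\<lambda>i. (\<alpha> (fst i) @ v (fst i)) @ \<beta> (fst i)) x"
    by (rule wlim_of_reps[OF U K_closed[OF x]]) (use ev in eventually_elim, simp)
  have "c = a \<odot>\<^bsub>A n\<^esub> y"
    by (rule wlim_append[OF fine_filterD(2)[OF U] a vy c ev\<alpha> evv]) simp
  moreover have "x = c \<odot>\<^bsub>A n\<^esub> b"
    by (rule wlim_append[OF fine_filterD(2)[OF U] c b wx evav ev\<beta>]) simp
  ultimately show ?thesis using plim_closed[OF a] plim_closed[OF b] by blast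
qed

text \<open>The language is closed under taking factors, and openness of multiplication transfers
  this to its closure.\<close>

lemma clo_L_left:
  assumes "x \<odot>\<^bsub>A n\<^esub> y \<in> clo (A n) (L n)" "x \<in> free_profinite (A n)" "y \<in> free_profinite (A n)"
  shows "x \<in> clo (A n) (L n)"
proof -
  have "\<exists>u\<in>L n. u \<in> x r" if r: "r \<in> finite_congruences (A n)" for r
  proof -
    obtain u v where uv: "u \<in> x r" "u @ v \<in> L n" using clo_split[OF assms r] by blast
    have "u \<noteq> []" using free_profinite_rep(1)[OF assms(2) r uv(1)] by (auto simp: words_def)
    then have "u \<in> L n" using L_factor[of "[]" u v] uv(2) by simp
    then show ?thesis using uv(1) by blast
  qed
  then show ?thesis using assms(2) by (simp add: clo_def)
qed

lemma K_nonempty: "\<exists>x. x \<in> K n"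
proof -
  obtain w where w: "\<And>k. w k \<in> L n" "\<And>k. k \<le> length (w k)" using L_long[of n] by metis
  obtain U :: "nat filter" where U: "ultra U" "\<And>k. eventually (\<lambda>i. k \<le> i) U"
    using ultra_nat_exists by blast
  have evw: "eventually (\<lambda>k. w k \<in> words (A n)) U" using w(1) L_words by (intro always_eventually) blast
  obtain x where x: "wlim U (A n) w x" using wlim_exists[OF U(1) evw] by blast
  have cl: "x \<in> clo (A n) (L n)"
    by (rule wlim_clo[OF ultra_nonbot[OF U(1)] x _ L_words]) (simp add: w(1))
  have "\<exists>w\<in>x (ps_congruence (A n) M). M \<le> length w" for M
  proof -
    note p = ps_congruence[OF finite_alphabet, of n M]
    have "eventually (\<lambda>k. w k \<in> x (ps_congruence (A n) M) \<and> M \<le> k) U"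
      using plim_wordsD[OF x p evw] U(2)[of M] by eventually_elim simp
    then obtain k where "w k \<in> x (ps_congruence (A n) M)" "M \<le> k"
      using eventually_happens'[OF ultra_nonbot[OF U(1)]] by blast
    then show ?thesis using w(2)[of k] by (meson order_trans)
  qed
  then have "infinite_pw (A n) x" by (rule infinite_pwI[OF finite_alphabet clo_closed[OF cl]])
  then show ?thesis using cl by (auto simp: K_def)
qed

text \<open>Recurrence of the approximations \<open>w\<close> gives words w z w in the language.
  Their limit x c x lies in \<open>K n\<close>, so \<open>x\<close> divides and is divided by it,
  and stability makes \<open>x\<close> regular.\<close>

lemma K_regular:
  assumes x: "x \<in> K n"
  shows "\<exists>s\<in>free_profinite (A n). x = (x \<odot>\<^bsub>A n\<^esub> s) \<odot>\<^bsub>A n\<^esub> x"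
proof -
  obtain U where U: "fine_filter (A n) U" using fine_filter_exists by blast
  have "\<exists>w\<in>L n. \<exists>z\<in>words (A n). w \<in> x s \<and> w @ z @ w \<in> L n" if s: "s \<in> finite_congruences (A n)" for s
    using K_long_word[OF x s] recurrent by blast
  then obtain w z where *: "\<And>s. s \<in> finite_congruences (A n) \<Longrightarrow> w s \<in> L n \<and> z s \<in> words (A n) \<and> w s \<in> x s \<and>
      w s @ z s @ w s \<in> L n" by metis
  have ev: "eventually (\<lambda>i. w (fst i) \<in> words (A n) \<and> z (fst i) \<in> words (A n) \<and> w (fst i) \<in> x (fst i) \<and>
      w (fst i) @ z (fst i) @ w (fst i) \<in> L n) U"
    using fine_filterD(4)[OF U] by eventually_elim (use * L_words in blast)
  have evw: "eventually (\<lambda>i. w (fst i) \<in> words (A n)) U" and evz: "eventually (\<lambda>i. z (fst i) \<in> words (A n)) U"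
    and evzw: "eventually (\<lambda>i. z (fst i) @ w (fst i) \<in> words (A n)) U"
    and evL: "eventually (\<lambda>i. w (fst i) @ z (fst i) @ w (fst i) \<in> L n) U"
    and evwzw: "eventually (\<lambda>i. w (fst i) @ z (fst i) @ w (fst i) \<in> words (A n)) U"
    using ev by (eventually_elim, simp add: words_append)+
  have wx: "wlim U (A n) (\<lambda>i. w (fst i)) x"
    by (rule wlim_of_reps[OF U K_closed[OF x]]) (use ev in eventually_elim, simp)
  obtain c where c: "wlim U (A n) (\<lambda>i. z (fst i)) c" using wlim_exists[OF fine_filterD(1)[OF U] evz] by blast
  obtain d where d: "wlim U (A n) (\<lambda>i. z (fst i) @ w (fst i)) d" using wlim_exists[OF fine_filterD(1)[OF U] evzw] by blast
  obtain y where y: "wlim U (A n) (\<lambda>i. w (fst i) @ z (fst i) @ w (fst i)) y"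
    using wlim_exists[OF fine_filterD(1)[OF U] evwzw] by blast
  have d_eq: "d = c \<odot>\<^bsub>A n\<^esub> x"
    by (rule wlim_append[OF fine_filterD(2)[OF U] c wx d evz evw]) simp
  have y_eq: "y = x \<odot>\<^bsub>A n\<^esub> d"
    by (rule wlim_append[OF fine_filterD(2)[OF U] wx d y evw evzw]) simp
  have "y \<in> clo (A n) (L n)" by (rule wlim_clo[OF fine_filterD(2)[OF U] y evL L_words])
  moreover have "infinite_pw (A n) y"
    unfolding y_eq by (rule infinite_pw_mult[OF finite_alphabet K_closed[OF x] plim_closed[OF d]])
      (use x in \<open>simp add: K_def\<close>)
  ultimately have "y \<in> K n" by (simp add: K_def)
  then obtain a b where "a \<in> free_profinite (A n)" "b \<in> free_profinite (A n)" "x = (a \<odot>\<^bsub>A n\<^esub> y) \<odot>\<^bsub>A n\<^esub> b"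
    using K_J_below[OF x] by blast
  then show ?thesis
    using fp.regular_if_recurrent[OF K_closed[OF x] _ plim_closed[OF c]] unfolding y_eq d_eq by blast
qed

text \<open>If x = x s x, then x s is idempotent, and it is a left factor of x = (x s) x, hence lies
  in the closure of the language.\<close>

lemma K_idempotent: "\<exists>e\<in>K n. e \<odot>\<^bsub>A n\<^esub> e = e"
proof -
  obtain x where x: "x \<in> K n" using K_nonempty by blast
  note x' = K_closed[OF x]
  obtain s where s: "s \<in> free_profinite (A n)" "x = (x \<odot>\<^bsub>A n\<^esub> s) \<odot>\<^bsub>A n\<^esub> x" using K_regular[OF x] by blast
  let ?e = "x \<odot>\<^bsub>A n\<^esub> s"
  have e: "?e \<in> free_profinite (A n)" using x' s(1) by (rule profinite_mult_closed)
  have "?e \<odot>\<^bsub>A n\<^esub> ?e = (?e \<odot>\<^bsub>A n\<^esub> x) \<odot>\<^bsub>A n\<^esub> s" by (rule profinite_mult_assoc[OF e x' s(1), symmetric])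
  also have "\<dots> = ?e" by (simp only: s(2)[symmetric])
  finally have ee: "?e \<odot>\<^bsub>A n\<^esub> ?e = ?e" .
  have "?e \<odot>\<^bsub>A n\<^esub> x \<in> clo (A n) (L n)" using x unfolding s(2)[symmetric] by (simp add: K_def)
  then have "?e \<in> clo (A n) (L n)" by (rule clo_L_left[OF _ e x'])
  then have "?e \<in> K n" using idempotent_infinite_pw[OF finite_alphabet e ee] by (simp add: K_def)
  then show ?thesis using ee by blast
qed

text \<open>The J-class of any \<open>k\<close> in \<open>K 0\<close> meets the conditions of the
  definite description and, classes being disjoint, is the only one to do so. As \<open>k\<close> is
  regular, membership amounts to two-sided divisibility both ways.\<close>

lemma seq_J_class_iff:
  assumes k: "k \<in> K 0"
  shows "x \<in> seq_J_class A \<sigma> \<longleftrightarrow> x \<in> free_profinite (A 0) \<and>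
    (\<exists>a\<in>free_profinite (A 0). \<exists>b\<in>free_profinite (A 0). \<exists>c\<in>free_profinite (A 0). \<exists>d\<in>free_profinite (A 0).
      x = (a \<odot>\<^bsub>A 0\<^esub> k) \<odot>\<^bsub>A 0\<^esub> b \<and> k = (c \<odot>\<^bsub>A 0\<^esub> x) \<odot>\<^bsub>A 0\<^esub> d)"
proof -
  let ?S = "free_profinite (A 0)" and ?f = "profinite_mult (A 0)"
  let ?rel = "{(x, y) \<in> ?S \<times> ?S. principal_ideal ?S ?f x = principal_ideal ?S ?f y}"
  have eq: "equiv ?S ?rel" by (rule equivI) (auto simp: refl_on_def sym_def trans_def)
  note k' = K_closed[OF k]
  obtain t where t: "t \<in> ?S" "k = (k \<odot>\<^bsub>A 0\<^esub> t) \<odot>\<^bsub>A 0\<^esub> k" using K_regular[OF k] by blast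
  let ?J = "?rel `` {k}"
  have Jiff: "x \<in> ?J \<longleftrightarrow> x \<in> ?S \<and> (\<exists>a\<in>?S. \<exists>b\<in>?S. \<exists>c\<in>?S. \<exists>d\<in>?S.
      x = (a \<odot>\<^bsub>A 0\<^esub> k) \<odot>\<^bsub>A 0\<^esub> b \<and> k = (c \<odot>\<^bsub>A 0\<^esub> x) \<odot>\<^bsub>A 0\<^esub> d)" for x
    using fp.J_equiv_regular_iff[OF k' t, of x] k' by auto
  have clos: "Abstract_Topology.closure_of (profinite_topology (A 0)) (pseudoword_of (A 0) ` seq_language A \<sigma>)
       - pseudoword_of (A 0) ` seq_language A \<sigma> = K 0"
    using seq_language_shift[of A 0 \<sigma>] closure_of_words[OF L_words[of 0]] by (simp add: K_eq)
  have "seq_J_class A \<sigma> = ?J"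
    unfolding seq_J_class_def clos
  proof (rule the_equality)
    have "?J \<in> J_classes ?S ?f" unfolding J_classes_def using k' by (rule quotientI)
    moreover have "?J \<subseteq> regular_elements ?S ?f"
    proof
      fix x assume "x \<in> ?J"
      then obtain a b c d where x: "x \<in> ?S" "a \<in> ?S" "b \<in> ?S" "c \<in> ?S" "d \<in> ?S" "x = (a \<odot>\<^bsub>A 0\<^esub> k) \<odot>\<^bsub>A 0\<^esub> b"
        "k = (c \<odot>\<^bsub>A 0\<^esub> x) \<odot>\<^bsub>A 0\<^esub> d" unfolding Jiff by blast
      obtain s where s: "s \<in> ?S" "x = (x \<odot>\<^bsub>A 0\<^esub> s) \<odot>\<^bsub>A 0\<^esub> x"
        using fp.regular_J_equiv[OF x(1) k' t(1) x(2-5) t(2) x(6,7)] by blast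
      show "x \<in> regular_elements ?S ?f" unfolding regular_elements_def using x(1) s(1) s(2)[symmetric] by blast
    qed
    moreover have "K 0 \<subseteq> ?J"
    proof
      fix x assume x: "x \<in> K 0"
      show "x \<in> ?J" unfolding Jiff using K_J_below[OF x k] K_J_below[OF k x] K_closed[OF x] by blast
    qed
    ultimately show "?J \<in> J_classes ?S ?f \<and> ?J \<subseteq> regular_elements ?S ?f \<and> K 0 \<subseteq> ?J" by blast
  next
    fix J assume J: "J \<in> J_classes ?S ?f \<and> J \<subseteq> regular_elements ?S ?f \<and> K 0 \<subseteq> J"
    then have "k \<in> J" "J \<in> ?S // ?rel" using k by (auto simp: J_classes_def)
    moreover have "k \<in> ?J" by (rule equiv_class_self[OF eq k'])
    moreover have "?J \<in> ?S // ?rel" by (rule quotientI[OF k'])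
    ultimately show "J = ?J" using quotient_disj[OF eq] by blast
  qed
  then show ?thesis by (simp only: Jiff)
qed

text \<open>The lifts must lie in the closure of the language of their level, not merely exist: only
  then is \<open>e\<close> approximated by images of words of \<open>L n\<close>, whose cutting
  points can be compared. Lifts at different levels need not be compatible.\<close>

definition deep_idempotent :: "'a pseudoword \<Rightarrow> bool" where
  "deep_idempotent e \<longleftrightarrow> (\<forall>n. \<exists>g\<in>clo (A n) (L n). g \<odot>\<^bsub>A n\<^esub> g = g \<and> E 0 n g = e)"

lemma E_closed: "n \<le> m \<Longrightarrow> x \<in> free_profinite (A m) \<Longrightarrow> E n m x \<in> free_profinite (A n)"
  by (rule profinite_extension_closed[OF comp_hom_hom])

lemma E_mult: "n \<le> m \<Longrightarrow> x \<in> free_profinite (A m) \<Longrightarrow> y \<in> free_profinite (A m) \<Longrightarrow>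
    E n m (x \<odot>\<^bsub>A m\<^esub> y) = E n m x \<odot>\<^bsub>A n\<^esub> E n m y"
  by (rule profinite_extension_mult[OF comp_hom_hom])

lemma E_comp: "n \<le> m \<Longrightarrow> m \<le> k \<Longrightarrow> x \<in> free_profinite (A k) \<Longrightarrow> E n k x = E n m (E m k x)"
  unfolding comp_hom_split[of n m k \<sigma>] by (rule profinite_extension_comp[OF comp_hom_hom[of m k] comp_hom_hom[of n m]])

lemma E_clo: "n \<le> m \<Longrightarrow> x \<in> clo (A m) (L m) \<Longrightarrow> E n m x \<in> clo (A n) (L n)"
  using profinite_extension_clo[OF comp_hom_hom, of n m x "L m"] clo_mono[of "\<Sigma> n m ` L m" "L n"] L_image by blast

text \<open>Idempotents \<open>f i\<close> chosen independently at all levels are pushed down to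
  level \<open>n\<close>, and one ultrafilter limit over \<open>i\<close> is taken for all
  \<open>n\<close> at once. The limits are compatible, since for large \<open>i\<close> the terms
  are.\<close>

lemma deep_idempotent_exists: "\<exists>e. deep_idempotent e"
proof -
  have "\<exists>f. f \<in> clo (A n) (L n) \<and> f \<odot>\<^bsub>A n\<^esub> f = f" for n using K_idempotent[of n] by (auto simp: K_def)
  then obtain f where f: "\<And>n. f n \<in> clo (A n) (L n)" "\<And>n. f n \<odot>\<^bsub>A n\<^esub> f n = f n" by metis
  obtain U :: "nat filter" where U: "ultra U" "\<And>k. eventually (\<lambda>i. k \<le> i) U"
    using ultra_nat_exists by blast
  note nb = ultra_nonbot[OF U(1)]
  have evc: "eventually (\<lambda>i. E n i (f i) \<in> clo (A n) (L n)) U" for n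
    using U(2)[of n] by eventually_elim (rule E_clo[OF _ f(1)])
  have evp: "eventually (\<lambda>i. E n i (f i) \<in> free_profinite (A n)) U" for n
    using evc by eventually_elim (rule clo_closed)
  have "\<forall>n. \<exists>g. plim U (A n) (\<lambda>i. E n i (f i)) g" using plim_exists[OF U(1) evp] by (rule allI)
  from choice[OF this] obtain g where "\<forall>n. plim U (A n) (\<lambda>i. E n i (f i)) (g n)" by (rule exE)
  then have g: "plim U (A n) (\<lambda>i. E n i (f i)) (g n)" for n by (rule spec)
  have gc: "g n \<in> clo (A n) (L n)" for n by (rule clo_plim[OF nb evc g])
  have gg: "g n \<odot>\<^bsub>A n\<^esub> g n = g n" for n
  proof (rule plim_unique[OF nb _ g])
    have "eventually (\<lambda>i. E n i (f i) \<odot>\<^bsub>A n\<^esub> E n i (f i) = E n i (f i)) U"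
      using U(2)[of n]
    proof eventually_elim
      case (elim i)
      show ?case
        using E_mult[OF elim clo_closed[OF f(1)] clo_closed[OF f(1)]] unfolding f(2) by (rule sym)
    qed
    then show "plim U (A n) (\<lambda>i. E n i (f i)) (g n \<odot>\<^bsub>A n\<^esub> g n)"
      using plim_mult[OF g[of n] g[of n]] by (rule plim_cong)
  qed
  have "E 0 n (g n) = g 0" for n
  proof (rule plim_unique[OF nb _ g])
    have 1: "plim U (A 0) (\<lambda>i. E 0 n (E n i (f i))) (E 0 n (g n))"
      by (rule plim_extension[OF comp_hom_hom evp g]) simp
    have "eventually (\<lambda>i. E 0 n (E n i (f i)) = E 0 i (f i)) U"
      using U(2)[of n] by eventually_elim (rule E_comp[OF le0 _ clo_closed[OF f(1)], symmetric])
    then show "plim U (A 0) (\<lambda>i. E 0 i (f i)) (E 0 n (g n))" using 1 by (rule plim_cong)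
  qed
  then have "deep_idempotent (g 0)" unfolding deep_idempotent_def using gc gg by blast
  then show ?thesis by blast
qed

abbreviation "units \<equiv> fp.unit_group (A 0)"

lemma deep_idempotentD:
  assumes "deep_idempotent e"
  shows "e \<in> free_profinite (A 0)" "e \<odot>\<^bsub>A 0\<^esub> e = e" "e \<in> K 0"
proof -
  obtain g where g: "g \<in> clo (A 0) (L 0)" "g \<odot>\<^bsub>A 0\<^esub> g = g" "E 0 0 g = e"
    using assms unfolding deep_idempotent_def by blast
  have g': "g \<in> free_profinite (A 0)" using g(1) by (rule clo_closed)
  show 1: "e \<in> free_profinite (A 0)" using E_closed[OF _ g'] g(3) by blast
  show 2: "e \<odot>\<^bsub>A 0\<^esub> e = e" using E_mult[OF _ g' g', of 0] g(2,3) by simp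
  have "e \<in> clo (A 0) (L 0)" using E_clo[OF _ g(1)] g(3) by blast
  then show "e \<in> K 0" using idempotent_infinite_pw[OF finite_alphabet 1 2] by (simp add: K_def)
qed

lemma saturatingI:
  assumes e: "deep_idempotent e" and sub: "units e \<subseteq> profinite_image A \<sigma>"
  shows "saturating_seq A \<sigma>"
proof -
  note e' = deep_idempotentD[OF e]
  have "units e \<in> maximal_subgroups (free_profinite (A 0)) (profinite_mult (A 0))"
    by (rule fp.unit_group_maximal[OF e'(1,2)])
  moreover have "units e \<subseteq> seq_J_class A \<sigma>"
  proof
    fix h assume "h \<in> units e"
    then obtain h' where h: "h \<in> free_profinite (A 0)" "e \<odot>\<^bsub>A 0\<^esub> h = h" "h' \<in> free_profinite (A 0)" "h \<odot>\<^bsub>A 0\<^esub> h' = e"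
      by (auto elim: fp.unit_groupE)
    have "h = (e \<odot>\<^bsub>A 0\<^esub> e) \<odot>\<^bsub>A 0\<^esub> h" "e = (e \<odot>\<^bsub>A 0\<^esub> h) \<odot>\<^bsub>A 0\<^esub> h'" using h e'(2) by simp_all
    then show "h \<in> seq_J_class A \<sigma>"
      unfolding seq_J_class_iff[OF e'(3)] using h(1,3) e'(1) by blast
  qed
  ultimately show ?thesis unfolding saturating_seq_def using sub by blast
qed

lemma profinite_image_clo:
  "profinite_image A \<sigma> = (\<Inter>n. clo (A 0) (\<Sigma> 0 n ` words (A n)))"
  unfolding profinite_image_def by (simp add: profinite_extension_image[OF comp_hom_hom])

end


section \<open>Cutting points\<close>

lemma cut_or_inside:
  assumes "letterwise \<phi> V = a @ b"
  shows "(\<exists>V1 V2. V = V1 @ V2 \<and> letterwise \<phi> V1 = a \<and> letterwise \<phi> V2 = b) \<or>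
    (\<exists>V1 c V2 t z. V = V1 @ c # V2 \<and> \<phi> [c] = t @ z \<and> t \<noteq> [] \<and> z \<noteq> [] \<and> a = letterwise \<phi> V1 @ t \<and> b = z @ letterwise \<phi> V2)"
  using assms
proof (induction V arbitrary: a)
  case (Cons c V)
  have eq: "\<phi> [c] @ letterwise \<phi> V = a @ b" using Cons.prems by simp
  then consider us where "\<phi> [c] = a @ us" "us @ letterwise \<phi> V = b" | us where "a = \<phi> [c] @ us" "letterwise \<phi> V = us @ b"
    unfolding append_eq_append_conv2 by metis
  then show ?case
  proof cases
    case 1
    show ?thesis
    proof (cases "a = [] \<or> us = []")
      case True
      then show ?thesis
      proof
        assume "a = []"
        then show ?thesis using 1 by (intro disjI1 exI[of _ "[]"] exI[of _ "c # V"]) simp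
      next
        assume "us = []"
        then show ?thesis using 1 by (intro disjI1 exI[of _ "[c]"] exI[of _ V]) simp
      qed
    next
      case False
      then show ?thesis using 1
        by (intro disjI2 exI[of _ "[]"] exI[of _ c] exI[of _ V] exI[of _ a] exI[of _ us]) simp
    qed
  next
    case 2
    from Cons.IH[OF 2(2)] show ?thesis
    proof
      assume "\<exists>V1 V2. V = V1 @ V2 \<and> letterwise \<phi> V1 = us \<and> letterwise \<phi> V2 = b"
      then obtain V1 V2 where "V = V1 @ V2" "letterwise \<phi> V1 = us" "letterwise \<phi> V2 = b" by blast
      then show ?thesis using 2 by (intro disjI1 exI[of _ "c # V1"] exI[of _ V2]) simp
    next
      assume "\<exists>V1 d V2 t z. V = V1 @ d # V2 \<and> \<phi> [d] = t @ z \<and> t \<noteq> [] \<and> z \<noteq> [] \<and> us = letterwise \<phi> V1 @ t \<and> b = z @ letterwise \<phi> V2"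
      then obtain V1 d V2 t z where "V = V1 @ d # V2" "\<phi> [d] = t @ z" "t \<noteq> []" "z \<noteq> []" "us = letterwise \<phi> V1 @ t" "b = z @ letterwise \<phi> V2"
        by blast
      then show ?thesis using 2
        by (intro disjI2 exI[of _ "c # V1"] exI[of _ d] exI[of _ V2] exI[of _ t] exI[of _ z]) simp
    qed
  qed
qed simp

text \<open>Preimages of the two sides would concatenate to a preimage of the whole word with a
  block boundary strictly inside the block of \<open>c\<close>, contrary to the uniqueness of
  preimages.\<close>

lemma injective_hom_cut:
  assumes \<phi>: "word_hom A B \<phi>" and inj: "inj_on \<phi> (words A)"
    and sets: "set v1 \<subseteq> A" "set v2 \<subseteq> A" "c \<in> A" and c: "\<phi> [c] = t @ z" "t \<noteq> []" "z \<noteq> []"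
    and 1: "letterwise \<phi> v1 @ t \<in> \<phi> ` words A" and 2: "z @ letterwise \<phi> v2 \<in> \<phi> ` words A"
  shows False
proof -
  obtain l1 l2 where l: "l1 \<in> words A" "l2 \<in> words A" "letterwise \<phi> v1 @ t = letterwise \<phi> l1" "z @ letterwise \<phi> v2 = letterwise \<phi> l2"
    using 1 2 word_hom_letterwise[OF \<phi>] by (metis imageE)
  have w: "v1 @ c # v2 \<in> words A" using sets by (auto simp: words_def)
  have "\<phi> (l1 @ l2) = \<phi> (v1 @ c # v2)"
    using word_hom_letterwise[OF \<phi>] words_append[OF l(1,2)] w l(3,4) c(1) by (metis append_assoc letterwise_simps(2,3))
  then have "l1 @ l2 = v1 @ c # v2" using inj words_append[OF l(1,2)] w by (auto dest: inj_onD)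
  then consider us where "v1 = l1 @ us" | us where "l1 = v1 @ us" "us @ l2 = c # v2"
    unfolding append_eq_append_conv2 by metis
  then show False
  proof cases
    case 1
    then have "length (letterwise \<phi> l1) \<le> length (letterwise \<phi> v1)" by simp
    then show False using arg_cong[OF l(3), of length] c(2) by (cases t) auto
  next
    case 2
    show False
    proof (cases us)
      case Nil
      then show False using 2(1) l(3) c(2) by simp
    next
      case (Cons d us')
      then have "l1 = v1 @ c # us'" using 2 by simp
      then show False using arg_cong[OF l(3), of length] c by simp
    qed
  qed
qed

text \<open>Desynchronization: arbitrarily long words of the image are parsed in two ways, with a cutting
  point of the first parsing falling strictly inside the block of \<open>c\<close> of the second.\<close>

definition desync :: "('a list \<Rightarrow> 'b list) \<Rightarrow> 'a list set \<Rightarrow> bool" where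
  "desync \<phi> L \<longleftrightarrow> (\<exists>c t z. \<phi> [c] = t @ z \<and> t \<noteq> [] \<and> z \<noteq> [] \<and>
    (\<forall>M. \<exists>v1 v2 v1' v2' s p. v1 @ v2 \<in> L \<and> v1' @ c # v2' \<in> L \<and> M \<le> length s \<and> M \<le> length p \<and>
      suffix s (letterwise \<phi> v1) \<and> suffix s (letterwise \<phi> v1' @ t) \<and>
      prefix p (letterwise \<phi> v2) \<and> prefix p (z @ letterwise \<phi> v2')))"

text \<open>The negation of \<open>desync\<close> yields one bound for each splitting of a block.
  There are finitely many splittings, and larger bounds only make the condition weaker, so the
  maximum serves for all.\<close>

lemma not_desync_window:
  assumes "\<not> desync \<phi> L" and A: "finite A" and L: "L \<subseteq> words A"
  shows "\<exists>M. \<forall>c t z v1 v2 v1' v2' s p. \<phi> [c] = t @ z \<longrightarrow> t \<noteq> [] \<longrightarrow> z \<noteq> [] \<longrightarrow> v1 @ v2 \<in> L \<longrightarrow> v1' @ c # v2' \<in> L \<longrightarrow>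
      M \<le> length s \<longrightarrow> M \<le> length p \<longrightarrow> suffix s (letterwise \<phi> v1) \<longrightarrow> suffix s (letterwise \<phi> v1' @ t) \<longrightarrow>
      prefix p (letterwise \<phi> v2) \<longrightarrow> \<not> prefix p (z @ letterwise \<phi> v2')"
proof -
  define Q where "Q M c t z \<longleftrightarrow> (\<exists>v1 v2 v1' v2' s p. v1 @ v2 \<in> L \<and> v1' @ c # v2' \<in> L \<and> M \<le> length s \<and> M \<le> length p \<and>
      suffix s (letterwise \<phi> v1) \<and> suffix s (letterwise \<phi> v1' @ t) \<and>
      prefix p (letterwise \<phi> v2) \<and> prefix p (z @ letterwise \<phi> v2'))" for M c t z
  have mono: "Q M c t z" if "Q M' c t z" "M \<le> M'" for M M' c t z
    using that unfolding Q_def by (meson order_trans)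
  let ?T = "(\<lambda>(c, k). (c, take k (\<phi> [c]), drop k (\<phi> [c]))) ` (SIGMA c:A. {..length (\<phi> [c])})"
  have fin: "finite ?T" using A by auto
  have "\<forall>x\<in>?T. case x of (c, t, z) \<Rightarrow> t \<noteq> [] \<longrightarrow> z \<noteq> [] \<longrightarrow> (\<exists>M. \<not> Q M c t z)"
  proof
    fix x assume "x \<in> ?T"
    then obtain c k where "x = (c, take k (\<phi> [c]), drop k (\<phi> [c]))" by auto
    then obtain t z where x: "x = (c, t, z)" "\<phi> [c] = t @ z" by (metis append_take_drop_id)
    show "case x of (c, t, z) \<Rightarrow> t \<noteq> [] \<longrightarrow> z \<noteq> [] \<longrightarrow> (\<exists>M. \<not> Q M c t z)"
      using assms(1) x(2) unfolding desync_def Q_def[symmetric] x(1) prod.case by blast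
  qed
  then have "\<forall>x. \<exists>M. x \<in> ?T \<longrightarrow> fst (snd x) \<noteq> [] \<longrightarrow> snd (snd x) \<noteq> [] \<longrightarrow> \<not> Q M (fst x) (fst (snd x)) (snd (snd x))"
    by (fastforce simp: split_beta)
  from choice[OF this] obtain m where m: "\<And>x. x \<in> ?T \<Longrightarrow> fst (snd x) \<noteq> [] \<Longrightarrow> snd (snd x) \<noteq> [] \<Longrightarrow> \<not> Q (m x) (fst x) (fst (snd x)) (snd (snd x))"
    by blast
  define M where "M = Max (insert 0 (m ` ?T))"
  have "\<not> Q M c t z" if "\<phi> [c] = t @ z" "t \<noteq> []" "z \<noteq> []" for c t z
  proof
    assume Q: "Q M c t z"
    then obtain v1' v2' where "v1' @ c # v2' \<in> L" unfolding Q_def by blast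
    then have "c \<in> A" using L by (auto simp: words_def)
    then have "(c, length t) \<in> (SIGMA c:A. {..length (\<phi> [c])})" using that(1) by simp
    then have "(\<lambda>(c, k). (c, take k (\<phi> [c]), drop k (\<phi> [c]))) (c, length t) \<in> ?T" by (rule imageI)
    then have mem: "(c, t, z) \<in> ?T" using that(1) by simp
    have "m (c, t, z) \<le> M" unfolding M_def by (rule Max_ge) (use fin mem in auto)
    then show False using m[OF mem] mono[OF Q] that(2,3) by simp
  qed
  then show ?thesis unfolding Q_def by (intro exI[of _ M]) blast
qed


section \<open>Groups of units\<close>

lemma profinite_mult_class_cong:
  assumes "x r = x' r" "y r = y' r"
  shows "(x \<odot>\<^bsub>A\<^esub> y) r = (x' \<odot>\<^bsub>A\<^esub> y') r"
  using assms by (simp add: profinite_mult_def restrict_def)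

lemma unit_power:
  assumes "e \<in> free_profinite A" "h \<in> fp.unit_group A e"
  shows "profinite_power A h n \<in> fp.unit_group A e"
  by (induction n) (simp_all add: assms fp.unit_group_mult)

lemma profinite_power_add:
  assumes "h \<in> free_profinite A"
  shows "profinite_power A h (Suc (i + j)) = profinite_power A h i \<odot>\<^bsub>A\<^esub> profinite_power A h j"
  using assms by (induction j) (simp_all add: profinite_mult_assoc profinite_power_closed)

text \<open>Two powers of a representative of \<open>h\<close> are congruent, and multiplying by the
  inverse of the smaller power cancels it.\<close>

lemma unit_torsion_mod:
  assumes e: "e \<in> free_profinite A" and h: "h \<in> fp.unit_group A e" and r: "r \<in> finite_congruences A"
  shows "\<exists>m. profinite_power A h m r = e r"
proof -
  have h': "h \<in> free_profinite A" using h by (auto elim: fp.unit_groupE)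
  obtain \<nu> where \<nu>: "\<nu> \<in> words A" "\<nu> \<in> h r" by (rule free_profinite_ex_rep[OF h' r])
  obtain i m where im: "0 < i" "2 \<le> m" "(word_power \<nu> i, word_power \<nu> (i + m)) \<in> r"
    using word_power_periodic[OF r \<nu>(1)] by blast
  define i' m' where "i' = i - 1" and "m' = m - 1"
  have im': "i = Suc i'" "i + m = Suc (Suc (i' + m'))" using im by (simp_all add: i'_def m'_def)
  let ?x = "profinite_power A h i'" and ?y = "profinite_power A h m'"
  note cl = profinite_power_closed[OF h']
  have "word_power \<nu> i \<in> ?x r" using profinite_power_rep[OF r h' \<nu>(2), of i'] im'(1) by simp
  then have "word_power \<nu> (i + m) \<in> ?x r" using im(3) free_profinite_rep_iff[OF cl r] by blast
  moreover have "word_power \<nu> (i + m) \<in> profinite_power A h (Suc (i' + m')) r"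
    using profinite_power_rep[OF r h' \<nu>(2), of "Suc (i' + m')"] im'(2) by (simp only:)
  ultimately have eq: "?x r = (?x \<odot>\<^bsub>A\<^esub> ?y) r"
    unfolding profinite_power_add[OF h'] by (intro free_profinite_eq_at[OF cl profinite_mult_closed[OF cl cl] r])
  obtain x' where x': "x' \<in> free_profinite A" "x' \<odot>\<^bsub>A\<^esub> ?x = e" "e \<odot>\<^bsub>A\<^esub> ?y = ?y"
    using fp.unit_groupE[OF unit_power[OF e h, of i']] fp.unit_groupE[OF unit_power[OF e h, of m']] by metis
  have "(x' \<odot>\<^bsub>A\<^esub> ?x) r = (x' \<odot>\<^bsub>A\<^esub> (?x \<odot>\<^bsub>A\<^esub> ?y)) r" by (rule profinite_mult_class_cong) (rule refl, rule eq)
  also have "x' \<odot>\<^bsub>A\<^esub> (?x \<odot>\<^bsub>A\<^esub> ?y) = ?y" unfolding profinite_mult_assoc[OF x'(1) cl cl, symmetric] x'(2,3) ..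
  finally show ?thesis using x'(2) by metis
qed

lemma clo_split3:
  assumes cl: "(x \<odot>\<^bsub>A\<^esub> y) \<odot>\<^bsub>A\<^esub> z \<in> clo A L" and x: "x \<in> free_profinite A" and y: "y \<in> free_profinite A" and z: "z \<in> free_profinite A"
    and r: "r \<in> finite_congruences A"
  shows "\<exists>u v w. u \<in> x r \<and> v \<in> y r \<and> w \<in> z r \<and> u @ v @ w \<in> L"
proof -
  let ?L = "{a. \<exists>b\<in>z r. a @ b \<in> L}"
  note xy = profinite_mult_closed[OF x y]
  have "\<exists>a\<in>?L. a \<in> (x \<odot>\<^bsub>A\<^esub> y) s" if s: "s \<in> finite_congruences A" for s
  proof -
    note t = finite_congruences_Int[OF s r]
    obtain a b where "a \<in> (x \<odot>\<^bsub>A\<^esub> y) (s \<inter> r)" "b \<in> z (s \<inter> r)" "a @ b \<in> L" using clo_split[OF cl xy z t] by blast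
    then show ?thesis using free_profinite_mono[OF xy t s] free_profinite_mono[OF z t r] by blast
  qed
  then have "x \<odot>\<^bsub>A\<^esub> y \<in> clo A ?L" using xy by (simp add: clo_def)
  then show ?thesis using clo_split[OF _ x y r] by force
qed

context primitive_directive
begin

text \<open>An approximation of \<open>h = ehe\<close> inside a word of the language is delimited on both sides by
  approximations of \<open>ee\<close>, whose middle is a cutting point.\<close>

lemma units_subset_image:
  assumes e: "deep_idempotent e" and h: "h \<in> units e" and sync: "\<not> desync (\<Sigma> 0 n) (L n)"
  shows "h \<in> clo (A 0) (\<Sigma> 0 n ` words (A n))"
proof -
  let ?\<phi> = "\<Sigma> 0 n"
  note \<phi> = comp_hom_hom[OF le0, of n]
  note e' = deep_idempotentD[OF e]
  obtain h' where h': "h \<in> free_profinite (A 0)" "e \<odot>\<^bsub>A 0\<^esub> h = h" "h \<odot>\<^bsub>A 0\<^esub> e = h" "h' \<in> free_profinite (A 0)"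
    "e \<odot>\<^bsub>A 0\<^esub> h' = h'" "h \<odot>\<^bsub>A 0\<^esub> h' = e"
    by (rule fp.unit_groupE[OF h])
  obtain g where g: "g \<in> clo (A n) (L n)" "g \<odot>\<^bsub>A n\<^esub> g = g" "E 0 n g = e" using e unfolding deep_idempotent_def by blast
  note g' = clo_closed[OF g(1)]
  obtain M where M: "\<And>c t z v1 v2 v1' v2' s p. ?\<phi> [c] = t @ z \<Longrightarrow> t \<noteq> [] \<Longrightarrow> z \<noteq> [] \<Longrightarrow> v1 @ v2 \<in> L n \<Longrightarrow> v1' @ c # v2' \<in> L n \<Longrightarrow>
      M \<le> length s \<Longrightarrow> M \<le> length p \<Longrightarrow> suffix s (letterwise ?\<phi> v1) \<Longrightarrow> suffix s (letterwise ?\<phi> v1' @ t) \<Longrightarrow>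
      prefix p (letterwise ?\<phi> v2) \<Longrightarrow> \<not> prefix p (z @ letterwise ?\<phi> v2')"
    using not_desync_window[OF sync finite_alphabet L_words] by blast
  have "\<exists>w\<in>?\<phi> ` words (A n). w \<in> h r0" if r0: "r0 \<in> finite_congruences (A 0)" for r0
  proof -
    let ?ps = "ps_congruence (A 0) M"
    note p = ps_congruence[OF finite_alphabet, of 0 M]
    define r where "r = r0 \<inter> ?ps"
    have r: "r \<in> finite_congruences (A 0)" unfolding r_def by (rule finite_congruences_Int[OF r0 p])
    have psD: "take M u = take M v" "take M (rev u) = take M (rev v)" if "(u, v) \<in> r" for u v
      using that by (auto simp: r_def ps_congruence_def)
    have "g \<odot>\<^bsub>A n\<^esub> g \<in> clo (A n) (L n)" using g by simp
    \<comment> \<open>As \<open>g\<close> is an idempotent in the closure of the language, two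
      approximations of it occur side by side in a word of \<open>L n\<close>. The boundary between
      them is the reference cutting point.\<close>
    then obtain v1 v2 where v: "v1 \<in> g (pullback (A n) ?\<phi> r)" "v2 \<in> g (pullback (A n) ?\<phi> r)" "v1 @ v2 \<in> L n"
      using clo_split[OF _ g' g' pullback_congruence[OF \<phi> r]] by blast
    have vw: "v1 \<in> words (A n)" "v2 \<in> words (A n)"
      using v(1,2) free_profinite_rep(1)[OF g' pullback_congruence[OF \<phi> r]] by blast+
    let ?u1 = "letterwise ?\<phi> v1" and ?u2 = "letterwise ?\<phi> v2"
    have u: "?u1 \<in> e r" "?u2 \<in> e r"
      using profinite_extension_rep[OF \<phi> g' r v(1)] profinite_extension_rep[OF \<phi> g' r v(2)] g(3)
        word_hom_letterwise[OF \<phi>] vw by simp_all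
    have long: "M \<le> length w" if "w \<in> e r" for w
      using that free_profinite_mono[OF e'(1) r p] e'(3) unfolding K_def infinite_pw_def r_def by blast
    \<comment> \<open>The last \<open>M\<close> letters before the reference cut and, in
      \<open>q\<close>, the first \<open>M\<close> letters after it. Every approximation of
      \<open>e\<close> modulo \<open>r\<close> ends with \<open>s\<close> and begins with
      \<open>q\<close>.\<close>
    define s where "s = rev (take M (rev ?u1))"
    define q where "q = take M ?u2"
    have sq: "M \<le> length s" "M \<le> length q" using long u by (simp_all add: s_def q_def)
    have suf: "suffix s w" if "take M (rev w) = take M (rev ?u1)" for w
      unfolding s_def that[symmetric] suffix_to_prefix by (simp add: take_is_prefix)
    have pre: "prefix q w" if "take M w = take M ?u2" for w
      unfolding q_def that[symmetric] by (rule take_is_prefix)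
    have "(e \<odot>\<^bsub>A 0\<^esub> h) \<odot>\<^bsub>A 0\<^esub> h' \<in> clo (A 0) (L 0)" using h' e'(3) by (simp add: K_def)
    \<comment> \<open>The product e h h' equals \<open>e\<close>, so approximations of its three
      factors occur consecutively in a word of the language.\<close>
    then obtain a w b where awb: "a \<in> e r" "w \<in> h r" "b \<in> h' r" "a @ w @ b \<in> L 0"
      using clo_split3[OF _ e'(1) h'(1,4) r] by blast
    \<comment> \<open>Because h = e h and h' = e h', the words \<open>w\<close> and \<open>b\<close>
      begin like approximations of \<open>e\<close>; \<open>a\<close> and \<open>w\<close> end like
      them for the dual reason.\<close>
    have q_w: "prefix q w"
    proof (rule pre)
      have "?u2 @ w \<in> h r" using profinite_mult_rep[OF r e'(1) h'(1) u(2) awb(2)] h'(2) by simp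
      then have "take M w = take M (?u2 @ w)" using free_profinite_rep_iff[OF h'(1) r awb(2)] psD(1) by blast
      then show "take M w = take M ?u2" using long[OF u(2)] by simp
    qed
    have q_b: "prefix q b"
    proof (rule pre)
      have "?u2 @ b \<in> h' r" using profinite_mult_rep[OF r e'(1) h'(4) u(2) awb(3)] h'(5) by simp
      then have "take M b = take M (?u2 @ b)" using free_profinite_rep_iff[OF h'(4) r awb(3)] psD(1) by blast
      then show "take M b = take M ?u2" using long[OF u(2)] by simp
    qed
    have s_a: "suffix s a"
      by (rule suf) (use psD(2) free_profinite_rep_iff[OF e'(1) r awb(1)] u(1) in blast)
    have s_w: "suffix s w"
    proof (rule suf)
      have "w @ ?u1 \<in> h r" using profinite_mult_rep[OF r h'(1) e'(1) awb(2) u(1)] h'(3) by simp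
      then have "take M (rev w) = take M (rev (w @ ?u1))" using free_profinite_rep_iff[OF h'(1) r awb(2)] psD(2) by blast
      then show "take M (rev w) = take M (rev ?u1)" using long[OF u(1)] by simp
    qed
    \<comment> \<open>A position between \<open>s\<close> and \<open>q\<close> that fell inside a
      block would be desynchronized from the reference cut on a window of size
      \<open>M\<close>.\<close>
    have cut: "\<exists>V1 V2. V = V1 @ V2 \<and> letterwise ?\<phi> V1 = x \<and> letterwise ?\<phi> V2 = y"
      if V: "V \<in> L n" "letterwise ?\<phi> V = x @ y" and "suffix s x" "prefix q y" for V x y
    proof (rule ccontr)
      assume "\<not> ?thesis"
      then obtain V1 c V2 t z where "V = V1 @ c # V2" "?\<phi> [c] = t @ z" "t \<noteq> []" "z \<noteq> []"
        "x = letterwise ?\<phi> V1 @ t" "y = z @ letterwise ?\<phi> V2"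
        using cut_or_inside[OF V(2)] by blast
      then show False
        using M[of c t z v1 v2 V1 V2 s q] v(3) V(1) sq that(3,4) suf[of ?u1] pre[of ?u2] by simp
    qed
    obtain V x y where V: "V \<in> L n" "?\<phi> V = x @ (a @ w @ b) @ y" using L_in_image[OF le0 awb(4)] by blast
    have Vw: "V \<in> words (A n)" using V(1) L_words by blast
    have "letterwise ?\<phi> V = (x @ a) @ (w @ b @ y)" using V(2) word_hom_letterwise[OF \<phi> Vw] by simp
    then obtain V1 V2 where V12: "V = V1 @ V2" "letterwise ?\<phi> V2 = w @ (b @ y)"
      using cut[OF V(1), of "x @ a" "w @ b @ y"] s_a q_w by (auto simp: suffix_append)
    have wne: "w \<noteq> []" using free_profinite_rep(1)[OF h'(1) r awb(2)] by (simp add: words_def)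
    have "V2 \<noteq> []" using V12(2) wne by auto
    then have "V2 \<in> L n" using L_factor[of V1 V2 "[]"] V12(1) V(1) by simp
    then obtain V3 V4 where V34: "V2 = V3 @ V4" "letterwise ?\<phi> V3 = w"
      using cut[OF _ V12(2) s_w] q_b by auto
    have "V3 \<in> words (A n)" using V34 V12(1) Vw wne by (auto simp: words_def)
    then have "w \<in> ?\<phi> ` words (A n)" using V34(2) word_hom_letterwise[OF \<phi>] by (metis imageI)
    moreover have "w \<in> h r0" using free_profinite_mono[OF h'(1) r r0] awb(2) by (auto simp: r_def)
    ultimately show ?thesis by blast
  qed
  then show ?thesis using h'(1) by (simp add: clo_def)
qed

lemma saturating_if_sync:
  assumes "\<And>n. \<not> desync (\<Sigma> 0 n) (L n)"
  shows "saturating_seq A \<sigma>"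
  using deep_idempotent_exists saturatingI units_subset_image assms unfolding profinite_image_clo by blast

end


section \<open>Blocks of bi-infinite images\<close>

text \<open>The position in \<open>biinf_image \<phi> x\<close> at which the block of
  \<open>x i\<close> begins, normalized so that the block of \<open>x 0\<close> begins at the
  origin.\<close>

definition cut :: "('a list \<Rightarrow> 'b list) \<Rightarrow> (int \<Rightarrow> 'a) \<Rightarrow> int \<Rightarrow> int" where
  "cut \<phi> x i = (if 0 \<le> i then int (length (letterwise \<phi> (map x [0..i - 1])))
     else - int (length (letterwise \<phi> (map x [i..-1]))))"

lemma cut_0 [simp]: "cut \<phi> x 0 = 0"
  by (simp add: cut_def)

lemma cut_step: "cut \<phi> x (i + 1) = cut \<phi> x i + int (length (\<phi> [x i]))"
proof -
  consider "i < -1" | "i = -1" | "0 \<le> i" by linarith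
  then show ?thesis
  proof cases
    case 1
    then have "[i..-1] = i # [i + 1..-1]" by (simp add: upto_rec1)
    then show ?thesis using 1 by (simp add: cut_def)
  next
    case 2
    then show ?thesis by (simp add: cut_def upto_rec1)
  next
    case 3
    then have "[0..i] = [0..i - 1] @ [i]" by (simp add: upto_rec2)
    then show ?thesis using 3 by (simp add: cut_def)
  qed
qed

lemma cut_interval:
  assumes "i \<le> j"
  shows "cut \<phi> x j - cut \<phi> x i = int (length (letterwise \<phi> (map x [i..j - 1])))"
  using assms
proof (induction j rule: int_ge_induct)
  case (step j)
  have "[i..j] = [i..j - 1] @ [j]" using step.hyps by (simp add: upto_rec2)
  then show ?case using step.IH cut_step[of \<phi> x j] by simp
qed simp

lemma letterwise_concat: "letterwise \<phi> (map x js) = concat (map (\<lambda>j. \<phi> [x j]) js)"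
  by (simp add: letterwise_def comp_def)

locale nonerasing =
  fixes \<phi> :: "'a list \<Rightarrow> 'b list" and x :: "int \<Rightarrow> 'a"
  assumes nonempty: "\<phi> [x j] \<noteq> []"
begin

lemma cut_less: "i < j \<Longrightarrow> cut \<phi> x i < cut \<phi> x j"
proof (induction j rule: int_gr_induct)
  case base
  show ?case using cut_step[of \<phi> x i] nonempty[of i] by simp
next
  case (step j)
  then show ?case using cut_step[of \<phi> x j] by simp
qed

lemma cut_less_iff: "cut \<phi> x i < cut \<phi> x j \<longleftrightarrow> i < j"
  using cut_less by (metis less_asym linorder_neqE)

lemma cut_add_ge: "0 \<le> j \<Longrightarrow> j \<le> cut \<phi> x (i + j) - cut \<phi> x i"
proof (induction j rule: int_ge_induct)
  case (step j)
  have "cut \<phi> x (i + j) < cut \<phi> x (i + j + 1)" by (rule cut_less) simp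
  then show ?case using step.IH by (simp add: add.assoc)
qed simp

lemma cut_diff_ge: "i \<le> j \<Longrightarrow> j - i \<le> cut \<phi> x j - cut \<phi> x i"
  using cut_add_ge[of "j - i" i] by simp

lemma position_in_block: "\<exists>i. cut \<phi> x i \<le> q \<and> q < cut \<phi> x (i + 1)"
proof -
  define l where "l = - \<bar>q\<bar>"
  have l: "cut \<phi> x l \<le> q" using cut_diff_ge[of l 0] by (simp add: l_def)
  have u: "q < cut \<phi> x (\<bar>q\<bar> + 1)" using cut_diff_ge[of 0 "\<bar>q\<bar> + 1"] by simp
  have "\<exists>i. cut \<phi> x i \<le> q \<and> q < cut \<phi> x (i + 1)" if "l \<le> j" "q < cut \<phi> x j" for j
    using that
  proof (induction j rule: int_ge_induct)
    case base
    then show ?case using l by simp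
  next
    case (step j)
    show ?case
    proof (cases "q < cut \<phi> x j")
      case False
      then show ?thesis using step.prems by (intro exI[of _ j]) simp
    qed (rule step.IH)
  qed
  from this[OF _ u] show ?thesis by (simp add: l_def)
qed

lemma image_block:
  assumes "p < length (\<phi> [x i])"
  shows "biinf_image \<phi> x (cut \<phi> x i + int p) = \<phi> [x i] ! p"
proof (cases "0 \<le> i")
  case True
  let ?W = "letterwise \<phi> (map x [0..i - 1])"
  have W: "concat (map (\<lambda>j. \<phi> [x j]) [0..i]) = ?W @ \<phi> [x i]"
    using True by (simp add: letterwise_concat upto_rec2)
  have "cut \<phi> x i + int p = int (length ?W + p)" using True by (simp add: cut_def)
  moreover have "biinf_image \<phi> x (int (length ?W + p)) = concat (map (\<lambda>j. \<phi> [x j]) [0..i]) ! (length ?W + p)"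
    by (rule biinf_image_right[where \<phi> = \<phi> and x = x, OF nonempty]) (simp add: W assms)
  ultimately show ?thesis by (simp add: W nth_append)
next
  case False
  let ?W = "letterwise \<phi> (map x [i + 1..-1])"
  have W: "concat (map (\<lambda>j. \<phi> [x j]) [i..-1]) = \<phi> [x i] @ ?W"
    using False by (simp add: letterwise_concat upto_rec1)
  \<comment> \<open>The left half of the image is indexed from the origin to the left; this is the
    index there of the letter at offset \<open>p\<close> in the block.\<close>
  define k where "k = length ?W + (length (\<phi> [x i]) - 1 - p)"
  have len: "length (letterwise \<phi> (map x [i..-1])) = length (\<phi> [x i]) + length ?W"
    using W by (simp add: letterwise_concat)
  have "cut \<phi> x i + int p = - int k - 1"
    using False len assms by (simp add: cut_def k_def)
  moreover have "biinf_image \<phi> x (- int k - 1) = rev (concat (map (\<lambda>j. \<phi> [x j]) [i..-1])) ! k"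
    by (rule biinf_image_left[where \<phi> = \<phi> and x = x, OF nonempty]) (use assms in \<open>simp add: W k_def\<close>)
  moreover have "rev (\<phi> [x i] @ ?W) ! k = \<phi> [x i] ! p"
  proof -
    have k: "k < length (\<phi> [x i] @ ?W)" "length (\<phi> [x i] @ ?W) - Suc k = p"
      using assms by (simp_all add: k_def)
    show ?thesis unfolding rev_nth[OF k(1)] k(2) using assms by (simp add: nth_append)
  qed
  ultimately show ?thesis by (simp add: W)
qed

lemma image_window:
  assumes "i \<le> j" "p < length (letterwise \<phi> (map x [i..j - 1]))"
  shows "biinf_image \<phi> x (cut \<phi> x i + int p) = letterwise \<phi> (map x [i..j - 1]) ! p"
  using assms
proof (induction j arbitrary: p rule: int_ge_induct)
  case (step j)
  have spl: "[i..j] = [i..j - 1] @ [j]" using step.hyps by (simp add: upto_rec2)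
  let ?W = "letterwise \<phi> (map x [i..j - 1])"
  show ?case
  proof (cases "p < length ?W")
    case True
    then show ?thesis using step.IH[of p] spl by (simp add: nth_append)
  next
    case False
    define q where "q = p - length ?W"
    have q: "p = length ?W + q" "q < length (\<phi> [x j])" using False step.prems spl by (auto simp: q_def)
    have "cut \<phi> x i + int p = cut \<phi> x j + int q" using cut_interval[OF step.hyps, of \<phi> x] q(1) by simp
    then have "biinf_image \<phi> x (cut \<phi> x i + int p) = \<phi> [x j] ! q" using image_block[OF q(2)] by (simp only:)
    then show ?thesis using q(1) spl by (simp add: nth_append)
  qed
qed simp

text \<open>The blocks cover all positions, so values on blocks determine the word. Images of
  shifted words and of compositions are identified in this way.\<close>

lemma image_unique:
  assumes "\<And>i p. p < length (\<phi> [x i]) \<Longrightarrow> y (cut \<phi> x i + int p) = \<phi> [x i] ! p"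
  shows "y = biinf_image \<phi> x"
proof
  fix q
  obtain i where i: "cut \<phi> x i \<le> q" "q < cut \<phi> x (i + 1)" using position_in_block by blast
  define p where "p = nat (q - cut \<phi> x i)"
  have p: "q = cut \<phi> x i + int p" "p < length (\<phi> [x i])" using i cut_step[of \<phi> x i] by (auto simp: p_def)
  show "y q = biinf_image \<phi> x q" using assms[OF p(2)] image_block[OF p(2)] p(1) by simp
qed

end

abbreviation (input) shift_by :: "int \<Rightarrow> (int \<Rightarrow> 'a) \<Rightarrow> int \<Rightarrow> 'a" where
  "shift_by k x \<equiv> \<lambda>i. x (i + k)"

lemma shift_map_power: "(shift_map ^^ k) x = shift_by (int k) x"
  by (induction k arbitrary: x) (auto simp: shift_map_def fun_eq_iff add_ac)

lemma cut_shift: "cut \<phi> (shift_by k x) i = cut \<phi> x (i + k) - cut \<phi> x k"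
proof -
  have "cut \<phi> (shift_by k x) j = cut \<phi> x (j + k) - cut \<phi> x k" if "0 \<le> j" for j
    using that
  proof (induction j rule: int_ge_induct)
    case (step j)
    then show ?case using cut_step[of \<phi> "shift_by k x" j] cut_step[of \<phi> x "j + k"] by (simp add: add_ac)
  qed simp
  moreover have "cut \<phi> (shift_by k x) j = cut \<phi> x (j + k) - cut \<phi> x k" if "j \<le> 0" for j
    using that
  proof (induction j rule: int_le_induct)
    case (step j)
    then show ?case using cut_step[of \<phi> "shift_by k x" "j - 1"] cut_step[of \<phi> x "j - 1 + k"] by (simp add: algebra_simps)
  qed simp
  ultimately show ?thesis by (metis linear)
qed

lemma image_shift:
  assumes "nonerasing \<phi> x"
  shows "biinf_image \<phi> (shift_by k x) = shift_by (cut \<phi> x k) (biinf_image \<phi> x)"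
proof -
  interpret x: nonerasing \<phi> x by fact
  interpret s: nonerasing \<phi> "shift_by k x" by unfold_locales (rule x.nonempty)
  show ?thesis
  proof (rule s.image_unique[symmetric])
    fix i p assume "p < length (\<phi> [x (i + k)])"
    from x.image_block[OF this]
    show "biinf_image \<phi> x (cut \<phi> (shift_by k x) i + int p + cut \<phi> x k) = \<phi> [x (i + k)] ! p"
      by (simp add: cut_shift algebra_simps)
  qed
qed

lemma map_shift_upto: "map (shift_by k x) [i..j] = map x [i + k..j + k]"
proof (cases "i \<le> j")
  case True
  then show ?thesis
    by (intro nth_equalityI) (auto simp: nth_upto algebra_simps)
qed simp

lemma map_image_upto:
  assumes "nonerasing \<psi> x" "i \<le> j"
  shows "map (biinf_image \<psi> x) [cut \<psi> x i..cut \<psi> x j - 1] = letterwise \<psi> (map x [i..j - 1])"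
proof -
  interpret nonerasing \<psi> x by fact
  have len: "cut \<psi> x j - cut \<psi> x i = int (length (letterwise \<psi> (map x [i..j - 1])))" by (rule cut_interval[OF assms(2)])
  show ?thesis
  proof (rule nth_equalityI)
    show "length (map (biinf_image \<psi> x) [cut \<psi> x i..cut \<psi> x j - 1]) = length (letterwise \<psi> (map x [i..j - 1]))"
      using len by simp
    fix p assume "p < length (map (biinf_image \<psi> x) [cut \<psi> x i..cut \<psi> x j - 1])"
    then have p: "p < length (letterwise \<psi> (map x [i..j - 1]))" using len by simp
    then have "cut \<psi> x i + int p \<le> cut \<psi> x j - 1" using len by simp
    then show "map (biinf_image \<psi> x) [cut \<psi> x i..cut \<psi> x j - 1] ! p = letterwise \<psi> (map x [i..j - 1]) ! p"
      using image_window[OF assms(2) p] p len by (simp add: nth_upto)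
  qed
qed

lemma image_compose:
  assumes \<psi>: "nonerasing \<psi> x" and \<phi>: "nonerasing \<phi> (biinf_image \<psi> x)"
    and comp: "\<And>i. \<rho> [x i] = letterwise \<phi> (\<psi> [x i])"
  shows "nonerasing \<rho> x" "cut \<rho> x i = cut \<phi> (biinf_image \<psi> x) (cut \<psi> x i)"
    "biinf_image \<rho> x = biinf_image \<phi> (biinf_image \<psi> x)"
proof -
  let ?y = "biinf_image \<psi> x"
  interpret P: nonerasing \<psi> x by fact
  interpret F: nonerasing \<phi> ?y by fact
  have blk: "map ?y [cut \<psi> x i..cut \<psi> x (i + 1) - 1] = \<psi> [x i]" for i
    using map_image_upto[OF \<psi>, of i "i + 1"] by simp
  have len: "cut \<phi> ?y (cut \<psi> x (i + 1)) - cut \<phi> ?y (cut \<psi> x i) = int (length (\<rho> [x i]))" for i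
    using cut_interval[of "cut \<psi> x i" "cut \<psi> x (i + 1)" \<phi> ?y] P.cut_less[of i "i + 1"] blk[of i] comp[of i] by simp
  show ne: "nonerasing \<rho> x"
  proof
    fix j
    have "cut \<phi> ?y (cut \<psi> x j) < cut \<phi> ?y (cut \<psi> x (j + 1))" by (intro F.cut_less P.cut_less) simp
    then show "\<rho> [x j] \<noteq> []" using len[of j] by auto
  qed
  interpret R: nonerasing \<rho> x by (rule ne)
  have cut_eq: "cut \<rho> x i = cut \<phi> ?y (cut \<psi> x i)" for i
  proof -
    have "cut \<rho> x j = cut \<phi> ?y (cut \<psi> x j)" if "0 \<le> j" for j
      using that
    proof (induction j rule: int_ge_induct)
      case (step j)
      then show ?case using cut_step[of \<rho> x j] len[of j] by simp
    qed simp
    moreover have "cut \<rho> x j = cut \<phi> ?y (cut \<psi> x j)" if "j \<le> 0" for j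
      using that
    proof (induction j rule: int_le_induct)
      case (step j)
      then show ?case using cut_step[of \<rho> x "j - 1"] len[of "j - 1"] by simp
    qed simp
    ultimately show ?thesis by (metis linear)
  qed
  then show "cut \<rho> x i = cut \<phi> ?y (cut \<psi> x i)" .
  show "biinf_image \<rho> x = biinf_image \<phi> ?y"
  proof (rule R.image_unique[symmetric])
    fix i p assume p: "p < length (\<rho> [x i])"
    have "\<rho> [x i] = letterwise \<phi> (map ?y [cut \<psi> x i..cut \<psi> x (i + 1) - 1])" using blk comp by simp
    then show "biinf_image \<phi> ?y (cut \<rho> x i + int p) = \<rho> [x i] ! p"
      using F.image_window[of "cut \<psi> x i" "cut \<psi> x (i + 1)" p] P.cut_less[of i "i + 1"] p by (simp add: cut_eq)
  qed
qed


section \<open>Recognizability and desynchronization\<close>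

lemma upto_split:
  fixes a b c :: int
  assumes "a \<le> b" "b \<le> c + 1"
  shows "[a..c] = [a..b - 1] @ [b..c]"
proof (cases "b = c + 1")
  case False
  then show ?thesis using assms by (intro upto_split1) auto
qed simp

lemma suffix_map_upto:
  assumes "a \<le> b" "b \<le> c + 1"
  shows "suffix (map f [b..c]) (map f [a..c :: int])"
  unfolding upto_split[OF assms] map_append suffix_def by blast

lemma prefix_map_upto:
  assumes "a \<le> b + 1" "b \<le> c"
  shows "prefix (map f [a..b]) (map f [a..c :: int])"
  using upto_split[of a "b + 1" c] assms by simp

text \<open>Both functions enumerate the same set in increasing order, so they agree on successors
  and predecessors; the common value at 0 starts the induction in both directions.\<close>

lemma strict_mono_int_range_eq:
  fixes f g :: "int \<Rightarrow> int"
  assumes f: "\<And>i j. i < j \<Longrightarrow> f i < f j" and g: "\<And>i j. i < j \<Longrightarrow> g i < g j"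
    and "f 0 = g 0" "range f = range g"
  shows "f i = g i"
proof -
  have gf: "g i < g j \<longleftrightarrow> i < j" "f i < f j \<longleftrightarrow> i < j" for i j
    using f g by (metis less_asym linorder_neqE)+
  have *: "f (i + 1) = g (i + 1) \<longleftrightarrow> f i = g i" for i
  proof -
    obtain j k where j: "f (i + 1) = g j" and k: "g (i + 1) = f k" using assms(4) by (metis rangeE rangeI)
    obtain j' k' where j': "f i = g j'" and k': "g i = f k'" using assms(4) by (metis rangeE rangeI)
    show ?thesis
    proof
      assume e: "f i = g i"
      have "i < j" using f[of i "i + 1"] unfolding e j gf by simp
      moreover have "i < k" using g[of i "i + 1"] unfolding e[symmetric] k gf by simp
      ultimately have "g (i + 1) \<le> g j" "f (i + 1) \<le> f k"
        using gf by (metis linorder_not_less zless_add1_eq order_less_le zle_add1_eq_le zless_imp_add1_zle)+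
      then show "f (i + 1) = g (i + 1)" using j k by simp
    next
      assume e: "f (i + 1) = g (i + 1)"
      have "j' < i + 1" using f[of i "i + 1"] unfolding e j' gf by simp
      moreover have "k' < i + 1" using g[of i "i + 1"] unfolding e[symmetric] k' gf by simp
      ultimately have "g j' \<le> g i" "f k' \<le> f i"
        using gf by (metis linorder_not_less zless_add1_eq order_less_le)+
      then show "f i = g i" using j' k' by simp
    qed
  qed
  show ?thesis
  proof (induction i rule: int_induct[of _ 0])
    case base
    show ?case by fact
  next
    case (step1 i)
    then show ?case using * by blast
  next
    case (step2 i)
    then show ?case using *[of "i - 1"] by simp
  qed
qed

context primitive_directive
begin

definition X :: "nat \<Rightarrow> (int \<Rightarrow> 'a) set" where
  "X n = seq_shift (\<lambda>i. A (i + n)) (\<lambda>i. \<sigma> (i + n))"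

lemma X_iff: "x \<in> X n \<longleftrightarrow> range x \<subseteq> A n \<and> (\<forall>i j. i \<le> j \<longrightarrow> map x [i..j] \<in> L n)"
  unfolding X_def seq_shift_def seq_language_shift by simp

lemma recognizable_at_iff: "recognizable_at A \<sigma> n \<longleftrightarrow> recognizable_in (A n) (\<sigma> n) (X (Suc n))"
  by (simp add: recognizable_at_def X_def)

lemma X_letter: "x \<in> X n \<Longrightarrow> x i \<in> A n"
  unfolding X_iff by blast

lemma X_nonerasing:
  assumes "n \<le> m" "x \<in> X m"
  shows "nonerasing (\<Sigma> n m) x"
proof
  fix j
  show "\<Sigma> n m [x j] \<noteq> []" by (rule word_hom_letter(1)[OF comp_hom_hom[OF assms(1)] X_letter[OF assms(2)]])
qed

lemma X_shift: "x \<in> X n \<Longrightarrow> shift_by k x \<in> X n"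
  unfolding X_iff map_shift_upto by auto

lemma X_image:
  assumes nm: "n \<le> m" and x: "x \<in> X m"
  shows "biinf_image (\<Sigma> n m) x \<in> X n"
proof -
  let ?\<phi> = "\<Sigma> n m"
  interpret nonerasing ?\<phi> x by (rule X_nonerasing[OF assms])
  let ?y = "biinf_image ?\<phi> x"
  have w: "map ?y [i..j] \<in> L n" if "i \<le> j" for i j
  proof -
    obtain a b where a: "cut ?\<phi> x a \<le> i" and b: "j < cut ?\<phi> x (b + 1)" using position_in_block by meson
    have "cut ?\<phi> x a < cut ?\<phi> x (b + 1)" using a b that by linarith
    then have ab: "a < b + 1" by (simp add: cut_less_iff)
    have wx: "map x [a..b] \<in> L m" using x ab by (auto simp: X_iff)
    have "map ?y [cut ?\<phi> x a..cut ?\<phi> x (b + 1) - 1] = letterwise ?\<phi> (map x [a..b])"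
      using map_image_upto[OF X_nonerasing[OF assms], of a "b + 1"] ab by simp
    also have "\<dots> = ?\<phi> (map x [a..b])" using comp_hom_letterwise[OF nm] wx L_words by (metis subsetD)
    finally have "map ?y [cut ?\<phi> x a..cut ?\<phi> x (b + 1) - 1] \<in> L n" using L_image[OF nm wx] by simp
    moreover have "[cut ?\<phi> x a..cut ?\<phi> x (b + 1) - 1] = [cut ?\<phi> x a..i - 1] @ [i..j] @ [j + 1..cut ?\<phi> x (b + 1) - 1]"
      using upto_split[of "cut ?\<phi> x a" i "cut ?\<phi> x (b + 1) - 1"] upto_split[of i "j + 1" "cut ?\<phi> x (b + 1) - 1"] a b that
      by simp
    ultimately show ?thesis using L_factor[of "map ?y [cut ?\<phi> x a..i - 1]" "map ?y [i..j]"] that by simp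
  qed
  have "?y i \<in> A n" for i
    using subsetD[OF L_words w[of i i]] by (simp add: words_def)
  then show ?thesis using w by (auto simp: X_iff)
qed

text \<open>The definition speaks only of offsets inside the block at the origin. Shifting
  \<open>x'\<close> to the block that contains position \<open>k\<close> reduces an arbitrary shift
  to this case, and uniqueness against the pair \<open>(0, x)\<close> forces the remaining offset to
  be 0.\<close>

lemma recognizable_at_cut:
  assumes rec: "recognizable_at A \<sigma> n" and x: "x \<in> X (Suc n)" and x': "x' \<in> X (Suc n)"
    and eq: "biinf_image (\<sigma> n) x = shift_by k (biinf_image (\<sigma> n) x')"
  shows "\<exists>i. k = cut (\<sigma> n) x' i \<and> x = shift_by i x'"
proof -
  have ne: "nonerasing (\<sigma> n) x" "nonerasing (\<sigma> n) x'"
    using X_nonerasing[of n "Suc n"] x x' by auto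
  interpret P: nonerasing "\<sigma> n" x by (rule ne)
  interpret P': nonerasing "\<sigma> n" x' by (rule ne)
  obtain i where i: "cut (\<sigma> n) x' i \<le> k" "k < cut (\<sigma> n) x' (i + 1)" using P'.position_in_block by blast
  define \<kappa> where "\<kappa> = nat (k - cut (\<sigma> n) x' i)"
  have \<kappa>: "k = cut (\<sigma> n) x' i + int \<kappa>" "\<kappa> < length (\<sigma> n [x' i])"
    using i cut_step[of "\<sigma> n" x' i] by (auto simp: \<kappa>_def)
  let ?y = "biinf_image (\<sigma> n) x"
  have y: "range ?y \<subseteq> A n" using X_image[of n "Suc n" x] x by (auto simp: X_iff)
  have "biinf_image (\<sigma> n) (shift_by i x') = shift_by (cut (\<sigma> n) x' i) (biinf_image (\<sigma> n) x')"
    by (rule image_shift[OF ne(2)])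
  then have 2: "(shift_map ^^ \<kappa>) (biinf_image (\<sigma> n) (shift_by i x')) = ?y"
    unfolding shift_map_power eq \<kappa>(1) by (simp add: add_ac)
  have u: "\<exists>\<^sub>\<le>\<^sub>1(k, x). x \<in> X (Suc n) \<and> k < length (\<sigma> n [x 0]) \<and> (shift_map ^^ k) (biinf_image (\<sigma> n) x) = ?y"
    using rec y unfolding recognizable_at_iff recognizable_in_def by blast
  have "(0, x) = (\<kappa>, shift_by i x')"
    by (rule Uniq_D[OF u]) (use x X_shift[OF x', of i] \<kappa>(2) 2 P.nonempty[of 0] in auto)
  then show ?thesis using \<kappa>(1) by auto
qed

lemma id_image:
  "cut id x i = i" "biinf_image id x = (x :: int \<Rightarrow> 'a)"
proof -
  interpret nonerasing id x by unfold_locales simp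
  have st: "cut id x (j + 1) = cut id x j + 1" for j
    unfolding cut_step[of id x j] by simp
  have *: "cut id x i = i" for i
  proof (induction i rule: int_induct[of _ 0])
    case base
    show ?case by (rule cut_0)
  next
    case (step1 i)
    then show ?case using st[of i] by linarith
  next
    case (step2 i)
    then show ?case using st[of "i - 1"] unfolding diff_add_cancel by linarith
  qed
  then show "cut id x i = i" .
  show "biinf_image id x = x"
  proof (rule image_unique[symmetric])
    fix i p assume "p < length (id [x i])"
    then have "p = 0" by simp
    then show "x (cut id x i + int p) = id [x i] ! p" unfolding * by simp
  qed
qed

lemma image_comp_hom:
  assumes "n \<le> m" "x \<in> X (Suc m)"
  shows "cut (\<Sigma> n (Suc m)) x i = cut (\<Sigma> n m) (biinf_image (\<sigma> m) x) (cut (\<sigma> m) x i)"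
    "biinf_image (\<Sigma> n (Suc m)) x = biinf_image (\<Sigma> n m) (biinf_image (\<sigma> m) x)"
proof -
  have ne: "nonerasing (\<sigma> m) x" using X_nonerasing[of m "Suc m" x] assms(2) by simp
  have y: "biinf_image (\<sigma> m) x \<in> X m" using X_image[of m "Suc m" x] assms(2) by simp
  have "\<Sigma> n (Suc m) [x i] = letterwise (\<Sigma> n m) (\<sigma> m [x i])" for i
    using comp_hom_letter_split(1)[OF assms(1), of "Suc m" "x i"] X_letter[OF assms(2)] by simp
  note c = image_compose[OF ne X_nonerasing[OF assms(1) y] this]
  show "cut (\<Sigma> n (Suc m)) x i = cut (\<Sigma> n m) (biinf_image (\<sigma> m) x) (cut (\<sigma> m) x i)"
    "biinf_image (\<Sigma> n (Suc m)) x = biinf_image (\<Sigma> n m) (biinf_image (\<sigma> m) x)" by (rule c)+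
qed

text \<open>The cuts of a composition are those cuts of the outer homomorphism that sit at cuts of
  the inner one, so recognizability is applied level by level, from \<open>n\<close>
  upwards.\<close>

lemma recognizable_composition:
  assumes "n \<le> m" "\<And>j. n \<le> j \<Longrightarrow> j < m \<Longrightarrow> recognizable_at A \<sigma> j" and "x \<in> X m" "x' \<in> X m"
    and "biinf_image (\<Sigma> n m) x = shift_by k (biinf_image (\<Sigma> n m) x')"
  shows "\<exists>i. k = cut (\<Sigma> n m) x' i \<and> x = shift_by i x'"
  using assms
proof (induction m arbitrary: x x' k rule: dec_induct)
  case base
  show ?case using base.prems(4) unfolding comp_hom_same id_image by blast
next
  case (step m)
  let ?y = "biinf_image (\<sigma> m) x" and ?y' = "biinf_image (\<sigma> m) x'"
  have y: "?y \<in> X m" "?y' \<in> X m"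
    using X_image[of m "Suc m"] step.prems(2,3) by auto
  have "biinf_image (\<Sigma> n m) ?y = shift_by k (biinf_image (\<Sigma> n m) ?y')"
    using step.prems(4) image_comp_hom(2)[OF step.hyps(1)] step.prems(2,3) by metis
  then obtain j where j: "k = cut (\<Sigma> n m) ?y' j" "?y = shift_by j ?y'"
    using step.IH[OF _ y] step.prems(1) by (meson less_SucI)
  obtain i where i: "j = cut (\<sigma> m) x' i" "x = shift_by i x'"
    using recognizable_at_cut[OF step.prems(1) step.prems(2,3) j(2)] step.hyps(1) by auto
  have "k = cut (\<Sigma> n (Suc m)) x' i" unfolding image_comp_hom(1)[OF step.hyps(1) step.prems(3)] i(1)[symmetric] by (rule j(1))
  then show ?case using i(2) by blast
qed

text \<open>Both words are recentred at the cut that is not shared: \<open>u\<close> starts there,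
  \<open>u'\<close> starts at the block that contains it. Windows of \<open>u\<close> and
  \<open>u'\<close> around the origin are the two parsings.\<close>

lemma desync_of_uncommon_cut:
  assumes nm: "n \<le> m" and x: "x \<in> X m" and x': "x' \<in> X m"
    and eq: "biinf_image (\<Sigma> n m) x = shift_by \<kappa> (biinf_image (\<Sigma> n m) x')"
    and unc: "\<And>i'. cut (\<Sigma> n m) x i + \<kappa> \<noteq> cut (\<Sigma> n m) x' i'"
  shows "desync (\<Sigma> n m) (L m)"
proof -
  let ?\<phi> = "\<Sigma> n m"
  interpret P': nonerasing ?\<phi> x' by (rule X_nonerasing[OF nm x'])
  define k where "k = cut ?\<phi> x i + \<kappa>"
  obtain i' where i': "cut ?\<phi> x' i' \<le> k" "k < cut ?\<phi> x' (i' + 1)" using P'.position_in_block by blast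
  define u u' where "u = shift_by i x" and "u' = shift_by i' x'"
  have uX: "u \<in> X m" "u' \<in> X m" unfolding u_def u'_def using x x' by (auto intro: X_shift)
  note ne = X_nonerasing[OF nm uX(1)] X_nonerasing[OF nm uX(2)]
  interpret U: nonerasing ?\<phi> u by (rule ne)
  interpret U': nonerasing ?\<phi> u' by (rule ne)
  let ?Y = "biinf_image ?\<phi> u" and ?Y' = "biinf_image ?\<phi> u'"
  \<comment> \<open>The offset of the cut inside the block of \<open>u' 0\<close>; it is strictly
    inside because the cut is not shared.\<close>
  define T where "T = k - cut ?\<phi> x' i'"
  have T: "0 < T" "T < cut ?\<phi> u' 1"
    using i' unc[of i'] cut_shift[where \<phi> = ?\<phi> and x = x' and k = i' and i = 1] by (auto simp: T_def k_def u'_def add.commute)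
  have YY: "?Y = shift_by T ?Y'"
    unfolding u_def u'_def image_shift[OF X_nonerasing[OF nm x]] image_shift[OF X_nonerasing[OF nm x']] eq
    by (simp add: T_def k_def algebra_simps)
  define c where "c = u' 0"
  have c1: "cut ?\<phi> u' 1 = int (length (?\<phi> [c]))" using cut_step[of ?\<phi> u' 0] by (simp add: c_def)
  have wc: "?\<phi> [c] = map ?Y' [0..cut ?\<phi> u' 1 - 1]"
    using map_image_upto[OF ne(2), of 0 1] by (simp add: c_def)
  define t z where "t = map ?Y' [0..T - 1]" and "z = map ?Y' [T..cut ?\<phi> u' 1 - 1]"
  have tz: "?\<phi> [c] = t @ z"
    unfolding wc t_def z_def using upto_split[of 0 T "cut ?\<phi> u' 1 - 1"] T by simp
  have "\<exists>v1 v2 v1' v2' s p. v1 @ v2 \<in> L m \<and> v1' @ c # v2' \<in> L m \<and> M \<le> length s \<and> M \<le> length p \<and>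
      suffix s (letterwise ?\<phi> v1) \<and> suffix s (letterwise ?\<phi> v1' @ t) \<and>
      prefix p (letterwise ?\<phi> v2) \<and> prefix p (z @ letterwise ?\<phi> v2')" for M
  proof -
    \<comment> \<open>The radius exceeds \<open>M\<close> so that the windows are nonempty also for
      \<open>M = 0\<close>; images are at least as long as the windows.\<close>
    define l where "l = int (Suc M)"
    have l: "0 < l" by (simp add: l_def)
    let ?v1 = "map u [-l..-1]" and ?v2 = "map u [0..l - 1]" and ?v1' = "map u' [-l..-1]" and ?v2' = "map u' [1..l]"
    have "?v1 @ ?v2 = map u [-l..l - 1]" using upto_split[of "-l" 0 "l - 1"] l by simp
    then have m1: "?v1 @ ?v2 \<in> L m" using uX(1) l by (simp add: X_iff)
    have "[-l..l] = [-l..-1] @ 0 # [1..l]" using l upto_split[of "-l" 0 l] upto_rec1[of 0 l] by simp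
    then have "?v1' @ c # ?v2' = map u' [-l..l]" by (simp add: c_def)
    then have m2: "?v1' @ c # ?v2' \<in> L m" using uX(2) l by (simp add: X_iff)
    have e1: "letterwise ?\<phi> ?v1 = map ?Y [cut ?\<phi> u (-l)..-1]"
      using map_image_upto[OF ne(1), of "-l" 0] l by simp
    have e2: "letterwise ?\<phi> ?v2 = map ?Y [0..cut ?\<phi> u l - 1]"
      using map_image_upto[OF ne(1), of 0 l] l by simp
    have "letterwise ?\<phi> ?v1' = map ?Y' [cut ?\<phi> u' (-l)..-1]"
      using map_image_upto[OF ne(2), of "-l" 0] l by simp
    moreover have cl: "cut ?\<phi> u' (-l) \<le> -l" using U'.cut_diff_ge[of "-l" 0] l by simp
    ultimately have "letterwise ?\<phi> ?v1' @ t = map ?Y' [cut ?\<phi> u' (-l)..T - 1]"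
      using upto_split[of "cut ?\<phi> u' (-l)" 0 "T - 1"] T l unfolding t_def by simp
    also have "\<dots> = map ?Y [cut ?\<phi> u' (-l) - T..-1]" unfolding YY map_shift_upto by simp
    finally have e3: "letterwise ?\<phi> ?v1' @ t = map ?Y [cut ?\<phi> u' (-l) - T..-1]" .
    have c3: "l \<le> cut ?\<phi> u' (l + 1) - cut ?\<phi> u' 1" using U'.cut_diff_ge[of 1 "l + 1"] l by simp
    have "letterwise ?\<phi> ?v2' = map ?Y' [cut ?\<phi> u' 1..cut ?\<phi> u' (l + 1) - 1]"
      using map_image_upto[OF ne(2), of 1 "l + 1"] l by simp
    then have "z @ letterwise ?\<phi> ?v2' = map ?Y' [T..cut ?\<phi> u' (l + 1) - 1]"
      using upto_split[of T "cut ?\<phi> u' 1" "cut ?\<phi> u' (l + 1) - 1"] T l c3 unfolding z_def by simp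
    also have "\<dots> = map ?Y [0..cut ?\<phi> u' (l + 1) - 1 - T]" unfolding YY map_shift_upto by simp
    finally have e4: "z @ letterwise ?\<phi> ?v2' = map ?Y [0..cut ?\<phi> u' (l + 1) - 1 - T]" .
    let ?s = "map ?Y [-l..-1]" and ?p = "map ?Y [0..l - 1]"
    have "cut ?\<phi> u (-l) \<le> -l" "l \<le> cut ?\<phi> u l" using U.cut_diff_ge[of "-l" 0] U.cut_diff_ge[of 0 l] l by simp_all
    then have "suffix ?s (letterwise ?\<phi> ?v1)" "prefix ?p (letterwise ?\<phi> ?v2)"
      "suffix ?s (letterwise ?\<phi> ?v1' @ t)" "prefix ?p (z @ letterwise ?\<phi> ?v2')"
      unfolding e1 e2 e3 e4 using l cl c3 T by (intro suffix_map_upto prefix_map_upto; simp)+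
    moreover have "M \<le> length ?s" "M \<le> length ?p" by (simp_all add: l_def)
    ultimately show ?thesis using m1 m2 by blast
  qed
  moreover have "t \<noteq> []" "z \<noteq> []" using T by (simp_all add: t_def z_def)
  ultimately show ?thesis unfolding desync_def using tz by blast
qed

text \<open>If each word had all the cuts of the other, the two sequences of cuts would coincide
  after a shift, hence so would the blocks. Injectivity on letters then makes the words equal up to
  that shift, and the bounds on the offsets make the shift trivial.\<close>

lemma desync_if_not_recognizable:
  assumes inj: "inj_on (\<sigma> n) (words (A (Suc n)))" and nrec: "\<not> recognizable_at A \<sigma> n"
  shows "desync (\<sigma> n) (L (Suc n))"
proof -
  let ?\<phi> = "\<sigma> n"
  obtain y k x k' x' where *: "x \<in> X (Suc n)" "k < length (?\<phi> [x 0])" "(shift_map ^^ k) (biinf_image ?\<phi> x) = y"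
    "x' \<in> X (Suc n)" "k' < length (?\<phi> [x' 0])" "(shift_map ^^ k') (biinf_image ?\<phi> x') = y" "(k, x) \<noteq> (k', x')"
    using nrec unfolding recognizable_at_iff recognizable_in_def Uniq_def by auto
  define \<kappa> where "\<kappa> = int k' - int k"
  have sh: "shift_by (int k) (biinf_image ?\<phi> x) = shift_by (int k') (biinf_image ?\<phi> x')"
    using *(3,6) unfolding shift_map_power by simp
  have eq: "biinf_image ?\<phi> x = shift_by \<kappa> (biinf_image ?\<phi> x')"
  proof
    fix i
    show "biinf_image ?\<phi> x i = biinf_image ?\<phi> x' (i + \<kappa>)"
      using fun_cong[OF sh, of "i - int k"] by (simp add: \<kappa>_def algebra_simps)
  qed
  then have eq': "biinf_image ?\<phi> x' = shift_by (-\<kappa>) (biinf_image ?\<phi> x)" by simp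
  note d = desync_of_uncommon_cut[of n "Suc n", simplified comp_hom_step]
  show ?thesis
  proof (rule ccontr)
    assume nd: "\<not> desync ?\<phi> (L (Suc n))"
    have c1: "\<exists>i'. cut ?\<phi> x i + \<kappa> = cut ?\<phi> x' i'" for i using d[OF _ *(1,4) eq] nd by (meson le_SucI order_refl)
    have c2: "\<exists>i. cut ?\<phi> x' i' + - \<kappa> = cut ?\<phi> x i" for i' using d[OF _ *(4,1) eq'] nd by (meson le_SucI order_refl)
    have ne: "nonerasing ?\<phi> x" "nonerasing ?\<phi> x'" using X_nonerasing[of n "Suc n"] *(1,4) by auto
    interpret P: nonerasing ?\<phi> x by (rule ne)
    interpret P': nonerasing ?\<phi> x' by (rule ne)
    obtain i0 where i0: "\<kappa> = cut ?\<phi> x' i0" using c1[of 0] by auto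
    let ?u = "shift_by i0 x'"
    have uX: "?u \<in> X (Suc n)" by (rule X_shift[OF *(4)])
    interpret U: nonerasing ?\<phi> ?u by unfold_locales (rule P'.nonempty)
    have im: "biinf_image ?\<phi> ?u = biinf_image ?\<phi> x" unfolding image_shift[OF ne(2)] eq i0 ..
    have cu: "cut ?\<phi> x i = cut ?\<phi> ?u i" for i
    proof (rule strict_mono_int_range_eq[of "cut ?\<phi> x" "cut ?\<phi> ?u"])
      show "range (cut ?\<phi> x) = range (cut ?\<phi> ?u)"
      proof (intro equalityI subsetI)
        fix q assume "q \<in> range (cut ?\<phi> x)"
        then obtain i where "q = cut ?\<phi> x i" by blast
        moreover obtain i' where "cut ?\<phi> x i + \<kappa> = cut ?\<phi> x' i'" using c1 by blast
        ultimately have "q = cut ?\<phi> ?u (i' - i0)" by (simp add: cut_shift i0)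
        then show "q \<in> range (cut ?\<phi> ?u)" by blast
      next
        fix q assume "q \<in> range (cut ?\<phi> ?u)"
        then obtain i where q: "q = cut ?\<phi> x' (i + i0) - \<kappa>" by (auto simp: cut_shift i0)
        obtain i' where "cut ?\<phi> x' (i + i0) + - \<kappa> = cut ?\<phi> x i'" using c2 by blast
        then show "q \<in> range (cut ?\<phi> x)" using q by auto
      qed
    qed (simp_all add: P.cut_less U.cut_less)
    have "x i = ?u i" for i
    proof -
      have "?\<phi> [x i] = map (biinf_image ?\<phi> x) [cut ?\<phi> x i..cut ?\<phi> x (i + 1) - 1]"
        using map_image_upto[OF ne(1), of i "i + 1"] by simp
      also have "\<dots> = ?\<phi> [?u i]"
        using map_image_upto[OF U.nonerasing_axioms, of i "i + 1"] by (simp add: im cu)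
      finally show ?thesis
        using inj X_letter[OF *(1)] X_letter[OF uX] letter_word by (metis inj_onD list.inject)
    qed
    then have xu: "x = ?u" by (rule ext)
    \<comment> \<open>Both offsets point into the block at the origin, which excludes a shift by one
      or more blocks in either direction.\<close>
    have "i0 = 0"
    proof (rule ccontr)
      assume "i0 \<noteq> 0"
      then consider "1 \<le> i0" | "i0 + 1 \<le> 0" by linarith
      then show False
      proof cases
        case 1
        then have "cut ?\<phi> x' 1 \<le> \<kappa>" unfolding i0 by (metis P'.cut_less_iff linorder_not_less)
        then show False using *(5) cut_step[of ?\<phi> x' 0] by (simp add: \<kappa>_def)
      next
        case 2
        then have "cut ?\<phi> x' (i0 + 1) \<le> 0" by (metis P'.cut_less_iff cut_0 linorder_not_less)
        moreover have "x 0 = x' i0" using fun_cong[OF xu, of 0] by simp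
        ultimately show False using *(2) cut_step[of ?\<phi> x' i0] i0 by (simp add: \<kappa>_def)
      qed
    qed
    then show False using xu i0 *(7) by (simp add: \<kappa>_def)
  qed
qed

end


section \<open>Bi-infinite limits of doubly parsed words\<close>

lemma length_letterwise_le:
  assumes "\<And>b. b \<in> set v \<Longrightarrow> length (\<phi> [b]) \<le> c"
  shows "length (letterwise \<phi> v) \<le> c * length v"
  using assms
proof (induction v)
  case (Cons b v)
  have "length (\<phi> [b]) \<le> c" "length (letterwise \<phi> v) \<le> c * length v"
    using Cons.prems Cons.IH by auto
  then show ?case by simp
qed simp

text \<open>The word \<open>w\<close> with its letter number \<open>k\<close> at the origin. The
  padding \<open>d\<close> never enters the windows that are inspected.\<close>

definition place :: "'a \<Rightarrow> 'a list \<Rightarrow> nat \<Rightarrow> int \<Rightarrow> 'a" where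
  "place d w k i = (if 0 \<le> i + int k \<and> i + int k < int (length w) then w ! nat (i + int k) else d)"

lemma place_left:
  assumes "k \<le> length u"
  shows "map (place d (u @ v) (length u)) [- int k..-1] = drop (length u - k) u"
proof (rule nth_equalityI)
  fix p assume "p < length (map (place d (u @ v) (length u)) [- int k..-1])"
  then have p: "p < k" by simp
  define m where "m = length u - k + p"
  have m: "- int k + int p + int (length u) = int m" "m < length u" using assms p by (simp_all add: m_def)
  have "map (place d (u @ v) (length u)) [- int k..-1] ! p = place d (u @ v) (length u) (- int k + int p)"
    using p by (simp add: nth_upto)
  also have "\<dots> = u ! m" unfolding place_def m(1) using m(2) by (simp add: nth_append)
  also have "\<dots> = drop (length u - k) u ! p" using assms by (simp add: m_def)
  finally show "map (place d (u @ v) (length u)) [- int k..-1] ! p = drop (length u - k) u ! p" .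
qed (use assms in simp)

lemma place_right:
  assumes "k \<le> length v"
  shows "map (place d (u @ v) (length u)) [0..int k - 1] = take k v"
proof (rule nth_equalityI)
  fix p assume "p < length (map (place d (u @ v) (length u)) [0..int k - 1])"
  then have p: "p < k" by simp
  have "nat (int p + int (length u)) = length u + p" by simp
  then show "map (place d (u @ v) (length u)) [0..int k - 1] ! p = take k v ! p"
    using assms p by (simp add: place_def nth_append)
qed (use assms in simp)

text \<open>Positions are counted from the boundary between the two halves, so that lengthening the
  halves outwards does not move a letter.\<close>

lemma aligned_nth:
  assumes "suffix u s" "prefix w p" "- int (length u) \<le> q" "q < int (length w)"
  shows "(u @ w) ! nat (q + int (length u)) = (s @ p) ! nat (q + int (length s))"
proof -
  obtain s0 where s: "s = s0 @ u" using assms(1) by (auto simp: suffix_def)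
  obtain p0 where p: "p = w @ p0" using assms(2) by (auto simp: prefix_def)
  have n: "nat (q + int (length s)) = length s0 + nat (q + int (length u))"
    using assms(3) s by simp
  define k where "k = nat (q + int (length u))"
  have k: "k < length (u @ w)" using assms(3,4) by (simp add: k_def)
  have sp: "s @ p = s0 @ ((u @ w) @ p0)" by (simp add: s p)
  have "(s @ p) ! nat (q + int (length s)) = (s0 @ ((u @ w) @ p0)) ! (length s0 + k)"
    unfolding n k_def[symmetric] sp ..
  also have "\<dots> = (u @ w) ! k" unfolding nth_append_length_plus nth_append[of "u @ w" p0] using k by (simp only: if_True)
  finally show ?thesis unfolding k_def by (rule sym)
qed

context primitive_directive
begin

text \<open>By compactness, the doubly parsed words converge to two bi-infinite words with the same image and
  different cutting points.\<close>

lemma no_desync_if_recognizable: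
  assumes rec: "\<And>j. j < n \<Longrightarrow> recognizable_at A \<sigma> j"
  shows "\<not> desync (\<Sigma> 0 n) (L n)"
proof
  let ?\<phi> = "\<Sigma> 0 n"
  note \<phi> = comp_hom_hom[OF le0, of n]
  assume "desync ?\<phi> (L n)"
  then obtain c t z where c: "?\<phi> [c] = t @ z" "t \<noteq> []" "z \<noteq> []" and
    ex: "\<And>M. \<exists>v1 v2 v1' v2' s p. v1 @ v2 \<in> L n \<and> v1' @ c # v2' \<in> L n \<and> M \<le> length s \<and> M \<le> length p \<and>
      suffix s (letterwise ?\<phi> v1) \<and> suffix s (letterwise ?\<phi> v1' @ t) \<and>
      prefix p (letterwise ?\<phi> v2) \<and> prefix p (z @ letterwise ?\<phi> v2')"
    unfolding desync_def by blast
  obtain d where d: "d \<in> A n" using alphabet_nonempty by blast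
  \<comment> \<open>The common cutting point is put at the origin of the first word, while the
    second word has the letter \<open>c\<close> at its origin; their images thus differ by a shift
    of \<open>length t\<close>.\<close>
  define G where "G M f f' \<longleftrightarrow> (\<exists>v1 v2 v1' v2' s p. v1 @ v2 \<in> L n \<and> v1' @ c # v2' \<in> L n \<and> M \<le> length s \<and> M \<le> length p \<and>
      suffix s (letterwise ?\<phi> v1) \<and> suffix s (letterwise ?\<phi> v1' @ t) \<and>
      prefix p (letterwise ?\<phi> v2) \<and> prefix p (z @ letterwise ?\<phi> v2') \<and>
      f = place d (v1 @ v2) (length v1) \<and> f' = place d (v1' @ c # v2') (length v1'))" for M f f'
  have "\<exists>f f'. G M f f'" for M unfolding G_def using ex[of M] by blast
  then obtain f f' where G: "\<And>M. G M (f M) (f' M)" by metis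
  have place_A: "place d w k i \<in> A n" if "w \<in> L n" for w k i
  proof -
    have "set w \<subseteq> A n" using that L_words[of n] by (auto simp: words_def)
    then show ?thesis using d by (auto simp: place_def subset_eq)
  qed
  have fA: "f M i \<in> A n" "f' M i \<in> A n" for M i
  proof -
    obtain v1 v2 v1' v2' where "v1 @ v2 \<in> L n" "v1' @ c # v2' \<in> L n"
      "f M = place d (v1 @ v2) (length v1)" "f' M = place d (v1' @ c # v2') (length v1')"
      using G[of M] unfolding G_def by blast
    then show "f M i \<in> A n" "f' M i \<in> A n" using place_A by simp_all
  qed
  obtain U :: "nat filter" where U: "ultra U" "\<And>k. eventually (\<lambda>i. k \<le> i) U"
    using ultra_nat_exists by blast
  note nb = ultra_nonbot[OF U(1)]
  \<comment> \<open>The alphabet is finite, so each position stabilizes along the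
    ultrafilter.\<close>
  have "\<forall>i. \<exists>a. eventually (\<lambda>M. f M i = a) U"
    using ultra_finite_image[OF U(1) finite_alphabet[of n]] fA(1) by (meson always_eventually)
  from choice[OF this] obtain x where x: "\<And>i. eventually (\<lambda>M. f M i = x i) U" by blast
  have "\<forall>i. \<exists>a. eventually (\<lambda>M. f' M i = a) U"
    using ultra_finite_image[OF U(1) finite_alphabet[of n]] fA(2) by (meson always_eventually)
  from choice[OF this] obtain x' where x': "\<And>i. eventually (\<lambda>M. f' M i = x' i) U" by blast
  define mx where "mx = Max (insert 1 ((\<lambda>b. length (?\<phi> [b])) ` A n))"
  have mx: "length (?\<phi> [b]) \<le> mx" if "b \<in> A n" for b
    unfolding mx_def by (rule Max_ge) (use that finite_alphabet in auto)
  have mx1: "1 \<le> mx" unfolding mx_def by (rule Max_ge) (use finite_alphabet in auto)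
  \<comment> \<open>A window of radius \<open>l\<close> of the limits, seen in some doubly parsed
    pair. Blocks have length at most \<open>mx\<close>, so common parts longer than
    \<open>mx * (l + 2)\<close> contain the images of \<open>l\<close> letters on each side,
    together with the pieces \<open>t\<close> and \<open>z\<close> of the block of
    \<open>c\<close>.\<close>
  define W where "W l v1 v2 v1' v2' s p \<longleftrightarrow> v1 @ v2 \<in> L n \<and> v1' @ c # v2' \<in> L n \<and> mx * (l + 2) < length s \<and> mx * (l + 2) < length p \<and>
      suffix s (letterwise ?\<phi> v1) \<and> suffix s (letterwise ?\<phi> v1' @ t) \<and>
      prefix p (letterwise ?\<phi> v2) \<and> prefix p (z @ letterwise ?\<phi> v2') \<and>
      map x [- int l..-1] = drop (length v1 - l) v1 \<and> map x [0..int l - 1] = take l v2 \<and>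
      map x' [- int l..-1] = drop (length v1' - l) v1' \<and> map x' [0..int l] = c # take l v2'"
    for l v1 v2 v1' v2' s p
  have window: "\<exists>v1 v2 v1' v2' s p. W l v1 v2 v1' v2' s p" for l
  proof -
    have "eventually (\<lambda>M. \<forall>i\<in>{- int l..int l}. f M i = x i \<and> f' M i = x' i) U"
      by (rule eventually_ball_finite) (use eventually_conj[OF x x'] in auto)
    then have "eventually (\<lambda>M. mx * (l + 2) + 1 \<le> M \<and> (\<forall>i\<in>{- int l..int l}. f M i = x i \<and> f' M i = x' i)) U"
      using U(2)[of "mx * (l + 2) + 1"] by eventually_elim blast
    from eventually_happens'[OF nb this] obtain M where
      M': "mx * (l + 2) + 1 \<le> M \<and> (\<forall>i\<in>{- int l..int l}. f M i = x i \<and> f' M i = x' i)" ..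
    have M: "mx * (l + 2) < M" "\<And>i. - int l \<le> i \<Longrightarrow> i \<le> int l \<Longrightarrow> f M i = x i \<and> f' M i = x' i"
      using M' by (simp, blast intro: atLeastAtMost_iff[THEN iffD2])
    obtain v1 v2 v1' v2' s p where v: "v1 @ v2 \<in> L n" "v1' @ c # v2' \<in> L n" "M \<le> length s" "M \<le> length p"
      "suffix s (letterwise ?\<phi> v1)" "suffix s (letterwise ?\<phi> v1' @ t)"
      "prefix p (letterwise ?\<phi> v2)" "prefix p (z @ letterwise ?\<phi> v2')"
      "f M = place d (v1 @ v2) (length v1)" "f' M = place d (v1' @ c # v2') (length v1')"
      using G[of M] unfolding G_def by blast
    have sets: "set v1 \<subseteq> A n" "set v2 \<subseteq> A n" "set v1' \<subseteq> A n" "set v2' \<subseteq> A n" "c \<in> A n"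
      using subsetD[OF L_words v(1)] subsetD[OF L_words v(2)] by (auto simp: words_def)
    have tz: "length t \<le> mx" "length z \<le> mx" using mx[OF sets(5)] c(1) by auto
    have lw: "length (letterwise ?\<phi> v) \<le> mx * length v" if "set v \<subseteq> A n" for v
      by (rule length_letterwise_le) (use mx that in blast)
    \<comment> \<open>A word of fewer than \<open>l\<close> letters has an image too short to carry
      the common part, even after a piece of the block of \<open>c\<close> is added.\<close>
    have le: "l \<le> k" if "M \<le> mx * k + mx" for k
    proof (rule ccontr)
      assume "\<not> l \<le> k"
      then have "mx * (k + 1) \<le> mx * (l + 2)" by (intro mult_le_mono2) simp
      then show False using that M(1) by simp
    qed
    have ls: "length s \<le> length (letterwise ?\<phi> v1)" "length s \<le> length (letterwise ?\<phi> v1') + length t"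
      "length p \<le> length (letterwise ?\<phi> v2)" "length p \<le> length z + length (letterwise ?\<phi> v2')"
      using suffix_length_le[OF v(5)] suffix_length_le[OF v(6)] prefix_length_le[OF v(7)] prefix_length_le[OF v(8)] by simp_all
    have l: "l \<le> length v1" "l \<le> length v2" "l \<le> length v1'" "l \<le> length v2'"
      using lw[OF sets(1)] lw[OF sets(2)] lw[OF sets(3)] lw[OF sets(4)] ls v(3,4) tz by (intro le; linarith)+
    have mapx: "map x [i..j] = map (f M) [i..j]" "map x' [i..j] = map (f' M) [i..j]" if "- int l \<le> i" "j \<le> int l" for i j
      using M(2) that by auto
    have "map x [- int l..-1] = drop (length v1 - l) v1" "map x [0..int l - 1] = take l v2"
      "map x' [- int l..-1] = drop (length v1' - l) v1'"
      using place_left[OF l(1), of d v2] place_right[OF l(2), of d v1] place_left[OF l(3), of d "c # v2'"]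
      by (simp_all add: mapx v(9,10))
    moreover have "map x' [0..int l] = c # take l v2'"
      using place_right[of "Suc l" "c # v2'" d v1'] l(4) by (simp add: mapx v(10))
    moreover have "mx * (l + 2) < length s" "mx * (l + 2) < length p" using M(1) v(3,4) by simp_all
    ultimately have "W l v1 v2 v1' v2' s p" using v(1,2,5-8) unfolding W_def by (simp only: simp_thms)
    then show ?thesis by blast
  qed
  have sub: "map y [i..j] \<in> L n" if "map y [- int l..k] \<in> L n" "i \<le> j" "- int l \<le> i" "j \<le> k" for y :: "int \<Rightarrow> 'a" and i j k l
  proof -
    have "map y [- int l..k] = map y [- int l..i - 1] @ map y [i..j] @ map y [j + 1..k]"
      using upto_split[of "- int l" i k] upto_split[of i "j + 1" k] that by simp
    then show ?thesis using that(1,2) L_factor[of "map y [- int l..i - 1]" "map y [i..j]" "map y [j + 1..k]"] by simp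
  qed
  have xX: "x \<in> X n" "x' \<in> X n"
  proof -
    have w: "map x [- int (Suc l)..int (Suc l) - 1] \<in> L n" "map x' [- int (Suc l)..int (Suc l)] \<in> L n" for l
    proof -
      obtain v1 v2 v1' v2' s p where W: "W (Suc l) v1 v2 v1' v2' s p" using window by blast
      have v: "v1 @ v2 \<in> L n" "v1' @ c # v2' \<in> L n"
        "map x [- int (Suc l)..-1] = drop (length v1 - Suc l) v1" "map x [0..int (Suc l) - 1] = take (Suc l) v2"
        "map x' [- int (Suc l)..-1] = drop (length v1' - Suc l) v1'" "map x' [0..int (Suc l)] = c # take (Suc l) v2'"
        using W unfolding W_def by - (elim conjE, assumption)+
      let ?d1 = "drop (length v1 - Suc l) v1" and ?d1' = "drop (length v1' - Suc l) v1'"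
      have e: "map x [- int (Suc l)..int (Suc l) - 1] = ?d1 @ take (Suc l) v2"
        "map x' [- int (Suc l)..int (Suc l)] = ?d1' @ c # take (Suc l) v2'"
        using upto_split[of "- int (Suc l)" 0 "int (Suc l) - 1"] upto_split[of "- int (Suc l)" 0 "int (Suc l)"] v(3-6)
        by (simp_all only: map_append) simp_all
      have "v1 @ v2 = take (length v1 - Suc l) v1 @ (?d1 @ take (Suc l) v2) @ drop (Suc l) v2"
        by (metis append_assoc append_take_drop_id)
      moreover have "?d1 @ take (Suc l) v2 \<noteq> []" using e(1)[symmetric] by simp
      ultimately have "?d1 @ take (Suc l) v2 \<in> L n" using L_factor v(1) by metis
      then show "map x [- int (Suc l)..int (Suc l) - 1] \<in> L n" using e(1) by simp
      have "v1' @ c # v2' = take (length v1' - Suc l) v1' @ (?d1' @ c # take (Suc l) v2') @ drop (Suc l) v2'"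
        by (metis append_assoc append_Cons append_take_drop_id)
      then have "?d1' @ c # take (Suc l) v2' \<in> L n" using L_factor v(2) by (metis append_is_Nil_conv list.discI)
      then show "map x' [- int (Suc l)..int (Suc l)] \<in> L n" using e(2) by simp
    qed
    have "map x [i..j] \<in> L n" "map x' [i..j] \<in> L n" if "i \<le> j" for i j
    proof -
      define l where "l = nat \<bar>i\<bar> + nat \<bar>j\<bar>"
      show "map x [i..j] \<in> L n" by (rule sub[OF w(1)[of l] that]) (simp_all add: l_def)
      show "map x' [i..j] \<in> L n" by (rule sub[OF w(2)[of l] that]) (simp_all add: l_def)
    qed
    moreover have "x i \<in> A n" "x' i \<in> A n" for i
      using eventually_happens'[OF nb x[of i]] eventually_happens'[OF nb x'[of i]] fA by metis+
    ultimately show "x \<in> X n" "x' \<in> X n" by (auto simp: X_iff)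
  qed
  interpret P: nonerasing ?\<phi> x by (rule X_nonerasing[OF le0 xX(1)])
  interpret P': nonerasing ?\<phi> x' by (rule X_nonerasing[OF le0 xX(2)])
  have x'0: "x' 0 = c"
  proof -
    obtain v1 v2 v1' v2' s p where "W 1 v1 v2 v1' v2' s p" using window by blast
    then have "map x' [0..int 1] = c # take 1 v2'" unfolding W_def by - (elim conjE, assumption)
    then show ?thesis by (simp add: upto_rec1)
  qed
  have eq: "biinf_image ?\<phi> x = shift_by (int (length t)) (biinf_image ?\<phi> x')"
  proof
    fix q :: int
    define l where "l = Suc (nat \<bar>q\<bar>)"
    have lq: "- int l \<le> q" "q < int l" by (simp_all add: l_def)
    obtain v1 v2 v1' v2' s p where W: "W l v1 v2 v1' v2' s p" using window by blast
    have v: "v1 @ v2 \<in> L n" "v1' @ c # v2' \<in> L n" "mx * (l + 2) < length s" "mx * (l + 2) < length p"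
      "suffix s (letterwise ?\<phi> v1)" "suffix s (letterwise ?\<phi> v1' @ t)"
      "prefix p (letterwise ?\<phi> v2)" "prefix p (z @ letterwise ?\<phi> v2')"
      and w: "map x [- int l..-1] = drop (length v1 - l) v1" "map x [0..int l - 1] = take l v2"
      "map x' [- int l..-1] = drop (length v1' - l) v1'" "map x' [0..int l] = c # take l v2'"
      using W unfolding W_def by - (elim conjE, assumption)+
    define a b a' b' where "a = letterwise ?\<phi> (map x [- int l..-1])" and "b = letterwise ?\<phi> (map x [0..int l - 1])"
      and "a' = letterwise ?\<phi> (map x' [- int l..-1])" and "b' = letterwise ?\<phi> (take l v2')"
    have len: "length (letterwise ?\<phi> (map y [i..j])) \<le> mx * length [i..j]" if "y \<in> X n" for y i j
      using length_letterwise_le[of "map y [i..j]" ?\<phi> mx] mx X_letter[OF that] by auto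
    have la: "int (length a) = - cut ?\<phi> x (- int l)" "int (length b) = cut ?\<phi> x (int l)"
      "int (length a') = - cut ?\<phi> x' (- int l)"
      using cut_interval[of "- int l" 0 ?\<phi> x] cut_interval[of 0 "int l" ?\<phi> x] cut_interval[of "- int l" 0 ?\<phi> x']
      by (simp_all add: a_def b_def a'_def)
    have lge: "int l \<le> int (length a)" "int l \<le> int (length b)" "int l \<le> int (length a')"
      unfolding la using P.cut_diff_ge[of "- int l" 0] P.cut_diff_ge[of 0 "int l"] P'.cut_diff_ge[of "- int l" 0] by simp_all
    have lw0l: "letterwise ?\<phi> (map x' [0..int l]) = (t @ z) @ b'" using w(4) c(1) by (simp add: b'_def)
    have lb': "int l \<le> int (length b')"
    proof -
      have "int l \<le> cut ?\<phi> x' (int l + 1) - cut ?\<phi> x' 1" using P'.cut_diff_ge[of 1 "int l + 1"] by simp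
      also have "\<dots> = int (length b')"
        using cut_interval[of 0 "int l + 1" ?\<phi> x'] lw0l cut_step[of ?\<phi> x' 0] x'0 c(1) by simp
      finally show ?thesis .
    qed
    have tz: "length t \<le> mx" "length z \<le> mx" using mx[OF X_letter[OF xX(2), of 0]] x'0 c(1) by auto
    have up: "length a \<le> mx * l" "length b \<le> mx * l" "length a' \<le> mx * l"
      using len[OF xX(1), of "- int l" "-1"] len[OF xX(1), of 0 "int l - 1"] len[OF xX(2), of "- int l" "-1"]
      by (simp_all add: a_def b_def a'_def)
    have "length ((t @ z) @ b') \<le> mx * Suc l" using len[OF xX(2), of 0 "int l"] lw0l by (simp add: nat_add_distrib)
    then have up': "length (z @ b') \<le> mx * Suc l" by simp
    have suf_cmp: "suffix u s" if "suffix u w" "suffix s w" "length u \<le> length s" for u s w :: "'a list"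
      using that by (metis suffix_length_suffix)
    have pre_cmp: "prefix u s" if "prefix u w" "prefix s w" "length u \<le> length s" for u s w :: "'a list"
      using that by (metis prefix_length_prefix)
    \<comment> \<open>The images of both windows are now located inside \<open>s\<close> and
      \<open>p\<close>, so that both bi-infinite images are read from the same word
      \<open>s @ p\<close>.\<close>
    have sa: "suffix a s"
    proof (rule suf_cmp[OF _ v(5)])
      have "letterwise ?\<phi> v1 = letterwise ?\<phi> (take (length v1 - l) v1) @ a"
        unfolding a_def w(1) by (metis append_take_drop_id letterwise_simps(3))
      then show "suffix a (letterwise ?\<phi> v1)" by (simp add: suffix_def)
    qed (use up v(3) in simp)
    have sa': "suffix (a' @ t) s"
    proof (rule suf_cmp[OF _ v(6)])
      have "letterwise ?\<phi> v1' = letterwise ?\<phi> (take (length v1' - l) v1') @ a'"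
        unfolding a'_def w(3) by (metis append_take_drop_id letterwise_simps(3))
      then show "suffix (a' @ t) (letterwise ?\<phi> v1' @ t)" by (simp add: suffix_def)
    qed (use up tz v(3) in simp)
    have pb: "prefix b p"
    proof (rule pre_cmp[OF _ v(7)])
      have "letterwise ?\<phi> v2 = b @ letterwise ?\<phi> (drop l v2)"
        unfolding b_def w(2) by (metis append_take_drop_id letterwise_simps(3))
      then show "prefix b (letterwise ?\<phi> v2)" by simp
    qed (use up v(4) in simp)
    have pb': "prefix (z @ b') p"
    proof (rule pre_cmp[OF _ v(8)])
      have "letterwise ?\<phi> v2' = b' @ letterwise ?\<phi> (drop l v2')"
        unfolding b'_def by (metis append_take_drop_id letterwise_simps(3))
      then show "prefix (z @ b') (z @ letterwise ?\<phi> v2')" by simp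
    qed (use up' v(4) in simp)
    have "biinf_image ?\<phi> x q = (a @ b) ! nat (q + int (length a))"
    proof -
      have spl: "letterwise ?\<phi> (map x [- int l..int l - 1]) = a @ b"
        using upto_split[of "- int l" 0 "int l - 1"] by (simp add: a_def b_def l_def)
      have "biinf_image ?\<phi> x (cut ?\<phi> x (- int l) + int (nat (q + int (length a)))) = (a @ b) ! nat (q + int (length a))"
        unfolding spl[symmetric] by (rule P.image_window) (use spl lge lq in \<open>auto simp: l_def\<close>)
      then show ?thesis using la(1) lge lq by simp
    qed
    also have "\<dots> = (s @ p) ! nat (q + int (length s))" by (rule aligned_nth[OF sa pb]) (use lge lq in linarith)+
    also have "\<dots> = ((a' @ t) @ (z @ b')) ! nat (q + int (length (a' @ t)))"
      by (rule aligned_nth[OF sa' pb', symmetric]) (use lge lb' lq in simp_all)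
    also have "\<dots> = biinf_image ?\<phi> x' (q + int (length t))"
    proof -
      have spl: "letterwise ?\<phi> (map x' [- int l..int l + 1 - 1]) = (a' @ t) @ (z @ b')"
        using upto_split[of "- int l" 0 "int l"] lw0l by (simp add: a'_def)
      have "biinf_image ?\<phi> x' (cut ?\<phi> x' (- int l) + int (nat (q + int (length (a' @ t))))) =
          ((a' @ t) @ (z @ b')) ! nat (q + int (length (a' @ t)))"
        unfolding spl[symmetric] by (rule P'.image_window) (use spl lge lb' lq in \<open>auto simp: l_def\<close>)
      then show ?thesis using la(3) lge lq by (simp add: algebra_simps)
    qed
    finally show "biinf_image ?\<phi> x q = biinf_image ?\<phi> x' (q + int (length t))" .
  qed
  \<comment> \<open>Recognizability would make \<open>length t\<close> a cut of \<open>x'\<close>,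
    but this position lies strictly between the consecutive cuts number 0 and 1.\<close>
  obtain i where i: "int (length t) = cut ?\<phi> x' i"
    using recognizable_composition[OF le0 _ xX eq] rec by blast
  have "cut ?\<phi> x' 1 = int (length (t @ z))" using cut_step[of ?\<phi> x' 0] x'0 c(1) by simp
  moreover have "0 < int (length t)" "0 < int (length z)" using c(2,3) by simp_all
  ultimately have "cut ?\<phi> x' 0 < cut ?\<phi> x' i" "cut ?\<phi> x' i < cut ?\<phi> x' 1" using i by simp_all
  then have "0 < i" "i < 1" unfolding P'.cut_less_iff by simp_all
  then show False by simp
qed

end


section \<open>Saturation\<close>

lemma wlim_mult:
  assumes "wlim U A u x" "wlim U A v y"
    and "eventually (\<lambda>i. u i \<in> words A) U" "eventually (\<lambda>i. v i \<in> words A) U"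
  shows "wlim U A (\<lambda>i. u i @ v i) (x \<odot>\<^bsub>A\<^esub> y)"
proof -
  have "eventually (\<lambda>i. pseudoword_of A (u i) \<odot>\<^bsub>A\<^esub> pseudoword_of A (v i) = pseudoword_of A (u i @ v i)) U"
    using assms(3,4) by eventually_elim (simp add: pseudoword_of_append)
  then show ?thesis using plim_mult[OF assms(1,2)] by (rule plim_cong)
qed

lemma clo_image_mult:
  assumes "word_hom A B \<phi>" "x \<in> clo B (\<phi> ` words A)" "y \<in> clo B (\<phi> ` words A)"
  shows "x \<odot>\<^bsub>B\<^esub> y \<in> clo B (\<phi> ` words A)"
proof (rule clo_mult[OF assms(2,3)])
  fix u v assume "u \<in> \<phi> ` words A" "v \<in> \<phi> ` words A"
  then obtain u' v' where "u' \<in> words A" "v' \<in> words A" "u = \<phi> u'" "v = \<phi> v'" by blast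
  then show "u @ v \<in> \<phi> ` words A" using word_homD(2)[OF assms(1)] words_append by (metis imageI)
qed

lemma suffix_letterwise: "suffix u v \<Longrightarrow> suffix (letterwise \<phi> u) (letterwise \<phi> v)"
  by (auto simp: suffix_def)

lemma prefix_letterwise: "prefix u v \<Longrightarrow> prefix (letterwise \<phi> u) (letterwise \<phi> v)"
  by (auto simp: prefix_def)

context primitive_directive
begin

lemma wlim_K:
  assumes U: "fine_filter (A n) U" and x: "wlim U (A n) w x" and w: "eventually (\<lambda>i. w i \<in> L n \<and> snd i \<le> length (w i)) U"
  shows "x \<in> K n"
proof -
  note nb = fine_filterD(2)[OF U]
  have evL: "eventually (\<lambda>i. w i \<in> L n) U" using w by eventually_elim simp
  have evw: "eventually (\<lambda>i. w i \<in> words (A n)) U" using evL by eventually_elim (use L_words in blast)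
  have cl: "x \<in> clo (A n) (L n)" by (rule wlim_clo[OF nb x evL L_words])
  have "\<exists>w\<in>x (ps_congruence (A n) M). M \<le> length w" for M
  proof -
    note p = ps_congruence[OF finite_alphabet, of n M]
    have "eventually (\<lambda>i. w i \<in> x (ps_congruence (A n) M) \<and> M \<le> length (w i)) U"
      using plim_wordsD[OF x p evw] fine_filterD(5)[OF U, of M] w by eventually_elim simp
    then show ?thesis using eventually_happens'[OF nb] by blast
  qed
  then have "infinite_pw (A n) x" by (rule infinite_pwI[OF finite_alphabet clo_closed[OF cl]])
  then show ?thesis using cl by (simp add: K_def)
qed

lemma comp_hom_Suc_letterwise:
  assumes "set v \<subseteq> A (Suc j)"
  shows "letterwise (\<Sigma> 0 (Suc j)) v = letterwise (\<Sigma> 0 j) (letterwise (\<sigma> j) v)"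
  using assms
proof (induction v)
  case (Cons a v)
  then show ?case using comp_hom_letter_split(1)[of 0 j "Suc j" a] by simp
qed simp

text \<open>Applying \<open>\<Sigma> 0 j\<close> to both parsings maps cuts to cuts and interior
  points of blocks to interior points; since it is nonerasing, the common parts stay arbitrarily
  long.\<close>

lemma desync_lift:
  assumes "desync (\<sigma> j) (L (Suc j))"
  shows "desync (\<Sigma> 0 (Suc j)) (L (Suc j))"
proof -
  let ?\<phi> = "\<Sigma> 0 j" and ?\<psi> = "\<Sigma> 0 (Suc j)"
  note \<phi> = comp_hom_hom[OF le0, of j]
  obtain c t z where c: "\<sigma> j [c] = t @ z" "t \<noteq> []" "z \<noteq> []" and
    ex: "\<And>M. \<exists>v1 v2 v1' v2' s p. v1 @ v2 \<in> L (Suc j) \<and> v1' @ c # v2' \<in> L (Suc j) \<and> M \<le> length s \<and> M \<le> length p \<and>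
      suffix s (letterwise (\<sigma> j) v1) \<and> suffix s (letterwise (\<sigma> j) v1' @ t) \<and>
      prefix p (letterwise (\<sigma> j) v2) \<and> prefix p (z @ letterwise (\<sigma> j) v2')"
    using assms unfolding desync_def by blast
  have sets: "set v1 \<subseteq> A (Suc j)" "set v2 \<subseteq> A (Suc j)" if "v1 @ v2 \<in> L (Suc j)" for v1 v2
    using subsetD[OF L_words that] by (auto simp: words_def)
  have cA: "c \<in> A (Suc j)" using ex[of 0] sets by fastforce
  have ne: "letterwise ?\<phi> v \<noteq> []" if "v \<noteq> []" "set v \<subseteq> A j" for v
    using that word_hom_letter(1)[OF \<phi>] by (cases v) auto
  have tz: "set t \<subseteq> A j" "set z \<subseteq> A j" using word_hom_letter(2)[OF step_hom cA] c(1) by auto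
  have ge: "length v \<le> length (letterwise ?\<phi> v)" if "set v \<subseteq> A j" for v
  proof -
    have "1 * length v \<le> length (letterwise ?\<phi> v)"
      by (rule length_letterwise_ge) (use that word_hom_letter(1)[OF \<phi>] in \<open>auto simp: Suc_le_eq\<close>)
    then show ?thesis by simp
  qed
  have "?\<psi> [c] = letterwise ?\<phi> t @ letterwise ?\<phi> z"
    using comp_hom_letter_split(1)[of 0 j "Suc j" c] cA c(1) by simp
  moreover have "letterwise ?\<phi> t \<noteq> []" "letterwise ?\<phi> z \<noteq> []" using ne tz c by auto
  moreover have "\<exists>v1 v2 v1' v2' s p. v1 @ v2 \<in> L (Suc j) \<and> v1' @ c # v2' \<in> L (Suc j) \<and> M \<le> length s \<and> M \<le> length p \<and>
      suffix s (letterwise ?\<psi> v1) \<and> suffix s (letterwise ?\<psi> v1' @ letterwise ?\<phi> t) \<and>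
      prefix p (letterwise ?\<psi> v2) \<and> prefix p (letterwise ?\<phi> z @ letterwise ?\<psi> v2')" for M
  proof -
    obtain v1 v2 v1' v2' s p where v: "v1 @ v2 \<in> L (Suc j)" "v1' @ c # v2' \<in> L (Suc j)" "M \<le> length s" "M \<le> length p"
      "suffix s (letterwise (\<sigma> j) v1)" "suffix s (letterwise (\<sigma> j) v1' @ t)"
      "prefix p (letterwise (\<sigma> j) v2)" "prefix p (z @ letterwise (\<sigma> j) v2')"
      using ex[of M] by blast
    have vA: "set v1 \<subseteq> A (Suc j)" "set v2 \<subseteq> A (Suc j)" "set v1' \<subseteq> A (Suc j)" "set v2' \<subseteq> A (Suc j)"
      using sets(1)[OF v(1)] sets(2)[OF v(1)] sets(1)[OF v(2)] sets(2)[OF v(2)] by auto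
    have "set s \<subseteq> A j" "set p \<subseteq> A j"
      using set_mono_suffix[OF v(5)] set_mono_prefix[OF v(7)] letterwise_set[OF step_hom vA(1)] letterwise_set[OF step_hom vA(2)]
      by blast+
    then have "M \<le> length (letterwise ?\<phi> s)" "M \<le> length (letterwise ?\<phi> p)" using ge v(3,4) order_trans by blast+
    then show ?thesis
      using v(1,2) suffix_letterwise[OF v(5), of ?\<phi>] suffix_letterwise[OF v(6), of ?\<phi>]
        prefix_letterwise[OF v(7), of ?\<phi>] prefix_letterwise[OF v(8), of ?\<phi>]
      by - (rule exI[of _ v1], rule exI[of _ v2], rule exI[of _ v1'], rule exI[of _ v2'],
        rule exI[of _ "letterwise ?\<phi> s"], rule exI[of _ "letterwise ?\<phi> p"], simp add: comp_hom_Suc_letterwise vA)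
  qed
  ultimately show ?thesis unfolding desync_def by blast
qed

text \<open>Every block of a late level contains both words, and an approximation of
  \<open>e\<close> that is an image from that level consists of such blocks. Both parsings thus
  appear in one approximation of \<open>e\<close>.\<close>

lemma image_class_contains_factors:
  assumes img: "e \<in> clo (A 0) (\<Sigma> 0 m ` words (A m))" and nm: "n \<le> m" and r: "r \<in> finite_congruences (A 0)"
    and occ: "\<And>a. a \<in> A m \<Longrightarrow> \<exists>x y. \<Sigma> n m [a] = x @ v @ y" "\<And>a. a \<in> A m \<Longrightarrow> \<exists>x y. \<Sigma> n m [a] = x @ v' @ y"
  shows "\<exists>w\<in>words (A n). \<Sigma> 0 n w \<in> e r \<and> (\<exists>x y. w = x @ v @ y) \<and> (\<exists>x y. w = x @ v' @ y)"
proof -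
  obtain u where u: "u \<in> words (A m)" "\<Sigma> 0 m u \<in> e r" using cloD[OF img r] by blast
  obtain a u' where a: "u = a # u'" "a \<in> A m" using u(1) by (cases u) (auto simp: words_def)
  have eq: "\<Sigma> n m u = \<Sigma> n m [a] @ letterwise (\<Sigma> n m) u'"
    using comp_hom_letterwise[OF nm u(1)] a(1) by simp
  obtain x y x' y' where "\<Sigma> n m [a] = x @ v @ y" "\<Sigma> n m [a] = x' @ v' @ y'" using occ[OF a(2)] by blast
  then have "\<Sigma> n m u = x @ v @ (y @ letterwise (\<Sigma> n m) u')" "\<Sigma> n m u = x' @ v' @ (y' @ letterwise (\<Sigma> n m) u')"
    using eq by simp_all
  moreover have "\<Sigma> 0 n (\<Sigma> n m u) \<in> e r" using u(2) comp_hom_split[of 0 n m \<sigma>] nm by simp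
  ultimately show ?thesis using comp_hom_word[OF nm u(1)] by blast
qed

text \<open>In the limit, the doubly parsed words give \<open>e = p q = p' q'\<close>, where \<open>p\<close> and \<open>q\<close> are limits of words of
  the image. Since \<open>p'\<close> and \<open>q'\<close> differ from \<open>p\<close> and \<open>q\<close> by units, they are limits of such words as well,
  which contradicts injectivity.\<close>

lemma not_desync_if_saturating:
  assumes sat: "saturating_seq A \<sigma>" and inj: "inj_on (\<Sigma> 0 n) (words (A n))"
  shows "\<not> desync (\<Sigma> 0 n) (L n)"
proof
  let ?\<phi> = "\<Sigma> 0 n"
  let ?C = "?\<phi> ` words (A n)"
  let ?S = "free_profinite (A 0)"
  note \<phi> = comp_hom_hom[OF le0, of n]
  assume "desync ?\<phi> (L n)"
  then obtain c t z where c: "?\<phi> [c] = t @ z" "t \<noteq> []" "z \<noteq> []" and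
    ex: "\<And>M. \<exists>v1 v2 v1' v2' s p. v1 @ v2 \<in> L n \<and> v1' @ c # v2' \<in> L n \<and> M \<le> length s \<and> M \<le> length p \<and>
      suffix s (letterwise ?\<phi> v1) \<and> suffix s (letterwise ?\<phi> v1' @ t) \<and>
      prefix p (letterwise ?\<phi> v2) \<and> prefix p (z @ letterwise ?\<phi> v2')"
    unfolding desync_def by blast
  have cA: "c \<in> A n" using ex[of 0] L_words[of n] by (fastforce simp: words_def)
  obtain H where H: "H \<in> maximal_subgroups ?S (profinite_mult (A 0))" "H \<subseteq> seq_J_class A \<sigma>" "H \<subseteq> profinite_image A \<sigma>"
    using sat unfolding saturating_seq_def by blast
  obtain e where e: "e \<in> ?S" "e \<odot>\<^bsub>A 0\<^esub> e = e" "H = units e" using fp.maximal_subgroup_unit_group[OF H(1)] by blast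
  have units: "h \<in> clo (A 0) (\<Sigma> 0 m ` words (A m))" if "h \<in> units e" for h m
    using that H(3) e(3) unfolding profinite_image_clo by blast
  have eH: "e \<in> units e" by (rule fp.unit_group_unit[OF e(1,2)])
  have eJ: "e \<in> seq_J_class A \<sigma>" using eH e(3) H(2) by blast
  \<comment> \<open>The six words \<open>d 0\<close>, ..., \<open>d 5\<close> approximate u, s, u',
    r, w, w', with the two products (u s)(r w) and (u' s)(r w') both approximating \<open>e\<close>.
    Packing them into one function allows a single choice and a uniform passage to the
    limit.\<close>
  define Q where "Q i d \<longleftrightarrow> (\<forall>k. d k \<in> words (A 0)) \<and> d 1 \<in> L 0 \<and> d 3 \<in> L 0 \<and> snd i \<le> length (d 1) \<and> snd i \<le> length (d 3) \<and>
      (d 0 @ d 1) @ (d 3 @ d 4) \<in> e (fst i) \<and> (d 2 @ d 1) @ (d 3 @ d 5) \<in> e (fst i) \<and>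
      d 0 @ d 1 \<in> ?C \<and> d 3 @ d 4 \<in> ?C \<and>
      (\<exists>v1 v2. set v1 \<subseteq> A n \<and> set v2 \<subseteq> A n \<and> d 2 @ d 1 = letterwise ?\<phi> v1 @ t \<and> d 3 @ d 5 = z @ letterwise ?\<phi> v2)"
    for i :: "('a list \<times> 'a list) set \<times> nat" and d :: "nat \<Rightarrow> 'a list"
  have "\<exists>d. Q i d" if r: "fst i \<in> finite_congruences (A 0)" for i
  proof -
    \<comment> \<open>Of the two extra letters, one is given to the outer factor and the other keeps
      the shortened common part nonempty.\<close>
    obtain v1 v2 v1' v2' s p where v: "v1 @ v2 \<in> L n" "v1' @ c # v2' \<in> L n" "snd i + 2 \<le> length s" "snd i + 2 \<le> length p"
      "suffix s (letterwise ?\<phi> v1)" "suffix s (letterwise ?\<phi> v1' @ t)"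
      "prefix p (letterwise ?\<phi> v2)" "prefix p (z @ letterwise ?\<phi> v2')"
      using ex[of "snd i + 2"] by blast
    obtain m1 where m1: "\<And>k a. m1 \<le> k \<Longrightarrow> a \<in> A k \<Longrightarrow> \<exists>x y. \<Sigma> n k [a] = x @ (v1 @ v2) @ y"
      using occurs_eventually[OF v(1)] by blast
    obtain m2 where m2: "\<And>k a. m2 \<le> k \<Longrightarrow> a \<in> A k \<Longrightarrow> \<exists>x y. \<Sigma> n k [a] = x @ (v1' @ c # v2') @ y"
      using occurs_eventually[OF v(2)] by blast
    define m where "m = max n (max m1 m2)"
    have m: "n \<le> m" "m1 \<le> m" "m2 \<le> m" by (simp_all add: m_def)
    obtain w x y x' y' where w: "w \<in> words (A n)" "?\<phi> w \<in> e (fst i)" "w = x @ (v1 @ v2) @ y" "w = x' @ (v1' @ c # v2') @ y'"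
      using image_class_contains_factors[OF units[OF eH] m(1) r m1[OF m(2)] m2[OF m(3)]] by blast
    have sub: "set x \<subseteq> A n" "set v1 \<subseteq> A n" "set v2 \<subseteq> A n" "set y \<subseteq> A n" "set x' \<subseteq> A n" "set v1' \<subseteq> A n" "set v2' \<subseteq> A n" "set y' \<subseteq> A n"
    proof -
      have "set w \<subseteq> A n" using w(1) by (simp add: words_def)
      then show "set x \<subseteq> A n" "set v1 \<subseteq> A n" "set v2 \<subseteq> A n" "set y \<subseteq> A n" using w(3) by simp_all
      show "set x' \<subseteq> A n" "set v1' \<subseteq> A n" "set v2' \<subseteq> A n" "set y' \<subseteq> A n" using \<open>set w \<subseteq> A n\<close> w(4) by simp_all
    qed
    \<comment> \<open>The first letter of \<open>s\<close>, and below the last letter of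
      \<open>p\<close>, are moved to the outer factors, which otherwise might be empty.\<close>
    obtain h s1 where s: "s = h # s1" using v(3) by (cases s) auto
    have "p \<noteq> []" using v(4) by auto
    then obtain r1 g where p: "p = r1 @ [g]" using rev_exhaust by blast
    obtain a0 where a0: "letterwise ?\<phi> v1 = a0 @ s" using v(5) by (auto simp: suffix_def)
    obtain a1 where a1: "letterwise ?\<phi> v1' @ t = a1 @ s" using v(6) by (auto simp: suffix_def)
    obtain b0 where b0: "letterwise ?\<phi> v2 = p @ b0" using v(7) by (auto simp: prefix_def)
    obtain b1 where b1: "z @ letterwise ?\<phi> v2' = p @ b1" using v(8) by (auto simp: prefix_def)
    define u u' w0 w' where "u = letterwise ?\<phi> x @ a0 @ [h]" and "u' = letterwise ?\<phi> x' @ a1 @ [h]"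
      and "w0 = g # b0 @ letterwise ?\<phi> y" and "w' = g # b1 @ letterwise ?\<phi> y'"
    have us: "u @ s1 = letterwise ?\<phi> (x @ v1)" "r1 @ w0 = letterwise ?\<phi> (v2 @ y)"
      using a0 b0 s p by (simp_all add: u_def w0_def)
    have us': "u' @ s1 = letterwise ?\<phi> (x' @ v1') @ t" "r1 @ w' = z @ letterwise ?\<phi> (v2' @ y')"
    proof -
      show "u' @ s1 = letterwise ?\<phi> (x' @ v1') @ t" using a1 s by (simp add: u'_def)
      show "r1 @ w' = z @ letterwise ?\<phi> (v2' @ y')"
        using arg_cong[OF b1, of "\<lambda>v. v @ letterwise ?\<phi> y'"] p by (simp add: w'_def)
    qed
    have \<phi>w: "?\<phi> w = (u @ s1) @ (r1 @ w0)" "?\<phi> w = (u' @ s1) @ (r1 @ w')"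
    proof -
      show "?\<phi> w = (u @ s1) @ (r1 @ w0)"
        unfolding us comp_hom_letterwise[OF le0 w(1)] unfolding w(3) by simp
      show "?\<phi> w = (u' @ s1) @ (r1 @ w')"
        unfolding us' comp_hom_letterwise[OF le0 w(1)] unfolding w(4) using c(1) by simp
    qed
    have set_w: "set (?\<phi> w) \<subseteq> A 0" using comp_hom_word[OF le0 w(1)] by (simp add: words_def)
    have lens: "snd i < length s1" "snd i < length r1" using v(3,4) s p by simp_all
    have ne: "u \<noteq> []" "u' \<noteq> []" "w0 \<noteq> []" "w' \<noteq> []" "s1 \<noteq> []" "r1 \<noteq> []"
      using lens by (auto simp: u_def u'_def w0_def w'_def)
    have wds: "u \<in> words (A 0)" "u' \<in> words (A 0)" "w0 \<in> words (A 0)" "w' \<in> words (A 0)" "s1 \<in> words (A 0)" "r1 \<in> words (A 0)"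
    proof -
      have "set ((u @ s1) @ (r1 @ w0)) \<subseteq> A 0" "set ((u' @ s1) @ (r1 @ w')) \<subseteq> A 0" using set_w \<phi>w by metis+
      then show "u \<in> words (A 0)" "u' \<in> words (A 0)" "w0 \<in> words (A 0)" "w' \<in> words (A 0)" "s1 \<in> words (A 0)" "r1 \<in> words (A 0)"
        using ne by (simp_all add: words_def)
    qed
    have "v1 @ v2 \<in> words (A n)" using v(1) L_words by blast
    then have "?\<phi> (v1 @ v2) = (a0 @ [h]) @ s1 @ (p @ b0)" "?\<phi> (v1 @ v2) = (a0 @ s) @ r1 @ ([g] @ b0)"
      using comp_hom_letterwise[OF le0] a0 b0 s p by simp_all
    then have sL: "s1 \<in> L 0" "r1 \<in> L 0" using L_image[OF le0 v(1)] L_factor ne(5,6) by metis+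
    have C: "letterwise ?\<phi> l \<in> ?C" if "set l \<subseteq> A n" "letterwise ?\<phi> l \<noteq> []" for l
    proof -
      have "l \<in> words (A n)" using that by (cases l) (auto simp: words_def)
      then show ?thesis using comp_hom_letterwise[OF le0] by (metis imageI)
    qed
    have uC: "u @ s1 \<in> ?C" "r1 @ w0 \<in> ?C" unfolding us
      using C[of "x @ v1"] C[of "v2 @ y"] sub us[symmetric] ne by (simp_all del: letterwise_simps)
    define d :: "nat \<Rightarrow> 'a list" where "d = (\<lambda>k. if k = 0 then u else if k = 1 then s1 else if k = 2 then u' else if k = 3 then r1
      else if k = 4 then w0 else w')"
    have d: "d 0 = u" "d 1 = s1" "d 2 = u'" "d 3 = r1" "d 4 = w0" "d 5 = w'" by (simp_all add: d_def)
    have mem: "(u @ s1) @ (r1 @ w0) \<in> e (fst i)" "(u' @ s1) @ (r1 @ w') \<in> e (fst i)"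
      using w(2) \<phi>w by metis+
    have vs: "\<exists>v1 v2. set v1 \<subseteq> A n \<and> set v2 \<subseteq> A n \<and> u' @ s1 = letterwise ?\<phi> v1 @ t \<and> r1 @ w' = z @ letterwise ?\<phi> v2"
      by (rule exI[of _ "x' @ v1'"], rule exI[of _ "v2' @ y'"], intro conjI us') (use sub in simp_all)
    have "Q i d" unfolding Q_def d
    proof (intro conjI allI)
      show "d k \<in> words (A 0)" for k using wds by (simp add: d_def)
    qed (rule sL uC mem vs less_imp_le[OF lens(1)] less_imp_le[OF lens(2)])+
    then show ?thesis by blast
  qed
  then have "\<forall>i. \<exists>d. fst i \<in> finite_congruences (A 0) \<longrightarrow> Q i d" by blast
  from choice[OF this] obtain d where d: "\<And>i. fst i \<in> finite_congruences (A 0) \<Longrightarrow> Q i (d i)" by blast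
  obtain U where U: "fine_filter (A 0) U" using fine_filter_exists by blast
  note nb = fine_filterD(2)[OF U]
  have ev: "eventually (\<lambda>i. Q i (d i)) U" using fine_filterD(4)[OF U] by eventually_elim (rule d)
  have evw: "eventually (\<lambda>i. d i k \<in> words (A 0)) U" for k using ev by eventually_elim (simp add: Q_def)
  have "\<forall>k. \<exists>x. wlim U (A 0) (\<lambda>i. d i k) x" using wlim_exists[OF fine_filterD(1)[OF U] evw] by blast
  from choice[OF this] obtain l where l: "\<And>k. wlim U (A 0) (\<lambda>i. d i k) (l k)" by blast
  note lc = plim_closed[OF l]
  note prod = wlim_mult[OF l l evw evw]
  have evw2: "eventually (\<lambda>i. d i j @ d i k \<in> words (A 0)) U" for j k
    using evw[of j] evw[of k] by eventually_elim (rule words_append)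
  define p p' q q' where "p = l 0 \<odot>\<^bsub>A 0\<^esub> l 1" and "p' = l 2 \<odot>\<^bsub>A 0\<^esub> l 1" and "q = l 3 \<odot>\<^bsub>A 0\<^esub> l 4" and "q' = l 3 \<odot>\<^bsub>A 0\<^esub> l 5"
  note pq_defs = p_def p'_def q_def q'_def
  have pq: "p \<odot>\<^bsub>A 0\<^esub> q = e" "p' \<odot>\<^bsub>A 0\<^esub> q' = e"
  proof -
    have "wlim U (A 0) (\<lambda>i. (d i 0 @ d i 1) @ (d i 3 @ d i 4)) e" "wlim U (A 0) (\<lambda>i. (d i 2 @ d i 1) @ (d i 3 @ d i 5)) e"
      by (rule wlim_of_reps[OF U e(1)], use ev in eventually_elim, simp add: Q_def)+
    then show "p \<odot>\<^bsub>A 0\<^esub> q = e" "p' \<odot>\<^bsub>A 0\<^esub> q' = e"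
      unfolding pq_defs using plim_unique[OF nb wlim_mult[OF prod prod evw2 evw2]] by blast+
  qed
  have sK: "l 1 \<in> K 0"
    by (rule wlim_K[OF U l]) (use ev in eventually_elim, simp add: Q_def)
  have rK: "l 3 \<in> K 0"
    by (rule wlim_K[OF U l]) (use ev in eventually_elim, simp add: Q_def)
  \<comment> \<open>The limits of the common parts lie in \<open>K 0\<close>, and \<open>e\<close>
    is in the same J-class, so they factor through \<open>e\<close> as the exchange argument
    requires.\<close>
  obtain b1 b2 where b: "b1 \<in> ?S" "b2 \<in> ?S" "l 1 = (b1 \<odot>\<^bsub>A 0\<^esub> e) \<odot>\<^bsub>A 0\<^esub> b2" using eJ unfolding seq_J_class_iff[OF sK] by blast
  obtain b1' b2' where b': "b1' \<in> ?S" "b2' \<in> ?S" "l 3 = (b1' \<odot>\<^bsub>A 0\<^esub> e) \<odot>\<^bsub>A 0\<^esub> b2'" using eJ unfolding seq_J_class_iff[OF rK] by blast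
  note exch = fp.exchange_factorizations[OF e(1) lc[of 0] lc[of 2] lc[of 1] lc[of 3] lc[of 4] lc[of 5] b(1,2) b'(1,2) e(2)
      p_def p'_def q_def q'_def pq b(3) b'(3)]
  have pC: "p \<in> clo (A 0) ?C" "q \<in> clo (A 0) ?C"
  proof -
    have C: "?C \<subseteq> words (A 0)" using comp_hom_word[OF le0] by blast
    show "p \<in> clo (A 0) ?C" unfolding p_def
      by (rule wlim_clo[OF nb prod _ C]) (use ev in eventually_elim, simp add: Q_def)
    show "q \<in> clo (A 0) ?C" unfolding q_def
      by (rule wlim_clo[OF nb prod _ C]) (use ev in eventually_elim, simp add: Q_def)
  qed
  have "q \<odot>\<^bsub>A 0\<^esub> (p \<odot>\<^bsub>A 0\<^esub> q') \<in> clo (A 0) ?C" "(p' \<odot>\<^bsub>A 0\<^esub> q) \<odot>\<^bsub>A 0\<^esub> p \<in> clo (A 0) ?C"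
    by (intro clo_image_mult[OF \<phi>] pC units exch(1,2))+
  \<comment> \<open>Here saturation enters: the mixed products are units, hence limits of images,
    and they carry \<open>q\<close> to \<open>q'\<close> and \<open>p\<close> to
    \<open>p'\<close>.\<close>
  then have pC': "q' \<in> clo (A 0) ?C" "p' \<in> clo (A 0) ?C" unfolding exch(3,4)[symmetric] .
  \<comment> \<open>Since the image is clopen, words close to \<open>p'\<close> and
    \<open>q'\<close> are themselves images, which brings the contradiction back to finite
    words.\<close>
  from clo_image_saturated[OF \<phi> finite_alphabet] obtain r where r: "r \<in> finite_congruences (A 0)"
    "\<forall>x\<in>?S. (\<exists>w\<in>?C. w \<in> x r) \<longrightarrow> x \<in> clo (A 0) ?C \<and> x r \<subseteq> ?C" by (rule bexE)
  have sub: "x r \<subseteq> ?C" if x: "x \<in> clo (A 0) ?C" for x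
  proof -
    obtain w where "w \<in> ?C" "w \<in> x r" by (rule cloD[OF x r(1)])
    then show ?thesis using bspec[OF r(2) clo_closed[OF x]] by blast
  qed
  have "eventually (\<lambda>i. Q i (d i) \<and> d i 2 @ d i 1 \<in> ?C \<and> d i 3 @ d i 5 \<in> ?C) U"
    using ev plim_wordsD[OF prod[of 2 1] r(1) evw2] plim_wordsD[OF prod[of 3 5] r(1) evw2]
    by eventually_elim (use sub[OF pC'(1)] sub[OF pC'(2)] in \<open>auto simp: pq_defs\<close>)
  then obtain i where i: "Q i (d i)" "d i 2 @ d i 1 \<in> ?C" "d i 3 @ d i 5 \<in> ?C" using eventually_happens'[OF nb] by blast
  then obtain v1 v2 where "set v1 \<subseteq> A n" "set v2 \<subseteq> A n" "letterwise ?\<phi> v1 @ t \<in> ?C" "z @ letterwise ?\<phi> v2 \<in> ?C"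
    unfolding Q_def by metis
  then show False using injective_hom_cut[OF \<phi> inj _ _ cA c] by blast
qed

lemma inj_comp_hom:
  assumes enc: "encoding_seq A \<sigma>" and "n \<le> m"
  shows "inj_on (\<Sigma> n m) (words (A m))"
  using assms(2)
proof (induction m rule: dec_induct)
  case (step m)
  have "inj_on (\<sigma> m) (words (A (Suc m)))" using enc by (simp add: encoding_seq_def)
  moreover have "inj_on (\<Sigma> n m) (\<sigma> m ` words (A (Suc m)))"
    by (rule inj_on_subset[OF step.IH]) (use word_homD(1)[OF step_hom] in blast)
  ultimately have "inj_on (\<Sigma> n m \<circ> \<sigma> m) (words (A (Suc m)))" by (rule comp_inj_on)
  moreover have "\<Sigma> n (Suc m) = \<Sigma> n m \<circ> \<sigma> m" using comp_hom_split[of n m "Suc m" \<sigma>] step.hyps by simp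
  ultimately show ?case by (simp only:)
qed simp

lemma recognizable_if_saturating:
  assumes sat: "saturating_seq A \<sigma>" and enc: "encoding_seq A \<sigma>"
  shows "recognizable_seq A \<sigma>"
  unfolding recognizable_seq_def
proof (rule allI, rule ccontr)
  fix n assume "\<not> recognizable_at A \<sigma> n"
  then have "desync (\<sigma> n) (L (Suc n))"
    using desync_if_not_recognizable enc unfolding encoding_seq_def by blast
  then show False using desync_lift not_desync_if_saturating[OF sat inj_comp_hom[OF enc le0]] by blast
qed

end


section \<open>Pure and recurrent sequences\<close>

lemma generated_subsemigroup_image:
  assumes \<phi>: "word_hom A B \<phi>"
  shows "generated_subsemigroup ((\<lambda>a. \<phi> [a]) ` A) = \<phi> ` words A"
proof (intro equalityI subsetI)
  fix u assume "u \<in> generated_subsemigroup ((\<lambda>a. \<phi> [a]) ` A)"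
  then show "u \<in> \<phi> ` words A"
  proof induction
    case (incl c)
    then obtain a where "a \<in> A" "c = \<phi> [a]" by blast
    moreover have "[a] \<in> words A" using \<open>a \<in> A\<close> by (simp add: words_def)
    ultimately show ?case by blast
  next
    case (app u v)
    then obtain u' v' where "u' \<in> words A" "v' \<in> words A" "u = \<phi> u'" "v = \<phi> v'" by blast
    then show ?case using word_homD(2)[OF \<phi>] words_append by (metis imageI)
  qed
next
  have "\<phi> w \<in> generated_subsemigroup ((\<lambda>a. \<phi> [a]) ` A)" if "w \<noteq> []" "set w \<subseteq> A" for w
    using that
  proof (induction w rule: list_nonempty_induct)
    case (single a)
    then show ?case by (auto intro: generated_subsemigroup.incl)
  next
    case (cons a w)
    then have "\<phi> ([a] @ w) = \<phi> [a] @ \<phi> w" by (intro word_homD(2)[OF \<phi>]) (auto simp: words_def)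
    moreover have "\<phi> [a] \<in> generated_subsemigroup ((\<lambda>a. \<phi> [a]) ` A)"
      using cons.prems by (auto intro: generated_subsemigroup.incl)
    ultimately show ?case using generated_subsemigroup.app cons by fastforce
  qed
  then show "u \<in> generated_subsemigroup ((\<lambda>a. \<phi> [a]) ` A)" if "u \<in> \<phi> ` words A" for u
    using that by (auto simp: words_def)
qed

lemma word_hom_power:
  assumes \<phi>: "word_hom A B \<phi>" and v: "v \<in> words A"
  shows "\<phi> (word_power v (Suc k)) = word_power (\<phi> v) (Suc k)"
proof (induction k)
  case (Suc k)
  have "\<phi> (word_power v (Suc (Suc k))) = \<phi> (v @ word_power v (Suc k))" by simp
  also have "\<dots> = \<phi> v @ \<phi> (word_power v (Suc k))" by (rule word_homD(2)[OF \<phi> v word_power_words[OF v]]) simp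
  finally show ?case using Suc by simp
qed simp

section \<open>Powers and inverses of units in the closure of an image\<close>

lemma power_in_image:
  assumes \<phi>: "word_hom A B \<phi>" and x: "x \<in> clo B (\<phi> ` words A)"
  shows "profinite_power B x n \<in> clo B (\<phi> ` words A)"
  by (induction n) (simp_all add: x clo_image_mult[OF \<phi>])

text \<open>Some power of \<open>h\<close> agrees with \<open>e\<close> modulo the congruence that
  decides membership in the closure of the image.\<close>

lemma unit_power_in_image:
  assumes \<phi>: "word_hom A B \<phi>" and A: "finite A" and e: "e \<in> clo B (\<phi> ` words A)" and h: "h \<in> fp.unit_group B e"
  shows "\<exists>m. profinite_power B h m \<in> clo B (\<phi> ` words A)"
proof -
  note e' = clo_closed[OF e]
  from clo_image_saturated[OF \<phi> A] obtain r where r: "r \<in> finite_congruences B"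
    "\<forall>x\<in>free_profinite B. (\<exists>w\<in>\<phi> ` words A. w \<in> x r) \<longrightarrow> x \<in> clo B (\<phi> ` words A) \<and> x r \<subseteq> \<phi> ` words A" by (rule bexE)
  obtain m where m: "profinite_power B h m r = e r" using unit_torsion_mod[OF e' h r(1)] by blast
  have h': "h \<in> free_profinite B" using h by (auto elim: fp.unit_groupE)
  obtain w where "w \<in> \<phi> ` words A" "w \<in> e r" by (rule cloD[OF e r(1)])
  then have "profinite_power B h m \<in> clo B (\<phi> ` words A)"
    using bspec[OF r(2) profinite_power_closed[OF h']] m by blast
  then show ?thesis by blast
qed

text \<open>Modulo the congruence that decides membership, h^(m+1) agrees with \<open>e\<close> for
  some m, so the inverse h' = h' e agrees with h' h^(m+1), which is h^m or, for m = 0, the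
  idempotent \<open>e\<close>.\<close>

lemma unit_inverse_in_image:
  assumes \<phi>: "word_hom A B \<phi>" and A: "finite A" and e: "e \<in> clo B (\<phi> ` words A)"
    and h: "h \<in> fp.unit_group B e" "h \<in> clo B (\<phi> ` words A)"
    and h': "h' \<in> free_profinite B" "h' \<odot>\<^bsub>B\<^esub> h = e" "h' \<odot>\<^bsub>B\<^esub> e = h'"
  shows "h' \<in> clo B (\<phi> ` words A)"
proof -
  let ?C = "\<phi> ` words A"
  note e' = clo_closed[OF e]
  from clo_image_saturated[OF \<phi> A] obtain r where r: "r \<in> finite_congruences B"
    "\<forall>x\<in>free_profinite B. (\<exists>w\<in>?C. w \<in> x r) \<longrightarrow> x \<in> clo B ?C \<and> x r \<subseteq> ?C" by (rule bexE)
  have eq: "h' \<in> clo B ?C" if hx: "h' r = x r" "x \<in> clo B ?C" for x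
  proof -
    obtain w where "w \<in> ?C" "w \<in> x r" by (rule cloD[OF hx(2) r(1)])
    then show ?thesis using bspec[OF r(2) h'(1)] hx(1) by blast
  qed
  obtain m where m: "profinite_power B h m r = e r" using unit_torsion_mod[OF e' h(1) r(1)] by blast
  have hc: "h \<in> free_profinite B" "e \<odot>\<^bsub>B\<^esub> h = h" using h(1) by (auto elim: fp.unit_groupE)
  have cancel: "h' \<odot>\<^bsub>B\<^esub> profinite_power B h (Suc j) = profinite_power B h j" for j
  proof (induction j)
    case 0
    show ?case using profinite_mult_assoc[OF h'(1) hc(1) hc(1)] h'(2) hc(2) by simp
  next
    case (Suc j)
    have "h' \<odot>\<^bsub>B\<^esub> profinite_power B h (Suc (Suc j)) = (h' \<odot>\<^bsub>B\<^esub> profinite_power B h (Suc j)) \<odot>\<^bsub>B\<^esub> h"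
      unfolding profinite_power.simps(2)[of B h "Suc j"]
      by (rule profinite_mult_assoc[OF h'(1) profinite_power_closed[OF hc(1)] hc(1), symmetric])
    then show ?case unfolding Suc.IH by simp
  qed
  have "(h' \<odot>\<^bsub>B\<^esub> profinite_power B h m) r = (h' \<odot>\<^bsub>B\<^esub> e) r"
    by (rule profinite_mult_class_cong) (rule refl, rule m)
  then have "h' r = (h' \<odot>\<^bsub>B\<^esub> profinite_power B h m) r" using h'(3) by simp
  then have img: "h' \<odot>\<^bsub>B\<^esub> profinite_power B h m \<in> clo B ?C \<Longrightarrow> h' \<in> clo B ?C" by (rule eq)
  show ?thesis
  proof (cases m)
    case 0
    then show ?thesis using img h'(2) e by simp
  next
    case (Suc j)
    show ?thesis using img unfolding Suc cancel by (simp add: power_in_image[OF \<phi> h(2)])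
  qed
qed

section \<open>Homomorphisms that agree modulo a finite congruence\<close>

lemma word_hom_congruent:
  assumes r: "r \<in> finite_congruences B" and \<phi>: "word_hom A B \<phi>" and \<psi>: "word_hom A B \<psi>"
    and letters: "\<And>a. a \<in> A \<Longrightarrow> (\<phi> [a], \<psi> [a]) \<in> r" and w: "w \<in> words A"
  shows "(\<phi> w, \<psi> w) \<in> r"
proof -
  have "w \<noteq> []" "set w \<subseteq> A" using w by (auto simp: words_def)
  then show ?thesis
  proof (induction w rule: list_nonempty_induct)
    case (single a)
    then show ?case using letters by simp
  next
    case (cons a w)
    then have wa: "[a] \<in> words A" "w \<in> words A" "a \<in> A" by (auto simp: words_def)
    have "(\<phi> [a] @ \<phi> w, \<psi> [a] @ \<phi> w) \<in> r"
      by (rule finite_congruencesD(3)[OF r letters[OF wa(3)] word_homD(1)[OF \<phi> wa(2)]])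
    moreover have "(\<psi> [a] @ \<phi> w, \<psi> [a] @ \<psi> w) \<in> r"
      using finite_congruencesD(4)[OF r _ word_homD(1)[OF \<psi> wa(1)]] cons by simp
    ultimately have "(\<phi> [a] @ \<phi> w, \<psi> [a] @ \<psi> w) \<in> r"
      using finite_congruencesD(1)[OF r] by (meson equivE transD)
    then show ?case using word_homD(2)[OF \<phi> wa(1,2)] word_homD(2)[OF \<psi> wa(1,2)] by simp
  qed
qed

lemma profinite_extension_congruent:
  assumes r: "r \<in> finite_congruences B" and \<phi>: "word_hom A B \<phi>" and \<psi>: "word_hom A B \<psi>"
    and cong: "\<And>w. w \<in> words A \<Longrightarrow> (\<phi> w, \<psi> w) \<in> r" and x: "x \<in> free_profinite A"
  shows "profinite_extension A B \<phi> x r = profinite_extension A B \<psi> x r"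
proof -
  note p = pullback_congruence[OF \<phi> r] pullback_congruence[OF \<psi> r]
  note t = finite_congruences_Int[OF p]
  obtain w where w: "w \<in> words A" "w \<in> x (pullback A \<phi> r \<inter> pullback A \<psi> r)" by (rule free_profinite_ex_rep[OF x t])
  have "w \<in> x (pullback A \<phi> r)" "w \<in> x (pullback A \<psi> r)"
    using free_profinite_mono[OF x t p(1)] free_profinite_mono[OF x t p(2)] w(2) by blast+
  then have "\<phi> w \<in> profinite_extension A B \<phi> x r" "\<psi> w \<in> profinite_extension A B \<psi> x r"
    using profinite_extension_rep[OF \<phi> x r] profinite_extension_rep[OF \<psi> x r] by blast+
  moreover from this(1) have "\<psi> w \<in> profinite_extension A B \<phi> x r"
    using free_profinite_rep_iff[OF profinite_extension_closed[OF \<phi> x] r] cong[OF w(1)] by blast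
  ultimately show ?thesis
    using free_profinite_eq_at[OF profinite_extension_closed[OF \<phi> x] profinite_extension_closed[OF \<psi> x] r] by blast
qed

lemma level_language_shift: "level_language (\<lambda>i. A (i + N)) (\<lambda>i. \<sigma> (i + N)) n = level_language A \<sigma> (n + N)"
  unfolding seq_language_shift[symmetric] by (simp add: add_ac)

lemma recognizable_at_shift: "recognizable_at (\<lambda>i. A (i + N)) (\<lambda>i. \<sigma> (i + N)) n = recognizable_at A \<sigma> (n + N)"
  by (simp add: recognizable_at_def add_ac)

context primitive_directive
begin

section \<open>Pure sequences\<close>

lemma deep_idempotent_image:
  assumes "deep_idempotent e"
  shows "e \<in> clo (A 0) (\<Sigma> 0 n ` words (A n))"
proof -
  obtain g where "g \<in> clo (A n) (L n)" "E 0 n g = e" using assms unfolding deep_idempotent_def by blast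
  then show ?thesis using profinite_extension_image[OF comp_hom_hom[OF le0, of n]] clo_closed by blast
qed

text \<open>The root is lifted one level at a time: if u is the image of v at level n, injectivity
  of \<open>\<Sigma> 0 n\<close> turns the hypothesis on u into one on v, and purity of the code at
  level n applies.\<close>

lemma pure_comp:
  assumes pure: "pure_seq A \<sigma>" and "u \<in> words (A 0)" "word_power u (Suc k) \<in> \<Sigma> 0 n ` words (A n)"
  shows "u \<in> \<Sigma> 0 n ` words (A n)"
  using assms(3)
proof (induction n)
  case 0
  show ?case using assms(2) by simp
next
  case (Suc n)
  have enc: "encoding_seq A \<sigma>" using pure by (simp add: pure_seq_def)
  note c = comp_hom_split[of 0 n "Suc n" \<sigma>]
  obtain w where w: "w \<in> words (A (Suc n))" "word_power u (Suc k) = \<Sigma> 0 n (\<sigma> n w)" using Suc.prems c by auto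
  note \<sigma>w = word_homD(1)[OF step_hom w(1)]
  obtain v where v: "v \<in> words (A n)" "u = \<Sigma> 0 n v" using Suc.IH w(2) \<sigma>w by auto
  note pw = word_power_words[OF v(1), of "Suc k"]
  have "\<Sigma> 0 n (word_power v (Suc k)) = \<Sigma> 0 n (\<sigma> n w)"
    using word_hom_power[OF comp_hom_hom[OF le0] v(1), of k] v(2) w(2) by simp
  then have "word_power v (Suc k) = \<sigma> n w"
    using inj_comp_hom[OF enc le0] pw \<sigma>w by (auto dest: inj_onD)
  then have "word_power v (Suc k) \<in> generated_subsemigroup ((\<lambda>a. \<sigma> n [a]) ` A (Suc n))"
    unfolding generated_subsemigroup_image[OF step_hom] using w(1) by blast
  then have "v \<in> generated_subsemigroup ((\<lambda>a. \<sigma> n [a]) ` A (Suc n))"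
    using pure v(1) unfolding pure_seq_def pure_in_def by (metis le_add1 plus_1_eq_Suc)
  then obtain v' where "v' \<in> words (A (Suc n))" "v = \<sigma> n v'" unfolding generated_subsemigroup_image[OF step_hom] by blast
  then show ?case using v(2) c by auto
qed

lemma saturating_if_pure:
  assumes pure: "pure_seq A \<sigma>"
  shows "saturating_seq A \<sigma>"
proof -
  obtain e where e: "deep_idempotent e" using deep_idempotent_exists by blast
  have "h \<in> clo (A 0) (\<Sigma> 0 n ` words (A n))" if h: "h \<in> units e" for h n
  proof -
    let ?C = "\<Sigma> 0 n ` words (A n)"
    note e' = deep_idempotent_image[OF e, of n]
    have h': "h \<in> free_profinite (A 0)" using h by (auto elim: fp.unit_groupE)
    from clo_image_saturated[OF comp_hom_hom[OF le0, of n] finite_alphabet] obtain r where r: "r \<in> finite_congruences (A 0)"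
      "\<forall>x\<in>free_profinite (A 0). (\<exists>w\<in>?C. w \<in> x r) \<longrightarrow> x \<in> clo (A 0) ?C \<and> x r \<subseteq> ?C" by (rule bexE)
    obtain m where m: "profinite_power (A 0) h m r = e r"
      using unit_torsion_mod[OF clo_closed[OF e'] h r(1)] by blast
    obtain w where "w \<in> ?C" "w \<in> e r" by (rule cloD[OF e' r(1)])
    then have eC: "e r \<subseteq> ?C" using bspec[OF r(2) clo_closed[OF e']] by blast
    obtain \<nu> where \<nu>: "\<nu> \<in> words (A 0)" "\<nu> \<in> h r" by (rule free_profinite_ex_rep[OF h' r(1)])
    \<comment> \<open>The power lies in the class of \<open>e\<close> modulo \<open>r\<close>, all
      of whose words are images.\<close>
    have "word_power \<nu> (Suc m) \<in> ?C" using profinite_power_rep[OF r(1) h' \<nu>(2), of m] m eC by blast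
    then have "\<nu> \<in> ?C" by (rule pure_comp[OF pure \<nu>(1)])
    then show ?thesis using bspec[OF r(2) h'] \<nu>(2) by blast
  qed
  then show ?thesis using saturatingI[OF e] unfolding profinite_image_clo by blast
qed

section \<open>Recurrent sequences: returns and the retraction onto the profinite image\<close>

lemma return_level:
  assumes rec: "recurrent_seq A \<sigma>"
  shows "\<exists>m\<ge>k. A m = A 0 \<and> A (m + n) = A n \<and> (\<forall>w\<in>words (A n). \<Sigma> m (m + n) w = \<Sigma> 0 n w)"
proof -
  define P where "P m n \<longleftrightarrow> (\<forall>i\<le>n. A i = A (m + i) \<and> A (Suc i) = A (Suc (m + i)) \<and>
      (\<forall>w\<in>words (A (Suc i)). \<sigma> i w = \<sigma> (m + i) w))" for m n
  have PD: "A i = A (m + i)" "A (Suc i) = A (Suc (m + i))" "w \<in> words (A (Suc i)) \<Longrightarrow> \<sigma> i w = \<sigma> (m + i) w"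
    if "P m n" "i \<le> n" for m n i w
    using that unfolding P_def by blast+
  have ret: "\<exists>m>0. P m n" for n using rec unfolding recurrent_seq_def P_def by blast
  have "\<exists>m\<ge>k. P m n"
  proof (induction k)
    case 0
    then show ?case using ret by blast
  next
    case (Suc k)
    then obtain m where m: "k \<le> m" "P m n" by blast
    \<comment> \<open>The next return has to preserve everything up to \<open>m + n\<close>, so that
      the copy of the initial segment found at level \<open>m\<close> is copied once more, to level
      \<open>m' + m\<close>.\<close>
    obtain m' where m': "0 < m'" "P m' (m + n)" using ret by blast
    have "A i = A ((m' + m) + i) \<and> A (Suc i) = A (Suc ((m' + m) + i)) \<and>
        (\<forall>w\<in>words (A (Suc i)). \<sigma> i w = \<sigma> ((m' + m) + i) w)" if i: "i \<le> n" for i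
    proof -
      note 1 = PD[OF m(2) i] and 2 = PD[OF m'(2), of "m + i", OF add_left_mono[OF i]]
      have "\<sigma> i w = \<sigma> ((m' + m) + i) w" if "w \<in> words (A (Suc i))" for w
        using 1(3)[OF that] 2(3)[of w] that unfolding 1(2) add.assoc by (metis trans)
      then show ?thesis using 1(1,2) 2(1,2) by (metis add.assoc)
    qed
    then have "P (m' + m) n" unfolding P_def by blast
    moreover have "Suc k \<le> m' + m" using m(1) m'(1) by simp
    ultimately show ?case by blast
  qed
  then obtain m where m: "k \<le> m" "P m n" by blast
  have *: "\<Sigma> m (m + j) w = \<Sigma> 0 j w" if "w \<in> words (A j)" "j \<le> Suc n" for j w
    using that
  proof (induction j arbitrary: w)
    case (Suc j)
    have "\<sigma> j w = \<sigma> (m + j) w" using PD(3)[OF m(2) _ Suc.prems(1)] Suc.prems(2) by simp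
    moreover have "\<sigma> j w \<in> words (A j)" by (rule word_homD(1)[OF step_hom Suc.prems(1)])
    ultimately have "\<Sigma> m (m + j) (\<sigma> (m + j) w) = \<Sigma> 0 j (\<sigma> j w)" using Suc.IH[of "\<sigma> j w"] Suc.prems(2) by simp
    then show ?case
      using comp_hom_split[of m "m + j" "Suc (m + j)" \<sigma>] comp_hom_split[of 0 j "Suc j" \<sigma>] by simp
  qed simp
  have "A m = A 0" "A (m + n) = A n" using PD(1)[OF m(2), of 0] PD(1)[OF m(2), of n] by simp_all
  then show ?thesis using m(1) * by auto
qed

text \<open>Nested returns satisfy \<open>\<sigma>\<^sub>0\<^sub>,\<^sub>j = \<tau> \<circ> \<sigma>\<^sub>0\<^sub>,\<^sub>i\<close>. By the pigeonhole principle some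
  \<open>\<sigma>\<^sub>0\<^sub>,\<^sub>i\<close> and \<open>\<sigma>\<^sub>0\<^sub>,\<^sub>j\<close> agree modulo \<open>r\<close>, and then \<open>\<tau>\<close> is the identity modulo \<open>r\<close> on the image of \<open>\<sigma>\<^sub>0\<^sub>,\<^sub>i\<close>.\<close>

lemma recurrent_retraction_mod:
  assumes rec: "recurrent_seq A \<sigma>" and r: "r \<in> finite_congruences (A 0)"
  shows "\<exists>\<tau>. word_hom (A 0) (A 0) \<tau> \<and> \<tau> ` words (A 0) \<subseteq> \<Sigma> 0 k ` words (A k) \<and>
    (\<forall>x\<in>profinite_image A \<sigma>. profinite_extension (A 0) (A 0) \<tau> x r = x r)"
proof -
  have "\<forall>n. \<exists>m. k \<le> m \<and> A m = A 0 \<and> A (m + n) = A n \<and> (\<forall>w\<in>words (A n). \<Sigma> m (m + n) w = \<Sigma> 0 n w)"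
    using return_level[OF rec, of k] by blast
  from choice[OF this] obtain m where m: "\<And>n. k \<le> m n" "\<And>n. A (m n) = A 0" "\<And>n. A (m n + n) = A n"
    "\<And>n w. w \<in> words (A n) \<Longrightarrow> \<Sigma> (m n) (m n + n) w = \<Sigma> 0 n w" by blast
  \<comment> \<open>The last part of \<open>\<Sigma> 0 (l (Suc i))\<close>, from level
    \<open>m (l i)\<close> on, repeats \<open>\<Sigma> 0 (l i)\<close>.\<close>
  define l where "l = rec_nat 0 (\<lambda>_ n. m n + n)"
  have l: "l 0 = 0" "\<And>i. l (Suc i) = m (l i) + l i" by (simp_all add: l_def)
  have Al: "A (l i) = A 0" for i by (induction i) (simp_all add: l m(3))
  have hom: "word_hom (A 0) (A 0) (\<Sigma> 0 (l i))" for i using comp_hom_hom[OF le0, of "l i"] Al by simp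
  have homm: "word_hom (A 0) (A 0) (\<Sigma> 0 (m i))" for i using comp_hom_hom[OF le0, of "m i"] m(2) by simp
  have img: "\<Sigma> 0 (m i) ` words (A 0) \<subseteq> \<Sigma> 0 k ` words (A k)" for i
    using comp_hom_split[OF le0 m(1), of \<sigma> i] comp_hom_word[OF m(1), of _ i] m(2)[of i] by auto
  have step: "\<Sigma> 0 (l (Suc i)) w = \<Sigma> 0 (m (l i)) (\<Sigma> 0 (l i) w)" if "w \<in> words (A 0)" for i w
    using comp_hom_split[of 0 "m (l i)" "m (l i) + l i" \<sigma>] m(4)[of w "l i"] that Al[of i] by (simp add: l)
  \<comment> \<open>The homomorphism \<tau> is a composition of maps
    \<open>\<Sigma> 0 (m _)\<close>, and the outermost of them has its image inside that of
    \<open>\<Sigma> 0 k\<close>, because \<open>k \<le> m _\<close>.\<close>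
  have fac: "\<exists>\<tau>. word_hom (A 0) (A 0) \<tau> \<and> \<tau> ` words (A 0) \<subseteq> \<Sigma> 0 k ` words (A k) \<and>
      (\<forall>w\<in>words (A 0). \<Sigma> 0 (l (Suc (i + d))) w = \<tau> (\<Sigma> 0 (l i) w))" for i d
  proof (induction d)
    case 0
    show ?case using homm[of "l i"] img[of "l i"] step[of _ i] by auto
  next
    case (Suc d)
    then obtain \<tau> where \<tau>: "word_hom (A 0) (A 0) \<tau>" "\<And>w. w \<in> words (A 0) \<Longrightarrow> \<Sigma> 0 (l (Suc (i + d))) w = \<tau> (\<Sigma> 0 (l i) w)"
      by blast
    let ?\<tau> = "\<Sigma> 0 (m (l (Suc (i + d)))) \<circ> \<tau>"
    have "?\<tau> ` words (A 0) \<subseteq> \<Sigma> 0 k ` words (A k)" using word_homD(1)[OF \<tau>(1)] img[of "l (Suc (i + d))"] by fastforce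
    moreover have "\<Sigma> 0 (l (Suc (i + Suc d))) w = ?\<tau> (\<Sigma> 0 (l i) w)" if "w \<in> words (A 0)" for w
      using step[OF that, of "Suc (i + d)"] \<tau>(2)[OF that] by simp
    ultimately show ?case using word_hom_comp[OF \<tau>(1) homm] by blast
  qed
  \<comment> \<open>A homomorphism modulo \<open>r\<close> is given by the classes of the images of
    the letters, so only finitely many are possible.\<close>
  define f where "f i = (\<lambda>a\<in>A 0. r `` {\<Sigma> 0 (l i) [a]})" for i
  have "f i \<in> (\<Pi>\<^sub>E a\<in>A 0. words (A 0) // r)" for i
    using word_homD(1)[OF hom letter_word] unfolding f_def by (auto intro: quotientI)
  then have "range f \<subseteq> (\<Pi>\<^sub>E a\<in>A 0. words (A 0) // r)" by blast
  then have "finite (range f)"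
    by (rule finite_subset) (intro finite_PiE finite_alphabet finite_congruencesD(2)[OF r])
  then have "\<not> inj f" using finite_imageD infinite_UNIV_nat by blast
  then obtain i j where ij: "i < j" "f i = f j" unfolding inj_def by (metis linorder_neqE_nat)
  obtain d where d: "j = Suc (i + d)" using less_imp_Suc_add[OF ij(1)] by blast
  obtain \<tau> where \<tau>: "word_hom (A 0) (A 0) \<tau>" "\<tau> ` words (A 0) \<subseteq> \<Sigma> 0 k ` words (A k)"
    "\<And>w. w \<in> words (A 0) \<Longrightarrow> \<Sigma> 0 (l j) w = \<tau> (\<Sigma> 0 (l i) w)" using fac[of i d] unfolding d by blast
  have letters: "(\<Sigma> 0 (l i) [a], \<Sigma> 0 (l j) [a]) \<in> r" if "a \<in> A 0" for a
  proof -
    have "r `` {\<Sigma> 0 (l i) [a]} = r `` {\<Sigma> 0 (l j) [a]}" using fun_cong[OF ij(2), of a] that by (simp add: f_def)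
    then show ?thesis
      using eq_equiv_class_iff[OF finite_congruencesD(1)[OF r]] word_homD(1)[OF hom letter_word[OF that]] by blast
  qed
  have "profinite_extension (A 0) (A 0) \<tau> x r = x r" if "x \<in> profinite_image A \<sigma>" for x
  proof -
    have "x \<in> E 0 (l i) ` free_profinite (A (l i))" using that unfolding profinite_image_def by blast
    then obtain y where y: "y \<in> free_profinite (A 0)" "x = profinite_extension (A 0) (A 0) (\<Sigma> 0 (l i)) y"
      unfolding Al by blast
    have "profinite_extension (A 0) (A 0) \<tau> x = profinite_extension (A 0) (A 0) (\<tau> \<circ> \<Sigma> 0 (l i)) y"
      unfolding y(2) by (rule profinite_extension_comp[OF hom \<tau>(1) y(1), symmetric])
    also have "\<dots> = profinite_extension (A 0) (A 0) (\<Sigma> 0 (l j)) y"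
      using profinite_extension_cong[of "A 0" "\<tau> \<circ> \<Sigma> 0 (l i)" "\<Sigma> 0 (l j)" "A 0"] \<tau>(3) by (metis comp_apply)
    finally show ?thesis
      using profinite_extension_congruent[OF r hom hom word_hom_congruent[OF r hom hom letters] y(1)] y(2) by metis
  qed
  then show ?thesis using \<tau>(1,2) by blast
qed

lemma profinite_image_closed: "x \<in> profinite_image A \<sigma> \<Longrightarrow> x \<in> free_profinite (A 0)"
  unfolding profinite_image_clo using clo_closed by blast

text \<open>The homomorphisms \<tau> for growing levels and finer congruences converge pointwise.
  The growing level puts the limit into every image, the refining congruence makes it the identity
  on the profinite image, and multiplicativity passes to the limit.\<close>

lemma recurrent_retraction:
  assumes rec: "recurrent_seq A \<sigma>"
  shows "\<exists>\<rho>. (\<forall>x\<in>free_profinite (A 0). \<rho> x \<in> profinite_image A \<sigma>) \<and>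
    (\<forall>x\<in>free_profinite (A 0). \<forall>y\<in>free_profinite (A 0). \<rho> (x \<odot>\<^bsub>A 0\<^esub> y) = \<rho> x \<odot>\<^bsub>A 0\<^esub> \<rho> y) \<and>
    (\<forall>x\<in>profinite_image A \<sigma>. \<rho> x = x)"
proof -
  let ?S = "free_profinite (A 0)"
  define P where "P i \<tau> \<longleftrightarrow> word_hom (A 0) (A 0) \<tau> \<and> \<tau> ` words (A 0) \<subseteq> \<Sigma> 0 (snd i) ` words (A (snd i)) \<and>
      (\<forall>x\<in>profinite_image A \<sigma>. profinite_extension (A 0) (A 0) \<tau> x (fst i) = x (fst i))"
    for i :: "('a list \<times> 'a list) set \<times> nat" and \<tau>
  have "\<forall>i. \<exists>\<tau>. fst i \<in> finite_congruences (A 0) \<longrightarrow> P i \<tau>"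
  proof
    fix i
    show "\<exists>\<tau>. fst i \<in> finite_congruences (A 0) \<longrightarrow> P i \<tau>"
      using recurrent_retraction_mod[OF rec, of "fst i" "snd i"] unfolding P_def by (cases "fst i \<in> finite_congruences (A 0)") simp_all
  qed
  from choice[OF this] obtain \<tau> where P: "\<And>i. fst i \<in> finite_congruences (A 0) \<Longrightarrow> P i (\<tau> i)" by blast
  have \<tau>: "word_hom (A 0) (A 0) (\<tau> i)" "\<tau> i ` words (A 0) \<subseteq> \<Sigma> 0 (snd i) ` words (A (snd i))"
    "x \<in> profinite_image A \<sigma> \<Longrightarrow> profinite_extension (A 0) (A 0) (\<tau> i) x (fst i) = x (fst i)"
    if "fst i \<in> finite_congruences (A 0)" for i x
    using P[OF that] unfolding P_def by simp_all
  obtain U where U: "fine_filter (A 0) U" using fine_filter_exists by blast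
  note nb = fine_filterD(2)[OF U]
  let ?T = "\<lambda>i. profinite_extension (A 0) (A 0) (\<tau> i)"
  have closed: "eventually (\<lambda>i. ?T i x \<in> ?S) U" if "x \<in> ?S" for x
    using fine_filterD(4)[OF U] by eventually_elim (rule profinite_extension_closed[OF \<tau>(1) that])
  have "\<forall>x. \<exists>y. x \<in> ?S \<longrightarrow> plim U (A 0) (\<lambda>i. ?T i x) y"
  proof
    fix x
    show "\<exists>y. x \<in> ?S \<longrightarrow> plim U (A 0) (\<lambda>i. ?T i x) y"
      using plim_exists[OF fine_filterD(1)[OF U] closed] by (cases "x \<in> ?S") simp_all
  qed
  from choice[OF this] obtain \<rho> where \<rho>: "\<And>x. x \<in> ?S \<Longrightarrow> plim U (A 0) (\<lambda>i. ?T i x) (\<rho> x)" by blast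
  have "\<rho> x \<in> profinite_image A \<sigma>" if x: "x \<in> ?S" for x
  proof -
    have "\<rho> x \<in> clo (A 0) (\<Sigma> 0 n ` words (A n))" for n
    proof (rule clo_plim[OF nb _ \<rho>[OF x]])
      show "eventually (\<lambda>i. ?T i x \<in> clo (A 0) (\<Sigma> 0 n ` words (A n))) U"
        using fine_filterD(4)[OF U] fine_filterD(5)[OF U, of n]
      proof eventually_elim
        case (elim i)
        have "?T i x \<in> clo (A 0) (\<tau> i ` words (A 0))" using profinite_extension_image[OF \<tau>(1)[OF elim(1)]] x by blast
        moreover have "\<Sigma> 0 (snd i) ` words (A (snd i)) \<subseteq> \<Sigma> 0 n ` words (A n)"
          using comp_hom_split[OF le0 elim(2), of \<sigma>] comp_hom_word[OF elim(2)] by auto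
        ultimately show ?case using clo_mono[OF order_trans[OF \<tau>(2)[OF elim(1)]]] by blast
      qed
    qed
    then show ?thesis unfolding profinite_image_clo by blast
  qed
  moreover have "\<rho> (x \<odot>\<^bsub>A 0\<^esub> y) = \<rho> x \<odot>\<^bsub>A 0\<^esub> \<rho> y" if x: "x \<in> ?S" and y: "y \<in> ?S" for x y
  proof (rule plim_unique[OF nb \<rho>[OF profinite_mult_closed[OF x y]]])
    have "eventually (\<lambda>i. ?T i x \<odot>\<^bsub>A 0\<^esub> ?T i y = ?T i (x \<odot>\<^bsub>A 0\<^esub> y)) U"
      using fine_filterD(4)[OF U] by eventually_elim (rule profinite_extension_mult[OF \<tau>(1) x y, symmetric])
    then show "plim U (A 0) (\<lambda>i. ?T i (x \<odot>\<^bsub>A 0\<^esub> y)) (\<rho> x \<odot>\<^bsub>A 0\<^esub> \<rho> y)"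
      using plim_mult[OF \<rho>[OF x] \<rho>[OF y]] by (rule plim_cong)
  qed
  moreover have "\<rho> x = x" if x: "x \<in> profinite_image A \<sigma>" for x
  proof (rule plim_unique[OF nb \<rho>[OF profinite_image_closed[OF x]]])
    note x' = profinite_image_closed[OF x]
    have "eventually (\<lambda>i. ?T i x s = x s) U" if s: "s \<in> finite_congruences (A 0)" for s
      using fine_filterD(3)[OF U s]
    proof eventually_elim
      case (elim i)
      then have i: "fst i \<in> finite_congruences (A 0)" "fst i \<subseteq> s" by simp_all
      show ?case
        by (rule free_profinite_eq_mono[OF profinite_extension_closed[OF \<tau>(1)[OF i(1)] x'] x' s i(1) i(2) \<tau>(3)[OF i(1) x]])
    qed
    then show "plim U (A 0) (\<lambda>i. ?T i x) x" using x' by (simp add: plim_def)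
  qed
  ultimately show ?thesis by blast
qed

section \<open>Descent from the recognizable tail\<close>

lemma primitive_directive_shift: "primitive_directive (\<lambda>i. A (i + N)) (\<lambda>i. \<sigma> (i + N))"
proof
  show "directive_sequence (\<lambda>i. A (i + N)) (\<lambda>i. \<sigma> (i + N))" using directive by (simp add: directive_sequence_def)
  show "primitive_seq (\<lambda>i. A (i + N)) (\<lambda>i. \<sigma> (i + N))"
    unfolding primitive_seq_def comp_hom_shift
  proof
    fix n
    obtain m where "n + N < m" "positive_hom (A m) (A (n + N)) (\<Sigma> (n + N) m)" using primitive unfolding primitive_seq_def by blast
    then show "\<exists>m>n. positive_hom (A (m + N)) (A (n + N)) (\<Sigma> (n + N) (m + N))"
      by (intro exI[of _ "m - N"]) simp
  qed
qed

text \<open>From level \<open>N\<close> on, the sequence is recognizable. A unit in the image of \<open>\<sigma>\<^sub>0\<^sub>,\<^sub>N\<close> therefore pulls back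
  to a unit at level \<open>N\<close>, which lies in the images of all later levels.\<close>

lemma deep_idempotent_tail:
  assumes enc: "encoding_seq A \<sigma>" and rec: "\<And>n. N \<le> n \<Longrightarrow> recognizable_at A \<sigma> n"
  shows "\<exists>e. deep_idempotent e \<and> (\<forall>k\<in>units e. k \<in> clo (A 0) (\<Sigma> 0 N ` words (A N)) \<longrightarrow> k \<in> profinite_image A \<sigma>)"
proof -
  interpret S: primitive_directive "\<lambda>i. A (i + N)" "\<lambda>i. \<sigma> (i + N)" by (rule primitive_directive_shift)
  let ?F = "free_profinite (A N)" and ?C = "\<Sigma> 0 N ` words (A N)"
  note \<phi> = comp_hom_hom[OF le0, of N]
  obtain e' where e': "S.deep_idempotent e'" using S.deep_idempotent_exists by blast
  have g: "\<exists>g\<in>clo (A n) (L n). g \<odot>\<^bsub>A n\<^esub> g = g \<and> E N n g = e'" if "N \<le> n" for n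
  proof -
    have "\<exists>g\<in>clo (A (n - N + N)) (L (n - N + N)). g \<odot>\<^bsub>A (n - N + N)\<^esub> g = g \<and> E (0 + N) (n - N + N) g = e'"
      using e' unfolding S.deep_idempotent_def level_language_shift comp_hom_shift by blast
    then show ?thesis using that by simp
  qed
  have e'': "e' \<in> clo (A N) (L N)" "e' \<odot>\<^bsub>A N\<^esub> e' = e'"
    using S.deep_idempotentD[OF e'] unfolding S.K_def level_language_shift by simp_all
  note e'c = clo_closed[OF e''(1)]
  define e where "e = E 0 N e'"
  have deep: "deep_idempotent e"
    unfolding deep_idempotent_def
  proof
    \<comment> \<open>Below \<open>N\<close> the idempotent of the tail is pushed down; above
      \<open>N\<close> its own lifts are used.\<close>
    fix n
    show "\<exists>g\<in>clo (A n) (L n). g \<odot>\<^bsub>A n\<^esub> g = g \<and> E 0 n g = e"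
    proof (cases "n \<le> N")
      case True
      then show ?thesis
        using E_clo[OF True e''(1)] E_mult[OF True e'c e'c] E_comp[OF le0 True e'c] e''(2) by (intro bexI[of _ "E n N e'"]) (simp_all add: e_def)
    next
      case False
      then have Nn: "N \<le> n" by simp
      from g[OF Nn] obtain g where g: "g \<in> clo (A n) (L n)" "g \<odot>\<^bsub>A n\<^esub> g = g" "E N n g = e'" by blast
      moreover have "E 0 n g = e" using E_comp[OF le0 Nn clo_closed[OF g(1)]] g(3) by (simp add: e_def)
      ultimately show ?thesis by blast
    qed
  qed
  have inj: "x = y" if "E 0 N x = E 0 N y" "x \<in> ?F" "y \<in> ?F" for x y
    using profinite_extension_inj[OF \<phi> finite_alphabet inj_comp_hom[OF enc le0]] that by (auto dest: inj_onD)
  have "k \<in> profinite_image A \<sigma>" if k: "k \<in> units e" "k \<in> clo (A 0) ?C" for k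
  proof -
    obtain k' where k': "k \<in> free_profinite (A 0)" "e \<odot>\<^bsub>A 0\<^esub> k = k" "k \<odot>\<^bsub>A 0\<^esub> e = k" "k' \<in> free_profinite (A 0)"
      "e \<odot>\<^bsub>A 0\<^esub> k' = k'" "k' \<odot>\<^bsub>A 0\<^esub> e = k'" "k \<odot>\<^bsub>A 0\<^esub> k' = e" "k' \<odot>\<^bsub>A 0\<^esub> k = e"
      by (rule fp.unit_groupE[OF k(1)])
    \<comment> \<open>The inverse must have a preimage as well, or the preimage of \<open>k\<close>
      would not be known to be a unit.\<close>
    have "k' \<in> clo (A 0) ?C"
      by (rule unit_inverse_in_image[OF \<phi> finite_alphabet deep_idempotent_image[OF deep] k k'(4,8,6)])
    then obtain \<kappa> \<kappa>' where \<kappa>: "\<kappa> \<in> ?F" "k = E 0 N \<kappa>" "\<kappa>' \<in> ?F" "k' = E 0 N \<kappa>'"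
      using k(2) unfolding profinite_extension_image[OF \<phi>, symmetric] by blast
    \<comment> \<open>Identities at level \<open>N\<close> are verified after applying the injective
      extension of \<open>\<Sigma> 0 N\<close>.\<close>
    have m: "E 0 N (x \<odot>\<^bsub>A N\<^esub> y) = z \<Longrightarrow> x \<odot>\<^bsub>A N\<^esub> y = w" if "x \<in> ?F" "y \<in> ?F" "w \<in> ?F" "z = E 0 N w" for x y z w
      using inj profinite_mult_closed that by blast
    note EM = E_mult[OF le0, of _ N]
    have "\<kappa> \<in> fp.unit_group (A N) e'"
    proof (rule fp.unit_groupI(1)[OF \<kappa>(1) _ _ \<kappa>(3)])
      show "e' \<odot>\<^bsub>A N\<^esub> \<kappa> = \<kappa>" by (rule m[OF e'c \<kappa>(1,1,2)]) (simp only: EM[OF e'c \<kappa>(1)] e_def[symmetric] \<kappa>(2)[symmetric] k'(2))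
      show "\<kappa> \<odot>\<^bsub>A N\<^esub> e' = \<kappa>" by (rule m[OF \<kappa>(1) e'c \<kappa>(1,2)]) (simp only: EM[OF \<kappa>(1) e'c] e_def[symmetric] \<kappa>(2)[symmetric] k'(3))
      show "e' \<odot>\<^bsub>A N\<^esub> \<kappa>' = \<kappa>'" by (rule m[OF e'c \<kappa>(3,3,4)]) (simp only: EM[OF e'c \<kappa>(3)] e_def[symmetric] \<kappa>(4)[symmetric] k'(5))
      show "\<kappa>' \<odot>\<^bsub>A N\<^esub> e' = \<kappa>'" by (rule m[OF \<kappa>(3) e'c \<kappa>(3,4)]) (simp only: EM[OF \<kappa>(3) e'c] e_def[symmetric] \<kappa>(4)[symmetric] k'(6))
      show "\<kappa> \<odot>\<^bsub>A N\<^esub> \<kappa>' = e'" by (rule m[OF \<kappa>(1,3) e'c e_def]) (simp only: EM[OF \<kappa>(1,3)] \<kappa>(2,4)[symmetric] k'(7))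
      show "\<kappa>' \<odot>\<^bsub>A N\<^esub> \<kappa> = e'" by (rule m[OF \<kappa>(3,1) e'c e_def]) (simp only: EM[OF \<kappa>(3,1)] \<kappa>(2,4)[symmetric] k'(8))
    qed
    then have \<kappa>u: "\<kappa> \<in> S.units e'" by simp
    have "k \<in> clo (A 0) (\<Sigma> 0 n ` words (A n))" for n
    proof (cases "n \<le> N")
      case True
      have "?C \<subseteq> \<Sigma> 0 n ` words (A n)"
        using comp_hom_split[OF le0 True, of \<sigma>] comp_hom_word[OF True] by auto
      then show ?thesis using k(2) clo_mono by blast
    next
      case False
      then have Nn: "N \<le> n" by simp
      have "\<not> desync (comp_hom (\<lambda>i. \<sigma> (i + N)) 0 (n - N)) (level_language (\<lambda>i. A (i + N)) (\<lambda>i. \<sigma> (i + N)) (n - N))"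
        by (rule S.no_desync_if_recognizable) (simp add: recognizable_at_shift rec)
      from S.units_subset_image[OF e' \<kappa>u this] have "\<kappa> \<in> clo (A N) (\<Sigma> N n ` words (A n))"
        unfolding comp_hom_shift using Nn by simp
      from profinite_extension_clo[OF \<phi> this] show ?thesis
        using comp_hom_split[OF le0 Nn, of \<sigma>] \<kappa>(2) by (simp add: image_comp)
    qed
    then show ?thesis unfolding profinite_image_clo by blast
  qed
  then show ?thesis using deep by blast
qed

text \<open>For a unit \<open>g\<close>, the unit \<open>g \<rho>(g)\<^sup>-\<^sup>1\<close> is mapped to \<open>e\<close> by the retraction \<open>\<rho>\<close>, and one of its powers lies in the
  profinite image, where \<open>\<rho>\<close> is the identity. So it has finite order.\<close>

lemma saturating_if_recurrent:
  assumes enc: "encoding_seq A \<sigma>" and rec: "recurrent_seq A \<sigma>" and ev: "eventually_recognizable_seq A \<sigma>"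
  shows "saturating_seq A \<sigma>"
proof -
  let ?S = "free_profinite (A 0)" and ?I = "profinite_image A \<sigma>"
  obtain N where "\<forall>n\<in>{n. \<not> recognizable_at A \<sigma> n}. n < N"
    using ev unfolding eventually_recognizable_seq_def finite_nat_set_iff_bounded by blast
  then have N: "recognizable_at A \<sigma> n" if "N \<le> n" for n using that by fastforce
  obtain e where e: "deep_idempotent e"
    "\<And>k. k \<in> units e \<Longrightarrow> k \<in> clo (A 0) (\<Sigma> 0 N ` words (A N)) \<Longrightarrow> k \<in> ?I"
    using deep_idempotent_tail[OF enc N] by blast
  note e' = deep_idempotentD[OF e(1)]
  have eI: "e \<in> ?I" unfolding profinite_image_clo using deep_idempotent_image[OF e(1)] by blast
  from recurrent_retraction[OF rec] obtain \<rho> where \<rho>: "\<And>x. x \<in> ?S \<Longrightarrow> \<rho> x \<in> ?I"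
    "\<And>x y. x \<in> ?S \<Longrightarrow> y \<in> ?S \<Longrightarrow> \<rho> (x \<odot>\<^bsub>A 0\<^esub> y) = \<rho> x \<odot>\<^bsub>A 0\<^esub> \<rho> y" "\<And>x. x \<in> ?I \<Longrightarrow> \<rho> x = x" by blast
  have "g \<in> ?I" if g: "g \<in> units e" for g
  proof -
    obtain g' where g': "g \<in> ?S" "e \<odot>\<^bsub>A 0\<^esub> g = g" "g \<odot>\<^bsub>A 0\<^esub> e = g" "g' \<in> ?S"
      "e \<odot>\<^bsub>A 0\<^esub> g' = g'" "g' \<odot>\<^bsub>A 0\<^esub> e = g'" "g \<odot>\<^bsub>A 0\<^esub> g' = e" "g' \<odot>\<^bsub>A 0\<^esub> g = e"
      by (rule fp.unit_groupE[OF g])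
    have c: "\<rho> g \<in> ?S" "\<rho> g' \<in> ?S" using \<rho>(1)[OF g'(1)] \<rho>(1)[OF g'(4)] profinite_image_closed by blast+
    \<comment> \<open>As a multiplicative map that fixes \<open>e\<close>, the retraction sends
      units to units and inverses to inverses.\<close>
    have rel: "e \<odot>\<^bsub>A 0\<^esub> \<rho> g = \<rho> g" "\<rho> g \<odot>\<^bsub>A 0\<^esub> e = \<rho> g" "e \<odot>\<^bsub>A 0\<^esub> \<rho> g' = \<rho> g'" "\<rho> g' \<odot>\<^bsub>A 0\<^esub> e = \<rho> g'"
      "\<rho> g \<odot>\<^bsub>A 0\<^esub> \<rho> g' = e" "\<rho> g' \<odot>\<^bsub>A 0\<^esub> \<rho> g = e"
      using \<rho>(2)[OF e'(1) g'(1)] \<rho>(2)[OF g'(1) e'(1)] \<rho>(2)[OF e'(1) g'(4)] \<rho>(2)[OF g'(4) e'(1)]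
        \<rho>(2)[OF g'(1,4)] \<rho>(2)[OF g'(4,1)] unfolding \<rho>(3)[OF eI] g' by simp_all
    have \<rho>u: "\<rho> g' \<in> units e" by (rule fp.unit_groupI(2)[OF c(1) rel(1,2) c(2) rel(3-6)])
    define v where "v = g \<odot>\<^bsub>A 0\<^esub> \<rho> g'"
    have v: "v \<in> units e" unfolding v_def by (rule fp.unit_group_mult[OF g \<rho>u e'(1)])
    have v': "v \<in> ?S" "e \<odot>\<^bsub>A 0\<^esub> v = v" "v \<odot>\<^bsub>A 0\<^esub> e = v" using v by (auto elim: fp.unit_groupE)
    have \<rho>v: "\<rho> v = e" unfolding v_def \<rho>(2)[OF g'(1) c(2)] \<rho>(3)[OF \<rho>(1)[OF g'(4)]] by (rule rel(5))
    obtain m where m: "profinite_power (A 0) v m \<in> clo (A 0) (\<Sigma> 0 N ` words (A N))"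
      using unit_power_in_image[OF comp_hom_hom[OF le0] finite_alphabet deep_idempotent_image[OF e(1)] v] by blast
    have "\<rho> (profinite_power (A 0) v j) = e" for j
      by (induction j) (simp_all add: \<rho>v \<rho>(2) profinite_power_closed v'(1) e'(2))
    moreover have "profinite_power (A 0) v m \<in> ?I" by (rule e(2)[OF unit_power[OF e'(1) v] m])
    ultimately have "profinite_power (A 0) v m = e" using \<rho>(3) by metis
    then have "v = e" by (rule free_profinite_torsion_free[OF finite_alphabet e'(1) v'(1) e'(2) v'(2,3)])
    then have "e \<odot>\<^bsub>A 0\<^esub> \<rho> g = g"
      using profinite_mult_assoc[OF g'(1) c(2,1)] g'(3) unfolding v_def rel(6) by simp
    then show ?thesis using \<rho>(1)[OF g'(1)] rel(1) by simp
  qed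
  then show ?thesis by (intro saturatingI[OF e(1)] subsetI)
qed

end

theorem theorem1p1:
  fixes A :: "nat \<Rightarrow> 'a set" and \<sigma> :: "nat \<Rightarrow> 'a list \<Rightarrow> 'a list"
  assumes "directive_sequence A \<sigma>"
    and "eventually_recognizable_seq A \<sigma>"
    and "primitive_seq A \<sigma>"
  shows "(recognizable_seq A \<sigma> \<longrightarrow> saturating_seq A \<sigma>) \<and>
    (pure_seq A \<sigma> \<longrightarrow> recognizable_seq A \<sigma>) \<and>
    (saturating_seq A \<sigma> \<and> encoding_seq A \<sigma> \<longrightarrow> recognizable_seq A \<sigma>) \<and>
    (recurrent_seq A \<sigma> \<and> bounded_seq A \<and> encoding_seq A \<sigma> \<longrightarrow> recognizable_seq A \<sigma>)"
proof -
  interpret primitive_directive A \<sigma> using assms(1,3) by unfold_locales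
  have "saturating_seq A \<sigma>" if "recognizable_seq A \<sigma>"
    by (rule saturating_if_sync, rule no_desync_if_recognizable) (use that in \<open>simp add: recognizable_seq_def\<close>)
  moreover have "recognizable_seq A \<sigma>" if "pure_seq A \<sigma>"
    using recognizable_if_saturating[OF saturating_if_pure[OF that]] that by (simp add: pure_seq_def)
  ultimately show ?thesis
    using recognizable_if_saturating saturating_if_recurrent assms(2) by blast
qed

end
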